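(* Let $\Omega=\mathbf{R}\times(0,1)$ and let $\boldsymbol{f}\in H^{-1}_{\mathrm{uloc}}(\Omega)$. There exists a unique $\boldsymbol{u}$ in $H^1_{\mathrm{uloc}}(\Omega)$ satisfying the Stokes problem with zero flux $$\left\{\begin{array}{rcll}-\Delta\boldsymbol{u}+\nabla p&=&\boldsymbol{f}&\text{in }\Omega,\\ \mathrm{div}\,\boldsymbol{u}&=&0&\text{in }\Omega,\\ \boldsymbol{u}&=&\boldsymbol{0}&\text{on }\partial\Omega,\\ \int u_1\,dz&=&0&\text{in }\mathbf{R}.\end{array}\right.$$ Moreover it obeys $\|\boldsymbol{u}\|_{H^1_{\mathrm{uloc}}}\le C\|\boldsymbol{f}\|_{H^{-1}_{\mathrm{uloc}}}$, where $C>0$ is a constant independent of $\boldsymbol{f}$.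
   Context: Points of $\Omega$ are $(x,z)$, $(\boldsymbol{e}_x,\boldsymbol{e}_z)$ is the canonical basis of $\mathbf{R}^2$; $\boldsymbol{u}=(u_1,u_2)$ and $\boldsymbol{f}$ are $\mathbf{R}^2$-valued; $\int u_1\,dz:=\int_0^1u_1(x,z)\,dz$. The Stokes problem is understood in the weak sense: the first equation holds in the sense of distributions for some pressure $p$, and the boundary condition is in the sense of traces. Uniformly local (Kato) spaces: for $k\in\mathbf{Z}$ let $U_k=\{(x,z)\in\Omega:k<x<k+1\}$, $U_k^*=\{(x,z)\in\Omega:k-1<x<k+2\}$. Fix a smooth $\chi:\Omega\to[0,1]$ depending on $x$ only, equal to $1$ on $U_0$ and $0$ outside $U_0^*$, such that $\chi_k:=\chi(\cdot-k\boldsymbol{e}_x)$ satisfy $\sum_{k\in\mathbf{Z}}\chi_k=2$ in $\Omega$. For $m\in\mathbf{Z}$, $\|u\|_{H^m_{\mathrm{uloc}}}:=\sup_{k\in\mathbf{Z}}\|\chi_ku\|_{H^m(\Omega)}$ and $H^m_{\mathrm{uloc}}(\Omega)$ is the set of $u\in H^m_{\mathrm{loc}}(\Omega)$ (i.e. $\chi_ku\in H^m(\Omega)$ for all $k$) for which this is finite; for $m<0$, $H^{m}(\Omega)$ is the dual of $H^{-m}_0(\Omega)$. *)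

theory Defs
  imports "HOL-Analysis.Analysis"
begin

section \<open>Smooth functions, test functions and distributions\<close>

primrec iter_deriv ::
  "'a::euclidean_space list \<Rightarrow> ('a \<Rightarrow> real) \<Rightarrow> 'a \<Rightarrow> real" where
  "iter_deriv [] f = f"
| "iter_deriv (v # vs) f = (\<lambda>x. frechet_derivative (iter_deriv vs f) (at x) v)"

text \<open>If all iterated partial derivatives are differentiable, they are in particular
  all continuous, so the following is membership in \<open>C\<^sup>\<infinity>\<close>.\<close>

definition smooth :: "('a::euclidean_space \<Rightarrow> real) \<Rightarrow> bool" where
  "smooth f \<longleftrightarrow> (\<forall>vs. set vs \<subseteq> Basis \<longrightarrow> (\<forall>x. iter_deriv vs f differentiable (at x)))"

definition test_functions :: "'a::euclidean_space set \<Rightarrow> ('a \<Rightarrow> real) set" where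
  "test_functions S =
     {\<phi>. smooth \<phi> \<and> (\<exists>K. compact K \<and> K \<subseteq> S \<and> (\<forall>x. x \<notin> K \<longrightarrow> \<phi> x = 0))}"

text \<open>A distribution is represented by a functional on all functions, of which only
  the values on test functions matter.\<close>

type_synonym 'a functional = "('a \<Rightarrow> real) \<Rightarrow> real"

definition linear_functional_on :: "('a \<Rightarrow> real) set \<Rightarrow> 'a functional \<Rightarrow> bool" where
  "linear_functional_on V T \<longleftrightarrow>
     (\<forall>\<phi>\<in>V. \<forall>\<psi>\<in>V. \<forall>a b. T (\<lambda>x. a * \<phi> x + b * \<psi> x) = a * T \<phi> + b * T \<psi>)"

definition distributions :: "'a::euclidean_space set \<Rightarrow> 'a functional set" where
  "distributions S =
     {T. linear_functional_on (test_functions S) T \<and>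
         (\<forall>K. compact K \<and> K \<subseteq> S \<longrightarrow>
            (\<exists>C N. \<forall>\<phi>\<in>test_functions S. (\<forall>x. x \<notin> K \<longrightarrow> \<phi> x = 0) \<longrightarrow>
               \<bar>T \<phi>\<bar> \<le> C * (\<Sum>vs | set vs \<subseteq> Basis \<and> length vs \<le> N.
                               SUP x. \<bar>iter_deriv vs \<phi> x\<bar>)))}"

definition dist_deriv :: "'a::euclidean_space \<Rightarrow> 'a functional \<Rightarrow> 'a functional" where
  "dist_deriv v T = (\<lambda>\<phi>. - T (\<lambda>x. frechet_derivative \<phi> (at x) v))"

definition dist_laplacian :: "'a::euclidean_space functional \<Rightarrow> 'a functional" where
  "dist_laplacian T = (\<lambda>\<phi>. \<Sum>v\<in>Basis. dist_deriv v (dist_deriv v T) \<phi>)"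

section \<open>Sobolev spaces on the strip\<close>

type_synonym point = "real \<times> real"

definition Omega :: "point set" (\<open>\<Omega>\<close>) where
  "\<Omega> = UNIV \<times> {0<..<1}"

definition e\<^sub>x :: point where "e\<^sub>x = (1, 0)"

definition e\<^sub>z :: point where "e\<^sub>z = (0, 1)"

definition dist_of :: "(point \<Rightarrow> real) \<Rightarrow> point functional" where
  "dist_of u = (\<lambda>\<phi>. LINT p:\<Omega>|lborel. u p * \<phi> p)"

text \<open>Elements of the function spaces are functions on the plane rather than classes;
  their values outside \<open>\<Omega>\<close> are irrelevant.\<close>

definition L2 :: "(point \<Rightarrow> real) set" where
  "L2 = {u. set_borel_measurable lborel \<Omega> u \<and> set_integrable lborel \<Omega> (\<lambda>p. (u p)\<^sup>2)}"

definition L2_norm :: "(point \<Rightarrow> real) \<Rightarrow> real" where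
  "L2_norm u = sqrt (LINT p:\<Omega>|lborel. (u p)\<^sup>2)"

definition is_weak_deriv :: "point \<Rightarrow> (point \<Rightarrow> real) \<Rightarrow> (point \<Rightarrow> real) \<Rightarrow> bool" where
  "is_weak_deriv v u g \<longleftrightarrow>
     (\<forall>\<phi>\<in>test_functions \<Omega>. dist_deriv v (dist_of u) \<phi> = dist_of g \<phi>)"

definition H1 :: "(point \<Rightarrow> real) set" where
  "H1 = {u \<in> L2. \<forall>v\<in>{e\<^sub>x, e\<^sub>z}. \<exists>g\<in>L2. is_weak_deriv v u g}"

text \<open>For \<open>u\<close> in \<open>H1\<close> the choice is unique up to a null set of \<open>\<Omega>\<close>.\<close>

definition weak_deriv :: "point \<Rightarrow> (point \<Rightarrow> real) \<Rightarrow> point \<Rightarrow> real" where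
  "weak_deriv v u = (SOME g. g \<in> L2 \<and> is_weak_deriv v u g)"

definition H1_norm :: "(point \<Rightarrow> real) \<Rightarrow> real" where
  "H1_norm u =
     sqrt ((L2_norm u)\<^sup>2 + (L2_norm (weak_deriv e\<^sub>x u))\<^sup>2 + (L2_norm (weak_deriv e\<^sub>z u))\<^sup>2)"

definition H10 :: "(point \<Rightarrow> real) set" where
  "H10 = {u \<in> H1. \<exists>\<phi>. (\<forall>n::nat. \<phi> n \<in> test_functions \<Omega>) \<and>
                      (\<lambda>n. H1_norm (\<lambda>p. \<phi> n p - u p)) \<longlonglongrightarrow> 0}"

text \<open>The dual of \<open>H10\<close>. Boundedness also makes the functionals compatible with
  equality almost everywhere.\<close>

definition H10_dual :: "point functional set" where
  "H10_dual = {F. linear_functional_on H10 F \<and> (\<exists>C. \<forall>v\<in>H10. \<bar>F v\<bar> \<le> C * H1_norm v)}"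

definition H10_dual_norm :: "point functional \<Rightarrow> real" where
  "H10_dual_norm F = (SUP v \<in> {v \<in> H10. H1_norm v \<le> 1}. \<bar>F v\<bar>)"

text \<open>A distribution belongs to \<open>H\<^sup>-\<^sup>1\<close> if it extends to an element of the dual of
  \<open>H10\<close>. The extension is unique on \<open>H10\<close>, since test functions are dense there.\<close>

definition H_minus1 :: "point functional set" where
  "H_minus1 = {T \<in> distributions \<Omega>. \<exists>F\<in>H10_dual. \<forall>\<phi>\<in>test_functions \<Omega>. F \<phi> = T \<phi>}"

definition H_minus1_norm :: "point functional \<Rightarrow> real" where
  "H_minus1_norm T =
     (THE r. \<exists>F\<in>H10_dual. (\<forall>\<phi>\<in>test_functions \<Omega>. F \<phi> = T \<phi>) \<and> r = H10_dual_norm F)"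

text \<open>The trace as the continuous extension to \<open>H1\<close>, with values in \<open>L\<^sup>2(\<partial>\<Omega>)\<close>, of the
  restriction to \<open>\<partial>\<Omega> = \<real> \<times> {0, 1}\<close> of functions that are smooth with compact support up
  to the boundary.\<close>

definition has_trace :: "(point \<Rightarrow> real) \<Rightarrow> (point \<Rightarrow> real) \<Rightarrow> bool" where
  "has_trace u g \<longleftrightarrow>
     u \<in> H1 \<and>
     (\<forall>b\<in>{0, 1}. (\<lambda>x. g (x, b)) \<in> borel_measurable lborel \<and>
                 integrable lborel (\<lambda>x. (g (x, b))\<^sup>2)) \<and>
     (\<exists>\<phi>. (\<forall>n::nat. \<phi> n \<in> test_functions UNIV) \<and>
          (\<lambda>n. H1_norm (\<lambda>p. \<phi> n p - u p)) \<longlonglongrightarrow> 0 \<and>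
          (\<forall>b\<in>{0, 1}. (\<lambda>n. LINT x|lborel. (\<phi> n (x, b) - g (x, b))\<^sup>2) \<longlonglongrightarrow> 0))"

section \<open>Uniformly local spaces\<close>

text \<open>The cutoff depends on \<open>x\<close> only and is given as a function of that variable.\<close>

definition cutoff :: "(real \<Rightarrow> real) \<Rightarrow> bool" where
  "cutoff chi \<longleftrightarrow>
     smooth chi \<and> (\<forall>x. 0 \<le> chi x \<and> chi x \<le> 1) \<and>
     (\<forall>x\<in>{0<..<1}. chi x = 1) \<and> (\<forall>x. x \<notin> {-1<..<2} \<longrightarrow> chi x = 0) \<and>
     (\<forall>x. ((\<lambda>k::int. chi (x - of_int k)) has_sum 2) UNIV)"

definition cut_fun :: "(real \<Rightarrow> real) \<Rightarrow> int \<Rightarrow> (point \<Rightarrow> real) \<Rightarrow> point \<Rightarrow> real" where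
  "cut_fun chi k u = (\<lambda>p. chi (fst p - of_int k) * u p)"

definition cut_dist :: "(real \<Rightarrow> real) \<Rightarrow> int \<Rightarrow> point functional \<Rightarrow> point functional" where
  "cut_dist chi k T = (\<lambda>\<phi>. T (cut_fun chi k \<phi>))"

text \<open>Vector fields. The norm of an \<open>\<real>\<^sup>2\<close>-valued object is the Euclidean norm of the
  norms of its components, which is the Hilbert space norm on \<open>H\<^sup>1(\<Omega>)\<^sup>2\<close> and the
  corresponding dual norm.\<close>

definition H1_vec_norm_cut :: "(real \<Rightarrow> real) \<Rightarrow> int \<Rightarrow> (point \<Rightarrow> real \<times> real) \<Rightarrow> real" where
  "H1_vec_norm_cut chi k u =
     sqrt ((H1_norm (cut_fun chi k (fst \<circ> u)))\<^sup>2 + (H1_norm (cut_fun chi k (snd \<circ> u)))\<^sup>2)"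

definition H1_uloc :: "(real \<Rightarrow> real) \<Rightarrow> (point \<Rightarrow> real \<times> real) set" where
  "H1_uloc chi =
     {u. (\<forall>k. cut_fun chi k (fst \<circ> u) \<in> H1 \<and> cut_fun chi k (snd \<circ> u) \<in> H1) \<and>
         bdd_above (range (\<lambda>k. H1_vec_norm_cut chi k u))}"

definition H1_uloc_norm :: "(real \<Rightarrow> real) \<Rightarrow> (point \<Rightarrow> real \<times> real) \<Rightarrow> real" where
  "H1_uloc_norm chi u = (SUP k. H1_vec_norm_cut chi k u)"

definition H_minus1_vec_norm_cut ::
  "(real \<Rightarrow> real) \<Rightarrow> int \<Rightarrow> point functional \<times> point functional \<Rightarrow> real" where
  "H_minus1_vec_norm_cut chi k f =
     sqrt ((H_minus1_norm (cut_dist chi k (fst f)))\<^sup>2 +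
           (H_minus1_norm (cut_dist chi k (snd f)))\<^sup>2)"

definition H_minus1_uloc ::
  "(real \<Rightarrow> real) \<Rightarrow> (point functional \<times> point functional) set" where
  "H_minus1_uloc chi =
     {f. fst f \<in> distributions \<Omega> \<and> snd f \<in> distributions \<Omega> \<and>
         (\<forall>k. cut_dist chi k (fst f) \<in> H_minus1 \<and> cut_dist chi k (snd f) \<in> H_minus1) \<and>
         bdd_above (range (\<lambda>k. H_minus1_vec_norm_cut chi k f))}"

definition H_minus1_uloc_norm ::
  "(real \<Rightarrow> real) \<Rightarrow> point functional \<times> point functional \<Rightarrow> real" where
  "H_minus1_uloc_norm chi f = (SUP k. H_minus1_vec_norm_cut chi k f)"

section \<open>The Stokes problem with zero flux\<close>

definition momentum_eq ::
  "(point \<Rightarrow> real \<times> real) \<Rightarrow> point functional \<Rightarrow> point functional \<times> point functional \<Rightarrow> bool"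
  where
  "momentum_eq u p f \<longleftrightarrow>
     (\<forall>\<phi>\<in>test_functions \<Omega>.
        - dist_laplacian (dist_of (fst \<circ> u)) \<phi> + dist_deriv e\<^sub>x p \<phi> = fst f \<phi> \<and>
        - dist_laplacian (dist_of (snd \<circ> u)) \<phi> + dist_deriv e\<^sub>z p \<phi> = snd f \<phi>)"

definition divergence_free :: "(point \<Rightarrow> real \<times> real) \<Rightarrow> bool" where
  "divergence_free u \<longleftrightarrow>
     (\<forall>\<phi>\<in>test_functions \<Omega>.
        dist_deriv e\<^sub>x (dist_of (fst \<circ> u)) \<phi> + dist_deriv e\<^sub>z (dist_of (snd \<circ> u)) \<phi> = 0)"

text \<open>A field in \<open>H1_uloc\<close> need not be in \<open>H1\<close>, so its trace is taken locally, through the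
  products with the cutoffs.\<close>

definition zero_trace :: "(real \<Rightarrow> real) \<Rightarrow> (point \<Rightarrow> real \<times> real) \<Rightarrow> bool" where
  "zero_trace chi u \<longleftrightarrow>
     (\<forall>k. has_trace (cut_fun chi k (fst \<circ> u)) (\<lambda>_. 0) \<and>
          has_trace (cut_fun chi k (snd \<circ> u)) (\<lambda>_. 0))"

text \<open>For fields in \<open>H1_uloc\<close> the vertical integral exists for almost every \<open>x\<close> by Fubini,
  and it is defined up to null sets of \<open>x\<close>.\<close>

definition zero_flux :: "(point \<Rightarrow> real \<times> real) \<Rightarrow> bool" where
  "zero_flux u \<longleftrightarrow> (AE x in lborel. (LINT z:{0<..<1}|lborel. fst (u (x, z))) = 0)"

definition stokes_zero_flux ::
  "(real \<Rightarrow> real) \<Rightarrow> point functional \<times> point functional \<Rightarrow> (point \<Rightarrow> real \<times> real) \<Rightarrow> bool"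
  where
  "stokes_zero_flux chi f u \<longleftrightarrow>
     (\<exists>p\<in>distributions \<Omega>. momentum_eq u p f) \<and>
     divergence_free u \<and> zero_trace chi u \<and> zero_flux u"

end

(* A divergence-free field with zero flux is the rotated gradient (dz psi, - dx psi) of a stream
   function, which turns the Stokes problem into a biharmonic problem for psi in H^2_0. In two
   dimensions and with zero flux, Poincare's inequality in z controls all lower order terms, so the
   biharmonic form stays coercive when the test function is multiplied by a slowly varying weight
   w_k(x) = 1 / (1 + (x - k)^2 / 100). Since the translates w_k(j) sum to a constant over the
   integers j, uniformly local data have uniformly bounded weighted norms; solving in the weighted
   space for w_0 and estimating with each w_k gives existence and the uniform bound. The pressure is
   recovered by transposing a right inverse of the divergence on compactly supported fields.
   For uniqueness, the difference of two solutions is extended by zero, dilated away from the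
   boundary and mollified; its stream function, cut off at distance R, is an admissible test
   function, and the weighted coercivity forces it to vanish as R grows. *)

theory Submission
  imports Defs
begin

text \<open>Uniformly local data and solutions need not lie in an L2 space on the whole strip, hence
  the weights. The scale 10 in the weight is what keeps coercivity: its first two derivatives are at
  most 1/10 and 6/100 of it, and against the Poincare constant 1 the commutator with the weight
  stays below 26/100 of the weighted Hessian norm. The weighted form is not symmetric, so a Neumann
  iteration is put on top of the Riesz representation. All this happens on test functions, an
  incomplete space: equations are solved up to a small residual, and limits are taken in weighted L2
  of the derivatives of the approximate stream functions. The residual is small only for the weight
  centred at 0. For another centre one writes \<open>w_k psi = w_0 (w_k / w_0) psi\<close>; the
  quotient is bounded with two derivatives by a constant depending on k, but this constant
  multiplies a residual tending to 0, so the final bound is uniform in k. On the product domain the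
  divergence is inverted by two one-dimensional antiderivatives. Every cutoff and mollifier is made
  from the given \<open>chi\<close>.\<close>

abbreviation test :: "'a::euclidean_space set => ('a => real) set" where "test \<equiv> test_functions"

abbreviation bmeas :: "('a::topological_space => 'b::topological_space) set" where "bmeas \<equiv> borel_measurable borel"

lemmas LINT_cong = Bochner_Integration.integral_cong

abbreviation lims :: "(nat => 'a::topological_space) => 'a => bool" (infix "--->" 60) where "X ---> a \<equiv> X \<longlonglongrightarrow> a"

section \<open>Smooth functions\<close>

definition pd :: "'a::euclidean_space => ('a => real) => 'a => real" where
 "pd v f = (%x. frechet_derivative f (at x) v)"

text \<open>\<open>iter_deriv\<close> applies the head of the list last. Splitting off the end of
  the list exposes the innermost derivative instead, which is what passes smoothness from
  \<open>f\<close> to \<open>pd v f\<close>.\<close>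

lemma iter_deriv_append: "iter_deriv (vs @ [v]) f = iter_deriv vs (pd v f)"
 by (induction vs) (simp_all add: pd_def)

lemma smooth_differentiable: "smooth f ==> f differentiable (at x)"
 using iter_deriv.simps(1)[of f] unfolding smooth_def by (metis empty_set empty_subsetI)

lemma smooth_pd:
 assumes "smooth f" "v \<in> Basis"
 shows "smooth (pd v f)"
 unfolding smooth_def
proof (intro allI impI)
 fix vs :: "'a list" and x
 assume "set vs \<subseteq> Basis"
 then have "set (vs @ [v]) \<subseteq> Basis" using assms(2) by simp
 then show "iter_deriv vs (pd v f) differentiable at x"
  using assms(1) unfolding smooth_def by (metis iter_deriv_append)
qed

text \<open>Reverse induction on the list strips the innermost derivative, which stays in
  \<open>P\<close>. This serves as a coinduction rule: algebraic expressions, parameter integrals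
  and convolutions are each shown smooth by a class closed under partial derivatives.\<close>

lemma smooth_coinduct:
 assumes "P f"
  and step: "!!g. P g ==> (\<forall>x. g differentiable (at x)) & (\<forall>v\<in>Basis. P (pd v g))"
 shows "smooth f"
proof -
 have "\<forall>x. iter_deriv vs g differentiable (at x)" if "P g" "set vs \<subseteq> Basis" for g vs
  using that
 proof (induction vs arbitrary: g rule: rev_induct)
  case Nil then show ?case using step by simp
 next
  case (snoc v vs)
  then show ?case using step[OF snoc.prems(1)] by (simp add: iter_deriv_append)
 qed
 then show ?thesis using assms(1) by (auto simp: smooth_def)
qed

lemma frechet_derivativeD:
 assumes "f differentiable (at x)"
 shows "(f has_derivative frechet_derivative f (at x)) (at x)"
 using assms by (simp add: frechet_derivative_works)

lemma pd_eqI: "(f has_derivative f') (at x) ==> pd v f x = f' v"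
 unfolding pd_def using frechet_derivative_at by force

lemma pd_const [simp]: "pd v (%x. c) = (%x. 0)"
 by (rule ext) (rule pd_eqI, rule has_derivative_const)

lemma pd_add:
 assumes "f differentiable (at x)" "g differentiable (at x)"
 shows "pd v (%y. f y + g y) x = pd v f x + pd v g x"
 by (rule pd_eqI[THEN trans])
  (rule has_derivative_add frechet_derivativeD assms | simp add: pd_def)+

lemma pd_mult:
 assumes "f differentiable (at x)" "g differentiable (at x)"
 shows "pd v (%y. f y * g y) x = pd v f x * g x + f x * pd v g x"
 by (rule pd_eqI[THEN trans])
  (rule has_derivative_mult frechet_derivativeD assms | simp add: pd_def algebra_simps)+

lemma pd_inverse:
 assumes "f differentiable (at x)" "f x ~= 0"
 shows "pd v (%y. 1 / f y) x = - pd v f x * ((1 / f x) * (1 / f x))"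
proof -
 have "((%y. inverse (f y)) has_derivative
   (%h. - (inverse (f x) * frechet_derivative f (at x) h * inverse (f x)))) (at x)"
  by (rule Deriv.has_derivative_inverse[OF assms(2) frechet_derivativeD[OF assms(1)]])
 then have "pd v (%y. inverse (f y)) x = - (inverse (f x) * frechet_derivative f (at x) v * inverse (f x))"
  by (rule pd_eqI)
 then show ?thesis by (simp add: pd_def field_simps)
qed

lemma differentiable_comp_affine:
 fixes g :: "'b::euclidean_space => real" and l :: "'a::euclidean_space => 'b"
 assumes "g differentiable (at (l x + c))" "bounded_linear l"
 shows "(%x. g (l x + c)) differentiable (at x)"
  and "pd v (%x. g (l x + c)) x = frechet_derivative g (at (l x + c)) (l v)"
proof -
 have *: "((%x. g (l x + c)) has_derivative (%h. frechet_derivative g (at (l x + c)) (l h))) (at x)"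
  by (rule has_derivative_compose[where f="%x. l x + c"])
   (auto intro!: derivative_eq_intros bounded_linear_imp_has_derivative assms frechet_derivativeD)
 show "(%x. g (l x + c)) differentiable (at x)" using * differentiable_def by blast
 show "pd v (%x. g (l x + c)) x = frechet_derivative g (at (l x + c)) (l v)"
  using * by (rule pd_eqI)
qed

lemma pd_comp_affine:
 fixes g :: "'b::euclidean_space => real" and l :: "'a::euclidean_space => 'b"
 assumes "smooth g" "bounded_linear l"
 shows "pd v (%x. g (l x + c)) = (%x. \<Sum>b\<in>Basis. (l v \<bullet> b) * pd b g (l x + c))"
proof
 fix x
 let ?D = "frechet_derivative g (at (l x + c))"
 have bl: "bounded_linear ?D"
  using smooth_differentiable[OF assms(1)] frechet_derivativeD has_derivative_bounded_linear by blast
 then have "linear ?D" by (rule bounded_linear.linear)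
 have "?D (l v) = ?D (\<Sum>b\<in>Basis. (l v \<bullet> b) *\<^sub>R b)" by (simp add: euclidean_representation)
 also have "\<dots> = (\<Sum>b\<in>Basis. (l v \<bullet> b) * ?D b)"
  using \<open>linear ?D\<close> by (simp add: linear_sum linear_cmul)
 finally show "pd v (%x. g (l x + c)) x = (\<Sum>b\<in>Basis. (l v \<bullet> b) * pd b g (l x + c))"
  using differentiable_comp_affine(2)[OF smooth_differentiable[OF assms(1)] assms(2)]
  by (simp add: pd_def)
qed

text \<open>Auxiliary closure of the smooth functions under the algebraic operations; it is stable
 under differentiation, hence consists of smooth functions.\<close>

inductive smooth_closure :: "('a::euclidean_space => real) => bool" where
 base: "smooth f ==> smooth_closure f"
| affine: "smooth g ==> bounded_linear l ==> smooth_closure (%x. (g :: 'a => real) (l x + c))"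
| affine1: "smooth h ==> bounded_linear k ==> smooth_closure (%x. (h :: real => real) (k x + d))"
| add: "smooth_closure f ==> smooth_closure g ==> smooth_closure (%x. f x + g x)"
| mult: "smooth_closure f ==> smooth_closure g ==> smooth_closure (%x. f x * g x)"
| inverse: "smooth_closure f ==> (!!x. f x ~= 0) ==> smooth_closure (%x. 1 / f x)"

lemma smooth_const [simp]: "smooth (%x. c)"
 by (rule smooth_coinduct[where P="%f. \<exists>c. f = (%x. c)"]) auto

lemma smooth_closure_const: "smooth_closure (%x. c)"
 by (rule base) simp

lemma smooth_closure_sum:
 "finite I ==> (!!i. i \<in> I ==> smooth_closure (f i)) ==> smooth_closure (%x. \<Sum>i\<in>I. f i x)"
 by (induction I rule: finite_induct) (auto intro: smooth_closure_const smooth_closure.add)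

lemma smooth_closure_step:
 assumes "smooth_closure f"
 shows "(\<forall>x. f differentiable (at x)) & (\<forall>v\<in>Basis. smooth_closure (pd v f))"
 using assms
proof induction
 case (base f)
 then show ?case using smooth_differentiable smooth_pd smooth_closure.base by blast
next
 case (affine g l c)
 have "smooth_closure (%x. \<Sum>b\<in>Basis. l v \<bullet> b * pd b g (l x + c))" for v
  by (rule smooth_closure_sum, simp, rule smooth_closure.mult[OF smooth_closure_const],
    rule smooth_closure.affine[OF smooth_pd]) (use affine in auto)
 with affine show ?case
  by (auto simp: pd_comp_affine smooth_differentiable intro!: differentiable_comp_affine(1))
next
 case (affine1 h k d)
 have "smooth_closure (%x. \<Sum>b\<in>Basis. k v \<bullet> b * pd b h (k x + d))" for v
  by (rule smooth_closure_sum, simp, rule smooth_closure.mult[OF smooth_closure_const],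
    rule smooth_closure.affine1[OF smooth_pd]) (use affine1 in auto)
 with affine1 show ?case
  using pd_comp_affine[OF affine1]
  by (auto simp: smooth_differentiable intro!: differentiable_comp_affine(1))
next
 case (add f g)
 then have "pd v (%x. f x + g x) = (%x. pd v f x + pd v g x)" for v by (auto simp: pd_add)
 with add show ?case by (simp add: smooth_closure.add)
next
 case (mult f g)
 then have "pd v (%x. f x * g x) = (%x. pd v f x * g x + f x * pd v g x)" for v by (auto simp: pd_mult)
 with mult show ?case by (simp add: smooth_closure.add smooth_closure.mult)
next
 case (inverse f)
 then have "pd v (%x. 1 / f x) = (%x. ((-1) * pd v f x) * ((1 / f x) * (1 / f x)))" for v
  by (auto simp: pd_inverse)
 moreover have "smooth_closure (%x. ((-1) * pd v f x) * ((1 / f x) * (1 / f x)))" if "v \<in> Basis" for v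
  by (rule smooth_closure.mult[OF smooth_closure.mult[OF smooth_closure_const]
     smooth_closure.mult[OF smooth_closure.inverse smooth_closure.inverse]])
   (use inverse that in auto)
 ultimately show ?case
  using inverse by auto
qed

lemma smooth_closure_smooth: "smooth_closure f ==> smooth f"
 by (rule smooth_coinduct[where P=smooth_closure]) (use smooth_closure_step in auto)

lemma smooth_add: "smooth f ==> smooth g ==> smooth (%x. f x + g x)"
 by (rule smooth_closure_smooth[OF smooth_closure.add]) (simp_all add: smooth_closure.base)

lemma smooth_mult: "smooth f ==> smooth g ==> smooth (%x. f x * g x)"
 by (rule smooth_closure_smooth[OF smooth_closure.mult]) (simp_all add: smooth_closure.base)

lemma smooth_uminus: "smooth f ==> smooth (%x. - f x)"
 using smooth_mult[of "%x. -1" f] by simp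

lemma smooth_diff: "smooth f ==> smooth g ==> smooth (%x. f x - g x)"
 using smooth_add[of f "%x. - g x"] smooth_uminus[of g] by simp

lemma smooth_inverse: "smooth f ==> (!!x. f x ~= 0) ==> smooth (%x. 1 / f x)"
 by (rule smooth_closure_smooth[OF smooth_closure.inverse]) (simp_all add: smooth_closure.base)

lemma smooth_sum:
 "finite I ==> (!!i. i \<in> I ==> smooth (f i)) ==> smooth (%x. \<Sum>i\<in>I. f i x)"
 by (rule smooth_closure_smooth[OF smooth_closure_sum]) (simp_all add: smooth_closure.base)

lemma smooth_affine:
 fixes g :: "'a::euclidean_space => real" and l :: "'a => 'a"
 shows "smooth g ==> bounded_linear l ==> smooth (%x. g (l x + c))"
 by (rule smooth_closure_smooth[OF smooth_closure.affine])

lemma smooth_affine_real: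
 fixes g :: "real => real"
 shows "smooth g ==> bounded_linear l ==> smooth (%x. g (l x + c))"
 by (rule smooth_closure_smooth) (rule smooth_closure.affine1)

lemma smooth_ident_real: "smooth (%x::real. x)"
proof -
 have *: "pd v (%x::real. x) = (%x. v)" for v
  by (rule ext) (rule pd_eqI, rule has_derivative_ident)
 show ?thesis
  by (rule smooth_coinduct[where P="%f. f = (%x. x) \<or> (\<exists>c. f = (%x. c))"]) (auto simp: *)
qed

lemma smooth_fst: "smooth (g :: real => real) ==> smooth (%p::point. g (fst p))"
 using smooth_affine_real[of g fst 0] bounded_linear_fst by simp

lemma smooth_snd: "smooth (g :: real => real) ==> smooth (%p::point. g (snd p))"
 using smooth_affine_real[of g snd 0] bounded_linear_snd by simp

lemma smooth_shift_real: "smooth (g :: real => real) ==> smooth (%x. g (a * x + c))"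
 using smooth_affine_real[OF _ bounded_linear_mult_right[of a], of g c] by simp

lemma smooth_continuous: "smooth f ==> continuous_on S f"
 by (meson continuous_at_imp_continuous_on differentiable_imp_continuous_within smooth_differentiable)

lemma smooth_measurable [measurable (raw)]:
 fixes f :: "'a::euclidean_space => real"
 shows "smooth f ==> f \<in> bmeas"
 by (intro borel_measurable_continuous_onI smooth_continuous)

lemma smooth_has_field_derivative:
 fixes g :: "real => real"
 assumes "smooth g"
 shows "(g has_field_derivative pd 1 g x) (at x)"
proof -
 have *: "(g has_derivative frechet_derivative g (at x)) (at x)"
  using assms by (simp add: frechet_derivativeD smooth_differentiable)
 then have "frechet_derivative g (at x) h = pd 1 g x * h" for h
 proof -
  have "linear (frechet_derivative g (at x))" using * has_derivative_linear by blast
  then have "frechet_derivative g (at x) (h *\<^sub>R 1) = h *\<^sub>R frechet_derivative g (at x) 1"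
   by (rule linear_cmul)
  then show ?thesis by (simp add: pd_def)
 qed
 then have "frechet_derivative g (at x) = (*) (pd 1 g x)" by (rule ext)
 with * show ?thesis by (simp add: has_field_derivative_def)
qed

lemma pd_real_eqI: "(g has_field_derivative d) (at x) ==> pd 1 g x = d"
 unfolding has_field_derivative_def using pd_eqI by fastforce

lemma smooth_deriv: "smooth (g::real=>real) ==> smooth (pd 1 g)"
 by (rule smooth_pd) auto

lemma e_in_Basis [simp]: "e\<^sub>x \<in> Basis" "e\<^sub>z \<in> Basis" and Basis_point: "(Basis :: point set) = {e\<^sub>x, e\<^sub>z}"
 and e_neq [simp]: "e\<^sub>x ~= e\<^sub>z" "e\<^sub>z ~= e\<^sub>x"
 by (auto simp: e\<^sub>x_def e\<^sub>z_def Basis_prod_def)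

abbreviation dx :: "(point => real) => point => real" where "dx \<equiv> pd e\<^sub>x"
abbreviation dz :: "(point => real) => point => real" where "dz \<equiv> pd e\<^sub>z"

lemma smooth_dx: "smooth f ==> smooth (dx f)" and smooth_dz: "smooth f ==> smooth (dz f)"
 by (simp_all add: smooth_pd)

lemma smooth_has_derivative_point:
 assumes "smooth (f :: point => real)"
 shows "(f has_derivative (%h. fst h * dx f p + snd h * dz f p)) (at p)"
proof -
 have *: "(f has_derivative frechet_derivative f (at p)) (at p)"
  using assms by (simp add: frechet_derivativeD smooth_differentiable)
 then have lin: "linear (frechet_derivative f (at p))" using has_derivative_linear by blast
 have "frechet_derivative f (at p) h = fst h * dx f p + snd h * dz f p" for h
 proof -
  have "h = fst h *\<^sub>R e\<^sub>x + snd h *\<^sub>R e\<^sub>z" by (simp add: e\<^sub>x_def e\<^sub>z_def prod_eq_iff)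
  then have "frechet_derivative f (at p) h = frechet_derivative f (at p) (fst h *\<^sub>R e\<^sub>x + snd h *\<^sub>R e\<^sub>z)"
   by simp
  also have "\<dots> = fst h * dx f p + snd h * dz f p"
   using lin by (simp add: linear_add linear_cmul pd_def)
  finally show ?thesis .
 qed
 then have "frechet_derivative f (at p) = (%h. fst h * dx f p + snd h * dz f p)" by (rule ext)
 with * show ?thesis by simp
qed

lemma smooth_slice_x:
 assumes "smooth (f :: point => real)"
 shows "((%x. f (x, z)) has_field_derivative dx f (x, z)) (at x)"
proof -
 have "((%x. f (x, z)) has_derivative (%h. fst (h, 0::real) * dx f (x, z) + snd (h, 0::real) * dz f (x, z))) (at x)"
  by (rule has_derivative_compose[where f="%x. (x, z)"])
   (auto intro!: derivative_eq_intros smooth_has_derivative_point[OF assms])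
 then show ?thesis by (simp add: has_field_derivative_def mult.commute[of _ "dx f (x,z)"])
qed

lemma smooth_slice_z:
 assumes "smooth (f :: point => real)"
 shows "((%z. f (x, z)) has_field_derivative dz f (x, z)) (at z)"
proof -
 have "((%z. f (x, z)) has_derivative (%h. fst (0::real, h) * dx f (x, z) + snd (0::real, h) * dz f (x, z))) (at z)"
  by (rule has_derivative_compose[where f="%z. (x, z)"])
   (auto intro!: derivative_eq_intros smooth_has_derivative_point[OF assms])
 then show ?thesis by (simp add: has_field_derivative_def mult.commute[of _ "dz f (x,z)"])
qed

text \<open>The second difference over a square of side \<open>h\<close>, evaluated by two mean
  value theorems in either order, is \<open>h * h\<close> times either mixed derivative at a nearby
  point. Continuity of both mixed derivatives at \<open>p\<close> identifies them as
  \<open>h\<close> tends to 0.\<close>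

lemma pd_commute:
 assumes "smooth (f :: point => real)"
 shows "dz (dx f) = dx (dz f)"
proof
 fix p :: point
 obtain a b where p: "p = (a, b)" by (cases p)
 let ?F = "%h. f (a + h, b + h) - f (a + h, b) - f (a, b + h) + f (a, b)"
 have 1: "\<exists>q. dist q p <= 2 * h & ?F h = h * h * dz (dx f) q" if h: "h > 0" for h
 proof -
  have "\<exists>x>a. x < a + h & (f (a + h, b + h) - f (a + h, b)) - (f (a, b + h) - f (a, b))
    = (a + h - a) * (dx f (x, b + h) - dx f (x, b))"
   using h by (intro MVT2) (auto intro!: derivative_eq_intros smooth_slice_x[OF assms])
  then obtain x where x: "a < x" "x < a + h"
   and e1: "?F h = h * (dx f (x, b + h) - dx f (x, b))" by auto
  have "\<exists>z>b. z < b + h & dx f (x, b + h) - dx f (x, b) = (b + h - b) * dz (dx f) (x, z)"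
   using h by (intro MVT2) (auto intro!: smooth_slice_z smooth_dx assms)
  then obtain z where z: "b < z" "z < b + h" and e2: "dx f (x, b + h) - dx f (x, b) = h * dz (dx f) (x, z)"
   by auto
  have "dist (x, z) p <= 2 * h"
   using x z p sqrt_sum_squares_le_sum_abs[of "x - a" "z - b"] by (simp add: dist_prod_def dist_real_def)
  then show ?thesis using e1 e2 by auto
 qed
 have 2: "\<exists>q. dist q p <= 2 * h & ?F h = h * h * dx (dz f) q" if h: "h > 0" for h
 proof -
  have "\<exists>z>b. z < b + h & (f (a + h, b + h) - f (a, b + h)) - (f (a + h, b) - f (a, b))
    = (b + h - b) * (dz f (a + h, z) - dz f (a, z))"
   using h by (intro MVT2) (auto intro!: derivative_eq_intros smooth_slice_z[OF assms])
  then obtain z where z: "b < z" "z < b + h"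
   and e1: "?F h = h * (dz f (a + h, z) - dz f (a, z))" by auto
  have "\<exists>x>a. x < a + h & dz f (a + h, z) - dz f (a, z) = (a + h - a) * dx (dz f) (x, z)"
   using h by (intro MVT2) (auto intro!: smooth_slice_x smooth_dz assms)
  then obtain x where x: "a < x" "x < a + h" and e2: "dz f (a + h, z) - dz f (a, z) = h * dx (dz f) (x, z)"
   by auto
  have "dist (x, z) p <= 2 * h"
   using x z p sqrt_sum_squares_le_sum_abs[of "x - a" "z - b"] by (simp add: dist_prod_def dist_real_def)
  then show ?thesis using e1 e2 by auto
 qed
 have c: "isCont (dz (dx f)) p" "isCont (dx (dz f)) p"
  by (rule differentiable_imp_continuous_within[OF smooth_differentiable], simp add: smooth_dx smooth_dz assms)+
 show "dz (dx f) p = dx (dz f) p"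
 proof (rule ccontr)
  assume ne: "dz (dx f) p ~= dx (dz f) p"
  define e where "e = \<bar>dz (dx f) p - dx (dz f) p\<bar> / 2"
  have "e > 0" using ne by (simp add: e_def)
  obtain d1 where d1: "d1 > 0" "!!q. dist q p < d1 ==> dist (dz (dx f) q) (dz (dx f) p) < e"
   using c(1) \<open>e > 0\<close> unfolding continuous_at_eps_delta by blast
  obtain d2 where d2: "d2 > 0" "!!q. dist q p < d2 ==> dist (dx (dz f) q) (dx (dz f) p) < e"
   using c(2) \<open>e > 0\<close> unfolding continuous_at_eps_delta by blast
  define h where "h = min d1 d2 / 4"
  have h: "h > 0" "2 * h < d1" "2 * h < d2" using d1(1) d2(1) by (auto simp: h_def)
  from 1[OF h(1)] 2[OF h(1)] obtain q r where
   q: "dist q p <= 2 * h" "?F h = h * h * dz (dx f) q" and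
   r: "dist r p <= 2 * h" "?F h = h * h * dx (dz f) r" by blast
  have "dz (dx f) q = dx (dz f) r" using q(2) r(2) h(1) by simp
  moreover have "\<bar>dz (dx f) q - dz (dx f) p\<bar> < e" "\<bar>dx (dz f) r - dx (dz f) p\<bar> < e"
   using d1(2)[of q] d2(2)[of r] q(1) r(1) h by (auto simp: dist_real_def)
  ultimately show False unfolding e_def by (auto simp: abs_if split: if_splits)
 qed
qed

section \<open>Square integrable functions\<close>

text \<open>Functions rather than classes, so \<open>l2 M\<close> is only a seminorm here. The
  measure is a parameter because the plane, the strip and the real line all occur.\<close>

definition sqi :: "'a measure => ('a => real) set" where
 "sqi M = {f \<in> borel_measurable M. integrable M (%x. (f x)^2)}"

definition l2 :: "'a measure => ('a => real) => real" where
 "l2 M f = sqrt (\<integral>x. (f x)^2 \<partial>M)"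

lemma sqi_measurable [measurable_dest]: "f \<in> sqi M ==> f \<in> borel_measurable M"
 and sqi_integrable: "f \<in> sqi M ==> integrable M (%x. (f x)^2)"
 by (auto simp: sqi_def)

lemma sqi_mult:
 assumes f: "f \<in> sqi M" and g: "g \<in> sqi M"
 shows "integrable M (%x. f x * g x)"
proof (rule Bochner_Integration.integrable_bound)
 show "integrable M (%x. (f x)^2 + (g x)^2)" using assms by (simp add: sqi_def)
 show "(%x. f x * g x) \<in> borel_measurable M" using assms by measurable
 show "AE x in M. norm (f x * g x) <= norm ((f x)^2 + (g x)^2)"
 proof (rule AE_I2)
  fix x
  have "2 * (\<bar>f x\<bar> * \<bar>g x\<bar>) <= (f x)^2 + (g x)^2"
   using sum_squares_bound[of "\<bar>f x\<bar>" "\<bar>g x\<bar>"] by simp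
  moreover have "0 <= \<bar>f x\<bar> * \<bar>g x\<bar>" by simp
  ultimately have "\<bar>f x\<bar> * \<bar>g x\<bar> <= (f x)^2 + (g x)^2" by linarith
  then show "norm (f x * g x) <= norm ((f x)^2 + (g x)^2)" by (simp add: abs_mult)
 qed
qed

lemma sqi_lin:
 assumes f: "f \<in> sqi M" and g: "g \<in> sqi M"
 shows "(%x. a * f x + b * g x) \<in> sqi M"
proof -
 have "integrable M (%x. a\<^sup>2 * (f x)^2 + 2 * a * b * (f x * g x) + b\<^sup>2 * (g x)^2)"
  using assms sqi_mult[OF assms] by (auto simp: sqi_def)
 also have "(%x. a\<^sup>2 * (f x)^2 + 2 * a * b * (f x * g x) + b\<^sup>2 * (g x)^2) = (%x. (a * f x + b * g x)^2)"
  by (auto simp: power2_eq_square algebra_simps)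
 finally have "integrable M (%x. (a * f x + b * g x)^2)" .
 moreover have "(%x. a * f x + b * g x) \<in> borel_measurable M" using assms by measurable
 ultimately show ?thesis by (simp add: sqi_def)
qed

lemma sqi_add: "f \<in> sqi M ==> g \<in> sqi M ==> (%x. f x + g x) \<in> sqi M"
 using sqi_lin[of f M g 1 1] by simp

lemma sqi_diff: "f \<in> sqi M ==> g \<in> sqi M ==> (%x. f x - g x) \<in> sqi M"
 using sqi_lin[of f M g 1 "-1"] by simp

lemma sqi_zero [simp]: "(%x. 0) \<in> sqi M"
 by (simp add: sqi_def)

lemma sqi_cmult: "f \<in> sqi M ==> (%x. c * f x) \<in> sqi M"
 using sqi_lin[of f M f c 0] by simp

lemma sqi_uminus: "f \<in> sqi M ==> (%x. - f x) \<in> sqi M"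
 using sqi_cmult[of f M "-1"] by simp

lemma sqi_sum: "finite I ==> (!!i. i \<in> I ==> f i \<in> sqi M) ==> (%x. \<Sum>i\<in>I. f i x) \<in> sqi M"
 by (induction I rule: finite_induct) (simp_all add: sqi_add)

lemma sqi_bounded_mult:
 assumes f: "f \<in> sqi M" and [measurable]: "b \<in> borel_measurable M" and bd: "!!x. x \<in> space M ==> \<bar>b x\<bar> <= C"
 shows "(%x. b x * f x) \<in> sqi M"
proof -
 have [measurable]: "f \<in> borel_measurable M" using f by (simp add: sqi_def)
 have "integrable M (%x. (b x * f x)^2)"
 proof (rule Bochner_Integration.integrable_bound)
  show "integrable M (%x. C\<^sup>2 * (f x)^2)" using f by (simp add: sqi_def)
  show "AE x in M. norm ((b x * f x)^2) <= norm (C\<^sup>2 * (f x)^2)"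
  proof (rule AE_I2)
   fix x assume "x \<in> space M"
   then have "\<bar>b x\<bar> <= \<bar>C\<bar>" using bd by force
   then have "(b x)^2 <= C\<^sup>2" by (simp add: abs_le_square_iff)
   then show "norm ((b x * f x)^2) <= norm (C\<^sup>2 * (f x)^2)"
    by (auto simp: power_mult_distrib intro: mult_right_mono)
  qed
 qed simp
 then show ?thesis by (simp add: sqi_def)
qed

lemma l2_nonneg [simp]: "0 <= l2 M f"
 by (simp add: l2_def)

lemma l2_sq: "(l2 M f)^2 = (\<integral>x. (f x)^2 \<partial>M)"
 by (simp add: l2_def)

lemma l2_cong_AE:
 assumes "AE x in M. f x = g x" "f \<in> borel_measurable M" "g \<in> borel_measurable M"
 shows "l2 M f = l2 M g"
 unfolding l2_def by (rule arg_cong[where f=sqrt], rule integral_cong_AE) (use assms in auto)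

text \<open>Nonnegativity of the integral of \<open>(f - t g)^2\<close> as a quadratic in t. Its
  leading coefficient may vanish without \<open>g\<close> being 0 pointwise; in that case the
  quadratic is affine in t and its slope must be 0.\<close>

lemma l2_cauchy_schwarz:
 assumes f: "f \<in> sqi M" and g: "g \<in> sqi M"
 shows "\<bar>\<integral>x. f x * g x \<partial>M\<bar> <= l2 M f * l2 M g"
proof -
 define A B C where "A = (\<integral>x. (f x)^2 \<partial>M)" and "B = (\<integral>x. f x * g x \<partial>M)" and "C = (\<integral>x. (g x)^2 \<partial>M)"
 have nn: "0 <= A" "0 <= C" by (auto simp: A_def C_def)
 have q: "0 <= A - 2 * t * B + t\<^sup>2 * C" for t
 proof -
  have "0 <= (\<integral>x. (f x - t * g x)^2 \<partial>M)" by simp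
  also have "(%x. (f x - t * g x)^2) = (%x. (f x)^2 - 2 * t * (f x * g x) + t\<^sup>2 * (g x)^2)"
   by (auto simp: power2_eq_square algebra_simps)
  also have "(\<integral>x. (f x)^2 - 2 * t * (f x * g x) + t\<^sup>2 * (g x)^2 \<partial>M) = A - 2 * t * B + t\<^sup>2 * C"
   using sqi_mult[OF f g] f g by (simp add: A_def B_def C_def sqi_def)
  finally show ?thesis .
 qed
 have "B\<^sup>2 <= A * C"
 proof (cases "C = 0")
  case True
  have "B = 0"
  proof (rule ccontr)
   assume "B ~= 0"
   have "0 <= A - 2 * ((A + 1) / (2 * B)) * B" using q[of "(A + 1) / (2 * B)"] True by simp
   then show False using \<open>B ~= 0\<close> by simp
  qed
  then show ?thesis using nn by simp
 next
  case False
  then have "0 < C" using nn by simp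
  have "0 <= A - 2 * (B / C) * B + (B / C)^2 * C" by (rule q)
  also have "\<dots> = A - B\<^sup>2 / C" using False by (simp add: field_simps power2_eq_square)
  finally show ?thesis using \<open>0 < C\<close> by (simp add: field_simps)
 qed
 then have "sqrt (B\<^sup>2) <= sqrt (A * C)" by (rule real_sqrt_le_mono)
 then show ?thesis by (simp add: l2_def A_def B_def C_def real_sqrt_mult)
qed

lemma l2_triangle:
 assumes f: "f \<in> sqi M" and g: "g \<in> sqi M"
 shows "l2 M (%x. f x + g x) <= l2 M f + l2 M g"
proof (rule power2_le_imp_le)
 have "(l2 M (%x. f x + g x))^2 = (\<integral>x. (f x)^2 + 2 * (f x * g x) + (g x)^2 \<partial>M)"
  unfolding l2_sq by (rule LINT_cong) (auto simp: power2_eq_square algebra_simps)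
 also have "\<dots> = (l2 M f)^2 + 2 * (\<integral>x. f x * g x \<partial>M) + (l2 M g)^2"
  using sqi_mult[OF f g] f g by (simp add: l2_sq sqi_def)
 also have "\<dots> <= (l2 M f + l2 M g)^2"
  using l2_cauchy_schwarz[OF f g] by (simp add: power2_eq_square algebra_simps)
 finally show "(l2 M (%x. f x + g x))^2 <= (l2 M f + l2 M g)^2" .
qed simp

lemma l2_cmult: "l2 M (%x. c * f x) = \<bar>c\<bar> * l2 M f"
 by (simp add: l2_def power_mult_distrib real_sqrt_mult)

lemma l2_minus_commute: "l2 M (%x. f x - g x) = l2 M (%x. g x - f x)"
 by (simp add: l2_def power2_commute)

lemma l2_triangle_diff:
 assumes "f \<in> sqi M" "g \<in> sqi M" "h \<in> sqi M"
 shows "l2 M (%x. f x - h x) <= l2 M (%x. f x - g x) + l2 M (%x. g x - h x)"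
 using l2_triangle[OF sqi_diff[OF assms(1,2)] sqi_diff[OF assms(2,3)]] by simp

lemma l2_mono:
 assumes "g \<in> sqi M" "f \<in> borel_measurable M" "!!x. x \<in> space M ==> \<bar>f x\<bar> <= \<bar>g x\<bar>"
 shows "f \<in> sqi M" "l2 M f <= l2 M g"
proof -
 have i: "integrable M (%x. (f x)^2)"
  by (rule Bochner_Integration.integrable_bound[where f="%x. (g x)^2"])
   (use assms in \<open>auto simp: sqi_def abs_le_square_iff\<close>)
 then show "f \<in> sqi M" using assms by (simp add: sqi_def)
 show "l2 M f <= l2 M g"
  unfolding l2_def
  by (intro real_sqrt_le_mono integral_mono) (use assms i in \<open>auto simp: sqi_def abs_le_square_iff\<close>)
qed

text \<open>Bilinear expansion around the limits: each of the three error terms has a factor tending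
  to 0 in norm, and Cauchy-Schwarz applies to each.\<close>

lemma l2_tendsto_inner:
 assumes s: "!!n. s n \<in> sqi M" and t: "!!n. t n \<in> sqi M" and f: "f \<in> sqi M" and g: "g \<in> sqi M"
  and sf: "(%n. l2 M (%x. s n x - f x)) ---> 0" and tg: "(%n. l2 M (%x. t n x - g x)) ---> 0"
 shows "(%n. \<integral>x. s n x * t n x \<partial>M) ---> (\<integral>x. f x * g x \<partial>M)"
proof -
 let ?a = "%n. l2 M (%x. s n x - f x)" and ?b = "%n. l2 M (%x. t n x - g x)"
 have le: "norm ((\<integral>x. s n x * t n x \<partial>M) - (\<integral>x. f x * g x \<partial>M)) <= ?a n * ?b n + ?a n * l2 M g + l2 M f * ?b n" for n
 proof -
  note d = sqi_diff[OF s[of n] f] sqi_diff[OF t[of n] g]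
  have "(\<integral>x. s n x * t n x \<partial>M) - (\<integral>x. f x * g x \<partial>M) =
   (\<integral>x. (s n x - f x) * (t n x - g x) \<partial>M) + (\<integral>x. (s n x - f x) * g x \<partial>M) + (\<integral>x. f x * (t n x - g x) \<partial>M)"
  proof -
   have "(\<integral>x. s n x * t n x \<partial>M) =
    (\<integral>x. (s n x - f x) * (t n x - g x) + (s n x - f x) * g x + f x * (t n x - g x) + f x * g x \<partial>M)"
    by (rule LINT_cong) (simp_all add: algebra_simps)
   also have "\<dots> = (\<integral>x. (s n x - f x) * (t n x - g x) \<partial>M) + (\<integral>x. (s n x - f x) * g x \<partial>M)
     + (\<integral>x. f x * (t n x - g x) \<partial>M) + (\<integral>x. f x * g x \<partial>M)"
    using sqi_mult[OF d] sqi_mult[OF d(1) g] sqi_mult[OF f d(2)] sqi_mult[OF f g] by simp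
   finally show ?thesis by simp
  qed
  then show ?thesis
   using l2_cauchy_schwarz[OF d] l2_cauchy_schwarz[OF d(1) g] l2_cauchy_schwarz[OF f d(2)]
   unfolding real_norm_def by linarith
 qed
 have lim: "(%n. ?a n * ?b n + ?a n * l2 M g + l2 M f * ?b n) ---> 0"
  using tendsto_add[OF tendsto_add[OF tendsto_mult[OF sf tg] tendsto_mult_left_zero[OF sf, of "l2 M g"]]
    tendsto_mult_right_zero[OF tg, of "l2 M f"]] by simp
 have "(%n. (\<integral>x. s n x * t n x \<partial>M) - (\<integral>x. f x * g x \<partial>M)) ---> 0"
  by (rule Lim_null_comparison[OF always_eventually lim]) (use le in blast)
 then show ?thesis by (simp add: LIM_zero_iff)
qed

lemma l2_tendsto_norm:
 assumes s: "!!n. s n \<in> sqi M" and f: "f \<in> sqi M" and lim: "(%n. l2 M (%x. s n x - f x)) ---> 0"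
 shows "(%n. l2 M (s n)) ---> l2 M f"
proof -
 have "(%n. \<integral>x. s n x * s n x \<partial>M) ---> (\<integral>x. f x * f x \<partial>M)"
  by (rule l2_tendsto_inner[OF s s f f lim lim])
 then show ?thesis unfolding l2_def power2_eq_square by (rule tendsto_real_sqrt)
qed

lemma l2_eq_0_AE: "f \<in> sqi M ==> l2 M f = 0 ==> AE x in M. f x = 0"
 by (simp add: l2_def sqi_def integral_nonneg_eq_0_iff_AE)

text \<open>Riesz--Fischer: a rapidly convergent subsequence converges almost everywhere because
 \<open>\<Sum> (2\<^sup>k d\<^sub>k)\<^sup>2\<close> is integrable, where \<open>d\<^sub>k\<close> are the consecutive differences.\<close>

lemma l2_complete:
 assumes s: "!!n. s n \<in> sqi M"
  and cauchy: "!!e. e > 0 ==> \<exists>N. \<forall>m\<ge>N. \<forall>n\<ge>N. l2 M (%x. s m x - s n x) < e"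
 shows "\<exists>f\<in>sqi M. (%n. l2 M (%x. s n x - f x)) ---> 0"
proof -
 have [measurable]: "s n \<in> borel_measurable M" for n using s by (simp add: sqi_def)
 \<comment> \<open>The rate 4^-k leaves room for the factor 2^k put in front of the differences: the
   squares of \<open>2^k * d k\<close> still have summable integrals.\<close>
 have "\<forall>k::nat. \<exists>N. \<forall>m\<ge>N. \<forall>n\<ge>N. l2 M (%x. s m x - s n x) < (1/4)^k"
  using cauchy by simp
 then obtain N where N: "!!k m n. m >= N k ==> n >= N k ==> l2 M (%x. s m x - s n x) < (1/4)^k"
  by metis
 \<comment> \<open>Summing all earlier thresholds makes \<open>r j\<close> exceed \<open>N k\<close>
   for every k up to j; the summand \<open>k\<close> makes \<open>r\<close> tend to
   infinity.\<close>
 define r where "r k = (\<Sum>i\<le>k. N i) + k" for k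
 have rN: "r j >= N k" if "j >= k" for j k
  using that member_le_sum[of k "{..j}" N] by (simp add: r_def)
 have rk: "r k >= k" for k by (simp add: r_def)
 define d where "d k x = s (r (Suc k)) x - s (r k) x" for k x
 have dM: "d k \<in> sqi M" for k unfolding d_def by (intro sqi_diff s)
 have [measurable]: "d k \<in> borel_measurable M" for k unfolding d_def by measurable
 have dn: "l2 M (d k) <= (1/4)^k" for k
  unfolding d_def using N[OF rN rN, of k "Suc k" k] by simp
 have "(\<integral>\<^sup>+x. (\<Sum>k. ennreal ((2^k * d k x)^2)) \<partial>M) = (\<Sum>k. \<integral>\<^sup>+x. ennreal ((2^k * d k x)^2) \<partial>M)"
  by (rule nn_integral_suminf) simp
 also have "\<dots> <= (\<Sum>k. ennreal ((1/4)^k))"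
 proof (rule suminf_le)
  fix k
  have "(\<integral>\<^sup>+x. ennreal ((2^k * d k x)^2) \<partial>M) = ennreal (\<integral>x. (2^k * d k x)^2 \<partial>M)"
   using sqi_cmult[OF dM[of k], of "2^k"] by (intro nn_integral_eq_integral) (auto simp: sqi_def)
  also have "(\<integral>x. (2^k * d k x)^2 \<partial>M) = (2^k * l2 M (d k))^2"
   by (simp add: l2_sq[symmetric] l2_cmult)
  also have "\<dots> <= (2^k * (1/4)^k)^2"
   by (rule power_mono) (auto intro: mult_left_mono dn)
  also have "(2^k * (1/4)^k)^2 = (1/4::real)^k"
   by (simp add: power_mult_distrib[symmetric] power_mult[symmetric] mult.commute[of _ 2]) (simp add: power_mult power2_eq_square)
  finally show "(\<integral>\<^sup>+x. ennreal ((2^k * d k x)^2) \<partial>M) <= ennreal ((1/4)^k)" using ennreal_leI by blast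
 qed auto
 also have "\<dots> = ennreal (\<Sum>k. (1/4)^k)"
  by (rule suminf_ennreal2) (auto intro: summable_geometric)
 finally have "(\<integral>\<^sup>+x. (\<Sum>k. ennreal ((2^k * d k x)^2)) \<partial>M) ~= \<infinity>"
  by (auto simp: top_unique)
 then have "AE x in M. (\<Sum>k. ennreal ((2^k * d k x)^2)) ~= \<infinity>"
  by (intro nn_integral_noteq_infinite) auto
 then have conv: "AE x in M. convergent (%k. s (r k) x)"
 proof (rule AE_mp, intro AE_I2 impI)
  fix x assume "(\<Sum>k. ennreal ((2^k * d k x)^2)) ~= \<infinity>"
  then have "summable (%k. (2^k * d k x)^2)"
   by (intro summable_suminf_not_top) (auto simp: top_ennreal_def)
  then have "(%k. (2^k * d k x)^2) ---> 0" by (rule summable_LIMSEQ_zero)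
  then have "Bseq (%k. (2^k * d k x)^2)" using convergent_imp_Bseq convergent_def by blast
  then obtain K where K: "!!k. \<bar>(2^k * d k x)\<^sup>2\<bar> <= K" unfolding Bseq_def by auto
  have dk: "norm (d k x) <= sqrt K * (1/2)^k" for k
  proof -
   have "sqrt ((2^k * d k x)^2) <= sqrt K" using K[of k] by (intro real_sqrt_le_mono) simp
   then have "\<bar>2^k * d k x\<bar> <= sqrt K" by (simp only: real_sqrt_abs)
   then show ?thesis by (simp add: abs_mult field_simps)
  qed
  have "summable (%k. d k x)"
   by (rule summable_comparison_test'[where g="%k. sqrt K * (1/2)^k" and N=0])
    (use dk in \<open>auto intro: summable_mult summable_geometric\<close>)
  then have "convergent (%n. \<Sum>k<n. d k x)" by (simp add: summable_iff_convergent)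
  moreover have "(\<Sum>k<n. d k x) = s (r n) x - s (r 0) x" for n
   unfolding d_def by (rule sum_lessThan_telescope)
  ultimately have "convergent (%n. s (r n) x - s (r 0) x)" by simp
  then show "convergent (%k. s (r k) x)" by (simp add: convergent_diff_const_right_iff)
 qed
 define f where "f x = lim (%k. s (r k) x)" for x
 have [measurable]: "f \<in> borel_measurable M" unfolding f_def by measurable
 have lim: "AE x in M. (%k. s (r k) x) ---> f x"
  using conv by (rule AE_mp) (auto simp: f_def convergent_LIMSEQ_iff)
 \<comment> \<open>Fatou's lemma along the subsequence transfers the Cauchy estimate from
   \<open>s (r k)\<close> to the almost everywhere limit \<open>f\<close>.\<close>
 have est: "integrable M (%x. (s n x - f x)^2) & (\<integral>x. (s n x - f x)^2 \<partial>M) <= e\<^sup>2"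
  if e: "e > 0" and n: "!!m. m >= n ==> l2 M (%x. s n x - s m x) < e" for n e
 proof -
  have "(\<integral>\<^sup>+x. ennreal ((s n x - f x)^2) \<partial>M) = (\<integral>\<^sup>+x. liminf (%k. ennreal ((s n x - s (r k) x)^2)) \<partial>M)"
  proof (rule nn_integral_cong_AE, rule AE_mp[OF lim], intro AE_I2 impI)
   fix x assume "(%k. s (r k) x) ---> f x"
   then have "(%k. ennreal ((s n x - s (r k) x)^2)) ---> ennreal ((s n x - f x)^2)"
    by (intro tendsto_ennrealI tendsto_intros)
   then show "ennreal ((s n x - f x)^2) = liminf (%k. ennreal ((s n x - s (r k) x)^2))"
    using lim_imp_Liminf[OF trivial_limit_sequentially, symmetric] by blast
  qed
  also have "\<dots> <= liminf (%k. \<integral>\<^sup>+x. ennreal ((s n x - s (r k) x)^2) \<partial>M)"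
   by (rule nn_integral_liminf) simp
  also have "\<dots> <= ennreal (e\<^sup>2)"
  proof (rule Liminf_le, simp, rule eventually_sequentiallyI[of n])
   fix k assume "n <= k"
   then have "l2 M (%x. s n x - s (r k) x) < e" using rk[of k] by (intro n) simp
   then have "(l2 M (%x. s n x - s (r k) x))^2 <= e\<^sup>2" by (intro power_mono) auto
   moreover have "(\<integral>\<^sup>+x. ennreal ((s n x - s (r k) x)^2) \<partial>M) = ennreal ((l2 M (%x. s n x - s (r k) x))^2)"
    unfolding l2_sq using sqi_diff[OF s s] by (intro nn_integral_eq_integral) (auto simp: sqi_def)
   ultimately show "(\<integral>\<^sup>+x. ennreal ((s n x - s (r k) x)^2) \<partial>M) <= ennreal (e\<^sup>2)"
    by (simp add: ennreal_leI)
  qed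
  finally have *: "(\<integral>\<^sup>+x. ennreal ((s n x - f x)^2) \<partial>M) <= ennreal (e\<^sup>2)" .
  then have "(\<integral>\<^sup>+x. ennreal ((s n x - f x)^2) \<partial>M) < \<infinity>"
   using ennreal_less_top infinity_ennreal_def le_less_trans by metis
  then have "integrable M (%x. (s n x - f x)^2)" by (intro integrableI_nonneg) auto
  with * show ?thesis by (auto simp: nn_integral_eq_integral)
 qed
 have ev: "\<exists>n0. \<forall>n\<ge>n0. (%x. s n x - f x) \<in> sqi M & l2 M (%x. s n x - f x) <= e" if "e > 0" for e
 proof -
  obtain n0 where "\<forall>m\<ge>n0. \<forall>n\<ge>n0. l2 M (%x. s m x - s n x) < e" using cauchy[OF \<open>e > 0\<close>] by blast
  then have "integrable M (%x. (s n x - f x)^2) & (\<integral>x. (s n x - f x)^2 \<partial>M) <= e\<^sup>2" if "n >= n0" for n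
   using that by (intro est \<open>e > 0\<close>) auto
  then have "(%x. s n x - f x) \<in> sqi M & l2 M (%x. s n x - f x) <= e" if "n >= n0" for n
   using that \<open>e > 0\<close> by (auto simp: sqi_def l2_def intro: real_le_lsqrt)
  then show ?thesis by blast
 qed
 obtain n0 where "(%x. s n0 x - f x) \<in> sqi M" using ev[of 1] by force
 then have "f \<in> sqi M" using sqi_diff[OF s[of n0], of "%x. s n0 x - f x"] by simp
 moreover have "(%n. l2 M (%x. s n x - f x)) ---> 0"
 proof (rule LIMSEQ_I)
  fix e :: real assume "e > 0"
  then obtain n0 where "\<forall>n\<ge>n0. l2 M (%x. s n x - f x) <= e / 2" using ev[of "e/2"] by auto
  with \<open>e > 0\<close> show "\<exists>no. \<forall>n\<ge>no. norm (l2 M (%x. s n x - f x) - 0) < e" by force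
 qed
 ultimately show ?thesis by blast
qed

text \<open>Discriminant inequality for the nonnegative quadratic
  \<open>c + 2 t b + t\<^sup>2 N\<close>, degenerate case included. It converts near-minimality of
  an energy into smallness of its derivative.\<close>

lemma quadratic_nonneg:
 fixes N b c :: real
 assumes "0 <= N" "!!t. - c <= 2 * t * b + t\<^sup>2 * N"
 shows "b\<^sup>2 <= c * N"
proof (cases "N = 0")
 case True
 have "b = 0"
 proof (rule ccontr)
  assume "b ~= 0"
  then show False using assms(2)[of "- (c + 1) / (2 * b)"] True by simp
 qed
 with True show ?thesis by simp
next
 case False
 then have "N > 0" using assms(1) by simp
 have "- c <= 2 * (- b / N) * b + (- b / N)^2 * N" by (rule assms(2))
 also have "\<dots> = - (b\<^sup>2 / N)" using False by (simp add: field_simps power2_eq_square)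
 finally show ?thesis using \<open>N > 0\<close> by (simp add: field_simps)
qed

section \<open>Approximate Riesz representation and Neumann iteration without completeness\<close>

locale pre_hilbert =
 fixes V :: "('a => real) set" and ip :: "('a => real) => ('a => real) => real"
 assumes V_zero: "(%x. 0) \<in> V"
  and V_lin: "!!f g a b. f \<in> V ==> g \<in> V ==> (%x. a * f x + b * g x) \<in> V"
  and ip_lin: "!!f g h a b. f \<in> V ==> g \<in> V ==> h \<in> V ==> ip (%x. a * f x + b * g x) h = a * ip f h + b * ip g h"
  and ip_sym: "!!f g. f \<in> V ==> g \<in> V ==> ip f g = ip g f"
  and ip_nonneg: "!!f. f \<in> V ==> 0 <= ip f f"
begin

definition nm :: "('a => real) => real" where "nm v = sqrt (ip v v)"

lemma nm_nonneg: "v \<in> V ==> 0 <= nm v"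
 by (simp add: nm_def ip_nonneg)

lemma nm_sq: "v \<in> V ==> (nm v)\<^sup>2 = ip v v"
 by (simp add: nm_def ip_nonneg)

lemma ip_lin2: "f \<in> V ==> g \<in> V ==> h \<in> V ==> ip h (%x. a * f x + b * g x) = a * ip h f + b * ip h g"
 using ip_lin[of f g h a b] ip_sym[of h f] ip_sym[of h g] ip_sym[OF _ V_lin[of f g a b], of h] by simp

lemma ip_expand:
 assumes "f \<in> V" "g \<in> V"
 shows "ip (%x. 1 * f x + t * g x) (%x. 1 * f x + t * g x) = ip f f + 2 * t * ip f g + t\<^sup>2 * ip g g"
proof -
 let ?h = "%x. 1 * f x + t * g x"
 have h: "?h \<in> V" by (rule V_lin[OF assms])
 have "ip ?h ?h = 1 * ip f ?h + t * ip g ?h" by (rule ip_lin[OF assms h])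
 moreover have "ip f ?h = 1 * ip f f + t * ip f g" by (rule ip_lin2[OF assms assms(1)])
 moreover have "ip g ?h = 1 * ip g f + t * ip g g" by (rule ip_lin2[OF assms assms(2)])
 ultimately show ?thesis using ip_sym[OF assms] by (simp add: power2_eq_square algebra_simps)
qed

text \<open>An almost minimiser of \<open>J r = ip r r - 2 * G r\<close> almost represents
  \<open>G\<close>: comparing \<open>J\<close> at \<open>r\<close> and at \<open>r + t v\<close>
  gives a quadratic in t bounded below by \<open>- e\<^sup>2\<close>, and the discriminant
  inequality bounds the residual at \<open>v\<close>. Boundedness of \<open>G\<close> is what makes
  the infimum of \<open>J\<close> finite.\<close>

lemma approx_riesz:
 assumes G: "linear_functional_on V G" and bd: "!!v. v \<in> V ==> \<bar>G v\<bar> <= C * nm v" and e: "0 < e"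
 shows "\<exists>r\<in>V. \<forall>v\<in>V. \<bar>G v - ip r v\<bar> <= e * nm v"
proof -
 define J where "J r = ip r r - 2 * G r" for r
 have low: "- C\<^sup>2 <= J r" if "r \<in> V" for r
 proof -
  have "0 <= (nm r - C)^2" by simp
  also have "\<dots> = ip r r - 2 * (C * nm r) + C\<^sup>2"
   using nm_sq[OF that] by (simp add: power2_eq_square algebra_simps)
  finally show ?thesis using bd[OF that] by (simp add: J_def abs_le_iff)
 qed
 define I where "I = Inf (J ` V)"
 have bb: "bdd_below (J ` V)" using low by (intro bdd_belowI2)
 have "V ~= {}" using V_zero by auto
 then obtain r where r: "r \<in> V" "J r < I + e\<^sup>2"
  using e cInf_lessD[of "J ` V" "I + e\<^sup>2"] unfolding I_def by auto
 have "\<bar>G v - ip r v\<bar> <= e * nm v" if v: "v \<in> V" for v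
 proof -
  have "(ip r v - G v)^2 <= e\<^sup>2 * ip v v"
  proof (rule quadratic_nonneg)
   fix t
   have "I <= J (%x. 1 * r x + t * v x)"
    unfolding I_def using bb by (rule cINF_lower) (rule V_lin[OF r(1) v])
   also have "G (%x. 1 * r x + t * v x) = 1 * G r + t * G v"
    using G r(1) v unfolding linear_functional_on_def by blast
   then have "J (%x. 1 * r x + t * v x) = J r + 2 * t * (ip r v - G v) + t\<^sup>2 * ip v v"
    unfolding J_def ip_expand[OF r(1) v] by (simp add: algebra_simps)
   finally show "- e\<^sup>2 <= 2 * t * (ip r v - G v) + t\<^sup>2 * ip v v" using r(2) by simp
  qed (simp add: ip_nonneg v)
  then have "sqrt ((ip r v - G v)^2) <= sqrt (e\<^sup>2 * ip v v)" by (rule real_sqrt_le_mono)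
  then show ?thesis using e by (simp add: nm_def real_sqrt_mult abs_minus_commute)
 qed
 with r(1) show ?thesis by blast
qed

text \<open>A Neumann iteration for a bilinear form close to the inner product. Since the space is not
 assumed complete, the equation is only solved up to an arbitrarily small functional.\<close>

lemma approx_solve:
 assumes F: "linear_functional_on V F" and bd: "!!v. v \<in> V ==> \<bar>F v\<bar> <= C * nm v"
  and a1: "!!f g h s t. f \<in> V ==> g \<in> V ==> h \<in> V ==> a (%x. s * f x + t * g x) h = s * a f h + t * a g h"
  and a2: "!!f. f \<in> V ==> linear_functional_on V (a f)"
  and q: "0 <= q" "q < 1" "!!f g. f \<in> V ==> g \<in> V ==> \<bar>a f g - ip f g\<bar> <= q * (nm f * nm g)"
  and e: "0 < e"
 shows "\<exists>u\<in>V. \<forall>v\<in>V. \<bar>F v - a u v\<bar> <= e * nm v"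
proof -
 define P where "P d \<longleftrightarrow> (\<exists>u\<in>V. \<forall>v\<in>V. \<bar>F v - a u v\<bar> <= d * nm v)" for d
 have step: "P ((1 + q) / 2 * d)" if P: "P d" and d: "d > 0" for d
 proof -
  from P obtain u where u: "u \<in> V" "!!v. v \<in> V ==> \<bar>F v - a u v\<bar> <= d * nm v" by (auto simp: P_def)
  \<comment> \<open>With this tolerance one correction multiplies the residual by at most
    \<open>k + q * (1 + k)\<close>, which is at most
    \<open>q + 2 * k = (1 + q) / 2 < 1\<close>.\<close>
  define k where "k = (1 - q) / 4"
  have k: "k > 0" using q by (simp add: k_def)
  have "linear_functional_on V (%v. F v - a u v)"
   using F a2[OF u(1)] unfolding linear_functional_on_def by (simp add: algebra_simps)
  then obtain r where r: "r \<in> V" "!!v. v \<in> V ==> \<bar>(F v - a u v) - ip r v\<bar> <= (k * d) * nm v"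
   using approx_riesz[of "%v. F v - a u v" d "k * d"] u(2) k d by auto
  have nr: "nm r <= (1 + k) * d"
  proof (cases "nm r = 0")
   case True then show ?thesis using k d by simp
  next
   case False
   then have "nm r > 0" using nm_nonneg[OF r(1)] by simp
   have "nm r * nm r = ip r r" using nm_sq[OF r(1)] by (simp add: power2_eq_square)
   also have "\<dots> <= ((1 + k) * d) * nm r"
    using r(2)[OF r(1)] u(2)[OF r(1)] by (auto simp: abs_le_iff algebra_simps)
   finally show ?thesis using \<open>nm r > 0\<close> by (simp add: mult_le_cancel_right)
  qed
  have "\<bar>F v - a (%x. 1 * u x + 1 * r x) v\<bar> <= (1 + q) / 2 * d * nm v" if v: "v \<in> V" for v
  proof -
   have "\<bar>F v - a (%x. 1 * u x + 1 * r x) v\<bar> = \<bar>((F v - a u v) - ip r v) - (a r v - ip r v)\<bar>"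
    unfolding a1[OF u(1) r(1) v] by simp
   also have "\<dots> <= (k * d) * nm v + q * (nm r * nm v)"
    using r(2)[OF v] q(3)[OF r(1) v] by linarith
   also have "\<dots> <= (k * d) * nm v + q * (((1 + k) * d) * nm v)"
    using nr nm_nonneg[OF v] q(1) by (intro add_left_mono mult_left_mono mult_right_mono) auto
   also have "\<dots> = (k + q * (1 + k)) * (d * nm v)" by (simp add: algebra_simps)
   also have "\<dots> <= (1 + q) / 2 * (d * nm v)"
   proof (rule mult_right_mono)
    have "k * q <= k * 1" using k q by (intro mult_left_mono) auto
    then show "k + q * (1 + k) <= (1 + q) / 2" by (simp add: k_def field_simps)
   qed (use d nm_nonneg[OF v] in auto)
   finally show ?thesis by (simp add: mult.assoc)
  qed
  then show ?thesis unfolding P_def using V_lin[OF u(1) r(1), of 1 1] by blast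
 qed
 define C' where "C' = \<bar>C\<bar> + 1"
 have C': "C' > 0" by (simp add: C'_def)
 have Pn: "P (((1 + q) / 2)^n * C')" for n
 proof (induction n)
  case 0
  have "a (%x. 0) v = 0" if "v \<in> V" for v
   using a1[OF V_zero V_zero that, of 0 0] by simp
  moreover have "\<bar>F v\<bar> <= C' * nm v" if "v \<in> V" for v
  proof -
   have "C * nm v <= C' * nm v" using nm_nonneg[OF that] by (intro mult_right_mono) (auto simp: C'_def)
   with bd[OF that] show ?thesis by simp
  qed
  ultimately show ?case unfolding P_def using V_zero by (intro bexI[of _ "%x. 0"]) auto
 next
  case (Suc n)
  show ?case using step[OF Suc] C' q by (simp add: mult.assoc)
 qed
 have "(%n. ((1 + q) / 2)^n * C') ---> 0"
  using q by (intro tendsto_mult_left_zero LIMSEQ_realpow_zero) auto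
 from order_tendstoD(2)[OF this e] obtain n where n: "((1 + q) / 2)^n * C' < e"
  unfolding eventually_sequentially by blast
 from Pn[of n] obtain u where u: "u \<in> V" "!!v. v \<in> V ==> \<bar>F v - a u v\<bar> <= ((1 + q) / 2)^n * C' * nm v"
  unfolding P_def by blast
 have "\<bar>F v - a u v\<bar> <= e * nm v" if "v \<in> V" for v
  using u(2)[OF that] n nm_nonneg[OF that] by (meson less_imp_le mult_right_mono order_trans)
 with u(1) show ?thesis by blast
qed

end

section \<open>Test functions and the fundamental lemma\<close>

lemma test_smooth: "ph \<in> test S ==> smooth ph"
 by (simp add: test_functions_def)

lemma test_support: "ph \<in> test S ==> \<exists>K. compact K & K \<subseteq> S & (\<forall>x. x \<notin> K --> ph x = 0)"
 by (simp add: test_functions_def)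

lemma test_functionsI: "smooth ph ==> compact K ==> K \<subseteq> S ==> (!!x. x \<notin> K ==> ph x = 0) ==> ph \<in> test S"
 by (auto simp: test_functions_def)

lemma test_mono: "ph \<in> test S ==> S \<subseteq> T ==> ph \<in> test T"
 by (auto simp: test_functions_def)

lemma test_UNIV: "ph \<in> test S ==> ph \<in> test UNIV"
 by (rule test_mono) auto

lemma test_zero [simp]: "(%x. 0) \<in> test S"
 by (rule test_functionsI[of _ "{}"]) auto

lemma test_smooth_mult:
 assumes "smooth g" "ph \<in> test S"
 shows "(%x. g x * ph x) \<in> test S"
proof -
 obtain K where "compact K" "K \<subseteq> S" "!!x. x \<notin> K ==> ph x = 0" using test_support[OF assms(2)] by blast
 then show ?thesis using assms by (intro test_functionsI[of _ K]) (auto intro: smooth_mult test_smooth)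
qed

lemma test_add:
 assumes "ph \<in> test S" "\<psi> \<in> test S"
 shows "(%x. ph x + \<psi> x) \<in> test S"
proof -
 obtain K where "compact K" "K \<subseteq> S" "!!x. x \<notin> K ==> ph x = 0" using test_support[OF assms(1)] by blast
 moreover obtain L where "compact L" "L \<subseteq> S" "!!x. x \<notin> L ==> \<psi> x = 0" using test_support[OF assms(2)] by blast
 ultimately show ?thesis using assms
  by (intro test_functionsI[of _ "K \<union> L"]) (auto intro: smooth_add test_smooth)
qed

lemma test_lin:
 assumes "ph \<in> test S" "\<psi> \<in> test S"
 shows "(%x. a * ph x + b * \<psi> x) \<in> test S"
 using test_add[OF test_smooth_mult[OF smooth_const assms(1)] test_smooth_mult[OF smooth_const assms(2)]] .

lemma test_diff: "ph \<in> test S ==> \<psi> \<in> test S ==> (%x. ph x - \<psi> x) \<in> test S"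
 using test_lin[of ph S \<psi> 1 "-1"] by simp

lemma test_uminus: "ph \<in> test S ==> (%x. - ph x) \<in> test S"
 using test_lin[of ph S ph "-1" 0] by simp

lemma test_cmult: "ph \<in> test S ==> (%x. a * ph x) \<in> test S"
 using test_lin[of ph S ph a 0] by simp

lemma test_sum:
 "finite I ==> (!!i. i \<in> I ==> f i \<in> test S) ==> (%x. \<Sum>i\<in>I. f i x) \<in> test S"
 by (induction I rule: finite_induct) (auto intro: test_add)

lemma pd_zero_outside:
 assumes "closed K" "!!x. x \<notin> K ==> f x = 0" "x \<notin> K"
 shows "pd v f x = 0"
proof -
 have "(f has_derivative (%h. 0)) (at x)"
  by (rule has_derivative_transform_within_open[OF has_derivative_const[of 0], of "- K"]) (use assms in auto)
 then show ?thesis by (rule pd_eqI)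
qed

lemma test_pd:
 assumes "ph \<in> test S" "v \<in> Basis"
 shows "pd v ph \<in> test S"
proof -
 obtain K where K: "compact K" "K \<subseteq> S" "!!x. x \<notin> K ==> ph x = 0" using test_support[OF assms(1)] by blast
 then show ?thesis using assms pd_zero_outside[OF compact_imp_closed[OF K(1)] K(3)]
  by (intro test_functionsI[of _ K]) (auto intro: smooth_pd test_smooth)
qed

lemma test_dx: "ph \<in> test S ==> dx ph \<in> test S"
 and test_dz: "ph \<in> test S ==> dz ph \<in> test S"
 by (simp_all add: test_pd)

lemma test_integrable:
 assumes "ph \<in> test S"
 shows "integrable lborel ph"
proof -
 obtain K where K: "compact K" "K \<subseteq> S" "!!x. x \<notin> K ==> ph x = 0" using test_support[OF assms] by blast
 have "integrable lborel (%x. indicator K x *\<^sub>R ph x)"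
  by (rule borel_integrable_compact[OF K(1)]) (rule smooth_continuous[OF test_smooth[OF assms]])
 also have "(%x. indicator K x *\<^sub>R ph x) = ph" using K(3) by (auto simp: indicator_def fun_eq_iff)
 finally show ?thesis .
qed

lemma test_measurable: "ph \<in> test S ==> ph \<in> bmeas"
 by (simp add: smooth_measurable test_smooth)

lemma test_sqi:
 assumes "ph \<in> test S"
 shows "ph \<in> sqi lborel"
proof -
 have "(%x. ph x * ph x) \<in> test S" using assms by (intro test_smooth_mult test_smooth)
 then show ?thesis using test_integrable test_measurable[OF assms] by (auto simp: sqi_def power2_eq_square)
qed

lemma test_bounded:
 assumes "ph \<in> test S"
 obtains C where "C > 0" "!!x. \<bar>ph x\<bar> <= C"
proof -
 obtain K where K: "compact K" "K \<subseteq> S" "!!x. x \<notin> K ==> ph x = 0" using test_support[OF assms] by blast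
 have "bounded (ph ` K)"
  by (intro compact_imp_bounded compact_continuous_image K smooth_continuous test_smooth[OF assms])
 then obtain C where "!!x. x \<in> K ==> \<bar>ph x\<bar> <= C" by (auto simp: bounded_iff)
 then have "\<bar>ph x\<bar> <= max C 1" for x using K(3)[of x] by (cases "x \<in> K") (force simp: max_def)+
 then show thesis by (intro that[of "max C 1"]) auto
qed

text \<open>The smooth compactly supported functions needed below are all obtained from
  \<open>chi\<close> by dilating, translating, adding and multiplying. The value 2 of the sum of its
  translates explains the recurring division by 2.\<close>

locale cutoff_fun =
 fixes chi :: "real => real"
 assumes cut: "cutoff chi"
begin

lemma chi_smooth: "smooth chi"
 and chi_nonneg: "0 <= chi x"
 and chi_le_1: "chi x <= 1"
 and chi_1: "0 < x ==> x < 1 ==> chi x = 1"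
 and chi_0: "x <= -1 \<or> 2 <= x ==> chi x = 0"
 and chi_has_sum: "((%k::int. chi (x - of_int k)) has_sum 2) UNIV"
 using cut by (auto simp: cutoff_def)

lemma chi_sum_le: "finite J ==> (\<Sum>k\<in>J. chi (x - of_int k)) <= 2"
 using finite_sum_le_has_sum[OF chi_has_sum, of J x] by (auto simp: chi_nonneg)

lemma chi_sum_eq:
 assumes "finite J" "!!k. chi (x - of_int k) ~= 0 ==> k \<in> J"
 shows "(\<Sum>k\<in>J. chi (x - of_int k)) = 2"
proof -
 have "((%k::int. chi (x - of_int k)) has_sum 2) J"
  using has_sum_cong_neutral[of UNIV J "%k::int. chi (x - of_int k)" "%k::int. chi (x - of_int k)" 2]
   assms(2) chi_has_sum by blast
 then show ?thesis using assms(1) by (simp add: has_sum_finite_iff)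
qed

lemma chi_sum_eq':
 assumes "of_int m + 1 <= x" "x <= of_int n - 1"
 shows "(\<Sum>k\<in>{m..n}. chi (x - of_int k)) = 2"
proof (rule chi_sum_eq)
 fix k :: int assume "chi (x - of_int k) ~= 0"
 then have "- 1 < x - of_int k" "x - of_int k < 2" using chi_0[of "x - of_int k"] by linarith+
 with assms have "of_int m - 1 < (of_int k :: real)" "of_int k < (of_int n + 1 :: real)" by linarith+
 then show "k \<in> {m..n}" by simp
qed simp

text \<open>Smooth approximation of the indicator of an interval, at scale \<open>1/N\<close>.\<close>

definition bump :: "real => real => nat => real => real" where
 "bump a b N x = (\<Sum>k\<in>{\<lceil>real N * a\<rceil> + 1..\<lfloor>real N * b\<rfloor> - 2}. chi (real N * x - of_int k)) / 2"

lemma bump_smooth: "smooth (bump a b N)"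
proof -
 have "smooth (%x. \<Sum>k\<in>{\<lceil>real N * a\<rceil> + 1..\<lfloor>real N * b\<rfloor> - 2}. chi (real N * x + - of_int k))"
  by (intro smooth_sum smooth_shift_real chi_smooth) simp
 from smooth_mult[OF smooth_const[of "1/2"] this] show ?thesis by (simp add: bump_def[abs_def])
qed

lemma bump_range: "0 <= bump a b N x" "bump a b N x <= 1"
 using chi_sum_le[of "{\<lceil>real N * a\<rceil> + 1..\<lfloor>real N * b\<rfloor> - 2}" "real N * x"]
 by (auto simp: bump_def intro: sum_nonneg chi_nonneg)

lemma bump_0:
 assumes "x <= a \<or> b <= x"
 shows "bump a b N x = 0"
proof -
 have "chi (real N * x - of_int k) = 0" if "k \<in> {\<lceil>real N * a\<rceil> + 1..\<lfloor>real N * b\<rfloor> - 2}" for k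
 proof (rule chi_0)
  have k: "real N * a + 1 <= of_int k" "of_int k <= real N * b - 2" using that by (auto simp: le_floor_iff) linarith+
  from assms show "real N * x - of_int k <= - 1 \<or> 2 <= real N * x - of_int k"
  proof
   assume "x <= a"
   then have "real N * x <= real N * a" by (intro mult_left_mono) auto
   with k show ?thesis by linarith
  next
   assume "b <= x"
   then have "real N * b <= real N * x" by (intro mult_left_mono) auto
   with k show ?thesis by linarith
  qed
 qed
 then show ?thesis by (simp add: bump_def)
qed

text \<open>A translate that is nonzero at \<open>N x\<close> has its index strictly between
  \<open>N x - 2\<close> and \<open>N x + 1\<close>. The margin 3 puts all these indices into the
  range of summation, where the translates add up to 2.\<close>

lemma bump_1:
 assumes "real N * a + 3 <= real N * x" "real N * x <= real N * b - 3"
 shows "bump a b N x = 1"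
proof -
 have "(\<Sum>k\<in>{\<lceil>real N * a\<rceil> + 1..\<lfloor>real N * b\<rfloor> - 2}. chi (real N * x - of_int k)) = 2"
 proof (rule chi_sum_eq)
  fix k :: int assume "chi (real N * x - of_int k) ~= 0"
  then have "- 1 < real N * x - of_int k" "real N * x - of_int k < 2"
   using chi_0[of "real N * x - of_int k"] by linarith+
  with assms have "real N * a + 1 < of_int k" "of_int k < real N * b - 2" by linarith+
  then show "k \<in> {\<lceil>real N * a\<rceil> + 1..\<lfloor>real N * b\<rfloor> - 2}" by (simp add: ceiling_le_iff le_floor_iff) linarith
 qed simp
 then show ?thesis by (simp add: bump_def)
qed

lemma bump_tendsto: "(%N. bump a b N x) ---> indicator {a<..<b} x"
proof (cases "a < x & x < b")
 case True
 then have e: "min (x - a) (b - x) > 0" by simp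
 then obtain n0 where n0: "3 / min (x - a) (b - x) < real n0" using reals_Archimedean2 by blast
 have "bump a b N x = 1" if "N >= n0" for N
 proof (rule bump_1)
  have "3 < real n0 * min (x - a) (b - x)" using n0 e by (simp add: field_simps)
  also have "\<dots> <= real N * min (x - a) (b - x)" using that e by (intro mult_right_mono) auto
  finally have *: "3 < real N * min (x - a) (b - x)" .
  have "real N * min (x - a) (b - x) <= real N * (x - a)" "real N * min (x - a) (b - x) <= real N * (b - x)"
   by (intro mult_left_mono; simp)+
  with * show "real N * a + 3 <= real N * x" "real N * x <= real N * b - 3"
   by (simp_all add: right_diff_distrib)
 qed
 then have "eventually (%N. bump a b N x = 1) sequentially" by (auto simp: eventually_sequentially)
 then have "(%N. bump a b N x) ---> 1" by (rule tendsto_eventually)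
 with True show ?thesis by simp
next
 case False
 then have "bump a b N x = 0" for N by (intro bump_0) auto
 with False show ?thesis by simp
qed

definition bump2 :: "point => point => nat => point => real" where
 "bump2 a b N p = bump (fst a) (fst b) N (fst p) * bump (snd a) (snd b) N (snd p)"

lemma bump2_test:
 assumes "cbox a b \<subseteq> S"
 shows "bump2 a b N \<in> test S"
proof (rule test_functionsI[of _ "cbox a b"])
 show "smooth (bump2 a b N)"
  unfolding bump2_def[abs_def] by (intro smooth_mult smooth_fst smooth_snd bump_smooth)
 show "bump2 a b N x = 0" if "x \<notin> cbox a b" for x
  using that bump_0[of "fst x"] bump_0[of "snd x"]
  by (cases a; cases b; cases x) (fastforce simp: bump2_def cbox_Pair_eq)
qed (use assms in auto)

lemma bump2_tendsto: "(%N. bump2 a b N p) ---> indicator (box a b) p"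
proof -
 have "indicator (box a b) p = (indicator {fst a<..<fst b} (fst p) * indicator {snd a<..<snd b} (snd p) :: real)"
  by (cases a; cases b; cases p) (auto simp: indicator_def box_def Basis_prod_def)
 then show ?thesis unfolding bump2_def by (simp add: tendsto_mult bump_tendsto)
qed

lemma bump2_bound: "\<bar>bump2 a b N p\<bar> <= 1"
 unfolding bump2_def using bump_range by (auto simp: abs_mult intro: mult_le_one)

text \<open>Open boxes are an intersection-stable generator of the Borel sets. The sets over which
  \<open>f\<close> integrates to 0 are closed under disjoint unions, and under complements thanks to
  \<open>f0\<close>; hence \<open>f\<close> has the same indefinite integral as 0.\<close>

lemma AE_eq_0_if_box_integrals_0:
 fixes f :: "'a::euclidean_space => real"
 assumes f: "integrable lborel f" and f0: "(LBINT x. f x) = 0"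
  and box: "!!c d. (LBINT x. indicator (box c d) x * f x) = 0"
 shows "AE x in lborel. f x = 0"
proof (rule density_unique_real[OF f, of "%x. 0"])
 fix A :: "'a set" assume "A \<in> sets lborel"
 then have A: "A \<in> sigma_sets UNIV (range (%(a, b). box a b))" by (simp add: borel_eq_box)
 have st: "Int_stable (range (%(a, b). box a b :: 'a set))"
  by (auto simp: Int_stable_def box_Int_box)
 have "range (%(a, b). box a b :: 'a set) \<subseteq> Pow UNIV" by simp
 from st this A have "A \<in> sets lborel & (LINT x:A|lborel. f x) = 0"
 proof (induction rule: sigma_sets_induct_disjoint)
  case (basic A) then show ?case using box by (auto simp: set_lebesgue_integral_def)
 next
  case empty then show ?case by (simp add: set_lebesgue_integral_def)
 next
  case (compl A)
  have "(LINT x:UNIV - A|lborel. f x) = (LBINT x. f x - indicator A x * f x)"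
   unfolding set_lebesgue_integral_def
   by (rule LINT_cong) (auto simp: indicator_def)
  also have "\<dots> = (LBINT x. f x) - (LBINT x. indicator A x * f x)"
   using f compl integrable_mult_indicator[of A lborel f] by (intro Bochner_Integration.integral_diff) auto
  finally show ?case using compl f0 by (auto simp: set_lebesgue_integral_def)
 next
  case (union A)
  have "(LINT x:(\<Union>i. A i)|lborel. f x) = (\<Sum>i. LINT x:(A i)|lborel. f x)"
  proof (rule lebesgue_integral_countable_add)
   show "set_integrable lborel (\<Union>i. A i) f"
    using union f unfolding set_integrable_def by (intro integrable_mult_indicator) auto
  qed (use union in \<open>auto simp: disjoint_family_on_def\<close>)
  with union show ?case by auto
 qed
 then show "(LINT x:A|lborel. f x) = (LINT x:A|lborel. 0)" by simp
qed simp

text \<open>The bumps of a box are admissible and converge to its indicator under a common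
  integrable bound, so \<open>g\<close> integrates to 0 over every open box whose closed box lies in
  \<open>S\<close>. Each such box satisfies the box criterion, and countably many rational boxes
  cover \<open>S\<close>.\<close>

lemma fundamental_lemma:
 fixes g :: "point => real"
 assumes S: "open S" and [measurable]: "g \<in> bmeas"
  and loc: "!!a b. cbox a b \<subseteq> S ==> integrable lborel (%p. indicator (cbox a b) p * g p)"
  and 0: "!!ph. ph \<in> test S ==> (LBINT p. g p * ph p) = 0"
 shows "AE p in lborel. p \<in> S --> g p = 0"
proof -
 have box0: "(LBINT p. indicator (box a b) p * g p) = 0" if ab: "cbox a b \<subseteq> S" for a b
 proof -
  have "(%N. \<integral>p. g p * bump2 a b N p \<partial>lborel) ---> (LBINT p. g p * indicator (box a b) p)"
  proof (rule integral_dominated_convergence[where w="%p. \<bar>indicator (cbox a b) p * g p\<bar>"])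
   have m: "bump2 a b N \<in> bmeas" for N using test_measurable bump2_test[OF ab] by blast
   show "(%p. g p * bump2 a b N p) \<in> borel_measurable lborel" for N using m by simp
   show "integrable lborel (%p. \<bar>indicator (cbox a b) p * g p\<bar>)" using loc[OF ab] by simp
   show "AE p in lborel. (%N. g p * bump2 a b N p) ---> g p * indicator (box a b) p"
    by (intro AE_I2 tendsto_intros bump2_tendsto)
   show "AE p in lborel. norm (g p * bump2 a b N p) <= \<bar>indicator (cbox a b) p * g p\<bar>" for N
   proof (intro AE_I2)
    fix p
    have "bump2 a b N p = 0" if "p \<notin> cbox a b"
     using that bump_0[of "fst p"] bump_0[of "snd p"]
     by (cases a; cases b; cases p) (fastforce simp: bump2_def cbox_Pair_eq)
    then show "norm (g p * bump2 a b N p) <= \<bar>indicator (cbox a b) p * g p\<bar>"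
     using bump2_bound[of a b N p] mult_left_mono[of "\<bar>bump2 a b N p\<bar>" 1 "\<bar>g p\<bar>"]
     by (auto simp: indicator_def abs_mult)
   qed
  qed simp
  moreover have "(LBINT p. g p * bump2 a b N p) = 0" for N by (intro 0 bump2_test ab)
  ultimately have "(%N::nat. 0) ---> (LBINT p. g p * indicator (box a b) p)" by simp
  then have "(LBINT p. g p * indicator (box a b) p) = 0" by (simp add: LIMSEQ_const_iff)
  then show ?thesis by (simp add: mult.commute)
 qed
 have *: "AE p in lborel. p \<in> box a b --> g p = 0" if ab: "cbox a b \<subseteq> S" for a b
 proof -
  have "AE p in lborel. indicator (box a b) p * g p = 0"
  proof (rule AE_eq_0_if_box_integrals_0)
   have "integrable lborel (%p. indicator (box a b) p *\<^sub>R (indicator (cbox a b) p * g p))"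
    by (rule integrable_mult_indicator) (use loc[OF ab] in auto)
   also have "(%p. indicator (box a b) p *\<^sub>R (indicator (cbox a b) p * g p)) = (%p. indicator (box a b) p * g p)"
    using box_subset_cbox[of a b] by (auto simp: indicator_def fun_eq_iff)
   finally show "integrable lborel (%p. indicator (box a b) p * g p)" .
   show "(LBINT p. indicator (box a b) p * g p) = 0" by (rule box0[OF ab])
   fix c d :: point
   obtain c' d' where cd: "box c d \<inter> box a b = box c' d'" by (simp add: box_Int_box)
   show "(LBINT p. indicator (box c d) p * (indicator (box a b) p * g p)) = 0"
   proof (cases "box c' d' = {}")
    case True
    then have "(%p. indicator (box c d) p * (indicator (box a b) p * g p)) = (%p. 0)"
     using cd by (auto simp: indicator_def fun_eq_iff)
    then show ?thesis by simp
   next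
    case False
    then have "cbox c' d' \<subseteq> cbox a b"
     using cd closure_mono[of "box c' d'" "box a b"] by (cases "box a b = {}") auto
    then have "(LBINT p. indicator (box c' d') p * g p) = 0" using ab by (intro box0) auto
    also have "(%p. indicator (box c' d') p * g p) = (%p. indicator (box c d) p * (indicator (box a b) p * g p))"
     unfolding cd[symmetric] by (auto simp: indicator_def)
    finally show ?thesis .
   qed
  qed
  then show ?thesis by (rule AE_mp) (auto simp: indicator_def)
 qed
 obtain D where D: "countable D" "D \<subseteq> Pow S" "!!X. X \<in> D ==> \<exists>a b. X = cbox a b" "\<Union>D = S"
  "!!x. x \<in> S ==> \<exists>a b. x \<in> box a b & cbox a b \<in> D"
 proof -
  define D where "D = {cbox a b |a b. cbox a b \<subseteq> S & a \<in> {a::point. \<forall>i\<in>Basis. a \<bullet> i \<in> \<rat>} & b \<in> {a::point. \<forall>i\<in>Basis. a \<bullet> i \<in> \<rat>}}"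
  have cr: "countable {a::point. \<forall>i\<in>Basis. a \<bullet> i \<in> \<rat>}"
  proof -
   have "{a::point. \<forall>i\<in>Basis. a \<bullet> i \<in> \<rat>} = \<rat> \<times> \<rat>" by (auto simp: Basis_prod_def)
   then show ?thesis by (simp add: countable_rat)
  qed
  have "D \<subseteq> (%(a, b). cbox a b) ` ({a::point. \<forall>i\<in>Basis. a \<bullet> i \<in> \<rat>} \<times> {a::point. \<forall>i\<in>Basis. a \<bullet> i \<in> \<rat>})"
   by (auto simp: D_def)
  then have cD: "countable D" by (rule countable_subset) (intro countable_image countable_SIGMA cr)
  have ex: "\<exists>a b. x \<in> box a b & cbox a b \<in> D" if x: "x \<in> S" for x
  proof -
   obtain e where e: "e > 0" "ball x e \<subseteq> S" using S x openE by blast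
   obtain a b where "\<forall>i\<in>Basis. a \<bullet> i \<in> \<rat>" "\<forall>i\<in>Basis. b \<bullet> i \<in> \<rat>" "x \<in> box a b" "cbox a b \<subseteq> ball x e"
   proof -
    obtain a b where ab: "\<forall>i\<in>Basis. a \<bullet> i \<in> \<rat> & b \<bullet> i \<in> \<rat>" "x \<in> box a b" "box a b \<subseteq> ball x (e/2)"
     using rational_boxes[OF half_gt_zero[OF e(1)], of x] by blast
    have "closure (box a b) \<subseteq> closure (ball x (e/2))" using ab(3) by (rule closure_mono)
    moreover have "closure (box a b) = cbox a b" using ab(2) by (intro closure_box) auto
    ultimately have "cbox a b \<subseteq> cball x (e/2)" using e(1) by simp
    also have "\<dots> \<subseteq> ball x e" using e(1) by (auto simp: subset_eq)
    finally show thesis using that ab by blast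
   qed
   then show ?thesis using e unfolding D_def by blast
  qed
  have UD: "\<Union>D = S"
  proof
   show "S \<subseteq> \<Union>D"
   proof
    fix x assume "x \<in> S"
    then obtain a b where "x \<in> box a b" "cbox a b \<in> D" using ex by blast
    then show "x \<in> \<Union>D" using box_subset_cbox[of a b] by auto
   qed
  qed (auto simp: D_def)
  show thesis by (rule that[OF cD _ _ UD ex]) (use D_def in blast)+
 qed
 have "AE p in lborel. \<forall>X\<in>D. p \<in> interior X --> g p = 0"
 proof (subst AE_ball_countable[OF D(1)], intro ballI)
  fix X assume X: "X \<in> D"
  then obtain a b where ab: "X = cbox a b" using D(3) by blast
  then have "cbox a b \<subseteq> S" using X D(2) by auto
  from *[OF this] show "AE p in lborel. p \<in> interior X --> g p = 0" by (simp add: ab)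
 qed
 then show ?thesis
 proof (rule AE_mp, intro AE_I2 impI)
  fix p assume p: "\<forall>X\<in>D. p \<in> interior X --> g p = 0" "p \<in> S"
  then obtain a b where "p \<in> box a b" "cbox a b \<in> D" using D(5) by blast
  with p(1) show "g p = 0" by (metis interior_cbox)
 qed
qed

end

context pre_hilbert
begin

text \<open>Both residuals are tested with the difference of the two approximate solutions, and
  \<open>a\<close> is coercive with constant \<open>1 - q\<close>.\<close>

lemma residual_diff:
 assumes u: "u \<in> V" and u': "u' \<in> V"
  and r: "!!v. v \<in> V ==> \<bar>F v - a u v\<bar> <= e * nm v" and r': "!!v. v \<in> V ==> \<bar>F v - a u' v\<bar> <= e' * nm v"
  and a1: "!!f g h s t. f \<in> V ==> g \<in> V ==> h \<in> V ==> a (%x. s * f x + t * g x) h = s * a f h + t * a g h"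
  and q: "!!f. f \<in> V ==> \<bar>a f f - ip f f\<bar> <= q * (nm f * nm f)" "q < 1"
  and e: "0 <= e" "0 <= e'"
 shows "(1 - q) * nm (%x. 1 * u x + (-1) * u' x) <= e + e'"
proof -
 let ?d = "%x. 1 * u x + (-1) * u' x"
 have d: "?d \<in> V" by (rule V_lin[OF u u'])
 have "a ?d ?d = 1 * a u ?d + (-1) * a u' ?d" by (rule a1[OF u u' d])
 then have "a ?d ?d <= (e + e') * nm ?d" using r[OF d] r'[OF d] by (simp add: algebra_simps abs_le_iff)
 moreover have "(1 - q) * (nm ?d * nm ?d) <= a ?d ?d"
  using q(1)[OF d] nm_sq[OF d] by (simp add: power2_eq_square algebra_simps abs_le_iff)
 ultimately have *: "((1 - q) * nm ?d) * nm ?d <= (e + e') * nm ?d" by (simp only: mult.assoc)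
 show ?thesis
 proof (cases "nm ?d = 0")
  case True
  then show ?thesis using e by simp
 next
  case False
  then have "nm ?d > 0" using nm_nonneg[OF d] by linarith
  with * show ?thesis by (rule mult_right_le_imp_le)
 qed
qed

text \<open>Vanishing residuals together with the Cauchy property stand in for an exact solution,
  which \<open>V\<close> need not contain. The limit is taken afterwards by
  \<open>l2_complete\<close>.\<close>

lemma approx_solve_seq:
 assumes F: "linear_functional_on V F" and bd: "!!v. v \<in> V ==> \<bar>F v\<bar> <= C * nm v"
  and a1: "!!f g h s t. f \<in> V ==> g \<in> V ==> h \<in> V ==> a (%x. s * f x + t * g x) h = s * a f h + t * a g h"
  and a2: "!!f. f \<in> V ==> linear_functional_on V (a f)"
  and q: "0 <= q" "q < 1" "!!f g. f \<in> V ==> g \<in> V ==> \<bar>a f g - ip f g\<bar> <= q * (nm f * nm g)"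
 shows "\<exists>u. (\<forall>n. u n \<in> V) & (\<forall>n. \<forall>v\<in>V. \<bar>F v - a (u n) v\<bar> <= inverse (real (Suc n)) * nm v) &
  (\<forall>e>0. \<exists>N. \<forall>m\<ge>N. \<forall>n\<ge>N. nm (%x. 1 * u m x + (-1) * u n x) < e)"
proof -
 have "\<forall>n::nat. \<exists>u\<in>V. \<forall>v\<in>V. \<bar>F v - a u v\<bar> <= inverse (real (Suc n)) * nm v"
  by (intro allI approx_solve[OF F bd a1 a2 q]) auto
 then obtain u where u: "!!n. u n \<in> V" "!!n v. v \<in> V ==> \<bar>F v - a (u n) v\<bar> <= inverse (real (Suc n)) * nm v"
  by metis
 have est: "(1 - q) * nm (%x. 1 * u m x + (-1) * u n x) <= inverse (real (Suc m)) + inverse (real (Suc n))" for m n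
  by (rule residual_diff[OF u(1) u(1) u(2) u(2) a1 q(3) q(2)]) auto
 have "\<exists>N. \<forall>m\<ge>N. \<forall>n\<ge>N. nm (%x. 1 * u m x + (-1) * u n x) < e" if e: "e > 0" for e
 proof -
  obtain N where N: "inverse (real (Suc N)) < (1 - q) * e / 2"
   using reals_Archimedean[of "(1 - q) * e / 2"] e q by auto
  have "nm (%x. 1 * u m x + (-1) * u n x) < e" if "m >= N" "n >= N" for m n
  proof -
   have "inverse (real (Suc m)) <= inverse (real (Suc N))" "inverse (real (Suc n)) <= inverse (real (Suc N))"
    using that by (auto intro!: le_imp_inverse_le)
   then have "(1 - q) * nm (%x. 1 * u m x + (-1) * u n x) < (1 - q) * e"
    using est[of m n] N by linarith
   then show ?thesis using q by (simp only: mult_less_cancel_left_pos diff_gt_0_iff_gt)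
  qed
  then show ?thesis by blast
 qed
 with u show ?thesis by blast
qed

end

context cutoff_fun
begin

text \<open>The projection onto the closure of the test functions is computed by approximate Riesz
 representation, and the remainder vanishes by the fundamental lemma.\<close>

lemma test_dense:
 assumes h: "h \<in> sqi (lborel :: point measure)" and e: "e > 0"
 shows "\<exists>ph\<in>test UNIV. l2 lborel (%p. h p - ph p) < e"
proof -
 define ip where "ip = (%f g :: point => real. \<integral>p. f p * g p \<partial>lborel)"
 interpret pre_hilbert "test UNIV" ip
 proof
  fix f g h :: "point => real" and a b :: real
  assume "f \<in> test UNIV" "g \<in> test UNIV"
  then show "(%x. a * f x + b * g x) \<in> test UNIV" by (rule test_lin)
 next
  fix f g h :: "point => real" and a b :: real
  assume "f \<in> test UNIV" "g \<in> test UNIV" "h \<in> test UNIV"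
  then have "integrable lborel (%p. f p * h p)" "integrable lborel (%p. g p * h p)"
   by (auto intro: sqi_mult test_sqi)
  then show "ip (%x. a * f x + b * g x) h = a * ip f h + b * ip g h"
   unfolding ip_def by (simp add: distrib_right mult.assoc)
 qed (auto simp: ip_def mult.commute)
 have nm: "nm f = l2 lborel f" for f unfolding nm_def by (simp add: ip_def l2_def power2_eq_square)
 have ipl: "linear_functional_on (test UNIV) (ip f)" if "f \<in> sqi lborel" for f
  unfolding linear_functional_on_def
 proof (intro ballI allI)
  fix ph \<psi> :: "point => real" and a b assume *: "ph \<in> test UNIV" "\<psi> \<in> test UNIV"
  then have "integrable lborel (%p. f p * ph p)" "integrable lborel (%p. f p * \<psi> p)"
   using that by (auto intro: sqi_mult test_sqi)
  then show "ip f (%x. a * ph x + b * \<psi> x) = a * ip f ph + b * ip f \<psi>"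
   unfolding ip_def by (simp add: distrib_left mult.left_commute)
 qed
 have "\<exists>u. (\<forall>n. u n \<in> test UNIV) &
   (\<forall>n. \<forall>v\<in>test UNIV. \<bar>ip h v - ip (u n) v\<bar> <= inverse (real (Suc n)) * nm v) &
   (\<forall>e>0. \<exists>N. \<forall>m\<ge>N. \<forall>n\<ge>N. nm (%x. 1 * u m x + (-1) * u n x) < e)"
 proof (rule approx_solve_seq[where q=0 and C="l2 lborel h"])
  show "\<bar>ip h v\<bar> <= l2 lborel h * nm v" if "v \<in> test UNIV" for v
   unfolding nm unfolding ip_def by (rule l2_cauchy_schwarz[OF h test_sqi[OF that]])
 qed (auto simp: ipl h test_sqi ip_lin)
 then obtain u where u: "!!n. u n \<in> test UNIV"
  and res: "!!n v. v \<in> test UNIV ==> \<bar>ip h v - ip (u n) v\<bar> <= inverse (real (Suc n)) * l2 lborel v"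
  and cau: "!!e. e > 0 ==> \<exists>N. \<forall>m\<ge>N. \<forall>n\<ge>N. l2 lborel (%x. u m x - u n x) < e"
  by (auto simp: nm)
 note us = test_sqi[OF u]
 obtain r where r: "r \<in> sqi lborel" "(%n. l2 lborel (%x. u n x - r x)) ---> 0"
  using l2_complete[of u lborel, OF us cau] by blast
 have hr: "(%p. h p - r p) \<in> sqi lborel" by (rule sqi_diff[OF h r(1)])
 have "AE p in lborel. p \<in> UNIV --> h p - r p = 0"
 proof (rule fundamental_lemma)
  show "(%p. h p - r p) \<in> bmeas" using hr by (simp add: sqi_def)
  show "integrable lborel (%p. indicator (cbox a b) p * (h p - r p))" for a b :: point
  proof (rule sqi_mult[OF _ hr])
   have "integrable lborel (indicator (cbox a b) :: point => real)"
    by (rule integrable_real_indicator) (simp, rule emeasure_bounded_finite[OF bounded_cbox])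
   then show "indicator (cbox a b) \<in> sqi lborel"
    by (simp add: sqi_def power2_eq_square indicator_inter_arith[symmetric])
  qed
  fix ph :: "point => real" assume ph: "ph \<in> test UNIV"
  have "(%n. \<integral>p. u n p * ph p \<partial>lborel) ---> (LBINT p. r p * ph p)"
   by (rule l2_tendsto_inner[OF us test_sqi[OF ph] r(1) test_sqi[OF ph] r(2)]) (simp add: l2_def)
  moreover have "(%n. ip h ph - ip (u n) ph) ---> 0"
  proof (rule Lim_null_comparison[OF always_eventually])
   show "\<forall>n. norm (ip h ph - ip (u n) ph) <= inverse (real (Suc n)) * l2 lborel ph" using res[OF ph] by simp
   show "(%n. inverse (real (Suc n)) * l2 lborel ph) ---> 0"
    by (intro tendsto_mult_left_zero LIMSEQ_inverse_real_of_nat)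
  qed
  then have "(%n. ip (u n) ph) ---> ip h ph" by (simp add: LIM_zero_iff Lim_transform tendsto_iff dist_real_def abs_minus_commute)
  ultimately have "ip h ph = ip r ph" unfolding ip_def using LIMSEQ_unique by blast
  then show "(LBINT p. (h p - r p) * ph p) = 0"
   using sqi_mult[OF h test_sqi[OF ph]] sqi_mult[OF r(1) test_sqi[OF ph]]
   by (simp add: ip_def left_diff_distrib)
 qed simp
 then have ae: "AE p in lborel. h p = r p" by simp
 obtain n where n: "l2 lborel (%x. u n x - r x) < e"
  using order_tendstoD(2)[OF r(2) e] unfolding eventually_sequentially by blast
 have "l2 lborel (%p. h p - u n p) = l2 lborel (%p. r p - u n p)"
 proof (rule l2_cong_AE)
  show "AE p in lborel. h p - u n p = r p - u n p" using ae by auto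
 qed (use sqi_diff[OF h us] sqi_diff[OF r(1) us] in \<open>auto simp: sqi_def\<close>)
 then show ?thesis using n u by (metis l2_minus_commute)
qed

end

section \<open>Sobolev functions on the strip\<close>

abbreviation lom :: "point measure" where "lom \<equiv> restrict_space lborel \<Omega>"

lemma Omega_open: "open \<Omega>"
 unfolding Omega_def by (intro open_Times) auto

lemma Omega_borel [measurable]: "\<Omega> \<in> sets borel"
 using Omega_open by (rule borel_open)

lemma mem_Omega: "p \<in> \<Omega> \<longleftrightarrow> 0 < snd p & snd p < 1"
 by (cases p) (auto simp: Omega_def)

lemma space_lom [simp]: "space lom = \<Omega>"
 by (simp add: space_restrict_space)

lemma lom_integral: "(LINT p|lom. f p) = (LBINT p. indicator \<Omega> p * f p)"
 for f :: "point => real"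
 using integral_restrict_space[of \<Omega> lborel f] by simp

lemma lom_integrable: "integrable lom f \<longleftrightarrow> integrable lborel (%p. indicator \<Omega> p * f p)"
 for f :: "point => real"
 using integrable_restrict_space[of \<Omega> lborel f] by simp

lemma lom_measurable: "f \<in> borel_measurable lom \<longleftrightarrow> (%p. indicator \<Omega> p * f p) \<in> bmeas"
 for f :: "point => real"
 using borel_measurable_restrict_space_iff[of \<Omega> lborel f] by (simp add: mult.commute)

lemma lom_AE: "(AE p in lom. P p) \<longleftrightarrow> (AE p in lborel. p \<in> \<Omega> --> P p)"
 by (simp add: AE_restrict_space_iff)

lemma lom_measurable_borel: "f \<in> bmeas ==> f \<in> borel_measurable lom"
 by (rule measurable_restrict_space1) simp

lemma indicator_mult_sq: "(%p. (indicator A p * f p)^2) = (%p. indicator A p * (f p)^2)" for f :: "'a => real"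
 by (auto simp: indicator_def fun_eq_iff)

lemma sqi_lom: "f \<in> sqi lom \<longleftrightarrow> (%p. indicator \<Omega> p * f p) \<in> sqi lborel"
 unfolding sqi_def mem_Collect_eq lom_measurable lom_integrable indicator_mult_sq by simp

lemma l2_lom: "l2 lom f = l2 lborel (%p. indicator \<Omega> p * f p)"
 by (simp only: l2_def lom_integral indicator_mult_sq)

lemma sqi_lborel_lom: "f \<in> sqi lborel ==> f \<in> sqi lom"
 unfolding sqi_lom by (rule sqi_bounded_mult[where C=1]) (auto simp: indicator_def)

lemma L2_sqi: "L2 = sqi lom"
proof -
 have "u \<in> L2 \<longleftrightarrow> u \<in> sqi lom" for u
  unfolding L2_def sqi_def set_borel_measurable_def set_integrable_def by (simp add: lom_measurable lom_integrable)
 then show ?thesis by blast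
qed

lemma L2_norm_l2: "L2_norm u = l2 lom u"
 by (simp add: L2_norm_def l2_def set_lebesgue_integral_def lom_integral)

lemma dist_of_lom: "dist_of u ph = (LINT p|lom. u p * ph p)"
 by (simp add: dist_of_def set_lebesgue_integral_def lom_integral)

lemma dist_deriv_pd: "dist_deriv v T ph = - T (pd v ph)"
 by (simp add: dist_deriv_def pd_def)

lemma is_weak_deriv_iff:
 "is_weak_deriv v u g \<longleftrightarrow> (\<forall>ph\<in>test \<Omega>. (LINT p|lom. u p * pd v ph p) = - (LINT p|lom. g p * ph p))"
 unfolding is_weak_deriv_def dist_deriv_pd dist_of_lom by (rule ball_cong[OF refl]) arith

text \<open>Relational form of membership in \<open>H1\<close> that names a gradient, so that limits
  and products can be handled with explicit derivatives instead of those chosen by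
  \<open>weak_deriv\<close>.\<close>

definition weak_grad :: "(point => real) => (point => real) => (point => real) => bool" where
 "weak_grad u g h \<longleftrightarrow> u \<in> sqi lom & g \<in> sqi lom & h \<in> sqi lom &
  is_weak_deriv e\<^sub>x u g & is_weak_deriv e\<^sub>z u h"

lemma test_sqi_lom: "ph \<in> test S ==> ph \<in> sqi lom"
 by (intro sqi_lborel_lom test_sqi)

lemma H1_weak_grad:
 assumes "u \<in> H1"
 shows "weak_grad u (weak_deriv e\<^sub>x u) (weak_deriv e\<^sub>z u)"
proof -
 have "\<exists>g. g \<in> L2 & is_weak_deriv e\<^sub>x u g" "\<exists>g. g \<in> L2 & is_weak_deriv e\<^sub>z u g"
  using assms by (auto simp: H1_def)
 from someI_ex[OF this(1)] someI_ex[OF this(2)] show ?thesis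
  using assms unfolding weak_grad_def weak_deriv_def L2_sqi[symmetric] H1_def by auto
qed

lemma weak_grad_H1: "weak_grad u g h ==> u \<in> H1"
 unfolding weak_grad_def H1_def L2_sqi by auto

lemma weak_grad_lin:
 assumes "weak_grad u g h" "weak_grad u' g' h'"
 shows "weak_grad (%p. a * u p + b * u' p) (%p. a * g p + b * g' p) (%p. a * h p + b * h' p)"
proof -
 have *: "is_weak_deriv v (%p. a * u p + b * u' p) (%p. a * k p + b * k' p)"
  if k: "is_weak_deriv v u k" "is_weak_deriv v u' k'" "u \<in> sqi lom" "u' \<in> sqi lom" "k \<in> sqi lom" "k' \<in> sqi lom"
   and v: "v \<in> Basis" for v k k'
  unfolding is_weak_deriv_iff
 proof
  fix ph :: "point => real" assume ph: "ph \<in> test \<Omega>"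
  note s = test_sqi_lom[OF ph] test_sqi_lom[OF test_pd[OF ph v]]
  note i = sqi_mult[OF k(3) s(2)] sqi_mult[OF k(4) s(2)] sqi_mult[OF k(5) s(1)] sqi_mult[OF k(6) s(1)]
  show "(LINT p|lom. (a * u p + b * u' p) * pd v ph p) = - (LINT p|lom. (a * k p + b * k' p) * ph p)"
   using i k(1,2) ph unfolding is_weak_deriv_iff by (simp add: distrib_right mult.assoc)
 qed
 show ?thesis using assms unfolding weak_grad_def by (auto intro!: sqi_lin *)
qed

lemma weak_grad_diff:
 assumes "weak_grad u g h" "weak_grad u' g' h'"
 shows "weak_grad (%p. u p - u' p) (%p. g p - g' p) (%p. h p - h' p)"
 using weak_grad_lin[OF assms, of 1 "-1"] by simp

text \<open>Closedness of the weak gradient: both sides of its defining identity are L2 pairings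
  with a fixed test function, hence continuous under the assumed convergence.\<close>

lemma weak_grad_limit:
 assumes W: "!!n. weak_grad (s n) (a n) (b n)" and u: "u \<in> sqi lom" "g \<in> sqi lom" "h \<in> sqi lom"
  and lim: "(%n. l2 lom (%p. s n p - u p)) ---> 0" "(%n. l2 lom (%p. a n p - g p)) ---> 0"
   "(%n. l2 lom (%p. b n p - h p)) ---> 0"
 shows "weak_grad u g h"
proof -
 have *: "is_weak_deriv v u k" if "!!n. is_weak_deriv v (s n) (c n)" "!!n. c n \<in> sqi lom" "k \<in> sqi lom"
  "(%n. l2 lom (%p. c n p - k p)) ---> 0" "v \<in> Basis" for v k c
  unfolding is_weak_deriv_iff
 proof
  fix ph :: "point => real" assume ph: "ph \<in> test \<Omega>"
  note t = test_sqi_lom[OF ph] test_sqi_lom[OF test_pd[OF ph \<open>v \<in> Basis\<close>]]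
  have "(%n. \<integral>p. s n p * pd v ph p \<partial>lom) ---> (LINT p|lom. u p * pd v ph p)"
   by (rule l2_tendsto_inner[OF _ t(2) u(1) t(2) lim(1)]) (use W in \<open>auto simp: weak_grad_def l2_def\<close>)
  moreover have "(%n. \<integral>p. c n p * ph p \<partial>lom) ---> (LINT p|lom. k p * ph p)"
   by (rule l2_tendsto_inner[OF that(2) t(1) that(3) t(1) that(4)]) (auto simp: l2_def)
  moreover have "(LINT p|lom. s n p * pd v ph p) = - (LINT p|lom. c n p * ph p)" for n
   using that(1) ph by (simp add: is_weak_deriv_iff)
  ultimately have "(%n. - (LINT p|lom. c n p * ph p)) ---> (LINT p|lom. u p * pd v ph p)"
   "(%n. - (LINT p|lom. c n p * ph p)) ---> - (LINT p|lom. k p * ph p)"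
   by (auto intro: tendsto_minus)
  then show "(LINT p|lom. u p * pd v ph p) = - (LINT p|lom. k p * ph p)" by (rule LIMSEQ_unique)
 qed
 have "is_weak_deriv e\<^sub>x u g" by (rule *[of e\<^sub>x a g]) (use W u lim in \<open>auto simp: weak_grad_def\<close>)
 moreover have "is_weak_deriv e\<^sub>z u h" by (rule *[of e\<^sub>z b h]) (use W u lim in \<open>auto simp: weak_grad_def\<close>)
 ultimately show ?thesis using u unfolding weak_grad_def by blast
qed

lemma integral_deriv_eq_0:
 assumes g: "!!x. (g has_field_derivative g' x) (at x)" "continuous_on UNIV g'"
  and R: "!!x. \<bar>x\<bar> > R ==> g x = 0" "!!x. \<bar>x\<bar> > R ==> g' x = 0"
 shows "(LBINT x. g' x) = (0::real)"
proof -
 define S where "S = \<bar>R\<bar> + 1"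
 have "(LBINT x. indicator {- S .. S} x *\<^sub>R g' x) = g S - g (- S)"
  by (rule integral_FTC_atLeastAtMost)
   (use g in \<open>auto simp: S_def has_real_derivative_iff_has_vector_derivative[symmetric]
     intro: has_field_derivative_at_within continuous_on_subset\<close>)
 also have "(%x. indicator {- S .. S} x *\<^sub>R g' x) = g'"
 proof
  fix x show "indicator {- S .. S} x *\<^sub>R g' x = g' x"
   using R(2)[of x] by (cases "x \<in> {- S .. S}") (auto simp: S_def)
 qed
 finally show ?thesis using R(1) by (simp add: S_def)
qed

lemma test_box_support:
 assumes "ph \<in> test (S :: point set)"
 obtains R where "R > 0" "!!p. \<bar>fst p\<bar> > R \<or> \<bar>snd p\<bar> > R ==> ph p = 0"
proof -
 obtain K where K: "compact K" "!!x. x \<notin> K ==> ph x = 0" using test_support[OF assms] by auto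
 obtain R where R: "R > 0" "!!p. p \<in> K ==> norm p <= R"
  using compact_imp_bounded[OF K(1)] by (auto simp: bounded_pos)
 show thesis
 proof (rule that[OF R(1)])
  fix p :: point assume "\<bar>fst p\<bar> > R \<or> \<bar>snd p\<bar> > R"
  then have "norm p > R" using norm_fst_le[of "fst p" "snd p"] norm_snd_le[of "snd p" "fst p"] by auto
  then show "ph p = 0" using R(2)[of p] K(2)[of p] by force
 qed
qed

lemma integral_pd_test:
 assumes ph: "ph \<in> test (S :: point set)" and v: "v \<in> Basis"
 shows "(LBINT p. pd v ph p) = 0"
proof -
 obtain R where R: "!!p. \<bar>fst p\<bar> > R \<or> \<bar>snd p\<bar> > R ==> ph p = 0" by (rule test_box_support[OF ph]) blast
 have R': "pd v ph p = 0" if "\<bar>fst p\<bar> > R \<or> \<bar>snd p\<bar> > R" for p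
 proof -
  have "closed {p :: point. \<not> (\<bar>fst p\<bar> > R \<or> \<bar>snd p\<bar> > R)}"
   by (auto simp: not_less intro!: closed_Collect_conj closed_Collect_le continuous_intros)
  from pd_zero_outside[OF this, of ph] show ?thesis using that R by auto
 qed
 have sm: "smooth ph" by (rule test_smooth[OF ph])
 have i: "integrable (lborel \<Otimes>\<^sub>M lborel) (%p. pd v ph p)"
  unfolding lborel_prod by (rule test_integrable[OF test_pd[OF ph v]])
 have c: "continuous_on UNIV (pd v ph)" by (intro smooth_continuous smooth_pd sm v)
 from v consider "v = e\<^sub>x" | "v = e\<^sub>z" by (auto simp: Basis_point)
 then show ?thesis
 proof cases
  case 1
  have "(LBINT x. pd v ph (x, z)) = 0" for z
   by (rule integral_deriv_eq_0[where g="%x. ph (x, z)" and R=R])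
    (auto simp: 1 R R'[unfolded 1] intro: smooth_slice_x sm
     intro!: continuous_on_compose2[OF c[unfolded 1]] continuous_intros)
  then have "(LBINT z. (LBINT x. pd v ph (x, z))) = 0" by simp
  then show ?thesis using lborel_pair.integral_snd[of "%x z. pd v ph (x, z)"] i by (simp add: lborel_prod case_prod_unfold)
 next
  case 2
  have "(LBINT z. pd v ph (x, z)) = 0" for x
   by (rule integral_deriv_eq_0[where g="%z. ph (x, z)" and R=R])
    (auto simp: 2 R R'[unfolded 2] intro: smooth_slice_z sm
     intro!: continuous_on_compose2[OF c[unfolded 2]] continuous_intros)
  then have "(LBINT x. (LBINT z. pd v ph (x, z))) = 0" by simp
  then show ?thesis using lborel_pair.integral_fst'[of "pd v ph"] i by (simp add: lborel_prod case_prod_unfold)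
 qed
qed

lemma test_parts:
 assumes ph: "ph \<in> test (S :: point set)" and \<psi>: "smooth \<psi>" and v: "v \<in> Basis"
 shows "(LBINT p. \<psi> p * pd v ph p) = - (LBINT p. pd v \<psi> p * ph p)"
proof -
 have t: "(%p. \<psi> p * pd v ph p) \<in> test S" "(%p. pd v \<psi> p * ph p) \<in> test S"
  "(%p. \<psi> p * ph p) \<in> test S"
  using assms by (auto intro: test_smooth_mult test_pd smooth_pd)
 have "(LBINT p. pd v \<psi> p * ph p + \<psi> p * pd v ph p) = 0"
  using integral_pd_test[OF t(3) v] assms
  by (simp add: pd_mult smooth_differentiable test_smooth)
 then show ?thesis using test_integrable[OF t(1)] test_integrable[OF t(2)] by simp
qed

lemma test_parts_lom:
 assumes ph: "ph \<in> test \<Omega>" and \<psi>: "smooth \<psi>" and v: "v \<in> Basis"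
 shows "(LINT p|lom. \<psi> p * pd v ph p) = - (LINT p|lom. pd v \<psi> p * ph p)"
proof -
 have z: "ph p = 0 & pd v ph p = 0" if "p \<notin> \<Omega>" for p
  using test_support[OF ph] test_support[OF test_pd[OF ph v]] that by blast
 have "(%p. indicator \<Omega> p * (\<psi> p * pd v ph p)) = (%p. \<psi> p * pd v ph p)"
  "(%p. indicator \<Omega> p * (pd v \<psi> p * ph p)) = (%p. pd v \<psi> p * ph p)"
  using z by (auto simp: indicator_def fun_eq_iff)
 then show ?thesis using test_parts[OF assms] by (simp add: lom_integral)
qed

lemma weak_grad_test: "ph \<in> test S ==> weak_grad ph (dx ph) (dz ph)"
 unfolding weak_grad_def is_weak_deriv_iff
 by (auto intro: test_sqi_lom test_dx test_dz test_parts_lom test_smooth)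

lemma indicator_cbox_sqi: "indicator (cbox a b) \<in> sqi (lborel :: 'a::euclidean_space measure)"
proof -
 have "integrable lborel (indicator (cbox a b) :: 'a => real)"
  by (rule integrable_real_indicator) (simp, rule emeasure_bounded_finite[OF bounded_cbox])
 then show ?thesis by (simp add: sqi_def power2_eq_square indicator_inter_arith[symmetric])
qed

text \<open>The H1 norm with the gradient passed as arguments, so that it can be computed from
  classical derivatives for test functions.\<close>

definition n1 :: "(point => real) => (point => real) => (point => real) => real" where
 "n1 u g h = sqrt ((l2 lom u)^2 + (l2 lom g)^2 + (l2 lom h)^2)"

lemma n1_nonneg: "0 <= n1 u g h"
 by (simp add: n1_def)

lemma n1_ge: "l2 lom u <= n1 u g h" "l2 lom g <= n1 u g h" "l2 lom h <= n1 u g h"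
 unfolding n1_def by (rule real_le_rsqrt, simp)+

lemma n1_sq: "(n1 u g h)^2 = (LINT p|lom. (u p)^2) + (LINT p|lom. (g p)^2) + (LINT p|lom. (h p)^2)"
 by (simp add: n1_def l2_sq)

lemma n1_cmult: "n1 (%p. c * u p) (%p. c * g p) (%p. c * h p) = \<bar>c\<bar> * n1 u g h"
 by (simp add: n1_def l2_cmult power_mult_distrib distrib_left[symmetric] real_sqrt_mult)

lemma n1_tendsto:
 assumes "!!n. u n \<in> sqi lom" "!!n. g n \<in> sqi lom" "!!n. h n \<in> sqi lom" "u' \<in> sqi lom" "g' \<in> sqi lom" "h' \<in> sqi lom"
  "(%n. l2 lom (%p. u n p - u' p)) ---> 0" "(%n. l2 lom (%p. g n p - g' p)) ---> 0"
  "(%n. l2 lom (%p. h n p - h' p)) ---> 0"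
 shows "(%n. n1 (u n) (g n) (h n)) ---> n1 u' g' h'"
 unfolding n1_def
 by (intro tendsto_real_sqrt tendsto_add tendsto_power l2_tendsto_norm assms)

context cutoff_fun
begin

lemma fundamental_lom:
 assumes g: "g \<in> sqi lom" and 0: "!!ph. ph \<in> test \<Omega> ==> (LINT p|lom. g p * ph p) = 0"
 shows "AE p in lom. g p = 0"
proof -
 have g': "(%p. indicator \<Omega> p * g p) \<in> sqi lborel" using g by (simp only: sqi_lom)
 have "AE p in lborel. p \<in> \<Omega> --> indicator \<Omega> p * g p = 0"
 proof (rule fundamental_lemma[OF Omega_open])
  show "(%p. indicator \<Omega> p * g p) \<in> bmeas" using g' by (simp add: sqi_def)
  show "integrable lborel (%p. indicator (cbox a b) p * (indicator \<Omega> p * g p))" for a b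
   by (rule sqi_mult[OF indicator_cbox_sqi g'])
  show "(LBINT p. indicator \<Omega> p * g p * ph p) = 0" if "ph \<in> test \<Omega>" for ph
   using 0[OF that] by (simp only: lom_integral mult.assoc)
 qed
 then show ?thesis by (auto simp: lom_AE)
qed

lemma weak_deriv_unique:
 assumes g: "g \<in> sqi lom" "is_weak_deriv v u g" and g': "g' \<in> sqi lom" "is_weak_deriv v u g'"
 shows "AE p in lom. g p = g' p"
proof -
 have "AE p in lom. g p - g' p = 0"
 proof (rule fundamental_lom)
  show "(%p. g p - g' p) \<in> sqi lom" by (rule sqi_diff[OF g(1) g'(1)])
  fix ph assume ph: "ph \<in> test \<Omega>"
  have "- (LINT p|lom. g p * ph p) = - (LINT p|lom. g' p * ph p)"
   using g(2) g'(2) ph unfolding is_weak_deriv_iff by force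
  then show "(LINT p|lom. (g p - g' p) * ph p) = 0"
   using sqi_mult[OF g(1) test_sqi_lom[OF ph]] sqi_mult[OF g'(1) test_sqi_lom[OF ph]]
   by (simp add: left_diff_distrib)
 qed
 then show ?thesis by simp
qed

lemma weak_deriv_AE:
 assumes "weak_grad u g h"
 shows "AE p in lom. weak_deriv e\<^sub>x u p = g p" "AE p in lom. weak_deriv e\<^sub>z u p = h p"
 using H1_weak_grad[OF weak_grad_H1[OF assms]] assms
 unfolding weak_grad_def by (auto intro: weak_deriv_unique)

text \<open>The derivatives chosen by \<open>weak_deriv\<close> agree almost everywhere with any
  others, so the norm may be read off from whichever gradient is at hand.\<close>

lemma H1_norm_eq:
 assumes "weak_grad u g h"
 shows "H1_norm u = n1 u g h"
proof -
 have "l2 lom (weak_deriv e\<^sub>x u) = l2 lom g" "l2 lom (weak_deriv e\<^sub>z u) = l2 lom h"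
  using H1_weak_grad[OF weak_grad_H1[OF assms]] assms
  by (auto intro!: l2_cong_AE weak_deriv_AE[OF assms] simp: weak_grad_def sqi_def)
 then show ?thesis by (simp add: H1_norm_def n1_def L2_norm_l2)
qed

lemma H10I:
 assumes "weak_grad u g h" "!!n. ph n \<in> test \<Omega>"
  "(%n. l2 lom (%p. ph n p - u p)) ---> 0"
  "(%n. l2 lom (%p. dx (ph n) p - g p)) ---> 0" "(%n. l2 lom (%p. dz (ph n) p - h p)) ---> 0"
 shows "(%n. H1_norm (%p. ph n p - u p)) ---> 0" "u \<in> H10"
proof -
 have e: "H1_norm (%p. ph n p - u p) = n1 (%p. ph n p - u p) (%p. dx (ph n) p - g p) (%p. dz (ph n) p - h p)" for n
  by (rule H1_norm_eq[OF weak_grad_diff[OF weak_grad_test[OF assms(2)] assms(1)]])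
 have "(%n. n1 (%p. ph n p - u p) (%p. dx (ph n) p - g p) (%p. dz (ph n) p - h p)) ---> sqrt (0\<^sup>2 + 0\<^sup>2 + 0\<^sup>2)"
  unfolding n1_def by (intro tendsto_intros assms)
 then show *: "(%n. H1_norm (%p. ph n p - u p)) ---> 0" by (simp add: e)
 show "u \<in> H10" unfolding H10_def using weak_grad_H1[OF assms(1)] assms(2) * by blast
qed

lemma test_H10: "ph \<in> test \<Omega> ==> ph \<in> H10"
 by (rule H10I(2)[OF weak_grad_test, where ph="%_. ph"]) (auto simp: l2_def)

lemma H1_norm_minus_commute:
 assumes "u \<in> H1" "v \<in> H1"
 shows "H1_norm (%p. u p - v p) = H1_norm (%p. v p - u p)"
proof -
 note W = H1_weak_grad[OF assms(1)] H1_weak_grad[OF assms(2)]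
 show ?thesis
  unfolding H1_norm_eq[OF weak_grad_diff[OF W]] H1_norm_eq[OF weak_grad_diff[OF W(2,1)]] n1_def
  by (simp only: l2_minus_commute[of lom u v] l2_minus_commute[of lom "weak_deriv e\<^sub>x u"]
    l2_minus_commute[of lom "weak_deriv e\<^sub>z u"])
qed

lemma H10_H1: "u \<in> H10 ==> u \<in> H1"
 by (simp add: H10_def)

lemma H10_diff_test:
 assumes u: "u \<in> H10" and ph: "ph \<in> test \<Omega>"
 shows "(%p. u p - ph p) \<in> H10"
proof -
 from u obtain s where s: "!!n::nat. s n \<in> test \<Omega>" "(%n. H1_norm (%p. s n p - u p)) ---> 0"
  unfolding H10_def by blast
 have "(%p. u p - ph p) \<in> H1"
  by (rule weak_grad_H1[OF weak_grad_diff[OF H1_weak_grad[OF H10_H1[OF u]] weak_grad_test[OF ph]]])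
 moreover have "(%n. H1_norm (%p. (s n p - ph p) - (u p - ph p))) ---> 0" using s(2) by simp
 moreover have "(%p. s n p - ph p) \<in> test \<Omega>" for n by (rule test_diff[OF s(1) ph])
 ultimately show ?thesis unfolding H10_def
  by (intro CollectI conjI exI[of _ "%n p. s n p - ph p"]) auto
qed

text \<open>Boundedness passes along the test functions approximating \<open>u\<close> in H1. This
  is what makes the definite description in \<open>H_minus1_norm\<close> denote a value.\<close>

lemma H10_dual_unique:
 assumes F: "F \<in> H10_dual" and G: "G \<in> H10_dual"
  and eq: "!!ph. ph \<in> test \<Omega> ==> F ph = G ph" and u: "u \<in> H10"
 shows "F u = G u"
proof -
 from u obtain s where s: "!!n::nat. s n \<in> test \<Omega>" "(%n. H1_norm (%p. s n p - u p)) ---> 0"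
  unfolding H10_def by blast
 have lim: "(%n. L (s n)) ---> L u" if L: "L \<in> H10_dual" for L
 proof -
  obtain C where C: "!!v. v \<in> H10 ==> \<bar>L v\<bar> <= C * H1_norm v" using L by (auto simp: H10_dual_def)
  have "\<bar>L u - L (s n)\<bar> <= C * H1_norm (%p. s n p - u p)" for n
  proof -
   have "L (%p. 1 * u p + (-1) * s n p) = 1 * L u + (-1) * L (s n)"
    using L u test_H10[OF s(1)[of n]] unfolding H10_dual_def linear_functional_on_def by blast
   then have "L u - L (s n) = L (%p. u p - s n p)" by simp
   also have "\<bar>\<dots>\<bar> <= C * H1_norm (%p. u p - s n p)" by (intro C H10_diff_test u s)
   finally show ?thesis
    using H1_norm_minus_commute[OF H10_H1[OF u] H10_H1[OF test_H10[OF s(1)]]] by simp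
  qed
  then have "\<forall>n. norm (L (s n) - L u) <= C * H1_norm (%p. s n p - u p)" by (simp add: abs_minus_commute)
  then have "(%n. L (s n) - L u) ---> 0"
   by (rule Lim_null_comparison[OF always_eventually tendsto_mult_right_zero[OF s(2)]])
  then show ?thesis by (simp add: LIM_zero_iff)
 qed
 have "F (s n) = G (s n)" for n by (intro eq s)
 then show ?thesis using LIMSEQ_unique[OF lim[OF F]] lim[OF G] by simp
qed

text \<open>Normalising \<open>ph\<close> reduces to the unit ball, where the supremum applies once
  it is known to be over a bounded set. If \<open>ph\<close> has norm 0, the a priori bound by some
  constant gives \<open>F ph = 0\<close>.\<close>

lemma H10_dual_norm_bound:
 assumes F: "F \<in> H10_dual" and ph: "ph \<in> test \<Omega>"
 shows "\<bar>F ph\<bar> <= H10_dual_norm F * n1 ph (dx ph) (dz ph)" "0 <= H10_dual_norm F"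
proof -
 obtain C where C: "!!v. v \<in> H10 ==> \<bar>F v\<bar> <= C * H1_norm v" using F by (auto simp: H10_dual_def)
 have bdd: "bdd_above ((%v. \<bar>F v\<bar>) ` {v \<in> H10. H1_norm v <= 1})"
 proof (rule bdd_aboveI2)
  fix v assume v: "v \<in> {v \<in> H10. H1_norm v <= 1}"
  have "0 <= H1_norm v" by (simp add: H1_norm_def)
  then have "C * H1_norm v <= \<bar>C\<bar> * 1" using v by (intro mult_mono) auto
  then show "\<bar>F v\<bar> <= \<bar>C\<bar>" using C[of v] v by simp
 qed
 have nrm: "H1_norm \<psi> = n1 \<psi> (dx \<psi>) (dz \<psi>)" if "\<psi> \<in> test \<Omega>" for \<psi>
  by (rule H1_norm_eq[OF weak_grad_test[OF that]])
 have le: "\<bar>F \<psi>\<bar> <= H10_dual_norm F" if "\<psi> \<in> test \<Omega>" "H1_norm \<psi> <= 1" for \<psi>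
  unfolding H10_dual_norm_def using bdd by (rule cSUP_upper2) (use that test_H10 in auto)
 have "H1_norm (%p. 0) = 0" using nrm[of "%p. 0"] by (simp add: n1_def l2_def)
 then show nn: "0 <= H10_dual_norm F" using le[of "%p. 0"] by simp
 show "\<bar>F ph\<bar> <= H10_dual_norm F * n1 ph (dx ph) (dz ph)"
 proof (cases "H1_norm ph = 0")
  case True
  then show ?thesis using C[OF test_H10[OF ph]] nn n1_nonneg by simp
 next
  case False
  then have pos: "H1_norm ph > 0" using nrm[OF ph] n1_nonneg[of ph "dx ph" "dz ph"] by simp
  let ?c = "inverse (H1_norm ph)"
  have t: "(%p. ?c * ph p) \<in> test \<Omega>" by (rule test_cmult[OF ph])
  have "weak_grad (%p. ?c * ph p + 0 * ph p) (%p. ?c * dx ph p + 0 * dx ph p) (%p. ?c * dz ph p + 0 * dz ph p)"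
   by (rule weak_grad_lin[OF weak_grad_test[OF ph] weak_grad_test[OF ph]])
  then have "H1_norm (%p. ?c * ph p) = \<bar>?c\<bar> * n1 ph (dx ph) (dz ph)"
   using H1_norm_eq n1_cmult by fastforce
  also have "\<dots> = 1" using pos nrm[OF ph] by simp
  finally have "\<bar>F (%p. ?c * ph p)\<bar> <= H10_dual_norm F" using le[OF t] by simp
  moreover have "F (%p. ?c * ph p + 0 * ph p) = ?c * F ph + 0 * F ph"
   using F test_H10[OF ph] unfolding H10_dual_def linear_functional_on_def by blast
  ultimately have "\<bar>?c * F ph\<bar> <= H10_dual_norm F" by simp
  then show ?thesis using pos nrm[OF ph] by (simp add: abs_mult field_simps)
 qed
qed

text \<open>The interface through which the negative norm enters all estimates: from here on only
  its action on test functions is used.\<close>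

lemma H_minus1_bound:
 assumes T: "T \<in> H_minus1"
 shows "ph \<in> test \<Omega> ==> \<bar>T ph\<bar> <= H_minus1_norm T * n1 ph (dx ph) (dz ph)" "0 <= H_minus1_norm T"
proof -
 obtain F where F: "F \<in> H10_dual" "\<forall>ph\<in>test \<Omega>. F ph = T ph" using T by (auto simp: H_minus1_def)
 have eq: "H_minus1_norm T = H10_dual_norm F"
  unfolding H_minus1_norm_def
 proof (rule the_equality)
  show "\<exists>F'\<in>H10_dual. (\<forall>ph\<in>test \<Omega>. F' ph = T ph) & H10_dual_norm F = H10_dual_norm F'" using F by blast
  fix r assume "\<exists>F'\<in>H10_dual. (\<forall>ph\<in>test \<Omega>. F' ph = T ph) & r = H10_dual_norm F'"
  then obtain F' where F': "F' \<in> H10_dual" "\<forall>ph\<in>test \<Omega>. F' ph = T ph" "r = H10_dual_norm F'" by blast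
  have "F' v = F v" if "v \<in> H10" for v
   by (rule H10_dual_unique[OF F'(1) F(1) _ that]) (use F F' in auto)
  then show "r = H10_dual_norm F" unfolding F'(3) H10_dual_norm_def by (intro arg_cong[where f=Sup] image_cong) auto
 qed
 show "0 <= H_minus1_norm T" using H10_dual_norm_bound(2)[OF F(1) test_zero] eq by simp
 show "\<bar>T ph\<bar> <= H_minus1_norm T * n1 ph (dx ph) (dz ph)" if "ph \<in> test \<Omega>"
  using H10_dual_norm_bound(1)[OF F(1) that] F(2) that eq by simp
qed

end

section \<open>The weighted biharmonic form\<close>

lemma pd_lin:
 assumes "smooth f" "smooth g"
 shows "pd v (%x. a * f x + b * g x) = (%x. a * pd v f x + b * pd v g x)"
proof
 fix x
 note d = smooth_differentiable[OF assms(1), of x] smooth_differentiable[OF assms(2), of x]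
 have "((%x. a * f x + b * g x) has_derivative
   (%h. a * frechet_derivative f (at x) h + b * frechet_derivative g (at x) h)) (at x)"
  by (intro has_derivative_add has_derivative_mult_right frechet_derivativeD d)
 from pd_eqI[OF this] show "pd v (%x. a * f x + b * g x) x = a * pd v f x + b * pd v g x"
  by (simp add: pd_def)
qed

lemma pd_smooth_mult:
 "smooth f ==> smooth g ==> pd v (%x. f x * g x) = (%x. pd v f x * g x + f x * pd v g x)"
 by (rule ext) (simp add: pd_mult smooth_differentiable)

lemma pd_fst:
 assumes "smooth (r :: real => real)"
 shows "dx (%p. r (fst p)) = (%p. pd 1 r (fst p))" "dz (%p. r (fst p)) = (%p. 0)"
proof -
 have "((%p::point. r (fst p)) has_derivative (%h. pd 1 r (fst p) * fst h)) (at p)" for p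
  by (rule has_derivative_compose[where f=fst])
   (use smooth_has_field_derivative[OF assms] in \<open>auto simp: has_field_derivative_def intro!: derivative_eq_intros\<close>)
 note D = pd_eqI[OF this]
 show "dx (%p. r (fst p)) = (%p. pd 1 r (fst p))" "dz (%p. r (fst p)) = (%p. 0)"
  by (rule ext, simp add: D e\<^sub>x_def e\<^sub>z_def)+
qed

text \<open>Second-order jets \<open>(h, h\<^sub>x, h\<^sub>z, h\<^sub>x\<^sub>x, h\<^sub>x\<^sub>z, h\<^sub>z\<^sub>z)\<close>; \<open>jmult r r' r''\<close> is the product rule for
 the multiplication by a function of \<open>x\<close>, and \<open>jform\<close> is \<open>D\<^sup>2h : D\<^sup>2k\<close>.\<close>

type_synonym jet = "real \<times> real \<times> real \<times> real \<times> real \<times> real"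

definition jet :: "(point => real) => point => jet" where
 "jet f p = (f p, dx f p, dz f p, dx (dx f) p, dx (dz f) p, dz (dz f) p)"

definition jform :: "jet => jet => real" where
 "jform = (%(a, b, c, d, e, f) (a', b', c', d', e', f'). d * d' + 2 * (e * e') + f * f')"

definition jsq :: "jet => real" where
 "jsq = (%(a, b, c, d, e, f). a\<^sup>2 + b\<^sup>2 + c\<^sup>2 + d\<^sup>2 + e\<^sup>2 + f\<^sup>2)"

definition jmult :: "real => real => real => jet => jet" where
 "jmult r r1 r2 = (%(a, b, c, d, e, f).
  (r * a, r * b + r1 * a, r * c, r * d + 2 * r1 * b + r2 * a, r * e + r1 * c, r * f))"

definition jlin :: "real => jet => real => jet => jet" where
 "jlin s = (%(a, b, c, d, e, f) t (a', b', c', d', e', f').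
  (s * a + t * a', s * b + t * b', s * c + t * c', s * d + t * d', s * e + t * e', s * f + t * f'))"

lemma jsq_nonneg: "0 <= jsq J"
 by (cases J) (auto simp: jsq_def)

lemma jet_lin:
 "smooth f ==> smooth g ==> jet (%x. a * f x + b * g x) p = jlin a (jet f p) b (jet g p)"
 by (simp add: jet_def jlin_def pd_lin smooth_dx smooth_dz)

lemma jet_mult:
 assumes r: "smooth r" and f: "smooth f"
 shows "jet (%p. r (fst p) * f p) p = jmult (r (fst p)) (pd 1 r (fst p)) (pd 1 (pd 1 r) (fst p)) (jet f p)"
proof -
 note s = smooth_fst[OF r] smooth_fst[OF smooth_deriv[OF r]] f smooth_dx[OF f] smooth_dz[OF f]
 have 1: "dx (%p. r (fst p) * f p) = (%p. 1 * (pd 1 r (fst p) * f p) + 1 * (r (fst p) * dx f p))"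
  "dz (%p. r (fst p) * f p) = (%p. r (fst p) * dz f p)"
  using s r by (auto simp: pd_smooth_mult pd_fst)
 have 2: "dx (%p. 1 * (pd 1 r (fst p) * f p) + 1 * (r (fst p) * dx f p)) =
   (%p. 1 * (pd 1 (pd 1 r) (fst p) * f p + pd 1 r (fst p) * dx f p) + 1 * (pd 1 r (fst p) * dx f p + r (fst p) * dx (dx f) p))"
  using s r smooth_deriv[OF r] by (subst pd_lin) (auto intro: smooth_mult simp: pd_smooth_mult pd_fst)
 have 3: "dx (%p. r (fst p) * dz f p) = (%p. pd 1 r (fst p) * dz f p + r (fst p) * dx (dz f) p)"
  "dz (%p. r (fst p) * dz f p) = (%p. r (fst p) * dz (dz f) p)"
  using s r by (auto simp: pd_smooth_mult pd_fst)
 show ?thesis unfolding jet_def 1 2 3 by (simp add: jmult_def algebra_simps)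
qed

lemma jform_lin: "jform (jlin s J t K) L = s * jform J L + t * jform K L"
 by (cases J; cases K; cases L) (simp add: jform_def jlin_def algebra_simps)

lemma jform_commute: "jform J K = jform K J"
 by (cases J; cases K) (simp add: jform_def algebra_simps)

lemma jform_sq: "0 <= jform J J" "jform J J <= 2 * jsq J"
 by (cases J; simp add: jform_def jsq_def power2_eq_square)+

text \<open>The constant 9 is the largest collected coefficient: the square of the value
  \<open>a\<close> of the function occurs 1 + 2 + 6 times, through \<open>r\<close>,
  \<open>r1\<close> and \<open>r2\<close>.\<close>

lemma jsq_mult_le:
 assumes "\<bar>r\<bar> <= s" "\<bar>r1\<bar> <= s" "\<bar>r2\<bar> <= s"
 shows "jsq (jmult r r1 r2 J) <= 9 * s\<^sup>2 * jsq J"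
proof -
 obtain a b c d e f where J: "J = (a, b, c, d, e, f)" by (cases J)
 have s: "0 <= s" using assms(1) by linarith
 have two: "(x + y)^2 <= 2 * x\<^sup>2 + 2 * y\<^sup>2" for x y :: real
  using sum_squares_bound[of x y] by (simp add: power2_eq_square algebra_simps)
 \<comment> \<open>Cauchy-Schwarz with 1 + 4 + 1 = 6; the sum of squares in the proof is the
   remainder in Lagrange's identity.\<close>
 have three: "(x + 2 * y + z)^2 <= 6 * x\<^sup>2 + 6 * y\<^sup>2 + 6 * z\<^sup>2" for x y z :: real
 proof -
  have "0 <= (2 * x - y)^2 + (x - z)^2 + (2 * z - y)^2" by simp
  then show ?thesis by (simp add: power2_eq_square algebra_simps)
 qed
 have m: "(t * x)^2 <= s\<^sup>2 * x\<^sup>2" if "\<bar>t\<bar> <= s" for t x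
 proof -
  have "t\<^sup>2 <= s\<^sup>2" using that s by (simp add: abs_le_square_iff[symmetric])
  then show ?thesis by (simp add: power_mult_distrib mult_right_mono)
 qed
 have "jsq (jmult r r1 r2 J) = (r * a)^2 + (r * b + r1 * a)^2 + (r * c)^2 + (r * d + 2 * (r1 * b) + r2 * a)^2
   + (r * e + r1 * c)^2 + (r * f)^2"
  by (simp add: J jsq_def jmult_def mult.assoc)
 also have "\<dots> <= (r * a)^2 + (2 * (r * b)^2 + 2 * (r1 * a)^2) + (r * c)^2 + (6 * (r * d)^2 + 6 * (r1 * b)^2 + 6 * (r2 * a)^2)
   + (2 * (r * e)^2 + 2 * (r1 * c)^2) + (r * f)^2"
  using two[of "r * b" "r1 * a"] three[of "r * d" "r1 * b" "r2 * a"] two[of "r * e" "r1 * c"] by linarith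
 also have "\<dots> <= s\<^sup>2 * a\<^sup>2 + (2 * (s\<^sup>2 * b\<^sup>2) + 2 * (s\<^sup>2 * a\<^sup>2)) + s\<^sup>2 * c\<^sup>2 + (6 * (s\<^sup>2 * d\<^sup>2) + 6 * (s\<^sup>2 * b\<^sup>2) + 6 * (s\<^sup>2 * a\<^sup>2))
   + (2 * (s\<^sup>2 * e\<^sup>2) + 2 * (s\<^sup>2 * c\<^sup>2)) + s\<^sup>2 * f\<^sup>2"
  using m[OF assms(1)] m[OF assms(2)] m[OF assms(3)] by (intro add_mono mult_left_mono) auto
 also have "\<dots> <= 9 * s\<^sup>2 * jsq J"
 proof -
  have "0 <= s\<^sup>2 * a\<^sup>2" "0 <= s\<^sup>2 * b\<^sup>2" "0 <= s\<^sup>2 * c\<^sup>2" "0 <= s\<^sup>2 * d\<^sup>2" "0 <= s\<^sup>2 * e\<^sup>2" "0 <= s\<^sup>2 * f\<^sup>2" by simp_all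
  then show ?thesis by (simp add: J jsq_def distrib_left)
 qed
 finally show ?thesis .
qed

text \<open>Quadratic decay is fast enough for summability over the integers and slow enough for the
  quotient of two translates to stay bounded together with two derivatives.\<close>

definition wt :: "real => real => real" where "wt k x = 1 / (1 + (x - k)^2 / 100)"

lemma wt_denom: "0 < 1 + (x - k)^2 / (100::real)"
 by (simp add: add_pos_nonneg)

lemma wt_pos: "0 < wt k x" and wt_le_1: "wt k x <= 1"
 using wt_denom[of x k] by (auto simp: wt_def)

lemma smooth_quad: "smooth (%x. 1 + (x - k)^2 / (100::real))"
proof -
 have "smooth (%x. 1 + (x - k) * (x - k) * (1 / (100::real)))"
  by (intro smooth_add smooth_mult smooth_diff smooth_const smooth_ident_real)
 then show ?thesis by (simp add: power2_eq_square)
qed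

lemma wt_smooth: "smooth (wt k)"
proof -
 have "wt k = (%x. 1 / (1 + (x - k)^2 / 100))" by (simp add: wt_def fun_eq_iff)
 moreover have "smooth (%x. 1 / (1 + (x - k)^2 / (100::real)))"
  by (rule smooth_inverse[OF smooth_quad]) (use wt_denom in \<open>metis less_irrefl\<close>)
 ultimately show ?thesis by simp
qed

lemma wt_deriv: "pd 1 (wt k) x = - (x - k) / 50 * (wt k x)^2"
proof (rule pd_real_eqI)
 have ne: "1 + (x - k)^2 / 100 ~= 0" using wt_denom[of x k] by linarith
 have aux: "- ((200 * x - 200 * k) / (10000 * E)) = (k - x) / (50 * E)" for E
  by (cases "E = 0") (auto simp: divide_simps)
 have "((%x. 1 / (1 + (x - k)^2 / 100)) has_field_derivative - (x - k) / 50 * (1 / (1 + (x - k)^2 / 100))^2) (at x)"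
  by ((rule derivative_eq_intros refl ne | simp add: power2_eq_square)+, rule aux)
 then show "(wt k has_field_derivative - (x - k) / 50 * (wt k x)^2) (at x)" by (simp add: wt_def[abs_def])
qed

lemma wt_deriv2: "pd 1 (pd 1 (wt k)) x = - (wt k x)\<^sup>2 / 50 + (x - k)^2 / 1250 * (wt k x)^3"
proof (rule pd_real_eqI)
 have "(wt k has_field_derivative - (x - k) / 50 * (wt k x)^2) (at x)"
  using smooth_has_field_derivative[OF wt_smooth] by (simp add: wt_deriv)
 note [derivative_intros] = this
 have "((%x. - (x - k) / 50 * (wt k x)^2) has_field_derivative
   - (wt k x)\<^sup>2 / 50 + (x - k)^2 / 1250 * (wt k x)^3) (at x)"
  by (rule derivative_eq_intros refl | simp add: power2_eq_square power3_eq_cube field_simps)+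
 then show "(pd 1 (wt k) has_field_derivative - (wt k x)\<^sup>2 / 50 + (x - k)^2 / 1250 * (wt k x)^3) (at x)"
  by (simp add: wt_deriv[abs_def])
qed

lemma wt_deriv_bound: "\<bar>pd 1 (wt k) x\<bar> <= wt k x / 10"
proof -
 have "\<bar>x - k\<bar> / 5 <= 1 + (x - k)^2 / 100"
  using zero_le_power2[of "1 - \<bar>x - k\<bar> / 10"] by (simp add: power2_eq_square algebra_simps)
 then have "\<bar>x - k\<bar> * wt k x <= 5" using wt_denom[of x k] by (simp add: wt_def field_simps)
 then have "(\<bar>x - k\<bar> * wt k x) * wt k x <= 5 * wt k x" by (rule mult_right_mono) (simp add: wt_pos less_imp_le)
 then show ?thesis by (simp add: wt_deriv abs_mult power2_eq_square abs_minus_commute[of x k] mult_ac)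
qed

text \<open>The two terms of the second derivative have opposite signs: one is -2/100 of the squared
  weight, the other lies between 0 and 8/100 of it. Their sum is thus at most 6/100 in
  modulus.\<close>

lemma wt_deriv2_bound: "\<bar>pd 1 (pd 1 (wt k)) x\<bar> <= 6 / 100 * wt k x"
proof -
 have w: "0 < wt k x" "wt k x <= 1" by (rule wt_pos wt_le_1)+
 have "(x - k)^2 * wt k x <= 100" using wt_denom[of x k] by (simp add: wt_def field_simps)
 then have "((x - k)^2 * wt k x) * (wt k x)^2 <= 100 * (wt k x)^2" by (rule mult_right_mono) simp
 moreover have "(x - k)^2 / 1250 * (wt k x)^3 = ((x - k)^2 * wt k x) * (wt k x)^2 / 1250"
  by (simp add: power2_eq_square power3_eq_cube mult_ac)
 ultimately have a: "(x - k)^2 / 1250 * (wt k x)^3 <= 8 / 100 * (wt k x)^2" by linarith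
 have b: "0 <= (x - k)^2 / 1250 * (wt k x)^3" using w by simp
 have c: "(wt k x)^2 <= wt k x" using w by (simp add: power2_eq_square mult_left_le)
 show ?thesis unfolding wt_deriv2 abs_le_iff by (intro conjI; use a b c w in linarith)
qed

text \<open>Cauchy-Schwarz applied to \<open>g x\<close> as the integral of \<open>g'\<close> from 0
  to \<open>x\<close> bounds the square of \<open>g\<close> pointwise by the integral of the square
  of \<open>g'\<close>. The resulting constant 1 is not sharp, but small enough for the coercivity
  with this weight.\<close>

lemma poincare_1d:
 assumes g: "!!x. (g has_field_derivative g' x) (at x)" "continuous_on UNIV g'"
  and z: "!!x. x <= 0 \<or> 1 <= x ==> g x = 0" "!!x. x <= 0 \<or> 1 <= x ==> g' x = (0::real)"
 shows "(LBINT x. (g x)^2) <= (LBINT x. (g' x)^2)"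
proof -
 have cg: "continuous_on UNIV g" by (meson DERIV_isCont continuous_at_imp_continuous_on g(1))
 have int: "f \<in> sqi lborel" if "continuous_on UNIV f" "!!x. x <= 0 \<or> 1 <= x ==> f x = 0" for f :: "real => real"
 proof -
  have "integrable lborel (%x. indicator {0..1} x *\<^sub>R (f x)\<^sup>2)"
   by (rule borel_integrable_compact) (auto intro!: continuous_intros continuous_on_subset[OF that(1)])
  also have "(%x. indicator {0..1} x *\<^sub>R (f x)\<^sup>2) = (%x. (f x)^2)"
  proof
   fix x show "indicator {0..1} x *\<^sub>R (f x)\<^sup>2 = (f x)^2"
    using that(2)[of x] by (cases "0 <= x & x <= 1") auto
  qed
  finally show ?thesis using that(1) by (auto simp: sqi_def intro: borel_measurable_continuous_onI)
 qed
 have g's: "g' \<in> sqi lborel" by (rule int[OF g(2) z(2)])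
 have gs: "g \<in> sqi lborel" by (rule int[OF cg z(1)])
 define A where "A = (LBINT x. (g' x)^2)"
 have bound: "(g x)^2 <= indicator {0..1} x * A" for x
 proof (cases "0 <= x & x <= 1")
  case True
  have "(LBINT y. indicator {0 .. x} y *\<^sub>R g' y) = g x - g 0"
   by (rule integral_FTC_atLeastAtMost)
    (use g True in \<open>auto simp: has_real_derivative_iff_has_vector_derivative[symmetric]
     intro: has_field_derivative_at_within continuous_on_subset\<close>)
  then have gx: "g x = (LBINT y. indicator {0 .. x} y * g' y)" using z(1)[of 0] by simp
  have i: "indicator {0..x} \<in> sqi (lborel :: real measure)" using indicator_cbox_sqi[of 0 x] by simp
  have "\<bar>g x\<bar> <= l2 lborel (indicator {0..x} :: real => real) * l2 lborel g'"
   unfolding gx by (rule l2_cauchy_schwarz[OF i g's])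
  also have "l2 lborel (indicator {0..x} :: real => real) = sqrt x"
   using True by (simp add: l2_def power2_eq_square indicator_inter_arith[symmetric])
  also have "sqrt x * l2 lborel g' <= 1 * l2 lborel g'" by (rule mult_right_mono) (use True in auto)
  finally have "\<bar>g x\<bar> <= l2 lborel g'" by simp
  then have "\<bar>g x\<bar>\<^sup>2 <= (l2 lborel g')^2" by (rule power_mono) simp
  then show ?thesis using True by (simp add: A_def l2_sq)
 next
  case False
  then show ?thesis using z(1)[of x] by auto
 qed
 have "(LBINT x. (g x)^2) <= integral\<^sup>L lborel (%x::real. indicator {0..1} x * A)"
 proof (rule integral_mono[OF sqi_integrable[OF gs] _ bound])
  show "integrable lborel (%x::real. indicator {0..1} x * A)" by (intro integrable_mult_left) simp
 qed
 also have "\<dots> = A" by simp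
 finally show ?thesis by (simp add: A_def)
qed

definition wi :: "real => (point => real) => real" where
 "wi k f = (LBINT p. wt k (fst p) * (f p)^2)"

lemma wi_integrable:
 fixes f :: "point => real"
 assumes "f \<in> test S"
 shows "integrable lborel (%p. wt k (fst p) * (f p)^2)"
 using test_integrable[OF test_smooth_mult[OF smooth_fst[OF wt_smooth] test_smooth_mult[OF test_smooth[OF assms] assms]]]
 by (simp add: power2_eq_square)

lemma wi_nonneg: "0 <= wi k f"
 unfolding wi_def by (rule Bochner_Integration.integral_nonneg) (simp add: wt_pos less_imp_le)

lemma test_Omega_zero: "f \<in> test \<Omega> ==> z <= 0 \<or> 1 <= z ==> f (x, z) = 0"
 using test_support[of f \<Omega>] mem_Omega[of "(x, z)"] by (metis linorder_not_le snd_conv subsetD)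

text \<open>The weight depends on x only, so it factors out of the one-dimensional inequality on
  each vertical line and is not differentiated.\<close>

lemma poincare:
 assumes f: "f \<in> test \<Omega>"
 shows "wi k f <= wi k (dz f)"
proof -
 have sm: "smooth f" by (rule test_smooth[OF f])
 have i: "integrable (lborel \<Otimes>\<^sub>M lborel) (%p. wt k (fst p) * (f p)^2)"
  "integrable (lborel \<Otimes>\<^sub>M lborel) (%p. wt k (fst p) * (dz f p)^2)"
  unfolding lborel_prod by (rule wi_integrable[OF f] wi_integrable[OF test_dz[OF f]])+
 have "wi k f = (LBINT x. (LBINT z. wt k x * (f (x, z))^2))"
  using lborel_pair.integral_fst'[OF i(1)] by (simp add: wi_def lborel_prod)
 also have "\<dots> <= (LBINT x. (LBINT z. wt k x * (dz f (x, z))^2))"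
 proof (rule integral_mono)
  fix x
  have "continuous_on UNIV (%z. dz f (x, z))"
   by (rule continuous_on_compose2[OF smooth_continuous[OF smooth_dz[OF sm], of UNIV]]) (auto intro!: continuous_intros)
  then have "(LBINT z. (f (x, z))^2) <= (LBINT z. (dz f (x, z))^2)"
   by (rule poincare_1d[OF smooth_slice_z[OF sm]]) (auto intro: test_Omega_zero f test_dz)
  then show "(LBINT z. wt k x * (f (x, z))^2) <= (LBINT z. wt k x * (dz f (x, z))^2)"
   by (simp add: wt_pos less_imp_le mult_left_mono)
 qed (use lborel_pair.integrable_fst'[OF i(1)] lborel_pair.integrable_fst'[OF i(2)] in simp_all)
 also have "\<dots> = wi k (dz f)"
  using lborel_pair.integral_fst'[OF i(2)] by (simp add: wi_def lborel_prod)
 finally show ?thesis .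
qed

definition ipw :: "real => (point => real) => (point => real) => real" where
 "ipw k f g = (LBINT p. wt k (fst p) * jform (jet f p) (jet g p))"

text \<open>The biharmonic form written with full Hessians. Compared with the product of Laplacians,
  this version controls every second derivative pointwise, so that a weight can be inserted without
  further integration by parts.\<close>

definition bform :: "(point => real) => (point => real) => real" where
 "bform f g = (LBINT p. jform (jet f p) (jet g p))"

definition energy :: "real => (point => real) => real" where
 "energy k f = (LBINT p. wt k (fst p) * jsq (jet f p))"

lemma jform_test:
 assumes "f \<in> test S" "g \<in> test S"
 shows "(%p. jform (jet f p) (jet g p)) \<in> test S"
 unfolding jform_def jet_def prod.case
 by (intro test_add test_cmult test_smooth_mult test_smooth[of _ S] test_dx test_dz assms)

lemma jsq_test:
 assumes "f \<in> test S"
 shows "(%p. jsq (jet f p)) \<in> test S"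
 unfolding jsq_def jet_def prod.case power2_eq_square
 by (intro test_add test_cmult test_smooth_mult test_smooth[of _ S] test_dx test_dz assms)

lemma ipw_integrable:
 "f \<in> test S ==> g \<in> test S ==> integrable lborel (%p. wt k (fst p) * jform (jet f p) (jet g p))"
 by (rule test_integrable[OF test_smooth_mult[OF smooth_fst[OF wt_smooth] jform_test]])

lemma energy_integrable:
 "f \<in> test S ==> integrable lborel (%p. wt k (fst p) * jsq (jet f p))"
 by (rule test_integrable[OF test_smooth_mult[OF smooth_fst[OF wt_smooth] jsq_test]])

lemma pre_hilbert_ipw: "pre_hilbert (test \<Omega>) (ipw k)"
proof
 fix f g h :: "point => real" and a b :: real
 assume f: "f \<in> test \<Omega>" and g: "g \<in> test \<Omega>"
 then show "(%x. a * f x + b * g x) \<in> test \<Omega>" by (rule test_lin)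
next
 fix f g h :: "point => real" and a b :: real
 assume f: "f \<in> test \<Omega>" and g: "g \<in> test \<Omega>" and h: "h \<in> test \<Omega>"
 show "ipw k (%x. a * f x + b * g x) h = a * ipw k f h + b * ipw k g h"
  unfolding ipw_def using ipw_integrable[OF f h] ipw_integrable[OF g h]
  by (simp add: jet_lin[OF test_smooth[OF f] test_smooth[OF g]] jform_lin distrib_left mult.left_commute)
next
 fix f :: "point => real"
 show "0 <= ipw k f f" unfolding ipw_def
  by (rule Bochner_Integration.integral_nonneg) (simp add: wt_pos less_imp_le jform_sq)
qed (auto simp: ipw_def jform_commute)

lemma ipw_expand:
 assumes f: "f \<in> test \<Omega>"
 shows "ipw k f f = wi k (dx (dx f)) + 2 * wi k (dx (dz f)) + wi k (dz (dz f))"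
proof -
 note i = wi_integrable[OF test_dx[OF test_dx[OF f]]] wi_integrable[OF test_dx[OF test_dz[OF f]]]
  wi_integrable[OF test_dz[OF test_dz[OF f]]]
 have "(%p. wt k (fst p) * jform (jet f p) (jet f p)) =
  (%p. wt k (fst p) * (dx (dx f) p)^2 + 2 * (wt k (fst p) * (dx (dz f) p)^2) + wt k (fst p) * (dz (dz f) p)^2)"
  by (simp add: fun_eq_iff jform_def jet_def power2_eq_square algebra_simps)
 then show ?thesis using i by (simp add: ipw_def wi_def)
qed

lemma energy_expand:
 assumes f: "f \<in> test \<Omega>"
 shows "energy k f = wi k f + wi k (dx f) + wi k (dz f) + wi k (dx (dx f)) + wi k (dx (dz f)) + wi k (dz (dz f))"
proof -
 note i = wi_integrable[OF f] wi_integrable[OF test_dx[OF f]] wi_integrable[OF test_dz[OF f]]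
  wi_integrable[OF test_dx[OF test_dx[OF f]]] wi_integrable[OF test_dx[OF test_dz[OF f]]]
  wi_integrable[OF test_dz[OF test_dz[OF f]]]
 have "(%p. wt k (fst p) * jsq (jet f p)) = (%p. wt k (fst p) * (f p)^2 + wt k (fst p) * (dx f p)^2 + wt k (fst p) * (dz f p)^2
  + wt k (fst p) * (dx (dx f) p)^2 + wt k (fst p) * (dx (dz f) p)^2 + wt k (fst p) * (dz (dz f) p)^2)"
  by (simp add: fun_eq_iff jsq_def jet_def algebra_simps)
 then show ?thesis using i by (simp add: energy_def wi_def)
qed

lemma poincare_jet:
 assumes f: "f \<in> test \<Omega>"
 shows "wi k (dz f) <= wi k (dz (dz f))" "wi k f <= wi k (dz (dz f))" "wi k (dx f) <= wi k (dx (dz f))"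
 using poincare[OF f, of k] poincare[OF test_dz[OF f], of k] poincare[OF test_dx[OF f], of k]
  pd_commute[OF test_smooth[OF f]] by simp_all

text \<open>By Poincare in z, the terms \<open>f\<close> and \<open>dz f\<close> are absorbed into
  \<open>dz (dz f)\<close>, which is then counted three times, and \<open>dx f\<close> into
  \<open>dx (dz f)\<close>, which already carries the coefficient 2 in \<open>ipw\<close>.\<close>

lemma energy_le: "f \<in> test \<Omega> ==> energy k f <= 3 * ipw k f f"
 using poincare_jet[of f k] wi_nonneg[of k "dx (dx f)"] wi_nonneg[of k "dx (dz f)"]
 by (simp add: energy_expand ipw_expand)

lemma test_wt: "(f :: point => real) \<in> test S ==> (%p. wt k (fst p) * f p) \<in> test S"
 by (rule test_smooth_mult[OF smooth_fst[OF wt_smooth]])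

lemma bform_integrable: "f \<in> test S ==> g \<in> test S ==> integrable lborel (%p. jform (jet f p) (jet g p))"
 by (rule test_integrable[OF jform_test])

text \<open>The weight \<open>w\<close> is flat enough that \<open>D\<^sup>2f : D\<^sup>2(wg)\<close> is a small perturbation of
 \<open>w D\<^sup>2f : D\<^sup>2g\<close>.\<close>

lemma perturbation_quadratic:
 assumes f: "f \<in> test \<Omega>" and g: "g \<in> test \<Omega>"
 shows "\<bar>bform f (%p. wt k (fst p) * g p) - ipw k f g\<bar> <= 13 / 100 * (ipw k f f + ipw k g g)"
proof -
 let ?w = "%p::point. wt k (fst p)"
 define X where "X p = jform (jet f p) (jet (%p. ?w p * g p) p) - ?w p * jform (jet f p) (jet g p)" for p
 \<comment> \<open>Young's inequality on the three commutator terms. The coefficient 13/100 = 1/10 +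
   3/100 collects the two products in which the pure x derivative of \<open>f\<close> meets a first
   and a second derivative of the weight.\<close>
 define Y where "Y p = 13/100 * (?w p * (dx (dx f) p)^2) + 1/10 * (?w p * (dx (dz f) p)^2)
  + 1/10 * (?w p * (dx g p)^2) + 3/100 * (?w p * (g p)^2) + 1/10 * (?w p * (dz g p)^2)" for p
 have am: "\<bar>x * t * y\<bar> <= c / 2 * (w * x\<^sup>2) + c / 2 * (w * y\<^sup>2)" if "\<bar>t\<bar> <= c * w" for x t y c w :: real
 proof -
  have "\<bar>x * t * y\<bar> = \<bar>t\<bar> * (\<bar>x\<bar> * \<bar>y\<bar>)" by (simp add: abs_mult)
  also have "\<dots> <= (c * w) * (\<bar>x\<bar> * \<bar>y\<bar>)" by (rule mult_right_mono[OF that]) simp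
  also have "\<dots> <= (c * w) * ((x\<^sup>2 + y\<^sup>2) / 2)"
   using sum_squares_bound[of "\<bar>x\<bar>" "\<bar>y\<bar>"] that by (intro mult_left_mono) (auto simp: mult.assoc)
  also have "\<dots> = c / 2 * (w * x\<^sup>2) + c / 2 * (w * y\<^sup>2)" by (simp add: field_simps)
  finally show ?thesis .
 qed
 have XY: "\<bar>X p\<bar> <= Y p" for p
 proof -
  let ?w1 = "pd 1 (wt k) (fst p)" and ?w2 = "pd 1 (pd 1 (wt k)) (fst p)"
  have X: "X p = 2 * (dx (dx f) p * ?w1 * dx g p) + dx (dx f) p * ?w2 * g p + 2 * (dx (dz f) p * ?w1 * dz g p)"
   unfolding X_def jet_mult[OF wt_smooth test_smooth[OF g]]
   by (simp add: jet_def jform_def jmult_def algebra_simps)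
  have w: "\<bar>?w1\<bar> <= 1/10 * ?w p" "\<bar>?w2\<bar> <= 6/100 * ?w p"
   using wt_deriv_bound[of k "fst p"] wt_deriv2_bound[of k "fst p"] by simp_all
  have "0 <= ?w p * (dx (dx f) p)^2" by (simp add: wt_pos less_imp_le)
  then show ?thesis unfolding X Y_def
   using am[OF w(1), of "dx (dx f) p" "dx g p"] am[OF w(2), of "dx (dx f) p" "g p"]
    am[OF w(1), of "dx (dz f) p" "dz g p"] by linarith
 qed
 have iX: "integrable lborel X" unfolding X_def
  by (intro Bochner_Integration.integrable_diff bform_integrable[of _ \<Omega>] ipw_integrable[of _ \<Omega>] test_wt f g)
 note i = wi_integrable[OF test_dx[OF test_dx[OF f]]] wi_integrable[OF test_dx[OF test_dz[OF f]]]
  wi_integrable[OF g] wi_integrable[OF test_dx[OF g]] wi_integrable[OF test_dz[OF g]]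
 have iY: "integrable lborel Y" unfolding Y_def using i by (intro Bochner_Integration.integrable_add integrable_mult_right) auto
 have "bform f (%p. ?w p * g p) - ipw k f g = (LBINT p. X p)"
  unfolding X_def bform_def ipw_def
  by (rule Bochner_Integration.integral_diff[symmetric])
   (intro bform_integrable[of _ \<Omega>] ipw_integrable[of _ \<Omega>] test_wt f g)+
 also have "\<bar>\<dots>\<bar> <= (LBINT p. Y p)"
  using integral_mono[OF iX iY] integral_mono[OF integrable_minus[OF iX] iY] XY by (simp add: abs_le_iff)
 also have "\<dots> = 13/100 * wi k (dx (dx f)) + 1/10 * wi k (dx (dz f)) + 1/10 * wi k (dx g) + 3/100 * wi k g + 1/10 * wi k (dz g)"
  using i unfolding Y_def wi_def by simp
 also have "\<dots> <= 13 / 100 * (ipw k f f + ipw k g g)"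
  using poincare_jet[OF g, of k] wi_nonneg[of k "dx (dz f)"] wi_nonneg[of k "dz (dz f)"] wi_nonneg[of k "dx (dx g)"]
   wi_nonneg[of k "dx (dz g)"] wi_nonneg[of k "dz (dz g)"]
  by (simp add: ipw_expand f g)
 finally show ?thesis .
qed

context pre_hilbert
begin

text \<open>Replacing \<open>f\<close> by \<open>s f\<close> and \<open>g\<close> by
  \<open>g / s\<close> leaves \<open>D f g\<close> unchanged, so the bound by a sum of squares may
  be optimised over s. If one of the seminorms vanishes, extreme values of s force
  \<open>D f g = 0\<close>.\<close>

lemma bilinear_bound_from_quadratic:
 assumes D: "!!f g s. f \<in> V ==> g \<in> V ==> D (%x. s * f x) g = s * D f g"
  "!!f g s. f \<in> V ==> g \<in> V ==> D f (%x. s * g x) = s * D f g"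
  and q: "!!f g. f \<in> V ==> g \<in> V ==> \<bar>D f g\<bar> <= c * (ip f f + ip g g)"
  and f: "f \<in> V" and g: "g \<in> V"
 shows "\<bar>D f g\<bar> <= 2 * c * (nm f * nm g)"
proof -
 have V: "(%x. s * h x) \<in> V" if "h \<in> V" for s h using V_lin[OF that that, of s 0] by simp
 have ips: "ip (%x. s * h x) (%x. s * h x) = s\<^sup>2 * ip h h" if h: "h \<in> V" for s h
  using ip_lin[OF h h V[OF h], of s 0 s] ip_lin2[OF h h h, of s 0] by (simp add: power2_eq_square)
 have sc: "\<bar>D f g\<bar> <= c * (s\<^sup>2 * ip f f + ip g g / s\<^sup>2)" if "s > 0" for s
 proof -
  have "D f g = D (%x. s * f x) (%x. inverse s * g x)"
   using D(1)[OF f V[OF g]] D(2)[OF f g] that by simp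
  also have "\<bar>\<dots>\<bar> <= c * (s\<^sup>2 * ip f f + (inverse s)^2 * ip g g)"
   using q[OF V[OF f] V[OF g]] by (simp only: ips f g)
  finally show ?thesis using that by (simp add: power_inverse field_simps)
 qed
 show ?thesis
 proof (cases "ip f f = 0 \<or> ip g g = 0")
  case False
  then have pos: "ip f f > 0" "ip g g > 0" using ip_nonneg[OF f] ip_nonneg[OF g] by linarith+
  \<comment> \<open>This choice balances the two summands and turns their sum into twice the product
    of the norms.\<close>
  define s where "s = sqrt (nm g / nm f)"
  have n: "nm f > 0" "nm g > 0" using pos by (auto simp: nm_def)
  have s: "s > 0" "s\<^sup>2 = nm g / nm f" using n by (auto simp: s_def)
  have "s\<^sup>2 * ip f f + ip g g / s\<^sup>2 = 2 * (nm f * nm g)"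
   unfolding s(2) nm_sq[OF f, symmetric] nm_sq[OF g, symmetric] using n by (simp add: power2_eq_square)
  then show ?thesis using sc[OF s(1)] by simp
 next
  case True
  have "D f g = 0"
  proof (rule ccontr)
   assume ne: "D f g ~= 0"
   define M where "M = ip f f + ip g g"
   have bnd: "\<bar>D f g\<bar> * t <= c * M" if "t > 0" for t
    using True
   proof
    assume 0: "ip f f = 0"
    have "\<bar>D f g\<bar> <= c * (ip g g / t)" using sc[of "sqrt t"] 0 that by simp
    then show ?thesis using 0 that by (simp add: M_def field_simps)
   next
    assume 0: "ip g g = 0"
    have "\<bar>D f g\<bar> <= c * (inverse t * ip f f)" using sc[of "sqrt (inverse t)"] 0 that by simp
    then show ?thesis using 0 that by (simp add: M_def field_simps)
   qed
   have "\<bar>D f g\<bar> * ((\<bar>c * M\<bar> + 1) / \<bar>D f g\<bar>) <= c * M" by (rule bnd) (use ne in auto)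
   then show False using ne by simp
  qed
  moreover have "nm f * nm g = 0" using True by (auto simp: nm_def)
  ultimately show ?thesis by (simp only: abs_zero mult_zero_right)
 qed
qed

end

lemma bform_lin:
 assumes "f \<in> test \<Omega>" "g \<in> test \<Omega>" "h \<in> test \<Omega>"
 shows "bform (%x. a * f x + b * g x) h = a * bform f h + b * bform g h"
 unfolding bform_def using bform_integrable[OF assms(1,3)] bform_integrable[OF assms(2,3)]
 by (simp add: jet_lin[OF test_smooth[OF assms(1)] test_smooth[OF assms(2)]] jform_lin)

lemma bform_commute: "bform f g = bform g f"
 by (simp add: bform_def jform_commute)

text \<open>The value 26/100, twice the 13/100 of the quadratic version, is the contraction number
  fed into the Neumann iteration.\<close>

lemma perturbation:
 assumes f: "f \<in> test \<Omega>" and g: "g \<in> test \<Omega>"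
 shows "\<bar>bform f (%p. wt k (fst p) * g p) - ipw k f g\<bar> <= 26 / 100 * (sqrt (ipw k f f) * sqrt (ipw k g g))"
proof -
 interpret pre_hilbert "test \<Omega>" "ipw k" by (rule pre_hilbert_ipw)
 define D where "D f g = bform f (%p. wt k (fst p) * g p) - ipw k f g" for f g
 have D1: "D (%x. s * f x) g = s * D f g" if "f \<in> test \<Omega>" "g \<in> test \<Omega>" for f g s
  using bform_lin[OF that(1,1) test_wt[OF that(2)], of s 0 k] ip_lin[OF that(1,1,2), of s 0]
  by (simp add: D_def algebra_simps)
 have D2: "D f (%x. s * g x) = s * D f g" if "f \<in> test \<Omega>" "g \<in> test \<Omega>" for f g s
 proof -
  have "bform (%p. s * (wt k (fst p) * g p) + 0 * g p) f = s * bform (%p. wt k (fst p) * g p) f + 0 * bform g f"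
   by (rule bform_lin[OF test_wt[OF that(2)] that(2) that(1)])
  then have "bform f (%p. wt k (fst p) * (s * g p)) = s * bform f (%p. wt k (fst p) * g p)"
   by (simp add: bform_commute[of f] mult.left_commute)
  then show ?thesis using ip_lin2[OF that(2,2,1), of s 0] by (simp add: D_def right_diff_distrib)
 qed
 have D3: "\<bar>D f g\<bar> <= 13/100 * (ipw k f f + ipw k g g)" if "f \<in> test \<Omega>" "g \<in> test \<Omega>" for f g
  unfolding D_def by (rule perturbation_quadratic[OF that])
 have "\<bar>D f g\<bar> <= 2 * (13/100) * (nm f * nm g)"
  by (rule bilinear_bound_from_quadratic[OF D1 D2 D3 f g])
 then show ?thesis by (simp add: D_def nm_def)
qed

text \<open>By \<open>perturbation\<close> the form dominates 74/100 of \<open>ipw k f f\<close>,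
  and \<open>energy_le\<close> gives 3 / (74/100) < 5.\<close>

lemma coercive:
 assumes f: "f \<in> test \<Omega>"
 shows "energy k f <= 5 * bform f (%p. wt k (fst p) * f p)"
proof -
 have nn: "0 <= ipw k f f" unfolding ipw_def
  by (rule Bochner_Integration.integral_nonneg) (simp add: wt_pos less_imp_le jform_sq)
 have "\<bar>bform f (%p. wt k (fst p) * f p) - ipw k f f\<bar> <= 26 / 100 * ipw k f f"
  using perturbation[OF f f, of k] nn by simp
 then show ?thesis using energy_le[OF f, of k] nn by linarith
qed

section \<open>Existence\<close>

lemma test_lom_integral:
 fixes f :: "point => real"
 assumes "!!p. p \<notin> \<Omega> ==> f p = 0"
 shows "(LINT p|lom. f p) = (LBINT p. f p)"
proof -
 have "(%p. indicator \<Omega> p * f p) = f" using assms by (auto simp: indicator_def fun_eq_iff)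
 then show ?thesis by (simp only: lom_integral)
qed

lemma test_outside: "f \<in> test S ==> p \<notin> S ==> f p = 0"
 using test_support[of f S] by blast

lemma pd_shift:
 assumes "smooth (r :: real => real)"
 shows "pd 1 (%x. r (x - k)) = (%x. pd 1 r (x - k))"
proof
 fix x
 have "((%x. r (x - k)) has_field_derivative pd 1 r (x - k) * 1) (at x)"
  by (rule DERIV_chain2[OF smooth_has_field_derivative[OF assms]]) (auto intro!: derivative_eq_intros)
 then show "pd 1 (%x. r (x - k)) x = pd 1 r (x - k)" by (intro pd_real_eqI) simp
qed

lemma smooth_shift: "smooth (r :: real => real) ==> smooth (%x. r (x - k))"
 using smooth_shift_real[of r 1 "- k"] by simp

text \<open>Comparison with a telescoping series: the pair of indices m and -m adds at most 400/m -
  400/(m + 1), which explains the stronger induction statement. The value 803 is far from sharp;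
  what matters is that it depends neither on \<open>c\<close> nor on \<open>J\<close>.\<close>

lemma wt_sum_le:
 assumes "finite (J :: int set)"
 shows "(\<Sum>j\<in>J. wt (of_int c) (of_int j)) <= 803"
proof -
 have sym: "(\<Sum>j\<in>{- int n..int n}. wt 0 (of_int j)) <= 803 - 400 / (real n + 1)" for n
 proof (induction n)
  case (Suc n)
  have eq: "{- int (Suc n)..int (Suc n)} = insert (- int (Suc n)) (insert (int (Suc n)) {- int n..int n})" by auto
  have "(\<Sum>j\<in>{- int (Suc n)..int (Suc n)}. wt 0 (of_int j))
    = wt 0 (of_int (- int (Suc n))) + (wt 0 (of_int (int (Suc n))) + (\<Sum>j\<in>{- int n..int n}. wt 0 (of_int j)))"
   unfolding eq by (subst sum.insert, simp, simp, subst sum.insert) auto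
  also have "wt 0 (of_int (- int (Suc n))) = wt 0 (of_int (int (Suc n)))" by (simp add: wt_def power2_eq_square algebra_simps)
  also have "wt 0 (of_int (int (Suc n))) <= 200 / (real n + 1) - 200 / (real n + 2)"
  proof -
   define m where "m = real n + 1"
   have m: "m >= 1" by (simp add: m_def)
   define q where "q = m * m"
   have "100 * (m * (m + 1)) = 100 * q + 100 * m" "200 * (100 + m * m) = 20000 + 200 * q"
    by (simp_all add: q_def algebra_simps)
   moreover have "m <= q" using m mult_left_mono[of 1 m m] by (simp add: q_def)
   ultimately have "100 * (m * (m + 1)) <= 200 * (100 + m * m)" using m by linarith
   then have "100 / (100 + m * m) <= 200 / (m * (m + 1))"
   proof -
    have "0 < 100 + m * m" "0 < m * (m + 1)" using m by (auto intro: add_pos_nonneg)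
    with \<open>100 * (m * (m + 1)) <= 200 * (100 + m * m)\<close> show ?thesis by (simp add: divide_simps)
   qed
   also have "\<dots> = 200 / m - 200 / (m + 1)" using m by (simp add: field_simps)
   finally have "100 / (100 + m * m) <= 200 / m - 200 / (m + 1)" .
   moreover have "wt 0 (of_int (int (Suc n))) = 100 / (100 + m * m)"
    by (simp add: wt_def m_def power2_eq_square field_simps)
   ultimately show ?thesis by (simp add: m_def add.assoc)
  qed
  finally show ?case using Suc by (simp add: algebra_simps)
 qed (simp add: wt_def)
 let ?J = "(%j. j - c) ` J"
 obtain n where n: "?J \<subseteq> {- int n..int n}"
 proof -
  have "finite ((%j. nat \<bar>j\<bar>) ` ?J)" using assms by simp
  then obtain n where "!!j. j \<in> ?J ==> nat \<bar>j\<bar> <= n" using finite_nat_set_iff_bounded_le by fastforce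
  then have "?J \<subseteq> {- int n..int n}" by (fastforce simp: abs_le_iff)
  then show thesis by (rule that)
 qed
 have "(\<Sum>j\<in>J. wt (of_int c) (of_int j)) = (\<Sum>j\<in>?J. wt 0 (of_int j))"
  by (subst sum.reindex) (auto simp: inj_on_def wt_def)
 also have "\<dots> <= (\<Sum>j\<in>{- int n..int n}. wt 0 (of_int j))"
  by (rule sum_mono2[OF _ n]) (auto simp: wt_pos less_imp_le)
 also have "\<dots> <= 803"
 proof -
  have "0 <= 400 / (real n + 1)" by simp
  then show ?thesis using sym[of n] by linarith
 qed
 finally show ?thesis .
qed

text \<open>The distance 5 is the half-width of the support of the wide cutoff \<open>zeta\<close>.
  On one such support the weight can therefore be frozen at the centre at the price of a factor
  2.\<close>

lemma wt_near:
 assumes "\<bar>x - k\<bar> <= 5"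
 shows "wt c x <= 2 * wt c k"
proof -
 have "(x - k)^2 <= 5\<^sup>2" using power_mono[OF assms, of 2] by simp
 moreover have "(k - c)^2 <= 2 * (x - c)^2 + 2 * (x - k)^2"
 proof -
  have "0 <= ((x - c) + (x - k))^2" by simp
  then show ?thesis by (simp add: power2_eq_square algebra_simps)
 qed
 ultimately have "1 + (k - c)^2 / 100 <= 2 * (1 + (x - c)^2 / 100)" by simp
 then show ?thesis using wt_denom[of x c] wt_denom[of k c] by (simp add: wt_def field_simps)
qed

lemma strip_borel: "{p::point. \<bar>fst p - k\<bar> <= r} \<in> sets borel"
 by (intro borel_closed closed_Collect_le continuous_intros)

lemma card_near: "finite J ==> (\<Sum>k\<in>J. indicator {x. \<bar>x - of_int k\<bar> <= 5} x) <= (11 :: real)" for J :: "int set" and x :: real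
proof -
 assume J: "finite J"
 have "(\<Sum>k\<in>J. indicator {x. \<bar>x - of_int k\<bar> <= 5} x) = real (card {k \<in> J. \<bar>x - of_int k\<bar> <= 5})"
  using J by (simp add: indicator_def sum.If_cases Int_def)
 also have "card {k \<in> J. \<bar>x - of_int k\<bar> <= 5} <= card {\<lceil>x\<rceil> - 5..\<lfloor>x\<rfloor> + 5}"
  by (rule card_mono) (auto simp: abs_le_iff ceiling_le_iff le_floor_iff, linarith+)
 also have "\<dots> <= 11" using floor_le_ceiling[of x] by (simp add: nat_le_iff)
 finally show ?thesis by simp
qed

section \<open>Uniformly local data acting on weighted test functions\<close>

context cutoff_fun
begin

lemma chi_test: "chi \<in> test UNIV"
 by (rule test_functionsI[of _ "{-1..2}"]) (auto simp: chi_smooth intro: chi_0)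

text \<open>A cutoff that is 1 on the support of \<open>chi\<close>. Inserting it after
  \<open>chi\<close> changes nothing, but confines the test function whose H1 norm the negative norm
  sees.\<close>

definition zeta :: "real => real" where
 "zeta x = (\<Sum>i\<in>{-3..3::int}. chi (x - of_int i)) / 2"

lemma zeta_smooth: "smooth zeta"
proof -
 have "smooth (%x. \<Sum>i\<in>{-3..3::int}. chi (x - of_int i))"
  by (intro smooth_sum smooth_shift chi_smooth) simp
 from smooth_mult[OF smooth_const[of "1/2"] this] show ?thesis by (simp add: zeta_def[abs_def])
qed

lemma zeta_1: "\<bar>x\<bar> <= 2 ==> zeta x = 1"
 using chi_sum_eq'[of "-3" x 3] by (simp add: zeta_def abs_le_iff)

lemma zeta_0:
 assumes "5 <= \<bar>x\<bar>"
 shows "zeta x = 0"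
proof -
 have "chi (x - of_int i) = 0" if i: "i \<in> {-3..3}" for i :: int
 proof (rule chi_0)
  have "- 3 <= (of_int i :: real)" "of_int i <= (3 :: real)" using i by auto
  then show "x - of_int i <= - 1 \<or> 2 <= x - of_int i" using assms by linarith
 qed
 then show ?thesis by (simp add: zeta_def)
qed

lemma zeta_test: "zeta \<in> test UNIV"
 by (rule test_functionsI[of _ "{-5..5}"]) (auto simp: zeta_smooth intro!: zeta_0)

lemma pd_zeta_0: "5 < \<bar>x\<bar> ==> pd 1 zeta x = 0"
 by (rule pd_zero_outside[of "{-5..5}"]) (auto intro!: zeta_0)

lemma bounds_ex:
 "\<exists>L\<ge>1. \<forall>x. \<bar>chi x\<bar> <= L & \<bar>pd 1 chi x\<bar> <= L & \<bar>pd 1 (pd 1 chi) x\<bar> <= L &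
  \<bar>zeta x\<bar> <= L & \<bar>pd 1 zeta x\<bar> <= L & \<bar>pd 1 (pd 1 zeta) x\<bar> <= L"
proof -
 have t: "pd 1 ph \<in> test UNIV" if "ph \<in> test UNIV" for ph :: "real => real"
  by (rule test_pd[OF that]) simp
 obtain a1 where p1: "a1 > 0" and 1: "!!x. \<bar>chi x\<bar> <= a1" by (rule test_bounded[OF chi_test]) blast
 obtain a2 where p2: "a2 > 0" and 2: "!!x. \<bar>pd 1 chi x\<bar> <= a2" by (rule test_bounded[OF t[OF chi_test]]) blast
 obtain a3 where p3: "a3 > 0" and 3: "!!x. \<bar>pd 1 (pd 1 chi) x\<bar> <= a3" by (rule test_bounded[OF t[OF t[OF chi_test]]]) blast
 obtain a4 where p4: "a4 > 0" and 4: "!!x. \<bar>zeta x\<bar> <= a4" by (rule test_bounded[OF zeta_test]) blast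
 obtain a5 where p5: "a5 > 0" and 5: "!!x. \<bar>pd 1 zeta x\<bar> <= a5" by (rule test_bounded[OF t[OF zeta_test]]) blast
 obtain a6 where p6: "a6 > 0" and 6: "!!x. \<bar>pd 1 (pd 1 zeta) x\<bar> <= a6" by (rule test_bounded[OF t[OF t[OF zeta_test]]]) blast
 define L where "L = 1 + a1 + a2 + a3 + a4 + a5 + a6"
 note pos = p1 p2 p3 p4 p5 p6
 have "L >= 1" using pos by (simp add: L_def)
 moreover have "\<bar>chi x\<bar> <= L" for x by (rule order_trans[OF 1[of x]]) (use pos in \<open>simp add: L_def\<close>)
 moreover have "\<bar>pd 1 chi x\<bar> <= L" for x by (rule order_trans[OF 2[of x]]) (use pos in \<open>simp add: L_def\<close>)
 moreover have "\<bar>pd 1 (pd 1 chi) x\<bar> <= L" for x by (rule order_trans[OF 3[of x]]) (use pos in \<open>simp add: L_def\<close>)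
 moreover have "\<bar>zeta x\<bar> <= L" for x by (rule order_trans[OF 4[of x]]) (use pos in \<open>simp add: L_def\<close>)
 moreover have "\<bar>pd 1 zeta x\<bar> <= L" for x by (rule order_trans[OF 5[of x]]) (use pos in \<open>simp add: L_def\<close>)
 moreover have "\<bar>pd 1 (pd 1 zeta) x\<bar> <= L" for x by (rule order_trans[OF 6[of x]]) (use pos in \<open>simp add: L_def\<close>)
 ultimately show ?thesis by blast
qed

text \<open>Chosen once from \<open>chi\<close> alone, so that constants built from \<open>L\<close>
  are independent of the data.\<close>

definition L :: real where
 "L = (SOME L. L >= 1 & (\<forall>x. \<bar>chi x\<bar> <= L & \<bar>pd 1 chi x\<bar> <= L & \<bar>pd 1 (pd 1 chi) x\<bar> <= L &
  \<bar>zeta x\<bar> <= L & \<bar>pd 1 zeta x\<bar> <= L & \<bar>pd 1 (pd 1 zeta) x\<bar> <= L))"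

lemma L_ge: "L >= 1"
 and L_bounds: "\<bar>chi x\<bar> <= L" "\<bar>pd 1 chi x\<bar> <= L" "\<bar>pd 1 (pd 1 chi) x\<bar> <= L" "\<bar>zeta x\<bar> <= L"
  "\<bar>pd 1 zeta x\<bar> <= L" "\<bar>pd 1 (pd 1 zeta) x\<bar> <= L"
 using someI_ex[OF bounds_ex] unfolding L_def[symmetric] by auto

lemma n1_test_sq:
 assumes g: "g \<in> test \<Omega>"
 shows "(n1 g (dx g) (dz g))^2 = (LBINT p. (g p)^2 + (dx g p)^2 + (dz g p)^2)"
proof -
 have i: "integrable lborel (%p. (h p)^2)" if "h \<in> test \<Omega>" for h
  using test_sqi[OF that] by (rule sqi_integrable)
 have "(LINT p|lom. (h p)^2) = (LBINT p. (h p)^2)" if "h \<in> test \<Omega>" for h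
  by (rule test_lom_integral) (simp add: test_outside[OF that])
 then show ?thesis using g test_dx[OF g] test_dz[OF g] i by (simp add: n1_sq)
qed

text \<open>Here \<open>g\<close> stands for a first derivative of the weighted test function. The
  constant is 54 = 3 * 9 * 2: product rule with \<open>zeta\<close>, product rule with the weight,
  and freezing of the weight at \<open>k\<close>. Only one of the two powers of the weight is
  frozen; the other stays under the integral and forms the energy.\<close>

lemma n1_zeta_sq:
 assumes g: "g \<in> test \<Omega>" and gJ: "!!p. (g p)^2 + (dx g p)^2 + (dz g p)^2 <= jsq (jet (%p. wt c (fst p) * \<eta> p) p)"
  and \<eta>: "\<eta> \<in> test \<Omega>"
 shows "(n1 (%p. zeta (fst p - k) * g p) (dx (%p. zeta (fst p - k) * g p)) (dz (%p. zeta (fst p - k) * g p)))^2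
  <= 54 * L\<^sup>2 * wt c k * (LBINT p. indicator {x. \<bar>x - k\<bar> <= 5} (fst p) * (wt c (fst p) * jsq (jet \<eta> p)))"
proof -
 let ?z = "%x. zeta (x - k)" and ?I = "%p::point. indicator {x. \<bar>x - k\<bar> <= 5} (fst p) :: real"
 let ?h = "%p. zeta (fst p - k) * g p"
 have sz: "smooth ?z" by (rule smooth_shift[OF zeta_smooth])
 have sg: "smooth g" by (rule test_smooth[OF g])
 have h: "?h \<in> test \<Omega>" by (rule test_smooth_mult[OF smooth_fst[OF sz] g])
 have dh: "dx ?h = (%p. pd 1 zeta (fst p - k) * g p + zeta (fst p - k) * dx g p)"
  "dz ?h = (%p. zeta (fst p - k) * dz g p)"
  using smooth_fst[OF sz] sg
  by (auto simp: pd_smooth_mult pd_fst[OF sz] pd_shift[OF zeta_smooth])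
 have L0: "0 <= L\<^sup>2" by simp
 have m: "(t * y)^2 <= L\<^sup>2 * y\<^sup>2" if "\<bar>t\<bar> <= L" for t y
  using that L_ge by (simp add: power_mult_distrib abs_le_square_iff[symmetric] mult_right_mono)
 have pt: "(?h p)^2 + (dx ?h p)^2 + (dz ?h p)^2 <= 54 * L\<^sup>2 * wt c k * (?I p * (wt c (fst p) * jsq (jet \<eta> p)))" for p
 proof (cases "\<bar>fst p - k\<bar> <= 5")
  case True
  have two: "(x + y)^2 <= 2 * x\<^sup>2 + 2 * y\<^sup>2" for x y :: real
   using sum_squares_bound[of x y] by (simp add: power2_eq_square algebra_simps)
  have "(?h p)^2 + (dx ?h p)^2 + (dz ?h p)^2
    <= L\<^sup>2 * (g p)^2 + (2 * (L\<^sup>2 * (g p)^2) + 2 * (L\<^sup>2 * (dx g p)^2)) + L\<^sup>2 * (dz g p)^2"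
   unfolding dh using m[OF L_bounds(4)[of "fst p - k"], of "g p"] m[OF L_bounds(5)[of "fst p - k"], of "g p"]
    m[OF L_bounds(4)[of "fst p - k"], of "dx g p"] m[OF L_bounds(4)[of "fst p - k"], of "dz g p"]
    two[of "pd 1 zeta (fst p - k) * g p" "zeta (fst p - k) * dx g p"] by linarith
  also have "\<dots> <= 3 * L\<^sup>2 * ((g p)^2 + (dx g p)^2 + (dz g p)^2)" by (simp add: algebra_simps)
  also have "\<dots> <= 3 * L\<^sup>2 * jsq (jet (%p. wt c (fst p) * \<eta> p) p)" by (rule mult_left_mono[OF gJ]) simp
  also have "\<dots> <= 3 * L\<^sup>2 * (9 * (wt c (fst p))^2 * jsq (jet \<eta> p))"
  proof (rule mult_left_mono)
   have w: "0 < wt c (fst p)" by (rule wt_pos)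
   show "jsq (jet (%p. wt c (fst p) * \<eta> p) p) <= 9 * (wt c (fst p))^2 * jsq (jet \<eta> p)"
    unfolding jet_mult[OF wt_smooth test_smooth[OF \<eta>]]
    by (rule jsq_mult_le) (use w wt_deriv_bound[of c "fst p"] wt_deriv2_bound[of c "fst p"] in linarith)+
  qed simp
  also have "\<dots> = 27 * L\<^sup>2 * (wt c (fst p) * (wt c (fst p) * jsq (jet \<eta> p)))" by (simp add: power2_eq_square)
  also have "\<dots> <= 27 * L\<^sup>2 * ((2 * wt c k) * (wt c (fst p) * jsq (jet \<eta> p)))"
   by (intro mult_left_mono mult_right_mono wt_near[OF True]) (simp_all add: wt_pos less_imp_le jsq_nonneg)
  finally show ?thesis using True by (simp add: mult.assoc)
 next
  case False
  then have "zeta (fst p - k) = 0" "pd 1 zeta (fst p - k) = 0" by (auto intro: zeta_0 pd_zeta_0)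
  then show ?thesis unfolding dh using False by simp
 qed
 have i2: "integrable lborel (%p. ?I p * (wt c (fst p) * jsq (jet \<eta> p)))"
 proof -
  have "integrable lborel (%p. indicator {p::point. \<bar>fst p - k\<bar> <= 5} p *\<^sub>R (wt c (fst p) * jsq (jet \<eta> p)))"
   by (rule integrable_mult_indicator[OF _ energy_integrable[OF \<eta>]]) (simp add: strip_borel)
  then show ?thesis by (simp add: indicator_def)
 qed
 have "(n1 ?h (dx ?h) (dz ?h))^2 <= (LBINT p. 54 * L\<^sup>2 * wt c k * (?I p * (wt c (fst p) * jsq (jet \<eta> p))))"
  unfolding n1_test_sq[OF h]
 proof (rule integral_mono)
  show "integrable lborel (%p. (?h p)^2 + (dx ?h p)^2 + (dz ?h p)^2)"
   by (intro Bochner_Integration.integrable_add sqi_integrable test_sqi[of _ \<Omega>] h test_dx test_dz)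
  show "integrable lborel (%p. 54 * L\<^sup>2 * wt c k * (?I p * (wt c (fst p) * jsq (jet \<eta> p))))"
   using i2 by (rule integrable_mult_right)
 qed (rule pt)
 then show ?thesis by simp
qed

definition C0 :: real where "C0 = sqrt (54 * L\<^sup>2) * sqrt 803 * sqrt 11"

lemma C0_pos: "C0 > 0"
 using L_ge by (simp add: C0_def)

text \<open>Uniformly local bounds control the action on weighted test functions: the cutoffs split
  \<open>g\<close> into cells, the negative norm bounds each cell by \<open>M\<close>, and the
  weights make the sum over cells converge. The bound does not depend on the centre
  \<open>c\<close>.\<close>

lemma local_bound:
 assumes T: "linear_functional_on (test \<Omega>) T"
  and Tk: "!!k. cut_dist chi k T \<in> H_minus1" "!!k. H_minus1_norm (cut_dist chi k T) <= M"
  and g: "g \<in> test \<Omega>"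
  and gJ: "!!p. (g p)^2 + (dx g p)^2 + (dz g p)^2 <= jsq (jet (%p. wt (of_int c) (fst p) * \<eta> p) p)"
  and \<eta>: "\<eta> \<in> test \<Omega>"
 shows "\<bar>T g\<bar> <= C0 * M * sqrt (energy (of_int c) \<eta>)"
proof -
 have M: "0 <= M" using H_minus1_bound(2)[OF Tk(1)] Tk(2) order_trans by blast
 have T_lin: "T (%x. a * f x + b * h x) = a * T f + b * T h" if "f \<in> test \<Omega>" "h \<in> test \<Omega>" for a b f h
  using T that unfolding linear_functional_on_def by blast
 have T0: "T (%x. 0) = 0" using T_lin[OF test_zero test_zero, of 0 0] by simp
 have T_sum: "T (%x. \<Sum>i\<in>I. f i x) = (\<Sum>i\<in>I. T (f i))" if "finite I" "!!i. f i \<in> test \<Omega>" for I :: "int set" and f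
  using that(1)
 proof (induction I rule: finite_induct)
  case (insert i I)
  then show ?case using T_lin[OF that(2)[of i] test_sum[OF insert(1), of f], of 1 1] that(2) by simp
 qed (simp add: T0)
 have ct: "cut_fun chi k h \<in> test \<Omega>" if "h \<in> test \<Omega>" for k h
  unfolding cut_fun_def by (rule test_smooth_mult[OF smooth_fst[OF smooth_shift[OF chi_smooth]] that])
 obtain R where R: "!!p. \<bar>fst p\<bar> > R \<or> \<bar>snd p\<bar> > R ==> g p = 0" by (rule test_box_support[OF g]) blast
 \<comment> \<open>One cell beyond the support on either side, so that the finite sum of cutoffs
   already equals 2 wherever \<open>g\<close> is nonzero.\<close>
 define n where "n = \<lceil>R\<rceil> + 1"
 let ?J = "{- n..n}"
 have sum2: "(\<Sum>k\<in>?J. cut_fun chi k g p) = 2 * g p" for p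
 proof (cases "g p = 0")
  case False
  then have "\<bar>fst p\<bar> <= R" using R[of p] by force
  then have "(\<Sum>k\<in>?J. chi (fst p - of_int k)) = 2" unfolding n_def by (intro chi_sum_eq') (auto simp: abs_le_iff, linarith+)
  then show ?thesis by (simp add: cut_fun_def sum_distrib_right[symmetric])
 qed (simp add: cut_fun_def)
 let ?E = "%k::int. \<integral>p. indicator {x. \<bar>x - of_int k\<bar> <= 5} (fst p) * (wt (of_int c) (fst p) * jsq (jet \<eta> p)) \<partial>lborel"
 have E0: "0 <= ?E k" for k by (rule Bochner_Integration.integral_nonneg) (simp add: wt_pos less_imp_le jsq_nonneg)
 have Tcut: "\<bar>T (cut_fun chi k g)\<bar> <= M * (sqrt (54 * L\<^sup>2) * (sqrt (wt (of_int c) (of_int k)) * sqrt (?E k)))" for k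
 proof -
  let ?h = "%p. zeta (fst p - of_int k) * g p"
  have h: "?h \<in> test \<Omega>" by (rule test_smooth_mult[OF smooth_fst[OF smooth_shift[OF zeta_smooth]] g])
  \<comment> \<open>The wide cutoff is 1 wherever the narrow one is nonzero, so it may be inserted
    before the negative norm is applied.\<close>
  have "cut_fun chi k ?h = cut_fun chi k g"
  proof
   fix p :: point
   have "chi (fst p - of_int k) = 0 \<or> zeta (fst p - of_int k) = 1"
    using chi_0[of "fst p - of_int k"] zeta_1[of "fst p - of_int k"] by linarith
   then show "cut_fun chi k ?h p = cut_fun chi k g p" by (auto simp: cut_fun_def)
  qed
  then have "\<bar>T (cut_fun chi k g)\<bar> = \<bar>cut_dist chi k T ?h\<bar>" by (simp add: cut_dist_def)
  also have "\<dots> <= H_minus1_norm (cut_dist chi k T) * n1 ?h (dx ?h) (dz ?h)" by (rule H_minus1_bound(1)[OF Tk(1) h])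
  also have "\<dots> <= M * n1 ?h (dx ?h) (dz ?h)" by (rule mult_right_mono[OF Tk(2) n1_nonneg])
  also have "n1 ?h (dx ?h) (dz ?h) <= sqrt (54 * L\<^sup>2 * wt (of_int c) (of_int k) * ?E k)"
   by (rule real_le_rsqrt[OF n1_zeta_sq[OF g gJ \<eta>]])
  also have "\<dots> = sqrt (54 * L\<^sup>2) * (sqrt (wt (of_int c) (of_int k)) * sqrt (?E k))" by (simp add: real_sqrt_mult mult.assoc)
  finally show ?thesis using M by (simp add: mult_left_mono)
 qed
 have "2 * T g = T (%p. \<Sum>k\<in>?J. cut_fun chi k g p)"
  unfolding sum2 using T_lin[OF g g, of 2 0] by simp
 also have "\<dots> = (\<Sum>k\<in>?J. T (cut_fun chi k g))" by (rule T_sum) (auto intro: ct g)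
 also have "\<bar>\<dots>\<bar> <= (\<Sum>k\<in>?J. M * (sqrt (54 * L\<^sup>2) * (sqrt (wt (of_int c) (of_int k)) * sqrt (?E k))))"
  by (rule order_trans[OF sum_abs sum_mono[OF Tcut]])
 also have "\<dots> = M * sqrt (54 * L\<^sup>2) * (\<Sum>k\<in>?J. sqrt (wt (of_int c) (of_int k)) * sqrt (?E k))"
  by (simp add: sum_distrib_left mult.assoc)
 also have "(\<Sum>k\<in>?J. sqrt (wt (of_int c) (of_int k)) * sqrt (?E k)) <= sqrt 803 * sqrt (11 * energy (of_int c) \<eta>)"
 proof -
  have "(\<Sum>k\<in>?J. sqrt (wt (of_int c) (of_int k)) * sqrt (?E k))^2
    <= (\<Sum>k\<in>?J. (sqrt (wt (of_int c) (of_int k)))^2) * (\<Sum>k\<in>?J. (sqrt (?E k))^2)"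
   by (rule Cauchy_Schwarz_ineq_sum)
  also have "\<dots> = (\<Sum>k\<in>?J. wt (of_int c) (of_int k)) * (\<Sum>k\<in>?J. ?E k)"
   using E0 wt_pos by (simp add: less_imp_le)
  also have "\<dots> <= 803 * (11 * energy (of_int c) \<eta>)"
  proof (rule mult_mono)
   have i: "integrable lborel (%p. indicator {x. \<bar>x - of_int k\<bar> <= 5} (fst p) * (wt (of_int c) (fst p) * jsq (jet \<eta> p)))" for k :: int
   proof -
    have "integrable lborel (%p. indicator {p::point. \<bar>fst p - of_int k\<bar> <= 5} p *\<^sub>R (wt (of_int c) (fst p) * jsq (jet \<eta> p)))"
     by (rule integrable_mult_indicator[OF _ energy_integrable[OF \<eta>]]) (simp add: strip_borel)
    then show ?thesis by (simp add: indicator_def)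
   qed
   have "(\<Sum>k\<in>?J. ?E k) = (LBINT p. (\<Sum>k\<in>?J. indicator {x. \<bar>x - of_int k\<bar> <= 5} (fst p) * (wt (of_int c) (fst p) * jsq (jet \<eta> p))))"
    by (rule Bochner_Integration.integral_sum[symmetric]) (rule i)
   also have "\<dots> <= (LBINT p. 11 * (wt (of_int c) (fst p) * jsq (jet \<eta> p)))"
   proof (rule integral_mono)
    show "(\<Sum>k\<in>?J. indicator {x. \<bar>x - of_int k\<bar> <= 5} (fst p) * (wt (of_int c) (fst p) * jsq (jet \<eta> p)))
      <= 11 * (wt (of_int c) (fst p) * jsq (jet \<eta> p))" for p
     unfolding sum_distrib_right[symmetric] using wt_pos jsq_nonneg
     by (intro mult_right_mono card_near) (auto simp: less_imp_le)
   qed (intro Bochner_Integration.integrable_sum integrable_mult_right i energy_integrable[OF \<eta>])+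
   also have "\<dots> = 11 * energy (of_int c) \<eta>" by (simp add: energy_def)
   finally show "(\<Sum>k\<in>?J. ?E k) <= 11 * energy (of_int c) \<eta>" .
  qed (auto intro: wt_sum_le sum_nonneg E0)
  finally have "(\<Sum>k\<in>?J. sqrt (wt (of_int c) (of_int k)) * sqrt (?E k)) <= sqrt (803 * (11 * energy (of_int c) \<eta>))"
   by (rule real_le_rsqrt)
  then show ?thesis by (simp only: real_sqrt_mult)
 qed
 finally have "\<bar>2 * T g\<bar> <= M * sqrt (54 * L\<^sup>2) * (sqrt 803 * sqrt (11 * energy (of_int c) \<eta>))"
  using M by (simp add: mult_left_mono)
 also have "\<dots> = C0 * M * sqrt (energy (of_int c) \<eta>)" by (simp add: C0_def real_sqrt_mult)
 finally have "2 * \<bar>T g\<bar> <= C0 * M * sqrt (energy (of_int c) \<eta>)" by (simp add: abs_mult)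
 then show ?thesis by linarith
qed

text \<open>The pairing of \<open>f\<close> with the divergence-free field
  \<open>(dz \<eta>, - dx \<eta>)\<close>, from which a pressure gradient drops out.\<close>

definition curlf :: "point functional \<times> point functional => point functional" where
 "curlf f \<eta> = fst f (dz \<eta>) - snd f (dx \<eta>)"

lemma H_minus1_uloc_components:
 assumes f: "f \<in> H_minus1_uloc chi"
 shows "H_minus1_norm (cut_dist chi k (fst f)) <= H_minus1_uloc_norm chi f"
  "H_minus1_norm (cut_dist chi k (snd f)) <= H_minus1_uloc_norm chi f"
proof -
 have b: "bdd_above (range (%k. H_minus1_vec_norm_cut chi k f))" using f by (simp add: H_minus1_uloc_def)
 have le: "H_minus1_vec_norm_cut chi k f <= H_minus1_uloc_norm chi f"
  unfolding H_minus1_uloc_norm_def by (rule cSUP_upper[OF _ b]) simp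
 have "H_minus1_norm (cut_dist chi k (fst f)) <= H_minus1_vec_norm_cut chi k f"
  "H_minus1_norm (cut_dist chi k (snd f)) <= H_minus1_vec_norm_cut chi k f"
  unfolding H_minus1_vec_norm_cut_def by (rule real_le_rsqrt, simp)+
 with le show "H_minus1_norm (cut_dist chi k (fst f)) <= H_minus1_uloc_norm chi f"
  "H_minus1_norm (cut_dist chi k (snd f)) <= H_minus1_uloc_norm chi f" by linarith+
qed

lemma curlf_bound:
 assumes f: "f \<in> H_minus1_uloc chi" and \<eta>: "\<eta> \<in> test \<Omega>"
 shows "\<bar>curlf f (%p. wt (of_int c) (fst p) * \<eta> p)\<bar> <= 2 * C0 * H_minus1_uloc_norm chi f * sqrt (energy (of_int c) \<eta>)"
proof -
 let ?w = "%p. wt (of_int c) (fst p) * \<eta> p"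
 have w: "?w \<in> test \<Omega>" by (rule test_wt[OF \<eta>])
 have lin: "linear_functional_on (test \<Omega>) (fst f)" "linear_functional_on (test \<Omega>) (snd f)"
  using f by (auto simp: H_minus1_uloc_def distributions_def)
 have "\<bar>fst f (dz ?w)\<bar> <= C0 * H_minus1_uloc_norm chi f * sqrt (energy (of_int c) \<eta>)"
  by (rule local_bound[OF lin(1) _ H_minus1_uloc_components(1)[OF f] test_dz[OF w] _ \<eta>])
   (use f pd_commute[OF test_smooth[OF w]] in \<open>auto simp: H_minus1_uloc_def jet_def jsq_def\<close>)
 moreover have "\<bar>snd f (dx ?w)\<bar> <= C0 * H_minus1_uloc_norm chi f * sqrt (energy (of_int c) \<eta>)"
  by (rule local_bound[OF lin(2) _ H_minus1_uloc_components(2)[OF f] test_dx[OF w] _ \<eta>])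
   (use f pd_commute[OF test_smooth[OF w]] in \<open>auto simp: H_minus1_uloc_def jet_def jsq_def\<close>)
 ultimately show ?thesis unfolding curlf_def by linarith
qed

end

section \<open>Weights with different centres\<close>

definition qd :: "real => real" where "qd x = 1 + x\<^sup>2 / 100"

lemma qd_ge_1: "1 <= qd x"
 by (simp add: qd_def)

lemma wt_qd: "wt 0 x * qd x = 1"
 using wt_denom[of x 0] by (simp add: wt_def qd_def)

lemma qd_smooth: "smooth qd"
 using smooth_quad[of 0] by (simp add: qd_def[abs_def])

lemma qd_deriv: "pd 1 qd = (%x. x / 50)"
proof
 fix x :: real
 have "((%x. 1 + x\<^sup>2 / 100) has_field_derivative x / 50) (at x)"
  by (auto intro!: derivative_eq_intros)
 then show "pd 1 qd x = x / 50" by (intro pd_real_eqI) (simp add: qd_def[abs_def])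
qed

lemma qd_deriv2: "pd 1 (pd 1 qd) = (%x. 1 / 50)"
proof
 fix x :: real
 have "((%x. x / 50) has_field_derivative 1 / 50) (at x)" by (auto intro!: derivative_eq_intros)
 then show "pd 1 (pd 1 qd) x = 1 / 50" unfolding qd_deriv by (rule pd_real_eqI)
qed

text \<open>Here \<open>r\<close> is the weight centred at \<open>c\<close> divided by the one
  centred at 0. The inequality x^2 <= 2 (x - c)^2 + 2 c^2 bounds it by \<open>s\<close>.
  Differentiating either factor gains at least a factor 10, so the first derivative is at most a
  fifth and the second at most a tenth of \<open>r\<close>.\<close>

lemma ratio_bounds:
 fixes c :: real
 defines "r \<equiv> %x. qd x * wt c x" and "s \<equiv> 2 + c\<^sup>2 / 50"
 shows "\<bar>r x\<bar> <= s" "\<bar>pd 1 r x\<bar> <= s" "\<bar>pd 1 (pd 1 r) x\<bar> <= s"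
proof -
 have q: "1 <= qd x" by (rule qd_ge_1)
 have w: "0 < wt c x" by (rule wt_pos)
 have "x\<^sup>2 <= 2 * (x - c)^2 + 2 * c\<^sup>2"
  using zero_le_power2[of "x - 2 * c"] by (simp add: power2_eq_square algebra_simps)
 then have "qd x <= s * (1 + (x - c)^2 / 100)"
 proof -
  assume *: "x\<^sup>2 <= 2 * (x - c)^2 + 2 * c\<^sup>2"
  have "0 <= c\<^sup>2 / 50 * ((x - c)^2 / 100)" by simp
  moreover have "s * (1 + (x - c)^2 / 100) = 2 + 2 * ((x - c)^2 / 100) + c\<^sup>2 / 50 + c\<^sup>2 / 50 * ((x - c)^2 / 100)"
   unfolding s_def by (simp add: algebra_simps)
  ultimately show ?thesis using * unfolding qd_def by linarith
 qed
 then have r: "qd x * wt c x <= s" using wt_denom[of x c] by (simp add: wt_def field_simps)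
 have r0: "0 < qd x * wt c x" using q w by simp
 show "\<bar>r x\<bar> <= s" using r r0 by (simp add: r_def)
 have d1: "pd 1 r = (%x. x / 50 * wt c x + qd x * pd 1 (wt c) x)"
  unfolding r_def by (simp add: pd_smooth_mult qd_smooth wt_smooth qd_deriv)
 have id50: "smooth (%x::real. x / 50)"
  using smooth_mult[OF smooth_const[of "1/50"] smooth_ident_real] by simp
 have d2: "pd 1 (pd 1 r) = (%x. (1 / 50 * wt c x + x / 50 * pd 1 (wt c) x) + (x / 50 * pd 1 (wt c) x + qd x * pd 1 (pd 1 (wt c)) x))"
 proof -
  have e0: "pd 1 (%x::real. x / 50) = (%x. 1 / 50)" using qd_deriv2 unfolding qd_deriv .
  have e1: "pd 1 (%x. x / 50 * wt c x) = (%x. 1 / 50 * wt c x + x / 50 * pd 1 (wt c) x)"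
   unfolding pd_smooth_mult[OF id50 wt_smooth] e0 ..
  have e2: "pd 1 (%x. qd x * pd 1 (wt c) x) = (%x. x / 50 * pd 1 (wt c) x + qd x * pd 1 (pd 1 (wt c)) x)"
   unfolding pd_smooth_mult[OF qd_smooth smooth_deriv[OF wt_smooth]] qd_deriv ..
  have "pd 1 (%x. 1 * (x / 50 * wt c x) + 1 * (qd x * pd 1 (wt c) x)) =
    (%x. 1 * pd 1 (%x. x / 50 * wt c x) x + 1 * pd 1 (%x. qd x * pd 1 (wt c) x) x)"
   by (rule pd_lin; intro smooth_mult id50 wt_smooth qd_smooth smooth_deriv)
  then show ?thesis unfolding d1 by (simp only: mult_1 e1 e2)
 qed
 have x50: "\<bar>x / 50\<bar> <= qd x / 10"
  using zero_le_power2[of "1 - \<bar>x\<bar> / 10"] by (simp add: qd_def power2_eq_square algebra_simps)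
 note b1 = wt_deriv_bound[of c x] and b2 = wt_deriv2_bound[of c x]
 have m1: "\<bar>x / 50 * wt c x\<bar> <= 1/10 * (qd x * wt c x)"
  using mult_right_mono[OF x50, of "wt c x"] w by (simp add: abs_mult)
 have m2: "\<bar>qd x * pd 1 (wt c) x\<bar> <= 1/10 * (qd x * wt c x)"
  using mult_left_mono[OF b1, of "qd x"] q by (simp add: abs_mult)
 have m3: "\<bar>x / 50 * pd 1 (wt c) x\<bar> <= 1/100 * (qd x * wt c x)"
  using mult_mono[OF x50 b1] q w by (simp add: abs_mult)
 have m4: "\<bar>qd x * pd 1 (pd 1 (wt c)) x\<bar> <= 6/100 * (qd x * wt c x)"
  using mult_left_mono[OF b2, of "qd x"] q by (simp add: abs_mult)
 have m5: "\<bar>1 / 50 * wt c x\<bar> <= 1/50 * (qd x * wt c x)"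
  using mult_right_mono[OF q, of "wt c x"] w by (simp add: abs_mult)
 show "\<bar>pd 1 r x\<bar> <= s" unfolding d1 using m1 m2 r r0 by linarith
 show "\<bar>pd 1 (pd 1 r) x\<bar> <= s" unfolding d2 using m3 m4 m5 r r0 by linarith
qed

lemma ipw_le_energy:
 assumes "f \<in> test \<Omega>"
 shows "ipw k f f <= 2 * energy k f"
proof -
 have "ipw k f f <= (LBINT p. 2 * (wt k (fst p) * jsq (jet f p)))"
  unfolding ipw_def
 proof (rule integral_mono)
  show "wt k (fst p) * jform (jet f p) (jet f p) <= 2 * (wt k (fst p) * jsq (jet f p))" for p
   using mult_left_mono[OF jform_sq(2)[of "jet f p"], of "wt k (fst p)"] wt_pos[of k "fst p"] by simp
 qed (intro ipw_integrable[OF assms assms] integrable_mult_right energy_integrable[OF assms])+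
 then show ?thesis by (simp add: energy_def)
qed

lemma energy_nonneg: "0 <= energy k f"
 unfolding energy_def by (rule Bochner_Integration.integral_nonneg) (simp add: wt_pos less_imp_le jsq_nonneg)

lemma quadratic_root_bound:
 fixes X a b :: real
 assumes "0 <= X" "0 <= a" "0 <= b" "X\<^sup>2 <= a * X + b"
 shows "X <= a + sqrt b"
proof (rule ccontr)
 assume "\<not> X <= a + sqrt b"
 then have X: "X > a + sqrt b" by simp
 have sb: "0 <= sqrt b" using assms(3) by simp
 have X0: "0 < X" using X assms(2) sb by linarith
 have "(a + sqrt b) * X < X * X" by (rule mult_strict_right_mono[OF X X0])
 moreover have "sqrt b * sqrt b <= sqrt b * X" by (rule mult_left_mono[OF _ sb]) (use X assms(2) in linarith)
 ultimately show False using assms(3,4) by (simp add: power2_eq_square distrib_right)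
qed

section \<open>Convergence in the weighted L2 space\<close>

definition sw :: "point => real" where "sw p = sqrt (wt 0 (fst p))"

lemma sw_pos: "0 < sw p" and sw_le_1: "sw p <= 1" and sw_sq: "(sw p)^2 = wt 0 (fst p)"
 using wt_pos[of 0 "fst p"] wt_le_1[of 0 "fst p"] by (simp_all add: sw_def)

lemma sw_qd: "1 <= sw p * qd (fst p)"
proof -
 have "wt 0 (fst p) <= sw p"
  using sw_pos[of p] sw_le_1[of p] by (simp add: sw_sq[symmetric] power2_eq_square mult_left_le)
 then have "wt 0 (fst p) * qd (fst p) <= sw p * qd (fst p)"
  using qd_ge_1[of "fst p"] by (intro mult_right_mono) auto
 then show ?thesis by (simp add: wt_qd)
qed

lemma sw_measurable [measurable]: "sw \<in> bmeas"
proof -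
 have "(%p::point. wt 0 (fst p)) \<in> bmeas"
  by (rule smooth_measurable[OF smooth_fst[OF wt_smooth]])
 then show ?thesis unfolding sw_def[abs_def] by measurable
qed

text \<open>Convergence in L2 with density \<open>wt 0\<close>. The weight is essential, since
  uniformly local limits are in general not square integrable over the strip.\<close>

definition conv :: "(nat => point => real) => (point => real) => bool" where
 "conv E g \<longleftrightarrow> (\<forall>n. E n \<in> test \<Omega>) & (%p. sw p * g p) \<in> sqi lom &
  (%n. l2 lom (%p. sw p * E n p - sw p * g p)) ---> 0"

lemma sw_mult_sqi: "h \<in> sqi lom ==> (%p. sw p * h p) \<in> sqi lom"
 by (rule sqi_bounded_mult[where C=1]) (auto intro: lom_measurable_borel simp: sw_le_1 sw_pos less_imp_le abs_le_iff order_trans[of _ 0 1])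

lemma conv_uminus: "conv E g ==> conv (%n p. - E n p) (%p. - g p)"
proof -
 assume c: "conv E g"
 have "l2 lom (%p. sw p * (- E n p) - sw p * (- g p)) = l2 lom (%p. sw p * E n p - sw p * g p)" for n
  using l2_minus_commute[of lom "%p. sw p * g p" "%p. sw p * E n p"] by simp
 then show ?thesis using c sqi_uminus[of "%p. sw p * g p" lom] unfolding conv_def by (simp add: test_uminus)
qed

text \<open>A multiplier decaying like the weight absorbs it: \<open>1 <= sw p * qd (fst p)\<close>
  bounds \<open>b / sw\<close> by \<open>C\<close>. Cutoffs with compact support in x are of this
  kind.\<close>

lemma conv_mult:
 assumes c: "conv E g" and [measurable]: "b \<in> bmeas" and b: "!!p. \<bar>b p\<bar> * qd (fst p) <= C"
 shows "(%p. b p * g p) \<in> sqi lom" "(%n. l2 lom (%p. b p * E n p - b p * g p)) ---> 0"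
proof -
 define B where "B p = b p / sw p" for p
 have Bm: "B \<in> borel_measurable lom"
  unfolding B_def[abs_def] by (rule lom_measurable_borel) measurable
 have bB: "b p = B p * sw p" for p using sw_pos[of p] by (simp add: B_def)
 have BC: "\<bar>B p\<bar> <= C" for p
 proof -
  have "\<bar>b p\<bar> * 1 <= \<bar>b p\<bar> * (sw p * qd (fst p))" by (intro mult_left_mono sw_qd) simp
  also have "\<dots> = sw p * (\<bar>b p\<bar> * qd (fst p))" by simp
  also have "\<dots> <= sw p * C" using sw_pos[of p] by (intro mult_left_mono b) simp
  finally show ?thesis using sw_pos[of p] by (simp add: B_def field_simps)
 qed
 have C: "0 <= C" using BC[of "(0,0)"] by linarith
 have g: "(%p. sw p * g p) \<in> sqi lom" and lim: "(%n. l2 lom (%p. sw p * E n p - sw p * g p)) ---> 0"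
  and E: "!!n. E n \<in> test \<Omega>" using c by (auto simp: conv_def)
 show "(%p. b p * g p) \<in> sqi lom"
  using sqi_bounded_mult[OF g Bm, of C] BC by (simp add: bB mult.assoc)
 have d: "(%p. sw p * E n p - sw p * g p) \<in> sqi lom" for n
  by (rule sqi_diff[OF sw_mult_sqi[OF test_sqi_lom[OF E]] g])
 have le: "l2 lom (%p. b p * E n p - b p * g p) <= C * l2 lom (%p. sw p * E n p - sw p * g p)" for n
 proof -
  have eq: "(%p. b p * E n p - b p * g p) = (%p. B p * (sw p * E n p - sw p * g p))"
   by (simp add: bB fun_eq_iff algebra_simps)
  have m: "(%p. b p * E n p - b p * g p) \<in> borel_measurable lom"
   unfolding eq using sqi_measurable[OF d[of n]] Bm by measurable
  have "l2 lom (%p. b p * E n p - b p * g p) <= l2 lom (%p. C * (sw p * E n p - sw p * g p))"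
  proof (rule l2_mono(2)[OF sqi_cmult[OF d] m])
   fix p
   show "\<bar>b p * E n p - b p * g p\<bar> <= \<bar>C * (sw p * E n p - sw p * g p)\<bar>"
    using fun_cong[OF eq, of p] BC[of p] C by (simp add: abs_mult mult_right_mono)
  qed
  then show ?thesis using C by (simp add: l2_cmult)
 qed
 show "(%n. l2 lom (%p. b p * E n p - b p * g p)) ---> 0"
  by (rule Lim_null_comparison[OF always_eventually tendsto_mult_right_zero[OF lim]]) (use le in auto)
qed

text \<open>The pairing is split as \<open>sw * g\<close> against \<open>ph / sw\<close>. The second
  factor is square integrable because the inverse weight is bounded on the support of
  \<open>ph\<close>.\<close>

lemma conv_inner:
 assumes c: "conv E g" and ph: "ph \<in> test S"
 shows "(%n. \<integral>p. E n p * ph p \<partial>lom) ---> (LINT p|lom. g p * ph p)"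
  "\<bar>\<integral>p. g p * ph p \<partial>lom\<bar> <= l2 lom (%p. sw p * g p) * l2 lom (%p. ph p / sw p)"
  "integrable lom (%p. g p * ph p)"
proof -
 have t: "(%p. qd (fst p) * ph p) \<in> test S"
  by (rule test_smooth_mult[OF smooth_fst[OF qd_smooth] ph])
 have [measurable]: "ph \<in> bmeas" by (rule test_measurable[OF ph])
 have s: "(%p. ph p / sw p) \<in> sqi lom"
 proof (rule l2_mono(1)[OF test_sqi_lom[OF t]])
  show "(%p. ph p / sw p) \<in> borel_measurable lom" by (rule lom_measurable_borel) measurable
  fix p
  have "\<bar>ph p\<bar> * 1 <= \<bar>ph p\<bar> * (sw p * qd (fst p))" by (intro mult_left_mono sw_qd) simp
  then show "\<bar>ph p / sw p\<bar> <= \<bar>qd (fst p) * ph p\<bar>"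
   using sw_pos[of p] qd_ge_1[of "fst p"] by (simp add: abs_mult field_simps)
 qed
 have g: "(%p. sw p * g p) \<in> sqi lom" and lim: "(%n. l2 lom (%p. sw p * E n p - sw p * g p)) ---> 0"
  and E: "!!n. E n \<in> test \<Omega>" using c by (auto simp: conv_def)
 have e: "(%p. sw p * h p * (ph p / sw p)) = (%p. h p * ph p)" for h
  using sw_pos by (auto simp: fun_eq_iff less_imp_neq[symmetric])
 have "(%n. \<integral>p. sw p * E n p * (ph p / sw p) \<partial>lom) ---> (LINT p|lom. sw p * g p * (ph p / sw p))"
  by (rule l2_tendsto_inner[OF sw_mult_sqi[OF test_sqi_lom[OF E]] s g s lim]) (simp add: l2_def)
 then show "(%n. \<integral>p. E n p * ph p \<partial>lom) ---> (LINT p|lom. g p * ph p)" unfolding e .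
 show "\<bar>\<integral>p. g p * ph p \<partial>lom\<bar> <= l2 lom (%p. sw p * g p) * l2 lom (%p. ph p / sw p)"
  using l2_cauchy_schwarz[OF g s] unfolding e .
 show "integrable lom (%p. g p * ph p)" using sqi_mult[OF g s] unfolding e .
qed

lemma test_lom_parts:
 assumes E: "E \<in> test \<Omega>" and ph: "ph \<in> test \<Omega>" and v: "v \<in> Basis"
 shows "(LINT p|lom. E p * pd v ph p) = - (LINT p|lom. pd v E p * ph p)"
 by (rule test_parts_lom[OF ph test_smooth[OF E] v])

text \<open>One derivative is moved back to the limit gradients. Only first derivatives of
  \<open>ph\<close> then remain, which is the order of continuity that the construction of the
  pressure requires.\<close>

lemma conv_laplacian:
 assumes c: "conv E g" "conv (%n. dx (E n)) gx" "conv (%n. dz (E n)) gz" and ph: "ph \<in> test \<Omega>"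
 shows "(LINT p|lom. g p * dx (dx ph) p) + (LINT p|lom. g p * dz (dz ph) p)
  = - ((LINT p|lom. gx p * dx ph p) + (LINT p|lom. gz p * dz ph p))"
proof -
 have E: "E n \<in> test \<Omega>" for n using c(1) by (simp add: conv_def)
 have "(%n. (LINT p|lom. E n p * dx (dx ph) p) + (LINT p|lom. E n p * dz (dz ph) p))
   ---> (LINT p|lom. g p * dx (dx ph) p) + (LINT p|lom. g p * dz (dz ph) p)"
  by (intro tendsto_add conv_inner(1)[OF c(1), where S=\<Omega>]) (intro test_dx test_dz ph)+
 moreover have "(%n. - ((LINT p|lom. dx (E n) p * dx ph p) + (LINT p|lom. dz (E n) p * dz ph p)))
   ---> - ((LINT p|lom. gx p * dx ph p) + (LINT p|lom. gz p * dz ph p))"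
  by (intro tendsto_minus tendsto_add conv_inner(1)[OF c(2), where S=\<Omega>] conv_inner(1)[OF c(3), where S=\<Omega>]) (intro test_dx test_dz ph)+
 moreover have "(LINT p|lom. E n p * dx (dx ph) p) + (LINT p|lom. E n p * dz (dz ph) p) =
   - ((LINT p|lom. dx (E n) p * dx ph p) + (LINT p|lom. dz (E n) p * dz ph p))" for n
  using test_lom_parts[OF E test_dx[OF ph], of e\<^sub>x n] test_lom_parts[OF E test_dz[OF ph], of e\<^sub>z n] by simp
 ultimately show ?thesis using LIMSEQ_unique by fastforce
qed

section \<open>Approximate stream functions and their uniform bounds\<close>

locale stokes_seq = cutoff_fun +
 fixes f :: "point functional \<times> point functional" and \<psi> :: "nat => point => real"
 assumes f: "f \<in> H_minus1_uloc chi"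
  and \<psi>: "\<psi> n \<in> test \<Omega>"
  and residual: "\<eta> \<in> test \<Omega> ==>
   \<bar>curlf f (%p. wt 0 (fst p) * \<eta> p) - bform (\<psi> n) (%p. wt 0 (fst p) * \<eta> p)\<bar> <= inverse (real (Suc n)) * sqrt (2 * energy 0 \<eta>)"
  and cauchy: "e > 0 ==> \<exists>N. \<forall>m\<ge>N. \<forall>n\<ge>N. energy 0 (%p. \<psi> m p - \<psi> n p) < e"

context cutoff_fun
begin

lemma curlf_lin:
 assumes f: "f \<in> H_minus1_uloc chi" and ph: "ph \<in> test \<Omega>" and \<eta>: "\<eta> \<in> test \<Omega>"
 shows "curlf f (%p. a * ph p + b * \<eta> p) = a * curlf f ph + b * curlf f \<eta>"
proof -
 have lin: "linear_functional_on (test \<Omega>) (fst f)" "linear_functional_on (test \<Omega>) (snd f)"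
  using f by (auto simp: H_minus1_uloc_def distributions_def)
 have "fst f (%p. a * dz ph p + b * dz \<eta> p) = a * fst f (dz ph) + b * fst f (dz \<eta>)"
  using lin(1) test_dz[OF ph] test_dz[OF \<eta>] unfolding linear_functional_on_def by blast
 moreover have "snd f (%p. a * dx ph p + b * dx \<eta> p) = a * snd f (dx ph) + b * snd f (dx \<eta>)"
  using lin(2) test_dx[OF ph] test_dx[OF \<eta>] unfolding linear_functional_on_def by blast
 ultimately show ?thesis
  by (simp add: curlf_def pd_lin[OF test_smooth[OF ph] test_smooth[OF \<eta>]] algebra_simps)
qed

lemma uloc_norm_nonneg:
 assumes f: "f \<in> H_minus1_uloc chi"
 shows "0 <= H_minus1_uloc_norm chi f"
 using H_minus1_uloc_components(1)[OF f, of 0] H_minus1_bound(2)[of "cut_dist chi 0 (fst f)"] f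
 by (fastforce simp: H_minus1_uloc_def)

text \<open>The form sends \<open>f\<close>, \<open>g\<close> to \<open>bform f (w g)\<close> with w
  the weight centred at 0, and the right-hand side is \<open>curlf\<close> tested with the same
  weighted function. \<open>perturbation\<close> and \<open>curlf_bound\<close> are exactly the
  hypotheses of the approximate solver.\<close>

lemma stokes_seq_exists:
 assumes f: "f \<in> H_minus1_uloc chi"
 shows "\<exists>\<psi>. stokes_seq chi f \<psi>"
proof -
 interpret pre_hilbert "test \<Omega>" "ipw 0" by (rule pre_hilbert_ipw)
 let ?w = "%\<eta> p. wt 0 (fst p) * \<eta> p"
 have wl: "?w (%x. a * ph x + b * \<eta> x) = (%p. a * ?w ph p + b * ?w \<eta> p)" for a b and ph \<eta> :: "point => real"
  by (simp add: fun_eq_iff algebra_simps)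
 have F: "linear_functional_on (test \<Omega>) (%\<eta>. curlf f (?w \<eta>))"
  unfolding linear_functional_on_def wl by (intro ballI allI curlf_lin[OF f] test_wt)
 have Fb: "\<bar>curlf f (?w v)\<bar> <= 2 * C0 * H_minus1_uloc_norm chi f * sqrt 3 * nm v" if v: "v \<in> test \<Omega>" for v
 proof -
  have "\<bar>curlf f (?w v)\<bar> <= 2 * C0 * H_minus1_uloc_norm chi f * sqrt (energy 0 v)"
   using curlf_bound[OF f v, of 0] by simp
  also have "\<dots> <= 2 * C0 * H_minus1_uloc_norm chi f * sqrt (3 * ipw 0 v v)"
   using C0_pos uloc_norm_nonneg[OF f] energy_le[OF v, of 0] by (intro mult_left_mono) auto
  finally show ?thesis by (simp add: nm_def real_sqrt_mult mult.assoc)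
 qed
 have a1: "bform (%x. s * f x + t * g x) (?w h) = s * bform f (?w h) + t * bform g (?w h)"
  if "f \<in> test \<Omega>" "g \<in> test \<Omega>" "h \<in> test \<Omega>" for f g h s t
  using that by (intro bform_lin test_wt)
 have a2: "linear_functional_on (test \<Omega>) (%g. bform f (?w g))" if "f \<in> test \<Omega>" for f
  unfolding linear_functional_on_def wl bform_commute[of f] using that by (intro ballI allI bform_lin test_wt)
 have q: "\<bar>bform f (?w g) - ipw 0 f g\<bar> <= 26 / 100 * (nm f * nm g)"
  if "f \<in> test \<Omega>" "g \<in> test \<Omega>" for f g
  unfolding nm_def by (rule perturbation[OF that])
 have "\<exists>u. (\<forall>n. u n \<in> test \<Omega>) &
   (\<forall>n. \<forall>v\<in>test \<Omega>. \<bar>curlf f (?w v) - bform (u n) (?w v)\<bar> <= inverse (real (Suc n)) * nm v) &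
   (\<forall>e>0. \<exists>N. \<forall>m\<ge>N. \<forall>n\<ge>N. nm (%x. 1 * u m x + (-1) * u n x) < e)"
  by (rule approx_solve_seq[where F="%\<eta>. curlf f (?w \<eta>)" and a="%f g. bform f (?w g)", OF F Fb a1 a2 _ _ q]) auto
 then obtain u where u: "!!n. u n \<in> test \<Omega>"
  and res: "!!n v. v \<in> test \<Omega> ==> \<bar>curlf f (?w v) - bform (u n) (?w v)\<bar> <= inverse (real (Suc n)) * nm v"
  and cau: "!!e. e > 0 ==> \<exists>N. \<forall>m\<ge>N. \<forall>n\<ge>N. nm (%x. 1 * u m x + (-1) * u n x) < e"
  by blast
 have "stokes_seq chi f u"
 proof
  fix n \<eta> assume \<eta>: "\<eta> \<in> test \<Omega>"
  have "nm \<eta> <= sqrt (2 * energy 0 \<eta>)" unfolding nm_def using ipw_le_energy[OF \<eta>] by simp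
  then have "inverse (real (Suc n)) * nm \<eta> <= inverse (real (Suc n)) * sqrt (2 * energy 0 \<eta>)"
   by (intro mult_left_mono) auto
  with res[OF \<eta>, of n] show "\<bar>curlf f (?w \<eta>) - bform (u n) (?w \<eta>)\<bar> <= inverse (real (Suc n)) * sqrt (2 * energy 0 \<eta>)"
   by linarith
 next
  fix e :: real assume e: "e > 0"
  then obtain N where N: "!!m n. m >= N ==> n >= N ==> nm (%x. 1 * u m x + (-1) * u n x) < sqrt (e / 3)"
   using cau[of "sqrt (e / 3)"] by auto
  have "energy 0 (%p. u m p - u n p) < e" if "m >= N" "n >= N" for m n
  proof -
   have t: "(%p. u m p - u n p) \<in> test \<Omega>" by (rule test_diff[OF u u])
   have "nm (%x. u m x - u n x) < sqrt (e / 3)" using N[OF that] by simp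
   then have "ipw 0 (%p. u m p - u n p) (%p. u m p - u n p) < e / 3" unfolding nm_def by simp
   with energy_le[OF t, of 0] show ?thesis by linarith
  qed
  then show "\<exists>N. \<forall>m\<ge>N. \<forall>n\<ge>N. energy 0 (%p. u m p - u n p) < e" by blast
 qed (rule f u)+
 then show ?thesis by blast
qed

end

context stokes_seq
begin

abbreviation M :: real where "M \<equiv> H_minus1_uloc_norm chi f"

lemma M_nonneg: "0 <= M"
 by (rule uloc_norm_nonneg[OF f])

lemma energy_triangle:
 assumes "a \<in> test \<Omega>" "b \<in> test \<Omega>"
 shows "energy k a <= 2 * energy k b + 2 * energy k (%p. a p - b p)"
proof -
 have d: "(%p. a p - b p) \<in> test \<Omega>" by (rule test_diff[OF assms])
 have "energy k a <= (LBINT p. 2 * (wt k (fst p) * jsq (jet b p)) + 2 * (wt k (fst p) * jsq (jet (%p. a p - b p) p)))"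
  unfolding energy_def
 proof (rule integral_mono)
  fix p
  have j: "jet (%p. 1 * a p + (-1) * b p) p = jlin 1 (jet a p) (-1) (jet b p)"
   by (rule jet_lin) (intro test_smooth[of _ \<Omega>] assms)+
  have two: "x\<^sup>2 <= 2 * y\<^sup>2 + 2 * (x - y)^2" for x y :: real
   using zero_le_power2[of "x - 2 * y"] by (simp add: power2_eq_square algebra_simps)
  have "jsq J <= 2 * jsq K + 2 * jsq (jlin 1 J (-1) K)" for J K
  proof -
   obtain a1 b1 c1 d1 e1 f1 where J: "J = (a1, b1, c1, d1, e1, f1)" by (cases J)
   obtain a2 b2 c2 d2 e2 f2 where K: "K = (a2, b2, c2, d2, e2, f2)" by (cases K)
   show ?thesis using two[of a1 a2] two[of b1 b2] two[of c1 c2] two[of d1 d2] two[of e1 e2] two[of f1 f2]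
    by (simp add: J K jsq_def jlin_def)
  qed
  from this[of "jet a p" "jet b p"] have "jsq (jet a p) <= 2 * jsq (jet b p) + 2 * jsq (jet (%p. a p - b p) p)"
   using j by simp
  from mult_left_mono[OF this, of "wt k (fst p)"]
  show "wt k (fst p) * jsq (jet a p) <= 2 * (wt k (fst p) * jsq (jet b p)) + 2 * (wt k (fst p) * jsq (jet (%p. a p - b p) p))"
   by (simp add: wt_pos less_imp_le algebra_simps)
 qed (intro Bochner_Integration.integrable_add integrable_mult_right energy_integrable[of _ \<Omega>] assms d)+
 also have "\<dots> = 2 * energy k b + 2 * energy k (%p. a p - b p)"
  using energy_integrable[OF assms(2), of k] energy_integrable[OF d, of k] by (simp add: energy_def)
 finally show ?thesis .
qed

text \<open>This bound may depend on the whole sequence; it enters later only as a factor of the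
  vanishing residual.\<close>

lemma energy_bounded: "\<exists>B. \<forall>n. energy 0 (\<psi> n) <= B"
proof -
 obtain N where N: "!!m n. m >= N ==> n >= N ==> energy 0 (%p. \<psi> m p - \<psi> n p) < 1" using cauchy[of 1] by auto
 define B where "B = Max ((%n. energy 0 (\<psi> n)) ` {..N})"
 have B: "energy 0 (\<psi> n) <= B" if "n <= N" for n unfolding B_def by (rule Max_ge) (use that in auto)
 have B0: "0 <= B" using B[of N] energy_nonneg[of 0 "\<psi> N"] by linarith
 have "energy 0 (\<psi> n) <= 2 * B + 2" for n
 proof (cases "n <= N")
  case True
  then show ?thesis using B[OF True] B0 by linarith
 next
  case False
  then have "energy 0 (\<psi> n) <= 2 * energy 0 (\<psi> N) + 2 * energy 0 (%p. \<psi> n p - \<psi> N p)"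
   by (intro energy_triangle \<psi>)
  then show ?thesis using N[of n N] False B[of N] by simp
 qed
 then show ?thesis by blast
qed

text \<open>Testing with the weight centred at \<open>c\<close> amounts to testing with the weight
  centred at 0 after multiplication by the quotient \<open>r\<close>. The energy of the product is
  finite, with a bound depending on \<open>c\<close>, and it multiplies the residual. Coercivity and
  \<open>curlf_bound\<close> for the centre \<open>c\<close> then leave a quadratic inequality whose
  main coefficient 10 = 5 * 2 is free of \<open>c\<close>.\<close>

lemma uniform_bound:
 "\<exists>B\<ge>0. \<forall>n. sqrt (energy (of_int c) (\<psi> n)) <= 10 * C0 * M + sqrt (B * inverse (real (Suc n)))"
proof -
 obtain B where B: "!!n. energy 0 (\<psi> n) <= B" using energy_bounded by blast
 define r where "r = (%x. qd x * wt (of_int c) x)"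
 define s where "s = 2 + (of_int c)^2 / (50::real)"
 have rs: "smooth r" unfolding r_def by (intro smooth_mult qd_smooth wt_smooth)
 define Bc where "Bc = 5 * sqrt (2 * (9 * s\<^sup>2 * B))"
 have "sqrt (energy (of_int c) (\<psi> n)) <= 10 * C0 * M + sqrt (Bc * inverse (real (Suc n)))" for n
 proof -
  let ?z = "%p. r (fst p) * \<psi> n p"
  have z: "?z \<in> test \<Omega>" by (rule test_smooth_mult[OF smooth_fst[OF rs] \<psi>])
  \<comment> \<open>The inverse weight inside \<open>r\<close> cancels the weight centred at 0,
    which makes the residual estimate applicable.\<close>
  have wz: "(%p. wt 0 (fst p) * ?z p) = (%p. wt (of_int c) (fst p) * \<psi> n p)"
  proof
   fix p :: point
   have "wt 0 (fst p) * ?z p = (wt 0 (fst p) * qd (fst p)) * (wt (of_int c) (fst p) * \<psi> n p)" by (simp add: r_def)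
   then show "wt 0 (fst p) * ?z p = wt (of_int c) (fst p) * \<psi> n p" by (simp add: wt_qd)
  qed
  have ez: "energy 0 ?z <= 9 * s\<^sup>2 * B"
  proof -
   have "energy 0 ?z <= (LBINT p. 9 * s\<^sup>2 * (wt 0 (fst p) * jsq (jet (\<psi> n) p)))"
    unfolding energy_def
   proof (rule integral_mono)
    fix p
    have "jsq (jet ?z p) <= 9 * s\<^sup>2 * jsq (jet (\<psi> n) p)"
     unfolding jet_mult[OF rs test_smooth[OF \<psi>]]
     by (rule jsq_mult_le) (unfold r_def s_def, (rule ratio_bounds)+)
    from mult_left_mono[OF this, of "wt 0 (fst p)"]
    show "wt 0 (fst p) * jsq (jet ?z p) <= 9 * s\<^sup>2 * (wt 0 (fst p) * jsq (jet (\<psi> n) p))"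
     by (simp add: wt_pos less_imp_le mult.left_commute)
   qed (intro integrable_mult_right energy_integrable[of _ \<Omega>] \<psi> z)+
   also have "\<dots> = 9 * s\<^sup>2 * energy 0 (\<psi> n)" by (simp add: energy_def)
   also have "\<dots> <= 9 * s\<^sup>2 * B" by (intro mult_left_mono B) simp
   finally show ?thesis .
  qed
  define X where "X = sqrt (energy (of_int c) (\<psi> n))"
  have X2: "X\<^sup>2 = energy (of_int c) (\<psi> n)" by (simp add: X_def energy_nonneg)
  have "X\<^sup>2 <= 5 * bform (\<psi> n) (%p. wt (of_int c) (fst p) * \<psi> n p)" unfolding X2 by (rule coercive[OF \<psi>])
  also have "\<dots> <= 5 * (curlf f (%p. wt (of_int c) (fst p) * \<psi> n p) + inverse (real (Suc n)) * sqrt (2 * energy 0 ?z))"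
  proof (rule mult_left_mono)
   show "bform (\<psi> n) (%p. wt (of_int c) (fst p) * \<psi> n p)
     <= curlf f (%p. wt (of_int c) (fst p) * \<psi> n p) + inverse (real (Suc n)) * sqrt (2 * energy 0 ?z)"
    using residual[OF z, of n] unfolding wz by (simp only: abs_diff_le_iff diff_le_eq)
  qed simp
  also have "\<dots> <= 5 * (2 * C0 * M * X + inverse (real (Suc n)) * sqrt (2 * (9 * s\<^sup>2 * B)))"
  proof -
   have "curlf f (%p. wt (of_int c) (fst p) * \<psi> n p) <= 2 * C0 * M * X"
    using curlf_bound[OF f \<psi>, of c n] unfolding X_def by linarith
   moreover have "inverse (real (Suc n)) * sqrt (2 * energy 0 ?z) <= inverse (real (Suc n)) * sqrt (2 * (9 * s\<^sup>2 * B))"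
    using ez by (intro mult_left_mono real_sqrt_le_mono) auto
   ultimately show ?thesis by (rule mult_left_mono[OF add_mono]) simp
  qed
  also have "\<dots> = (10 * C0 * M) * X + Bc * inverse (real (Suc n))" by (simp add: Bc_def algebra_simps)
  finally have "X\<^sup>2 <= (10 * C0 * M) * X + Bc * inverse (real (Suc n))" .
  moreover have "0 <= Bc * inverse (real (Suc n))"
  proof -
   have "0 <= 9 * s\<^sup>2 * B" using ez energy_nonneg[of 0 ?z] by linarith
   then show ?thesis by (simp add: Bc_def)
  qed
  moreover have "0 <= X" by (simp add: X_def energy_nonneg)
  ultimately show ?thesis
   using quadratic_root_bound[of X "10 * C0 * M" "Bc * inverse (real (Suc n))"] C0_pos M_nonneg
   by (simp add: X_def)
 qed
 moreover have "0 <= Bc"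
 proof -
  have "0 <= B" using B[of 0] energy_nonneg[of 0 "\<psi> 0"] by linarith
  then show ?thesis by (simp add: Bc_def)
 qed
 ultimately show ?thesis by blast
qed

text \<open>Increments of a component of the jet are dominated by the energy of the differences, so
  the weighted sequence is Cauchy and \<open>l2_complete\<close> applies. The weight is positive and
  can be divided out of the limit.\<close>

lemma conv_exists:
 assumes D: "!!n. D n \<in> test \<Omega>" "!!m n p. (D m p - D n p)^2 <= jsq (jet (%p. \<psi> m p - \<psi> n p) p)"
 shows "\<exists>g. conv D g"
proof -
 define s where "s n p = sw p * D n p" for n p
 have s: "s n \<in> sqi lom" for n unfolding s_def by (rule sw_mult_sqi[OF test_sqi_lom[OF D(1)]])
 have le: "(l2 lom (%p. s m p - s n p))^2 <= energy 0 (%p. \<psi> m p - \<psi> n p)" for m n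
 proof -
  have "(l2 lom (%p. s m p - s n p))^2 = (LINT p|lom. wt 0 (fst p) * (D m p - D n p)^2)"
   unfolding l2_sq s_def by (simp add: right_diff_distrib[symmetric] power_mult_distrib sw_sq)
  also have "\<dots> = (LBINT p. wt 0 (fst p) * (D m p - D n p)^2)"
   by (rule test_lom_integral) (simp add: test_outside[OF D(1)])
  also have "\<dots> <= energy 0 (%p. \<psi> m p - \<psi> n p)"
   unfolding energy_def
  proof (rule integral_mono)
   show "integrable lborel (%p. wt 0 (fst p) * (D m p - D n p)^2)" by (rule wi_integrable[OF test_diff[OF D(1) D(1)]])
   show "integrable lborel (%p. wt 0 (fst p) * jsq (jet (%p. \<psi> m p - \<psi> n p) p))"
    by (rule energy_integrable[OF test_diff[OF \<psi> \<psi>]])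
   show "wt 0 (fst p) * (D m p - D n p)^2 <= wt 0 (fst p) * jsq (jet (%p. \<psi> m p - \<psi> n p) p)" for p
    by (rule mult_left_mono[OF D(2)]) (simp add: wt_pos less_imp_le)
  qed
  finally show ?thesis .
 qed
 have "\<exists>N. \<forall>m\<ge>N. \<forall>n\<ge>N. l2 lom (%p. s m p - s n p) < e" if "e > 0" for e
 proof -
  obtain N where N: "!!m n. m >= N ==> n >= N ==> energy 0 (%p. \<psi> m p - \<psi> n p) < e\<^sup>2"
   using cauchy[of "e\<^sup>2"] \<open>e > 0\<close> by auto
  have "l2 lom (%p. s m p - s n p) < e" if "m >= N" "n >= N" for m n
  proof (rule power2_less_imp_less)
   show "(l2 lom (%p. s m p - s n p))^2 < e\<^sup>2" using le[of m n] N[OF that] by linarith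
  qed (use \<open>e > 0\<close> in simp)
  then show ?thesis by blast
 qed
 from l2_complete[of s lom, OF s this] obtain G where G: "G \<in> sqi lom" "(%n. l2 lom (%p. s n p - G p)) ---> 0" by blast
 have "sw p * (G p / sw p) = G p" for p using sw_pos[of p] by simp
 then have "conv D (%p. G p / sw p)" unfolding conv_def using G D(1) by (simp add: s_def)
 then show ?thesis by blast
qed

lemma limits_exist:
 "\<exists>gx gz gxx gxz gzz. conv (%n. dx (\<psi> n)) gx & conv (%n. dz (\<psi> n)) gz & conv (%n. dx (dx (\<psi> n))) gxx &
  conv (%n. dx (dz (\<psi> n))) gxz & conv (%n. dz (dz (\<psi> n))) gzz"
proof -
 have j: "jet (%p. \<psi> m p - \<psi> n p) p = jlin 1 (jet (\<psi> m) p) (-1) (jet (\<psi> n) p)" for m n p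
  using jet_lin[OF test_smooth[OF \<psi>] test_smooth[OF \<psi>], of 1 m "-1" n] by simp
 note t = test_dx[OF \<psi>] test_dz[OF \<psi>] test_dx[OF test_dx[OF \<psi>]] test_dx[OF test_dz[OF \<psi>]] test_dz[OF test_dz[OF \<psi>]]
 have "\<exists>g. conv (%n. dx (\<psi> n)) g" by (rule conv_exists[OF t(1)]) (simp add: j jsq_def jlin_def jet_def)
 moreover have "\<exists>g. conv (%n. dz (\<psi> n)) g" by (rule conv_exists[OF t(2)]) (simp add: j jsq_def jlin_def jet_def)
 moreover have "\<exists>g. conv (%n. dx (dx (\<psi> n))) g" by (rule conv_exists[OF t(3)]) (simp add: j jsq_def jlin_def jet_def)
 moreover have "\<exists>g. conv (%n. dx (dz (\<psi> n))) g" by (rule conv_exists[OF t(4)]) (simp add: j jsq_def jlin_def jet_def)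
 moreover have "\<exists>g. conv (%n. dz (dz (\<psi> n))) g" by (rule conv_exists[OF t(5)]) (simp add: j jsq_def jlin_def jet_def)
 ultimately show ?thesis by blast
qed

text \<open>The residual estimate is applied to \<open>\<eta>\<close> divided by the weight, so that
  the weighted test function is \<open>\<eta>\<close> itself.\<close>

lemma bform_limit:
 assumes \<eta>: "\<eta> \<in> test \<Omega>"
 shows "(%n. bform (\<psi> n) \<eta>) ---> curlf f \<eta>"
proof -
 let ?z = "%p. qd (fst p) * \<eta> p"
 have z: "?z \<in> test \<Omega>" by (rule test_smooth_mult[OF smooth_fst[OF qd_smooth] \<eta>])
 have wz: "(%p. wt 0 (fst p) * ?z p) = \<eta>" by (simp add: mult.assoc[symmetric] wt_qd)
 have "\<forall>n. norm (bform (\<psi> n) \<eta> - curlf f \<eta>) <= inverse (real (Suc n)) * sqrt (2 * energy 0 ?z)"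
  using residual[OF z] unfolding wz by (simp add: abs_minus_commute)
 then have "(%n. bform (\<psi> n) \<eta> - curlf f \<eta>) ---> 0"
  by (rule Lim_null_comparison[OF always_eventually tendsto_mult_left_zero[OF LIMSEQ_inverse_real_of_nat]])
 then show ?thesis by (simp add: LIM_zero_iff)
qed

end

section \<open>Properties of the limit field\<close>

context cutoff_fun
begin

lemma chi_shift_smooth: "smooth (%x. chi (x - k))"
 by (rule smooth_shift[OF chi_smooth])

lemma chi_shift_test: "(%x. chi (x - k)) \<in> test UNIV"
 by (rule test_functionsI[of _ "{k - 1..k + 2}"]) (auto simp: chi_shift_smooth intro!: chi_0)

end

lemma test_real_qd_bound:
 assumes "r \<in> test (UNIV :: real set)"
 shows "\<exists>C. \<forall>x. \<bar>r x\<bar> * qd x <= C"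
proof -
 obtain C where "!!x. \<bar>qd x * r x\<bar> <= C" using test_bounded[OF test_smooth_mult[OF qd_smooth assms]] by blast
 moreover have "\<bar>qd x * r x\<bar> = \<bar>r x\<bar> * qd x" for x using qd_ge_1[of x] by (simp add: abs_mult)
 ultimately show ?thesis by auto
qed

text \<open>A factor with compact support in x turns weighted convergence of a field and its
  gradient into H1 convergence. In the x derivative the derivative of \<open>r\<close> contributes a
  second convergent term.\<close>

lemma conv_cut:
 assumes c: "conv E g" "conv (%n. dx (E n)) gx" "conv (%n. dz (E n)) gz" and r: "r \<in> test (UNIV :: real set)"
 defines "R \<equiv> %n p. r (fst p) * E n p"
 shows "R n \<in> test \<Omega>"
  "(%n. l2 lom (%p. R n p - r (fst p) * g p)) ---> 0"
  "(%n. l2 lom (%p. dx (R n) p - (r (fst p) * gx p + pd 1 r (fst p) * g p))) ---> 0"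
  "(%n. l2 lom (%p. dz (R n) p - r (fst p) * gz p)) ---> 0"
  "weak_grad (%p. r (fst p) * g p) (%p. r (fst p) * gx p + pd 1 r (fst p) * g p) (%p. r (fst p) * gz p)"
proof -
 have sr: "smooth r" by (rule test_smooth[OF r])
 have r': "pd 1 r \<in> test UNIV" by (rule test_pd[OF r]) simp
 have E: "E n \<in> test \<Omega>" for n using c(1) by (simp add: conv_def)
 show R: "R n \<in> test \<Omega>" for n unfolding R_def by (rule test_smooth_mult[OF smooth_fst[OF sr] E])
 obtain C where C: "!!x. \<bar>r x\<bar> * qd x <= C" using test_real_qd_bound[OF r] by blast
 obtain C' where C': "!!x. \<bar>pd 1 r x\<bar> * qd x <= C'" using test_real_qd_bound[OF r'] by blast
 have m: "(%p::point. r (fst p)) \<in> bmeas" "(%p::point. pd 1 r (fst p)) \<in> bmeas"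
  by (rule smooth_measurable[OF smooth_fst[OF sr]] smooth_measurable[OF smooth_fst[OF smooth_deriv[OF sr]]])+
 note c1 = conv_mult[OF c(1) m(1) C] and c1' = conv_mult[OF c(1) m(2) C']
  and c2 = conv_mult[OF c(2) m(1) C] and c3 = conv_mult[OF c(3) m(1) C]
 have dR: "dx (R n) = (%p. r (fst p) * dx (E n) p + pd 1 r (fst p) * E n p)" "dz (R n) = (%p. r (fst p) * dz (E n) p)" for n
  unfolding R_def using smooth_fst[OF sr] test_smooth[OF E]
  by (auto simp: pd_smooth_mult pd_fst[OF sr] fun_eq_iff)
 show l1: "(%n. l2 lom (%p. R n p - r (fst p) * g p)) ---> 0" unfolding R_def by (rule c1(2))
 show l3: "(%n. l2 lom (%p. dz (R n) p - r (fst p) * gz p)) ---> 0" unfolding dR by (rule c3(2))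
 show l2: "(%n. l2 lom (%p. dx (R n) p - (r (fst p) * gx p + pd 1 r (fst p) * g p))) ---> 0"
 proof (rule Lim_null_comparison[OF always_eventually])
  show "(%n. l2 lom (%p. r (fst p) * dx (E n) p - r (fst p) * gx p) + l2 lom (%p. pd 1 r (fst p) * E n p - pd 1 r (fst p) * g p)) ---> 0"
   using tendsto_add[OF c2(2) c1'(2)] by simp
  show "\<forall>n. norm (l2 lom (%p. dx (R n) p - (r (fst p) * gx p + pd 1 r (fst p) * g p)))
    <= l2 lom (%p. r (fst p) * dx (E n) p - r (fst p) * gx p) + l2 lom (%p. pd 1 r (fst p) * E n p - pd 1 r (fst p) * g p)"
  proof
   fix n
   have s: "(%p. r (fst p) * dx (E n) p - r (fst p) * gx p) \<in> sqi lom"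
    by (rule sqi_diff[OF test_sqi_lom[OF test_smooth_mult[OF smooth_fst[OF sr] test_dx[OF E]]] c2(1)])
   have s': "(%p. pd 1 r (fst p) * E n p - pd 1 r (fst p) * g p) \<in> sqi lom"
    by (rule sqi_diff[OF test_sqi_lom[OF test_smooth_mult[OF smooth_fst[OF smooth_deriv[OF sr]] E]] c1'(1)])
   have "(%p. dx (R n) p - (r (fst p) * gx p + pd 1 r (fst p) * g p)) =
    (%p. (r (fst p) * dx (E n) p - r (fst p) * gx p) + (pd 1 r (fst p) * E n p - pd 1 r (fst p) * g p))"
    by (simp add: dR fun_eq_iff)
   then show "norm (l2 lom (%p. dx (R n) p - (r (fst p) * gx p + pd 1 r (fst p) * g p)))
    <= l2 lom (%p. r (fst p) * dx (E n) p - r (fst p) * gx p) + l2 lom (%p. pd 1 r (fst p) * E n p - pd 1 r (fst p) * g p)"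
    using l2_triangle[OF s s'] by simp
  qed
 qed
 show "weak_grad (%p. r (fst p) * g p) (%p. r (fst p) * gx p + pd 1 r (fst p) * g p) (%p. r (fst p) * gz p)"
  by (rule weak_grad_limit[OF weak_grad_test[OF R] c1(1) sqi_add[OF c2(1) c1'(1)] c3(1) l1 l2 l3])
qed

context cutoff_fun
begin

text \<open>The cut approximants are test functions on the open strip; they vanish on its boundary,
  so the same sequence witnesses the zero trace of the limit.\<close>

lemma conv_cut_fun:
 assumes c: "conv E g" "conv (%n. dx (E n)) gx" "conv (%n. dz (E n)) gz"
 shows "cut_fun chi k g \<in> H1" "has_trace (cut_fun chi k g) (%_. 0)"
  "(%n. n1 (cut_fun chi k (E n)) (dx (cut_fun chi k (E n))) (dz (cut_fun chi k (E n)))) ---> H1_norm (cut_fun chi k g)"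
proof -
 note r = chi_shift_test[of "of_int k"]
 note cc = conv_cut[OF c r]
 have cf: "cut_fun chi k h = (%p. chi (fst p - of_int k) * h p)" for h by (simp add: cut_fun_def)
 show H1: "cut_fun chi k g \<in> H1" unfolding cf by (rule weak_grad_H1[OF cc(5)])
 note lim = H10I(1)[OF cc(5) cc(1) cc(2) cc(3) cc(4)]
 have bd: "chi (fst (x, b) - of_int k) * E n (x, b) = 0" if "b \<in> {0, 1}" for x b n
  using test_Omega_zero[of "E n" b x] c(1) that by (auto simp: conv_def)
 show "has_trace (cut_fun chi k g) (%_. 0)"
  unfolding has_trace_def
 proof (intro conjI ballI H1 exI[of _ "%n p. chi (fst p - of_int k) * E n p"] allI)
  show "(%p. chi (fst p - of_int k) * E n p) \<in> test UNIV" for n by (rule test_UNIV[OF cc(1)])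
  show "(%n. H1_norm (%p. chi (fst p - of_int k) * E n p - cut_fun chi k g p)) ---> 0" unfolding cf by (rule lim)
  show "(%n. LINT x|lborel. (chi (fst (x, b) - of_int k) * E n (x, b) - 0)^2) ---> 0" if "b \<in> {0, 1}" for b :: real
  proof -
   have "(chi (fst (x, b) - of_int k) * E n (x, b) - 0)^2 = 0" for x n
    unfolding bd[OF that] by simp
   then show ?thesis by (simp only: Bochner_Integration.integral_zero tendsto_const)
  qed
 qed auto
 show "(%n. n1 (cut_fun chi k (E n)) (dx (cut_fun chi k (E n))) (dz (cut_fun chi k (E n)))) ---> H1_norm (cut_fun chi k g)"
  unfolding cf H1_norm_eq[OF cc(5)]
  by (rule n1_tendsto[OF test_sqi_lom[OF cc(1)] test_sqi_lom[OF test_dx[OF cc(1)]] test_sqi_lom[OF test_dz[OF cc(1)]] _ _ _ cc(2,3,4)])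
   (use cc(5) in \<open>auto simp: weak_grad_def\<close>)
qed

text \<open>The constant 6 is 3 * 2: the product rule with \<open>chi\<close>, and the weight
  centred at k being at least 1/2 within distance 2 of k. This is where a weighted bound becomes a
  bound on one cell.\<close>

lemma n1_cut_sq:
 assumes g: "g \<in> test \<Omega>" and gJ: "!!p. (g p)^2 + (dx g p)^2 + (dz g p)^2 <= jsq (jet \<eta> p)"
  and \<eta>: "\<eta> \<in> test \<Omega>"
 shows "(n1 (cut_fun chi k g) (dx (cut_fun chi k g)) (dz (cut_fun chi k g)))^2 <= 6 * L\<^sup>2 * energy (of_int k) \<eta>"
proof -
 let ?h = "%p. chi (fst p - of_int k) * g p"
 have sz: "smooth (%x. chi (x - of_int k))" by (rule chi_shift_smooth)
 have sg: "smooth g" by (rule test_smooth[OF g])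
 have h: "?h \<in> test \<Omega>" by (rule test_smooth_mult[OF smooth_fst[OF sz] g])
 have dh: "dx ?h = (%p. pd 1 chi (fst p - of_int k) * g p + chi (fst p - of_int k) * dx g p)"
  "dz ?h = (%p. chi (fst p - of_int k) * dz g p)"
  using smooth_fst[OF sz] sg by (auto simp: pd_smooth_mult pd_fst[OF sz] pd_shift[OF chi_smooth])
 have m: "(t * y)^2 <= L\<^sup>2 * y\<^sup>2" if "\<bar>t\<bar> <= L" for t y
  using that L_ge by (simp add: power_mult_distrib abs_le_square_iff[symmetric] mult_right_mono)
 have pt: "(?h p)^2 + (dx ?h p)^2 + (dz ?h p)^2 <= 6 * L\<^sup>2 * (wt (of_int k) (fst p) * jsq (jet \<eta> p))" for p
 proof (cases "\<bar>fst p - of_int k\<bar> <= 2")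
  case True
  have two: "(x + y)^2 <= 2 * x\<^sup>2 + 2 * y\<^sup>2" for x y :: real
   using sum_squares_bound[of x y] by (simp add: power2_eq_square algebra_simps)
  have "(?h p)^2 + (dx ?h p)^2 + (dz ?h p)^2
    <= L\<^sup>2 * (g p)^2 + (2 * (L\<^sup>2 * (g p)^2) + 2 * (L\<^sup>2 * (dx g p)^2)) + L\<^sup>2 * (dz g p)^2"
   unfolding dh using m[OF L_bounds(1)[of "fst p - of_int k"], of "g p"] m[OF L_bounds(2)[of "fst p - of_int k"], of "g p"]
    m[OF L_bounds(1)[of "fst p - of_int k"], of "dx g p"] m[OF L_bounds(1)[of "fst p - of_int k"], of "dz g p"]
    two[of "pd 1 chi (fst p - of_int k) * g p" "chi (fst p - of_int k) * dx g p"] by linarith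
  also have "\<dots> <= 3 * L\<^sup>2 * ((g p)^2 + (dx g p)^2 + (dz g p)^2)" by (simp add: algebra_simps)
  also have "\<dots> <= 3 * L\<^sup>2 * jsq (jet \<eta> p)" by (rule mult_left_mono[OF gJ]) simp
  also have "\<dots> <= 3 * L\<^sup>2 * ((2 * wt (of_int k) (fst p)) * jsq (jet \<eta> p))"
  proof -
   have "(fst p - of_int k)^2 <= 4" using power_mono[OF True, of 2] by simp
   then have "1 <= 2 * wt (of_int k) (fst p)"
    using wt_denom[of "fst p" "of_int k"] by (simp add: wt_def field_simps)
   then have "1 * jsq (jet \<eta> p) <= (2 * wt (of_int k) (fst p)) * jsq (jet \<eta> p)" by (rule mult_right_mono[OF _ jsq_nonneg])
   then show ?thesis by (intro mult_left_mono) auto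
  qed
  finally show ?thesis by (simp add: mult.assoc)
 next
  case False
  then have "chi (fst p - of_int k) = 0" by (intro chi_0) linarith
  moreover have "pd 1 chi (fst p - of_int k) = 0"
   by (rule pd_zero_outside[of "{-2..2}"]) (use False in \<open>auto intro!: chi_0\<close>)
  ultimately show ?thesis unfolding dh by (simp add: wt_pos less_imp_le jsq_nonneg)
 qed
 have "(n1 ?h (dx ?h) (dz ?h))^2 <= (LBINT p. 6 * L\<^sup>2 * (wt (of_int k) (fst p) * jsq (jet \<eta> p)))"
  unfolding n1_test_sq[OF h]
 proof (rule integral_mono)
  show "integrable lborel (%p. (?h p)^2 + (dx ?h p)^2 + (dz ?h p)^2)"
   by (intro Bochner_Integration.integrable_add sqi_integrable test_sqi[of _ \<Omega>] h test_dx test_dz)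
  show "integrable lborel (%p. 6 * L\<^sup>2 * (wt (of_int k) (fst p) * jsq (jet \<eta> p)))"
   by (rule integrable_mult_right[OF energy_integrable[OF \<eta>]])
 qed (rule pt)
 then show ?thesis by (simp add: energy_def cut_fun_def)
qed

end

context stokes_seq
begin

definition K0 :: real where "K0 = sqrt (6 * L\<^sup>2) * (10 * C0)"

lemma H1_norm_cut_bound:
 assumes c: "conv E g" "conv (%n. dx (E n)) gx" "conv (%n. dz (E n)) gz"
  and EJ: "!!n p. (E n p)^2 + (dx (E n) p)^2 + (dz (E n) p)^2 <= jsq (jet (\<psi> n) p)"
 shows "H1_norm (cut_fun chi k g) <= K0 * M"
proof -
 obtain B where B: "!!n. sqrt (energy (of_int k) (\<psi> n)) <= 10 * C0 * M + sqrt (B * inverse (real (Suc n)))"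
  using uniform_bound[of k] by blast
 have E: "E n \<in> test \<Omega>" for n using c(1) by (simp add: conv_def)
 have "n1 (cut_fun chi k (E n)) (dx (cut_fun chi k (E n))) (dz (cut_fun chi k (E n)))
   <= sqrt (6 * L\<^sup>2) * (10 * C0 * M + sqrt (B * inverse (real (Suc n))))" for n
 proof -
  have "n1 (cut_fun chi k (E n)) (dx (cut_fun chi k (E n))) (dz (cut_fun chi k (E n))) <= sqrt (6 * L\<^sup>2 * energy (of_int k) (\<psi> n))"
   by (rule real_le_rsqrt[OF n1_cut_sq[OF E EJ \<psi>]])
  also have "\<dots> = sqrt (6 * L\<^sup>2) * sqrt (energy (of_int k) (\<psi> n))" by (rule real_sqrt_mult)
  also have "\<dots> <= sqrt (6 * L\<^sup>2) * (10 * C0 * M + sqrt (B * inverse (real (Suc n))))" by (rule mult_left_mono[OF B]) simp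
  finally show ?thesis .
 qed
 moreover have "(%n. sqrt (6 * L\<^sup>2) * (10 * C0 * M + sqrt (B * inverse (real (Suc n))))) ---> sqrt (6 * L\<^sup>2) * (10 * C0 * M + sqrt (B * 0))"
  by (intro tendsto_intros LIMSEQ_inverse_real_of_nat)
 ultimately have "H1_norm (cut_fun chi k g) <= sqrt (6 * L\<^sup>2) * (10 * C0 * M + sqrt (B * 0))"
  using LIMSEQ_le[OF conv_cut_fun(3)[OF c]] by blast
 then show ?thesis by (simp add: K0_def mult.assoc)
qed

lemma dz_dx_psi: "dz (dx (\<psi> n)) = dx (dz (\<psi> n))"
 by (rule pd_commute[OF test_smooth[OF \<psi>]])

lemma pd_uminus: "smooth h ==> pd v (%p. - h p) = (%p. - pd v h p)"
 using pd_lin[of h h v "-1" 0] by simp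

text \<open>Each \<open>\<psi> n\<close> vanishes at z = 0 and z = 1, so its z derivative integrates
  to 0 on every vertical line. Over a range bounded in x the integral is a continuous functional of
  the weighted limit.\<close>

lemma slab_integral_0:
 assumes gz: "conv (%n. dz (\<psi> n)) gz" and A: "A \<in> sets borel" "A \<subseteq> {-R..R}"
 shows "(LINT p|lom. indicator A (fst p) * gz p) = 0"
proof -
 let ?i = "indicator (cbox (-R, 0) (R, 1)) :: point => real"
 have [measurable]: "A \<in> sets borel" by (rule A)
 have m: "(%p::point. indicator A (fst p) :: real) \<in> bmeas"
 proof -
  have "(%p::point. indicator A (fst p) :: real) \<in> borel_measurable (borel \<Otimes>\<^sub>M borel)" by measurable
  then show ?thesis by (simp only: borel_prod)
 qed
 have b: "\<bar>indicator A (fst p)\<bar> * qd (fst p) <= 1 + R\<^sup>2 / 100" for p :: point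
 proof (cases "fst p \<in> A")
  case True
  then have "fst p \<in> {- R..R}" using A(2) by blast
  then have "\<bar>fst p\<bar> <= R" by (simp add: abs_le_iff)
  then have "\<bar>fst p\<bar>\<^sup>2 <= R\<^sup>2" by (rule power_mono) simp
  then show ?thesis using True by (simp add: qd_def)
 qed simp
 note cm = conv_mult[OF gz m b]
 have i: "?i \<in> sqi lom" by (rule sqi_lborel_lom[OF indicator_cbox_sqi])
 have t: "dz (\<psi> n) \<in> test \<Omega>" for n by (rule test_dz[OF \<psi>])
 have s: "(%p. indicator A (fst p) * dz (\<psi> n) p) \<in> sqi lom" for n
  by (rule sqi_bounded_mult[OF test_sqi_lom[OF t], where C=1]) (rule lom_measurable_borel[OF m], simp add: indicator_def)
 have "(%n. \<integral>p. indicator A (fst p) * dz (\<psi> n) p * ?i p \<partial>lom) ---> (LINT p|lom. indicator A (fst p) * gz p * ?i p)"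
  by (rule l2_tendsto_inner[OF s i cm(1) i cm(2)]) (simp add: l2_def)
 moreover have "(LINT p|lom. indicator A (fst p) * h p * ?i p) = (LINT p|lom. indicator A (fst p) * h p)" for h
 proof (rule LINT_cong)
  fix p assume "p \<in> space lom"
  then show "indicator A (fst p) * h p * ?i p = indicator A (fst p) * h p"
   using A(2) by (cases p) (auto simp: indicator_def mem_Omega cbox_Pair_eq)
 qed simp
 moreover have "(LINT p|lom. indicator A (fst p) * dz (\<psi> n) p) = 0" for n
 proof -
  have sm: "smooth (\<psi> n)" by (rule test_smooth[OF \<psi>])
  have "(LINT p|lom. indicator A (fst p) * dz (\<psi> n) p) = (LBINT p. indicator A (fst p) * dz (\<psi> n) p)"
   by (rule test_lom_integral) (simp add: test_outside[OF t])
  moreover have int: "integrable lborel (%p. indicator A (fst p) * dz (\<psi> n) p)"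
   by (rule Bochner_Integration.integrable_bound[OF test_integrable[OF t[of n]]])
    (use m test_measurable[OF t[of n]] in \<open>auto simp: indicator_def\<close>)
  have i: "integrable (lborel \<Otimes>\<^sub>M lborel) (%p. indicator A (fst p) * dz (\<psi> n) p)"
   unfolding lborel_prod by (rule int)
  have "(LBINT z. dz (\<psi> n) (x, z)) = 0" for x
  proof (rule integral_deriv_eq_0[where g="%z. \<psi> n (x, z)" and R=2])
   show "continuous_on UNIV (%z. dz (\<psi> n) (x, z))"
    by (rule continuous_on_compose2[OF smooth_continuous[OF smooth_dz[OF sm], of UNIV]]) (auto intro!: continuous_intros)
  qed (auto intro!: smooth_slice_z[OF sm] test_Omega_zero[OF \<psi>] test_Omega_zero[OF t])
  then have "(LBINT x. (LBINT z. indicator A x * dz (\<psi> n) (x, z))) = (0::real)" by simp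
  then have "(LBINT p. indicator A (fst p) * dz (\<psi> n) p) = 0"
   using lborel_pair.integral_fst'[OF i] by (simp add: lborel_prod)
  ultimately show ?thesis by simp
 qed
 ultimately show ?thesis using LIMSEQ_unique[OF _ tendsto_const] by simp
qed

text \<open>The vertical integrals have integral 0 over every interval, so the box criterion in
  dimension one makes them vanish almost everywhere. Integrability holds on bounded ranges of x,
  hence the exhaustion by the countably many [-R, R].\<close>

lemma limit_zero_flux:
 assumes gz: "conv (%n. dz (\<psi> n)) gz"
 shows "AE x in lborel. (LINT z:{0<..<1}|lborel. gz (x, z)) = 0"
proof -
 have 1: "AE x in lborel. x \<in> {- real R..real R} --> (LINT z:{0<..<1}|lborel. gz (x, z)) = 0" for R :: nat
 proof -
  define h where "h p = indicator {- real R..real R} (fst p) * (indicator \<Omega> p * gz p)" for p :: point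
  have sw: "(%p. sw p * gz p) \<in> sqi lom" using gz by (simp add: conv_def)
  have hs: "h \<in> sqi lborel & (LBINT x. h x) = 0"
  proof -
   have m: "(%p::point. indicator {- real R..real R} (fst p) :: real) \<in> bmeas"
   proof -
    have "(%p::point. indicator {- real R..real R} (fst p) :: real) \<in> borel_measurable (borel \<Otimes>\<^sub>M borel)" by measurable
    then show ?thesis by (simp only: borel_prod)
   qed
   have b: "\<bar>indicator {- real R..real R} (fst p)\<bar> * qd (fst p) <= 1 + (real R)^2 / 100" for p :: point
   proof (cases "fst p \<in> {- real R..real R}")
    case True
    then have "\<bar>fst p\<bar> <= real R" by auto
    then have "\<bar>fst p\<bar>\<^sup>2 <= (real R)^2" by (rule power_mono) simp
    then show ?thesis using True by (simp add: qd_def)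
   qed simp
   have "(%p. indicator {- real R..real R} (fst p) * gz p) \<in> sqi lom" by (rule conv_mult(1)[OF gz m b])
   then have "(%p. indicator \<Omega> p * (indicator {- real R..real R} (fst p) * gz p)) \<in> sqi lborel" by (simp only: sqi_lom)
   moreover have "(%p. indicator \<Omega> p * (indicator {- real R..real R} (fst p) * gz p)) = h"
    by (simp add: h_def fun_eq_iff)
   moreover have "(LINT p|lom. indicator {- real R..real R} (fst p) * gz p) = 0"
    by (rule slab_integral_0[OF gz, of _ "real R"]) auto
   ultimately show ?thesis by (simp only: lom_integral)
  qed
  have hi: "integrable lborel h"
  proof -
   have "integrable lborel (%p. indicator (cbox (- real R, 0) (real R, 1)) p * h p)"
    by (rule sqi_mult[OF indicator_cbox_sqi]) (use hs in blast)
   also have "(%p. indicator (cbox (- real R, 0) (real R, 1)) p * h p) = h"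
    by (auto simp: h_def fun_eq_iff indicator_def cbox_Pair_eq Omega_def)
   finally show ?thesis .
  qed
  have hi': "integrable (lborel \<Otimes>\<^sub>M lborel) h" unfolding lborel_prod by (rule hi)
  define G where "G x = (LBINT z. h (x, z))" for x
  have Gi: "integrable lborel G" unfolding G_def using lborel_pair.integrable_fst'[OF hi'] by simp
  have "AE x in lborel. G x = 0"
  proof (rule AE_eq_0_if_box_integrals_0[OF Gi])
   show "(LBINT x. G x) = 0" unfolding G_def using lborel_pair.integral_fst'[OF hi'] hs by (simp add: lborel_prod)
   fix c d :: real
   let ?A = "box c d \<inter> {- real R..real R}"
   have mm: "(%p::point. indicator (box c d) (fst p) :: real) \<in> bmeas"
   proof -
    have "(%p::point. indicator (box c d) (fst p) :: real) \<in> borel_measurable (borel \<Otimes>\<^sub>M borel)" by measurable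
    then show ?thesis by (simp only: borel_prod)
   qed
   have "integrable lborel (%p. indicator (box c d) (fst p) * h p)"
    by (rule Bochner_Integration.integrable_bound[OF hi]) (use hi mm in \<open>auto simp: indicator_def\<close>)
   then have i: "integrable (lborel \<Otimes>\<^sub>M lborel) (%p. indicator (box c d) (fst p) * h p)" unfolding lborel_prod .
   have "(LBINT x. indicator (box c d) x * G x) = (LBINT p. indicator (box c d) (fst p) * h p)"
    using lborel_pair.integral_fst'[OF i] by (simp add: G_def lborel_prod)
   also have "\<dots> = (LINT p|lom. indicator ?A (fst p) * gz p)"
    unfolding lom_integral by (rule LINT_cong) (auto simp: h_def indicator_def)
   also have "\<dots> = 0" by (rule slab_integral_0[OF gz]) auto
   finally show "(LBINT x. indicator (box c d) x * G x) = 0" .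
  qed
  then show ?thesis
  proof (rule AE_mp, intro AE_I2 impI)
   fix x assume G0: "G x = 0" and x: "x \<in> {- real R..real R}"
   have "(LINT z:{0<..<1}|lborel. gz (x, z)) = G x"
    unfolding G_def set_lebesgue_integral_def h_def using x
    by (intro LINT_cong) (auto simp: indicator_def Omega_def)
   with G0 show "(LINT z:{0<..<1}|lborel. gz (x, z)) = 0" by simp
  qed
 qed
 have "AE x in lborel. \<forall>R::nat. x \<in> {- real R..real R} --> (LINT z:{0<..<1}|lborel. gz (x, z)) = 0"
  unfolding AE_all_countable using 1 by blast
 then show ?thesis
 proof (rule AE_mp, intro AE_I2 impI)
  fix x :: real assume *: "\<forall>R::nat. x \<in> {- real R..real R} --> (LINT z:{0<..<1}|lborel. gz (x, z)) = 0"
  obtain R where "\<bar>x\<bar> < real R" using reals_Archimedean2 by blast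
  then have "x \<in> {- real R..real R}" by auto
  with * show "(LINT z:{0<..<1}|lborel. gz (x, z)) = 0" by blast
 qed
qed

lemma limit_divergence:
 assumes gx: "conv (%n. dx (\<psi> n)) gx" and gz: "conv (%n. dz (\<psi> n)) gz" and ph: "ph \<in> test \<Omega>"
 shows "(LINT p|lom. gz p * dx ph p) = (LINT p|lom. gx p * dz ph p)"
proof -
 have eq: "(LINT p|lom. dz (\<psi> n) p * dx ph p) = (LINT p|lom. dx (\<psi> n) p * dz ph p)" for n
  using test_lom_parts[OF test_dz[OF \<psi>[of n]] ph, of e\<^sub>x] test_lom_parts[OF test_dx[OF \<psi>[of n]] ph, of e\<^sub>z]
  by (simp add: dz_dx_psi)
 show ?thesis
  using conv_inner(1)[OF gz test_dx[OF ph]] conv_inner(1)[OF gx test_dz[OF ph]] LIMSEQ_unique unfolding eq by blast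
qed

text \<open>For each n, integration by parts places three derivatives on \<open>\<eta>\<close> and
  one on \<open>\<psi> n\<close>, so the corresponding expression with
  \<open>bform (\<psi> n) \<eta>\<close> is 0. Every term passes to the limit in this form.\<close>

lemma limit_curl:
 assumes gx: "conv (%n. dx (\<psi> n)) gx" and gz: "conv (%n. dz (\<psi> n)) gz" and \<eta>: "\<eta> \<in> test \<Omega>"
 shows "curlf f \<eta> + ((LINT p|lom. gz p * dx (dx (dz \<eta>)) p) + (LINT p|lom. gz p * dz (dz (dz \<eta>)) p))
  + ((LINT p|lom. gx p * dx (dx (dx \<eta>)) p) + (LINT p|lom. gx p * dz (dz (dx \<eta>)) p)) = 0"
proof -
 note t = test_dx[OF \<eta>] test_dz[OF \<eta>]
 have "(%n. bform (\<psi> n) \<eta> + ((LINT p|lom. dz (\<psi> n) p * dx (dx (dz \<eta>)) p) + (LINT p|lom. dz (\<psi> n) p * dz (dz (dz \<eta>)) p))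
  + ((LINT p|lom. dx (\<psi> n) p * dx (dx (dx \<eta>)) p) + (LINT p|lom. dx (\<psi> n) p * dz (dz (dx \<eta>)) p)))
  ---> curlf f \<eta> + ((LINT p|lom. gz p * dx (dx (dz \<eta>)) p) + (LINT p|lom. gz p * dz (dz (dz \<eta>)) p))
  + ((LINT p|lom. gx p * dx (dx (dx \<eta>)) p) + (LINT p|lom. gx p * dz (dz (dx \<eta>)) p))"
  by (intro tendsto_add bform_limit[OF \<eta>] conv_inner(1)[OF gx, where S=\<Omega>] conv_inner(1)[OF gz, where S=\<Omega>] test_dx test_dz \<eta>)
 moreover have "bform (\<psi> n) \<eta> + ((LINT p|lom. dz (\<psi> n) p * dx (dx (dz \<eta>)) p) + (LINT p|lom. dz (\<psi> n) p * dz (dz (dz \<eta>)) p))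
  + ((LINT p|lom. dx (\<psi> n) p * dx (dx (dx \<eta>)) p) + (LINT p|lom. dx (\<psi> n) p * dz (dz (dx \<eta>)) p)) = 0" for n
 proof -
  let ?I = "%a b. \<integral>p. a p * b p \<partial>lborel"
  note ts = test_dx[OF test_dx[OF \<psi>[of n]]] test_dx[OF test_dz[OF \<psi>[of n]]] test_dz[OF test_dz[OF \<psi>[of n]]]
  note te = test_dx[OF t(1)] test_dx[OF t(2)] test_dz[OF t(2)]
  have lb: "(LINT p|lom. a p * b p) = ?I a b" if "a \<in> test \<Omega>" for a b :: "point => real"
   by (rule test_lom_integral) (simp add: test_outside[OF that])
  have i: "integrable lborel (%p. a p * b p)" if "a \<in> test \<Omega>" "b \<in> test \<Omega>" for a b :: "point => real"
   by (rule sqi_mult[OF test_sqi[OF that(1)] test_sqi[OF that(2)]])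
  have "bform (\<psi> n) \<eta> = ?I (dx (dx (\<psi> n))) (dx (dx \<eta>)) + 2 * ?I (dx (dz (\<psi> n))) (dx (dz \<eta>)) + ?I (dz (dz (\<psi> n))) (dz (dz \<eta>))"
   using i[OF ts(1) te(1)] i[OF ts(2) te(2)] i[OF ts(3) te(3)]
   by (simp add: bform_def jform_def jet_def)
  then show ?thesis
   using test_lom_parts[OF test_dz[OF \<psi>[of n]] te(2), of e\<^sub>x] test_lom_parts[OF test_dz[OF \<psi>[of n]] te(3), of e\<^sub>z]
    test_lom_parts[OF test_dx[OF \<psi>[of n]] te(1), of e\<^sub>x] test_lom_parts[OF test_dx[OF \<psi>[of n]] te(2), of e\<^sub>z]
    lb[OF ts(1), of "dx (dx \<eta>)"] lb[OF ts(2), of "dx (dz \<eta>)"] lb[OF ts(3), of "dz (dz \<eta>)"]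
   by (simp add: dz_dx_psi pd_commute[OF test_smooth[OF \<eta>]])
 qed
 ultimately show ?thesis using LIMSEQ_unique[OF _ tendsto_const] by simp
qed

end

section \<open>The pressure\<close>

lemma param_has_derivative:
 fixes F A B :: "point => real => real"
 assumes d: "!!p t. t \<in> {0..1} ==> ((%p. F p t) has_derivative (%h. fst h * A p t + snd h * B p t)) (at p)"
  and cA: "continuous_on (UNIV \<times> {0..1}) (%(p, t). A p t)" and cB: "continuous_on (UNIV \<times> {0..1}) (%(p, t). B p t)"
  and cF: "!!p. continuous_on {0..1} (F p)"
 shows "((%p. integral {0..1} (F p)) has_derivative (%h. fst h * integral {0..1} (A p) + snd h * integral {0..1} (B p))) (at p)"
proof -
 define fx :: "point => real => (point \<Rightarrow>\<^sub>L real)"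
  where "fx p t = A p t *\<^sub>R fst_blinfun + B p t *\<^sub>R snd_blinfun" for p t
 have ap: "blinfun_apply (fx p t) = (%h. fst h * A p t + snd h * B p t)" for p t
  by (simp add: fx_def fun_eq_iff blinfun.bilinear_simps)
 have cA': "continuous_on {0..1} (A p)" and cB': "continuous_on {0..1} (B p)" for p
 proof -
  have c: "continuous_on {0..1} (%t::real. (p, t))" by (intro continuous_intros)
  have im: "(%t. (p, t)) ` {0..1} \<subseteq> UNIV \<times> {0..1}" by auto
  show "continuous_on {0..1} (A p)" using continuous_on_compose2[OF cA c im] by simp
  show "continuous_on {0..1} (B p)" using continuous_on_compose2[OF cB c im] by simp
 qed
 have "((%p. integral (cbox 0 1) (F p)) has_derivative integral (cbox 0 1) (fx p)) (at p within UNIV)"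
 proof (rule leibniz_rule)
  show "((%x. F x t) has_derivative blinfun_apply (fx x t)) (at x within UNIV)" if "t \<in> cbox 0 1" for x t
   using d[of t x] that by (simp add: ap)
  show "F x integrable_on cbox 0 1" for x using cF[of x] by (auto intro: integrable_continuous_interval)
  show "continuous_on (UNIV \<times> cbox 0 1) (%(x, t). fx x t)"
   using cA cB unfolding fx_def by (auto simp: case_prod_unfold intro!: continuous_intros)
 qed auto
 moreover have "integral (cbox 0 1) (fx p) = integral {0..1} (A p) *\<^sub>R fst_blinfun + integral {0..1} (B p) *\<^sub>R snd_blinfun"
  unfolding fx_def
  by (rule integral_unique, rule has_integral_add)
   (auto intro!: has_integral_scaleR_left integrable_integral integrable_continuous_interval cA' cB')
 moreover have "blinfun_apply (integral {0..1} (A p) *\<^sub>R fst_blinfun + integral {0..1} (B p) *\<^sub>R snd_blinfun)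
   = (%h. fst h * integral {0..1} (A p) + snd h * integral {0..1} (B p))"
  by (simp add: blinfun.bilinear_simps fun_eq_iff)
 ultimately show ?thesis by simp
qed

text \<open>Integrals of \<open>ph\<close> along affinely parametrised segments. Differentiation in
  the plane only replaces \<open>q\<close> by \<open>q * a\<close> or \<open>q * b\<close> and
  \<open>ph\<close> by a derivative, so the family is closed under partial derivatives and hence
  smooth.\<close>

definition pint :: "(real => real) => (real => real) => (real => real) => (real => real) => (real => real) =>
  (point => real) => point => real" where
 "pint q a c b e ph p = integral {0..1} (%t. q t * ph (a t * fst p + c t, b t * snd p + e t))"

context
 fixes q a c b e :: "real => real"
 assumes cont: "continuous_on {0..1} q" "continuous_on {0..1} a" "continuous_on {0..1} c" "continuous_on {0..1} b" "continuous_on {0..1} e"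
begin

lemma pint_cont:
 assumes "smooth ph"
 shows "continuous_on (UNIV \<times> {0..1}) (%(p, t). q t * ph (a t * fst p + c t, b t * snd p + e t))"
proof -
 have "continuous_on (UNIV \<times> {0..1}) (%x :: point \<times> real. h (snd x))" if "continuous_on {0..1} h" for h :: "real => real"
  by (rule continuous_on_compose2[OF that]) (auto intro!: continuous_intros)
 note [continuous_intros] = this[OF cont(1)] this[OF cont(2)] this[OF cont(3)] this[OF cont(4)] this[OF cont(5)]
 show ?thesis unfolding case_prod_unfold
  by (intro continuous_intros continuous_on_compose2[OF smooth_continuous[OF assms, of UNIV]]) auto
qed

lemma pint_cont1:
 assumes "smooth ph"
 shows "continuous_on {0..1} (%t. q t * ph (a t * x + c t, b t * z + e t))"
proof -
 have c: "continuous_on {0..1} (%t::real. ((x, z), t))" by (intro continuous_intros)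
 have "(%t. ((x, z), t)) ` {0..1} \<subseteq> UNIV \<times> {0..1}" by auto
 from continuous_on_compose2[OF pint_cont[OF assms] c this] show ?thesis by simp
qed

end

lemma pint_has_derivative:
 assumes cont: "continuous_on {0..1} q" "continuous_on {0..1} a" "continuous_on {0..1} c" "continuous_on {0..1} b" "continuous_on {0..1} e"
  and ph: "smooth ph"
 shows "(pint q a c b e ph has_derivative
  (%h. fst h * pint (%t. q t * a t) a c b e (dx ph) p + snd h * pint (%t. q t * b t) a c b e (dz ph) p)) (at p)"
 unfolding pint_def[abs_def]
proof (rule param_has_derivative)
 have qa: "continuous_on {0..1} (%t. q t * a t)" and qb: "continuous_on {0..1} (%t. q t * b t)"
  by (intro continuous_intros cont)+
 fix p :: point and t :: real
 show "((%p. q t * ph (a t * fst p + c t, b t * snd p + e t)) has_derivative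
   (%h. fst h * (q t * a t * dx ph (a t * fst p + c t, b t * snd p + e t))
    + snd h * (q t * b t * dz ph (a t * fst p + c t, b t * snd p + e t)))) (at p)"
 proof -
  have "((%p. ph (a t * fst p + c t, b t * snd p + e t)) has_derivative
    (%h. fst (a t * fst h, b t * snd h) * dx ph (a t * fst p + c t, b t * snd p + e t)
     + snd (a t * fst h, b t * snd h) * dz ph (a t * fst p + c t, b t * snd p + e t))) (at p)"
   by (rule has_derivative_compose[where f="%p. (a t * fst p + c t, b t * snd p + e t)", OF _ smooth_has_derivative_point[OF ph]])
    (auto intro!: derivative_eq_intros)
  from has_derivative_mult_right[OF this, of "q t"] show ?thesis by (simp add: algebra_simps)
 qed
 show "continuous_on (UNIV \<times> {0..1}) (%(p, t). q t * a t * dx ph (a t * fst p + c t, b t * snd p + e t))"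
  by (rule pint_cont[OF qa cont(2-5) smooth_dx[OF ph]])
 show "continuous_on (UNIV \<times> {0..1}) (%(p, t). q t * b t * dz ph (a t * fst p + c t, b t * snd p + e t))"
  by (rule pint_cont[OF qb cont(2-5) smooth_dz[OF ph]])
 show "continuous_on {0..1} (%t. q t * ph (a t * fst p + c t, b t * snd p + e t))"
  by (rule pint_cont1[OF cont ph])
qed

lemma pint_derivs:
 assumes cont: "continuous_on {0..1} q" "continuous_on {0..1} a" "continuous_on {0..1} c" "continuous_on {0..1} b" "continuous_on {0..1} e"
  and ph: "smooth ph"
 shows "dx (pint q a c b e ph) = pint (%t. q t * a t) a c b e (dx ph)"
  "dz (pint q a c b e ph) = pint (%t. q t * b t) a c b e (dz ph)"
 by (rule ext, subst pd_eqI[OF pint_has_derivative[OF assms]], simp add: e\<^sub>x_def e\<^sub>z_def)+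

lemma pint_smooth:
 assumes cont: "continuous_on {0..1} q" "continuous_on {0..1} a" "continuous_on {0..1} c" "continuous_on {0..1} b" "continuous_on {0..1} e"
  and ph: "smooth ph"
 shows "smooth (pint q a c b e ph)"
proof (rule smooth_coinduct[where P="%h. \<exists>q ph. continuous_on {0..1} q & smooth ph & h = pint q a c b e ph"])
 show "\<exists>q' ph'. continuous_on {0..1} q' & smooth ph' & pint q a c b e ph = pint q' a c b e ph'" using cont(1) ph by blast
 fix g assume "\<exists>q ph. continuous_on {0..1} q & smooth ph & g = pint q a c b e ph"
 then obtain q ph where g: "continuous_on {0..1} q" "smooth ph" "g = pint q a c b e ph" by blast
 have d: "g differentiable (at x)" for x
  unfolding g(3) using pint_has_derivative[OF g(1) cont(2-5) g(2)] differentiable_def by blast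
 have qa: "continuous_on {0..1} (%t. q t * a t)" and qb: "continuous_on {0..1} (%t. q t * b t)"
  by (intro continuous_intros cont g)+
 note D = pint_derivs[OF g(1) cont(2-5) g(2)]
 show "(\<forall>x. g differentiable (at x)) & (\<forall>v\<in>Basis. \<exists>q ph. continuous_on {0..1} q & smooth ph & pd v g = pint q a c b e ph)"
  using d qa qb smooth_dx[OF g(2)] smooth_dz[OF g(2)] D unfolding g(3) Basis_point by blast
qed

lemma pint_bound:
 assumes cont: "continuous_on {0..1} a" "continuous_on {0..1} c" "continuous_on {0..1} b" "continuous_on {0..1} e"
  and ph: "smooth ph" and S: "!!p. \<bar>ph p\<bar> <= S"
 shows "\<bar>pint (%t. 1) a c b e ph p\<bar> <= S"
proof -
 have "norm (integral {0..1} (%t. 1 * ph (a t * fst p + c t, b t * snd p + e t))) <= S * (1 - 0)"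
  by (rule integral_bound) (use S pint_cont1[OF continuous_on_const cont ph, of 1] in auto)
 then show ?thesis by (simp add: pint_def)
qed

text \<open>\<open>Iz\<close> and \<open>Ix R\<close> are the antiderivatives \<open>\<integral>\<^sub>0\<^sup>z\<close> and \<open>\<integral>\<^sub>-\<^sub>R\<^sup>x\<close>, rescaled to the unit interval so that
 they are smooth on the whole plane; \<open>Az\<close> is the average over \<open>0 < z < 1\<close>.\<close>

definition Iz :: "(point => real) => point => real" where
 "Iz ph p = snd p * pint (%t. 1) (%t. 1) (%t. 0) (%t. t) (%t. 0) ph p"

definition Ix :: "real => (point => real) => point => real" where
 "Ix R ph p = (fst p + R) * pint (%t. 1) (%t. t) (%t. R * t - R) (%t. 1) (%t. 0) ph p"

definition Az :: "(point => real) => point => real" where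
 "Az ph = pint (%t. 1) (%t. 1) (%t. 0) (%t. 0) (%t. t) ph"

lemma conts: "continuous_on {0..1} (%t::real. 1::real)" "continuous_on {0..1} (%t::real. 0::real)" "continuous_on {0..1} (%t::real. t)"
 "continuous_on {0..1} (%t::real. R * t - R)"
 by (auto intro!: continuous_intros)

lemma smooth_fst_id: "smooth (%p::point. fst p)" and smooth_snd_id: "smooth (%p::point. snd p)"
 using smooth_fst[OF smooth_ident_real] smooth_snd[OF smooth_ident_real] by simp_all

lemma pd_fst_id: "dx (%p. fst p + R) = (%p. 1)" "dz (%p. fst p + R) = (%p. 0)"
 and pd_snd_id: "dx (%p. snd p) = (%p. 0)" "dz (%p. snd p) = (%p. 1)"
proof -
 have 1: "((%p::point. fst p + R) has_derivative fst) (at p)" for p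
  by (rule derivative_eq_intros refl | simp)+
 have 2: "((%p::point. snd p) has_derivative snd) (at p)" for p
  by (rule derivative_eq_intros refl | simp)+
 show "dx (%p. fst p + R) = (%p. 1)" "dz (%p. fst p + R) = (%p. 0)"
  by (rule ext, subst pd_eqI[OF 1], simp add: e\<^sub>x_def e\<^sub>z_def)+
 show "dx (%p. snd p) = (%p. 0)" "dz (%p. snd p) = (%p. 1)"
  by (rule ext, subst pd_eqI[OF 2], simp add: e\<^sub>x_def e\<^sub>z_def)+
qed

lemma Iz_smooth: "smooth ph ==> smooth (Iz ph)"
 unfolding Iz_def[abs_def] by (intro smooth_mult smooth_snd_id pint_smooth conts)

lemma Ix_smooth: "smooth ph ==> smooth (Ix R ph)"
 unfolding Ix_def[abs_def] by (intro smooth_mult smooth_add smooth_const smooth_fst_id pint_smooth conts)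

lemma Az_smooth: "smooth ph ==> smooth (Az ph)"
 unfolding Az_def by (intro pint_smooth conts)

lemma Az_dx: "smooth ph ==> dx (Az ph) = Az (dx ph)"
 unfolding Az_def by (subst pint_derivs(1)[OF conts(1,1,2,2,3)]) auto

lemma Az_dz: "smooth ph ==> dz (Az ph) = (%p. 0)"
 unfolding Az_def by (subst pint_derivs(2)[OF conts(1,1,2,2,3)]) (auto simp: pint_def fun_eq_iff)

lemma integral_scaled_deriv:
 assumes "!!t. t \<in> {0..1} ==> (F has_field_derivative F' t) (at t)"
 shows "integral {0..1} F' = F 1 - (F 0 :: real)"
proof -
 have "(F' has_integral (F 1 - F 0)) {0..1}"
  by (rule fundamental_theorem_of_calculus)
   (use assms in \<open>auto simp: has_real_derivative_iff_has_vector_derivative[symmetric] intro: has_field_derivative_at_within\<close>)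
 then show ?thesis by (rule integral_unique)
qed

lemma Iz_dx: "smooth ph ==> dx (Iz ph) = Iz (dx ph)"
proof -
 assume s: "smooth ph"
 have "smooth (pint (%t. 1) (%t. 1) (%t. 0) (%t. t) (%t. 0) ph)" by (intro pint_smooth conts s)
 then show ?thesis unfolding Iz_def[abs_def]
  by (subst pd_smooth_mult[OF smooth_snd_id]) (auto simp: pd_snd_id pint_derivs(1)[OF conts(1,1,2,3,2) s])
qed

lemma Iz_dz: "smooth ph ==> dz (Iz ph) = ph"
proof
 fix p :: point
 assume s: "smooth ph"
 obtain x z where p: "p = (x, z)" by (cases p)
 have "smooth (pint (%t. 1) (%t. 1) (%t. 0) (%t. t) (%t. 0) ph)" by (intro pint_smooth conts s)
 then have "dz (Iz ph) p = pint (%t. 1) (%t. 1) (%t. 0) (%t. t) (%t. 0) ph p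
   + snd p * pint (%t. t) (%t. 1) (%t. 0) (%t. t) (%t. 0) (dz ph) p"
  unfolding Iz_def[abs_def]
  by (subst pd_smooth_mult[OF smooth_snd_id]) (auto simp: pd_snd_id pint_derivs(2)[OF conts(1,1,2,3,2) s])
 also have "\<dots> = integral {0..1} (%t. ph (x, t * z) + z * (t * dz ph (x, t * z)))"
 proof -
  have "(%t. ph (x, t * z)) integrable_on {0..1}" "(%t. t * dz ph (x, t * z)) integrable_on {0..1}"
   using pint_cont1[OF conts(1,1,2,3,2) s, of x z] pint_cont1[OF conts(3,1,2,3,2) smooth_dz[OF s], of x z]
   by (auto intro: integrable_continuous_interval)
  then show ?thesis
   unfolding pint_def p by (simp add: Henstock_Kurzweil_Integration.integral_add integrable_on_mult_right)
 qed
 \<comment> \<open>The integrand is the derivative of \<open>t * ph (x, t * z)\<close> with respect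
   to t.\<close>
 also have "\<dots> = 1 * ph (x, 1 * z) - 0 * ph (x, 0 * z)"
 proof (rule integral_scaled_deriv)
  fix t :: real
  have "((%t. ph (x, t * z)) has_field_derivative dz ph (x, t * z) * z) (at t)"
   by (rule DERIV_chain2[OF smooth_slice_z[OF s]]) (auto intro!: derivative_eq_intros)
  then show "((%t. t * ph (x, t * z)) has_field_derivative ph (x, t * z) + z * (t * dz ph (x, t * z))) (at t)"
   by (auto intro!: derivative_eq_intros)
 qed
 finally show "dz (Iz ph) p = ph p" by (simp add: p)
qed

lemma Iz_of_dz: "smooth ph ==> Iz (dz ph) (x, z) = ph (x, z) - ph (x, 0)"
proof -
 assume s: "smooth ph"
 have "integral {0..1} (%t. z * dz ph (x, t * z)) = ph (x, 1 * z) - ph (x, 0 * z)"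
 proof (rule integral_scaled_deriv)
  fix t :: real
  have "((%t. ph (x, t * z)) has_field_derivative dz ph (x, t * z) * z) (at t)"
   by (rule DERIV_chain2[OF smooth_slice_z[OF s]]) (auto intro!: derivative_eq_intros)
  then show "((%t. ph (x, t * z)) has_field_derivative z * dz ph (x, t * z)) (at t)" by (simp add: mult.commute)
 qed
 then show ?thesis by (simp add: Iz_def pint_def)
qed

lemma Ix_dz: "smooth ph ==> dz (Ix R ph) = Ix R (dz ph)"
proof -
 assume s: "smooth ph"
 have "smooth (pint (%t. 1) (%t. t) (%t. R * t - R) (%t. 1) (%t. 0) ph)" by (intro pint_smooth conts s)
 moreover have "smooth (%p::point. fst p + R)" by (intro smooth_add smooth_fst_id smooth_const)
 ultimately show ?thesis unfolding Ix_def[abs_def]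
  by (subst pd_smooth_mult) (auto simp: pd_fst_id pint_derivs(2)[OF conts(1,3,4,1,2) s])
qed

lemma Ix_dx: "smooth ph ==> dx (Ix R ph) = ph"
proof
 fix p :: point
 assume s: "smooth ph"
 obtain x z where p: "p = (x, z)" by (cases p)
 have "smooth (pint (%t. 1) (%t. t) (%t. R * t - R) (%t. 1) (%t. 0) ph)" by (intro pint_smooth conts s)
 moreover have "smooth (%p::point. fst p + R)" by (intro smooth_add smooth_fst_id smooth_const)
 ultimately have "dx (Ix R ph) p = pint (%t. 1) (%t. t) (%t. R * t - R) (%t. 1) (%t. 0) ph p
   + (fst p + R) * pint (%t. t) (%t. t) (%t. R * t - R) (%t. 1) (%t. 0) (dx ph) p"
  unfolding Ix_def[abs_def]
  by (subst pd_smooth_mult) (auto simp: pd_fst_id pint_derivs(1)[OF conts(1,3,4,1,2) s])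
 also have "\<dots> = integral {0..1} (%t. ph (t * x + (R * t - R), z) + (x + R) * (t * dx ph (t * x + (R * t - R), z)))"
 proof -
  have "(%t. ph (t * x + (R * t - R), z)) integrable_on {0..1}" "(%t. t * dx ph (t * x + (R * t - R), z)) integrable_on {0..1}"
   using pint_cont1[OF conts(1,3,4,1,2) s, of x R z] pint_cont1[OF conts(3,3,4,1,2) smooth_dx[OF s], of x R z]
   by (auto intro: integrable_continuous_interval)
  then show ?thesis
   unfolding pint_def p by (simp add: Henstock_Kurzweil_Integration.integral_add integrable_on_mult_right)
 qed
 also have "\<dots> = 1 * ph (1 * x + (R * 1 - R), z) - 0 * ph (0 * x + (R * 0 - R), z)"
 proof (rule integral_scaled_deriv)
  fix t :: real
  have "((%t. ph (t * x + (R * t - R), z)) has_field_derivative dx ph (t * x + (R * t - R), z) * (x + R)) (at t)"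
   by (rule DERIV_chain2[OF smooth_slice_x[OF s]]) (auto intro!: derivative_eq_intros)
  then show "((%t. t * ph (t * x + (R * t - R), z)) has_field_derivative
    ph (t * x + (R * t - R), z) + (x + R) * (t * dx ph (t * x + (R * t - R), z))) (at t)"
   by (auto intro!: derivative_eq_intros)
 qed
 finally show "dx (Ix R ph) p = ph p" by (simp add: p)
qed

section \<open>Antiderivatives with compact support\<close>

lemma compact_Omega_box:
 assumes "compact K" "K \<subseteq> \<Omega>"
 obtains R d where "R > 0" "0 < d" "d < 1/2" "!!x z. (x, z) \<in> K ==> \<bar>x\<bar> <= R & d <= z & z <= 1 - d"
proof (cases "K = {}")
 case True
 then show thesis by (intro that[of 1 "1/4"]) auto
next
 case False
 have cs: "continuous_on K (snd :: point => real)" by (rule continuous_on_snd[OF continuous_on_id])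
 obtain p where p: "p \<in> K" "!!q. q \<in> K ==> snd p <= snd q"
  using continuous_attains_inf[OF assms(1) False cs] by blast
 obtain p' where p': "p' \<in> K" "!!q. q \<in> K ==> snd q <= snd p'"
  using continuous_attains_sup[OF assms(1) False cs] by blast
 obtain R where R: "R > 0" "!!q. q \<in> K ==> norm q <= R"
  using compact_imp_bounded[OF assms(1)] by (auto simp: bounded_pos)
 define d where "d = min (min (snd p) (1 - snd p')) (1/4)"
 have "0 < snd p" "snd p' < 1" using p(1) p'(1) assms(2) mem_Omega by blast+
 then have "0 < d" by (simp add: d_def)
 moreover have "d <= 1/4" unfolding d_def by (rule min.cobounded2)
 ultimately have d: "0 < d" "d < 1/2" by linarith+
 show thesis
 proof (rule that[OF R(1) d])
  fix x z assume q: "(x, z) \<in> K"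
  have "\<bar>x\<bar> <= R" using R(2)[OF q] norm_fst_le[of x z] by simp
  moreover have "d <= snd p" "d <= 1 - snd p'" by (auto simp: d_def)
  ultimately show "\<bar>x\<bar> <= R & d <= z & z <= 1 - d" using p(2)[OF q] p'(2)[OF q] by simp
 qed
qed

lemma box_test:
 assumes "smooth ph" "0 < d" and z: "!!x z. \<bar>x\<bar> > R \<or> z < d \<or> 1 - d < z ==> ph (x, z) = 0"
 shows "ph \<in> test \<Omega>"
proof (rule test_functionsI[OF assms(1), of "cbox (- R, d) (R, 1 - d)"])
 show "cbox (- R, d) (R, 1 - d) \<subseteq> \<Omega>" using assms(2) by (auto simp: cbox_Pair_eq Omega_def)
 fix p assume "p \<notin> cbox (- R, d) (R, 1 - d)"
 then have "\<bar>fst p\<bar> > R \<or> snd p < d \<or> 1 - d < snd p" by (cases p) (simp add: cbox_Pair_eq, linarith)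
 then show "ph p = 0" using z[of "fst p" "snd p"] by simp
qed simp

lemma const_of_deriv_0:
 assumes f: "!!x. (f has_field_derivative f' x) (at x)" and 0: "!!x. min a b < x ==> f' x = (0::real)"
 shows "f a = f b"
proof -
 have *: "f a = f b" if ab: "a < b" and "!!x. a < x ==> x < b ==> f' x = 0" for a b
 proof -
  obtain x where "a < x" "x < b" "f b - f a = (b - a) * f' x" using MVT2[OF ab, of f f'] f by auto
  then show ?thesis using that(2) by simp
 qed
 consider "a < b" | "b < a" | "a = b" by linarith
 then show ?thesis
 proof cases
  case 1
  then show ?thesis by (rule *) (rule 0, simp add: min_def)
 next
  case 2
  then have "f b = f a" by (rule *) (rule 0, simp add: min_def)
  then show ?thesis by simp
 qed simp
qed

text \<open>Below the support of \<open>ph\<close> the antiderivative is 0. Above it, it is constant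
  in z and equal to the vertical mean, which vanishes by assumption.\<close>

lemma Iz_test:
 assumes sm: "smooth ph" and d: "0 < d" "d < 1/2"
  and z: "!!x z. \<bar>x\<bar> > R \<or> z < d \<or> 1 - d < z ==> ph (x, z) = 0" and A: "!!p. Az ph p = 0"
 shows "\<bar>x\<bar> > R \<or> z < d \<or> 1 - d < z ==> Iz ph (x, z) = 0"
proof -
 have low: "Iz ph (x, z) = 0" if "\<bar>x\<bar> > R \<or> z < d" for x z
 proof -
  have "integral {0..1} (%t. 1 * ph (1 * x + 0, t * z + 0)) = integral {0..1} (%t::real. 0)"
  proof (rule Henstock_Kurzweil_Integration.integral_cong)
   fix t :: real assume t: "t \<in> {0..1}"
   have "t * z < d" if "z < d"
   proof (cases "0 <= z")
    case True
    then have "t * z <= 1 * z" using t by (intro mult_right_mono) auto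
    with that show ?thesis by simp
   next
    case False
    then have "t * z <= 0" using t by (simp add: mult_nonneg_nonpos)
    with d show ?thesis by simp
   qed
   with \<open>\<bar>x\<bar> > R \<or> z < d\<close> show "1 * ph (1 * x + 0, t * z + 0) = 0" using z[of x "t * z"] by auto
  qed
  then show ?thesis by (simp add: Iz_def pint_def)
 qed
 have "Iz ph (x, z) = Iz ph (x, 1)" if "1 - d < z" for x z
 proof (rule const_of_deriv_0[of "%z. Iz ph (x, z)" "%z. dz (Iz ph) (x, z)"])
  show "((%z. Iz ph (x, z)) has_field_derivative dz (Iz ph) (x, y)) (at y)" for y
   by (rule smooth_slice_z[OF Iz_smooth[OF sm]])
  show "dz (Iz ph) (x, y) = 0" if "min z 1 < y" for y
   using that \<open>1 - d < z\<close> d z[of x y] by (simp add: Iz_dz[OF sm] min_def split: if_splits)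
 qed
 moreover have "Iz ph (x, 1) = 0" for x using A[of "(x, 0)"] by (simp add: Iz_def Az_def pint_def)
 ultimately have top: "Iz ph (x, z) = 0" if "1 - d < z" for x z using that by simp
 assume "\<bar>x\<bar> > R \<or> z < d \<or> 1 - d < z"
 then consider "\<bar>x\<bar> > R \<or> z < d" | "1 - d < z" by blast
 then show "Iz ph (x, z) = 0"
  by cases (rule low, assumption, rule top, assumption)
qed

text \<open>The stream function is \<open>Iz v1\<close>; vanishing divergence and
  \<open>v2 = 0\<close> at z = 0 give its x derivative. Its value at the top has x derivative
  \<open>- v2 (x, 1) = 0\<close> and is 0 far away, so the flux of a compactly supported solenoidal
  field vanishes and \<open>Iz v1\<close> has compact support.\<close>

lemma div_free_stream:
 assumes v1: "v1 \<in> test \<Omega>" and v2: "v2 \<in> test \<Omega>" and div: "!!p. dx v1 p + dz v2 p = 0"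
 shows "\<exists>\<eta>\<in>test \<Omega>. v1 = dz \<eta> & v2 = (%p. - dx \<eta> p)"
proof -
 note s1 = test_smooth[OF v1] and s2 = test_smooth[OF v2]
 obtain K where K: "compact K" "K \<subseteq> \<Omega>" "!!p. p \<notin> K ==> v1 p = 0" using test_support[OF v1] by blast
 obtain R d where R: "R > 0" "0 < d" "d < 1/2" "!!x z. (x, z) \<in> K ==> \<bar>x\<bar> <= R & d <= z & z <= 1 - d"
  by (rule compact_Omega_box[OF K(1,2)]) blast
 have z: "v1 (x, z) = 0" if "\<bar>x\<bar> > R \<or> z < d \<or> 1 - d < z" for x z using K(3)[of "(x, z)"] R(4)[of x z] that by force
 have dv: "dx v1 = (%p. (-1) * dz v2 p + 0 * dz v2 p)" using div by (auto simp: fun_eq_iff add_eq_0_iff)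
 have dx_eq: "dx (Iz v1) (x, z) = - v2 (x, z)" for x z
 proof -
  have "Iz (dx v1) (x, z) = - Iz (dz v2) (x, z)" unfolding dv by (simp add: Iz_def pint_def)
  also have "\<dots> = - v2 (x, z)" unfolding Iz_of_dz[OF s2] using test_Omega_zero[OF v2, of 0 x] by simp
  finally show ?thesis by (simp add: Iz_dx[OF s1])
 qed
 have A: "Az v1 p = 0" for p
 proof -
  have I1: "Az v1 (x, y) = Iz v1 (x, 1)" for x y by (simp add: Iz_def Az_def pint_def)
  have "Iz v1 (fst p, 1) = Iz v1 (R + 1 + \<bar>fst p\<bar>, 1)"
  proof (rule const_of_deriv_0[of "%x. Iz v1 (x, 1)" "%x. dx (Iz v1) (x, 1)"])
   show "((%x. Iz v1 (x, 1)) has_field_derivative dx (Iz v1) (x, 1)) (at x)" for x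
    by (rule smooth_slice_x[OF Iz_smooth[OF s1]])
  qed (simp add: dx_eq test_Omega_zero[OF v2])
  also have "\<dots> = 0"
  proof -
   have "v1 (R + 1 + \<bar>fst p\<bar>, t) = 0" for t by (rule z[OF disjI1]) (use R(1) in linarith)
   then show ?thesis by (simp add: Iz_def pint_def)
  qed
  finally show ?thesis using I1[of "fst p" "snd p"] by simp
 qed
 have "Iz v1 \<in> test \<Omega>"
  by (rule box_test[OF Iz_smooth[OF s1] R(2), of R]) (rule Iz_test[OF s1 R(2,3) z A])
 moreover have "v2 = (%p. - dx (Iz v1) p)" using dx_eq by (auto simp: fun_eq_iff)
 ultimately show ?thesis using Iz_dz[OF s1] by metis
qed

lemma Iz_bound:
 assumes "smooth ph" "!!p. \<bar>ph p\<bar> <= S" "0 <= z" "z <= 1"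
 shows "\<bar>Iz ph (x, z)\<bar> <= S"
proof -
 have "\<bar>Iz ph (x, z)\<bar> <= 1 * S"
  unfolding Iz_def abs_mult using assms by (intro mult_mono pint_bound conts) auto
 then show ?thesis by simp
qed

lemma Ix_bound:
 assumes "smooth ph" "!!p. \<bar>ph p\<bar> <= S" "\<bar>fst p\<bar> <= R"
 shows "\<bar>Ix R ph p\<bar> <= 2 * R * S"
 unfolding Ix_def abs_mult using assms by (intro mult_mono pint_bound conts) auto

lemma Az_bound: "smooth ph ==> (!!p. \<bar>ph p\<bar> <= S) ==> \<bar>Az ph p\<bar> <= S"
 unfolding Az_def by (intro pint_bound conts)

text \<open>Continuity of order one on compact sets, stated with the same three suprema that the
  inverse of the divergence preserves.\<close>

definition local_C1 :: "point functional => bool" where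
 "local_C1 G \<longleftrightarrow> (\<forall>K. compact K & K \<subseteq> \<Omega> --> (\<exists>C\<ge>0. \<forall>ph\<in>test \<Omega>. \<forall>S. (\<forall>p. p \<notin> K --> ph p = 0) -->
  (\<forall>p. \<bar>ph p\<bar> <= S & \<bar>dx ph p\<bar> <= S & \<bar>dz ph p\<bar> <= S) --> \<bar>G ph\<bar> <= C * S))"

section \<open>A right inverse of the divergence and De Rham's theorem\<close>

context cutoff_fun
begin

definition bz :: "real => real" where
 "bz z = bump (1/4) (3/4) 16 z / integral {0..1} (bump (1/4) (3/4) 16)"

text \<open>At scale 16 the margins of the bump have width 3/16, so it equals 1 on
  [7/16, 9/16].\<close>

lemma bump_integral_pos: "0 < integral {0..1} (bump (1/4) (3/4) 16)"
proof -
 have c: "continuous_on S (bump (1/4) (3/4) 16)" for S by (rule smooth_continuous[OF bump_smooth])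
 have "integral {7/16..9/16} (%x::real. 1::real) = integral {7/16..9/16} (bump (1/4) (3/4) 16)"
  by (rule Henstock_Kurzweil_Integration.integral_cong) (simp add: bump_1)
 also have "\<dots> <= integral {0..1} (bump (1/4) (3/4) 16)"
  by (rule integral_subset_le) (auto intro: integrable_continuous_interval c bump_range)
 finally show ?thesis by simp
qed

lemma bz_smooth: "smooth bz"
 using smooth_mult[OF smooth_const[of "1 / integral {0..1} (bump (1/4) (3/4) 16)"] bump_smooth]
 by (simp add: bz_def[abs_def])

lemma bz_0: "z <= 1/4 \<or> 3/4 <= z ==> bz z = 0"
 by (simp add: bz_def bump_0)

lemma bz_integral: "integral {0..1} bz = 1"
 using bump_integral_pos by (simp add: bz_def[abs_def])

lemma bz_test: "bz \<in> test UNIV"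
 by (rule test_functionsI[of _ "{1/4..3/4}"]) (auto simp: bz_smooth intro!: bz_0)

lemma Ix_chi_pos:
 assumes "R >= 3"
 shows "0 < Ix R (%p. chi (fst p)) (R, 0)"
proof -
 let ?f = "%t. chi (t * R + (R * t - R))"
 have c: "continuous_on S ?f" for S
  by (rule continuous_on_compose2[OF smooth_continuous[OF chi_smooth, of UNIV]]) (auto intro!: continuous_intros)
 \<comment> \<open>The map from t to 2 R t - R takes this interval to [1/4, 1/2], where
   \<open>chi\<close> is 1.\<close>
 let ?a = "1/2 + 1 / (8 * R)" and ?b = "1/2 + 1 / (4 * R)"
 have R: "R > 0" using assms by simp
 have ab: "?a < ?b" "0 <= ?a" "?b <= 1" using assms by (auto simp: field_simps)
 have "integral {?a..?b} (%x::real. 1::real) = integral {?a..?b} ?f"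
 proof (rule Henstock_Kurzweil_Integration.integral_cong)
  fix t assume t: "t \<in> {?a..?b}"
  have "?a * (2 * R) <= t * (2 * R)" "t * (2 * R) <= ?b * (2 * R)" using t R by (auto intro!: mult_right_mono)
  moreover have "?a * (2 * R) = R + 1/4" "?b * (2 * R) = R + 1/2" using R by (simp_all add: field_simps)
  moreover have "t * R + (R * t - R) = t * (2 * R) - R" by (simp add: algebra_simps)
  ultimately have "0 < t * R + (R * t - R)" "t * R + (R * t - R) < 1" by linarith+
  then show "1 = ?f t" using chi_1 by simp
 qed
 also have "\<dots> <= integral {0..1} ?f"
 proof (rule integral_subset_le)
  show "{?a..?b} \<subseteq> {0..1}" using ab by auto
  show "?f integrable_on {?a..?b}" "?f integrable_on {0..1}" by (rule integrable_continuous_interval[OF c])+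
 qed (simp add: chi_nonneg)
 finally have "0 < integral {0..1} ?f" using ab by simp
 then show ?thesis using R by (simp add: Ix_def pint_def)
qed

text \<open>With m the vertical mean of \<open>ph\<close>, the remainder \<open>ph - bz m\<close>
  has mean 0 on vertical lines and is the z derivative of \<open>v2 = Iz h\<close>. The rest,
  \<open>bz (m - c chi)\<close>, is the x derivative of \<open>v1 = bz G\<close>. Subtracting a
  multiple of the fixed profile is unavoidable, since a compactly supported field has divergence of
  integral 0. First-order bounds in terms of first-order bounds suffice, so no gain of a derivative
  is sought.\<close>

lemma bogovskii:
 assumes K: "compact K" "K \<subseteq> \<Omega>"
 shows "\<exists>K' C. compact K' & K' \<subseteq> \<Omega> & 0 <= C & (\<forall>ph\<in>test \<Omega>. \<forall>S. (\<forall>p. p \<notin> K --> ph p = 0) -->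
  (\<forall>p. \<bar>ph p\<bar> <= S & \<bar>dx ph p\<bar> <= S & \<bar>dz ph p\<bar> <= S) -->
  (\<exists>v1\<in>test \<Omega>. \<exists>v2\<in>test \<Omega>. \<exists>c. (\<forall>p. dx v1 p + dz v2 p = ph p - c * (bz (snd p) * chi (fst p))) &
   (\<forall>p. p \<notin> K' --> v1 p = 0 & v2 p = 0) &
   (\<forall>p. \<bar>v1 p\<bar> <= C * S & \<bar>dx v1 p\<bar> <= C * S & \<bar>dz v1 p\<bar> <= C * S) &
   (\<forall>p. \<bar>v2 p\<bar> <= C * S & \<bar>dx v2 p\<bar> <= C * S & \<bar>dz v2 p\<bar> <= C * S)))"
proof -
 obtain R0 d0 where R0: "R0 > 0" "0 < d0" "d0 < 1/2" "!!x z. (x, z) \<in> K ==> \<bar>x\<bar> <= R0 & d0 <= z & z <= 1 - d0"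
  by (rule compact_Omega_box[OF K]) blast
 \<comment> \<open>Beyond \<open>R\<close> both the given support and that of \<open>chi\<close>,
   contained in [-1, 2], have ended; \<open>Ix_chi_pos\<close> also needs
   \<open>R >= 3\<close>.\<close>
 define R where "R = R0 + 3"
 \<comment> \<open>At most 1/4, so that the support [1/4, 3/4] of \<open>bz\<close> keeps the
   distance \<open>d\<close> from the boundary too.\<close>
 define d where "d = min d0 (1/4)"
 have Rd: "R >= 3" "R0 < R" "0 < d" "d < 1/2" "d <= d0" "d <= 1/4" using R0 by (auto simp: R_def d_def)
 obtain A where A: "A > 0" "!!z. \<bar>bz z\<bar> <= A" by (rule test_bounded[OF bz_test]) blast
 obtain A' where A': "A' > 0" "!!z. \<bar>pd 1 bz z\<bar> <= A'"
  by (rule test_bounded[OF test_pd[OF bz_test]]) (auto simp: Basis_real_def)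
 let ?b = "%p::point. chi (fst p)"
 have sb: "smooth ?b" by (rule smooth_fst[OF chi_smooth])
 define w where "w = Ix R ?b (R, 0)"
 have w: "w > 0" unfolding w_def by (rule Ix_chi_pos[OF Rd(1)])
 define C1 where "C1 = 2 * R / w"
 define C where "C = (A + A') * (2 * R + 1) * (1 + C1) + (1 + A + A')"
 have C1: "0 <= C1" using w Rd by (simp add: C1_def)
 let ?K' = "cbox (- R, d) (R, 1 - d)"
 have C0: "0 <= C" unfolding C_def using A(1) A'(1) C1 Rd by simp
 have "\<exists>v1\<in>test \<Omega>. \<exists>v2\<in>test \<Omega>. \<exists>c. (\<forall>p. dx v1 p + dz v2 p = ph p - c * (bz (snd p) * chi (fst p))) &
   (\<forall>p. p \<notin> ?K' --> v1 p = 0 & v2 p = 0) &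
   (\<forall>p. \<bar>v1 p\<bar> <= C * S & \<bar>dx v1 p\<bar> <= C * S & \<bar>dz v1 p\<bar> <= C * S) &
   (\<forall>p. \<bar>v2 p\<bar> <= C * S & \<bar>dx v2 p\<bar> <= C * S & \<bar>dz v2 p\<bar> <= C * S)"
  if ph: "ph \<in> test \<Omega>" and phK: "\<forall>p. p \<notin> K --> ph p = 0"
   and S: "\<forall>p. \<bar>ph p\<bar> <= S & \<bar>dx ph p\<bar> <= S & \<bar>dz ph p\<bar> <= S" for ph S
 proof -
  note s = test_smooth[OF ph]
  have S0: "0 <= S" using S abs_ge_zero order_trans by blast
  have ph0: "ph (x, z) = 0" if "\<bar>x\<bar> > R0 \<or> z < d \<or> 1 - d < z" for x z
   using phK R0(4)[of x z] Rd that by force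
  define m where "m = Az ph"
  have sm: "smooth m" unfolding m_def by (rule Az_smooth[OF s])
  have m0: "m (x, z) = 0" if "\<bar>x\<bar> > R0" for x z unfolding m_def Az_def pint_def using ph0 that by simp
  have mS: "\<bar>m p\<bar> <= S" for p unfolding m_def by (rule Az_bound[OF s]) (use S in blast)
  have dxm: "dx m = Az (dx ph)" and dzm: "dz m = (%p. 0)" unfolding m_def by (rule Az_dx[OF s] Az_dz[OF s])+
  have dxmS: "\<bar>dx m p\<bar> <= S" for p unfolding dxm by (rule Az_bound[OF smooth_dx[OF s]]) (use S in blast)
  \<comment> \<open>This multiple of \<open>chi\<close> has the same integral in x as
    \<open>m\<close>, so that the antiderivative \<open>G\<close> vanishes again to the right of the
    supports.\<close>
  define c where "c = Ix R m (R, 0) / w"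
  have cS: "\<bar>c\<bar> <= C1 * S"
  proof -
   have "\<bar>Ix R m (R, 0)\<bar> <= 2 * R * S" by (rule Ix_bound[OF sm mS]) (use Rd in simp)
   then show ?thesis using w by (simp add: c_def C1_def abs_mult divide_right_mono)
  qed
  define g where "g p = 1 * m p + (- c) * chi (fst p)" for p
  have sg: "smooth g" unfolding g_def[abs_def] by (intro smooth_add smooth_mult smooth_const sm sb)
  have gS: "\<bar>g p\<bar> <= (1 + C1) * S" for p
  proof -
   have "\<bar>c * chi (fst p)\<bar> <= C1 * S * 1"
    unfolding abs_mult using cS chi_nonneg[of "fst p"] chi_le_1[of "fst p"] by (intro mult_mono) auto
   then show ?thesis using mS[of p] by (simp add: g_def algebra_simps abs_le_iff)
  qed
  have dzg: "dz g = (%p. 0)"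
   unfolding g_def[abs_def] by (subst pd_lin[OF sm sb]) (simp add: dzm pd_fst(2)[OF chi_smooth])
  have g0: "g (x, z) = 0" if "\<bar>x\<bar> >= R" for x z
  proof -
   have "x <= - 1 \<or> 2 <= x" "\<bar>x\<bar> > R0" using that Rd by linarith+
   then show ?thesis using m0[of x z] chi_0[of x] by (simp add: g_def)
  qed
  define G where "G = Ix R g"
  have sG: "smooth G" unfolding G_def by (rule Ix_smooth[OF sg])
  have dxG: "dx G = g" unfolding G_def by (rule Ix_dx[OF sg])
  have dzG: "dz G = (%p. 0)" unfolding G_def Ix_dz[OF sg] dzg by (auto simp: Ix_def pint_def fun_eq_iff)
  have GS: "\<bar>G p\<bar> <= 2 * R * ((1 + C1) * S)" if "\<bar>fst p\<bar> <= R" for p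
   unfolding G_def by (rule Ix_bound[OF sg gS that])
  have Gz: "G (x, z) = G (x, 0)" for x z
  proof -
   have "G (x, z) = G (x, 0)"
    by (rule const_of_deriv_0[OF smooth_slice_z[OF sG]]) (simp add: dzG)
   then show ?thesis .
  qed
  have GR: "G (R, 0) = 0"
  proof -
   have i: "(%t. m (t * R + (R * t - R), 0)) integrable_on {0..1}" "(%t. chi (t * R + (R * t - R))) integrable_on {0..1}"
    using pint_cont1[OF conts(1,3,4,1,2) sm, of R R 0] pint_cont1[OF conts(1,3,4,1,2) sb, of R R 0]
    by (auto intro: integrable_continuous_interval)
   have "integral {0..1} (%t. m (t * R + (R * t - R), 0) - c * chi (t * R + (R * t - R)))
     = integral {0..1} (%t. m (t * R + (R * t - R), 0)) - c * integral {0..1} (%t. chi (t * R + (R * t - R)))"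
    using i by (subst Henstock_Kurzweil_Integration.integral_diff) (auto intro: integrable_on_mult_right)
   note eq = this
   have 1: "Ix R m (R, 0) = (R + R) * integral {0..1} (%t. m (t * R + (R * t - R), 0))"
    "w = (R + R) * integral {0..1} (%t. chi (t * R + (R * t - R)))"
    unfolding w_def Ix_def pint_def by (simp_all only: fst_conv snd_conv mult_1 add_0_right)
   have "G (R, 0) = (R + R) * integral {0..1} (%t. m (t * R + (R * t - R), 0) - c * chi (t * R + (R * t - R)))"
    unfolding G_def g_def Ix_def pint_def
    by (simp only: fst_conv snd_conv mult_1 add_0_right mult_minus_left add_uminus_conv_diff)
   then have "G (R, 0) = Ix R m (R, 0) - c * w" unfolding eq 1 by (simp add: right_diff_distrib)
   then show ?thesis using w by (simp add: c_def)
  qed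
  have G0: "G (x, z) = 0" if "\<bar>x\<bar> > R" for x z
  proof (cases "x > R")
   case True
   have "G (x, 0) = G (R, 0)"
    by (rule const_of_deriv_0[OF smooth_slice_x[OF sG]]) (use True Rd g0 in \<open>simp add: dxG\<close>)
   then show ?thesis using GR Gz[of x z] by simp
  next
   case False
   then have x: "x < - R" using that by simp
   have "integral {0..1} (%t. 1 * g (t * x + (R * t - R), 1 * z + 0)) = integral {0..1} (%t::real. 0)"
   proof (rule Henstock_Kurzweil_Integration.integral_cong)
    fix t :: real assume t: "t \<in> {0..1}"
    have "t * (x + R) <= 0" using t x by (simp add: mult_nonneg_nonpos)
    then have "t * x + (R * t - R) <= - R" by (simp add: algebra_simps)
    then show "1 * g (t * x + (R * t - R), 1 * z + 0) = 0" using g0 Rd by simp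
   qed
   then show ?thesis by (simp add: G_def Ix_def pint_def)
  qed
  define v1 where "v1 p = bz (snd p) * G p" for p
  \<comment> \<open>Since \<open>bz\<close> has integral 1, subtracting \<open>bz\<close> times the
    mean of \<open>ph\<close> removes the vertical mean.\<close>
  define h where "h p = 1 * ph p + (-1) * (bz (snd p) * m p)" for p
  have sbz: "smooth (%p::point. bz (snd p))" by (rule smooth_snd[OF bz_smooth])
  have dbz: "dx (%p. bz (snd p)) = (%p. 0)" "dz (%p. bz (snd p)) = (%p. pd 1 bz (snd p))"
  proof -
   have "((%p::point. bz (snd p)) has_derivative (%h. pd 1 bz (snd p) * snd h)) (at p)" for p
    by (rule has_derivative_compose[where f=snd])
     (use smooth_has_field_derivative[OF bz_smooth] in \<open>auto simp: has_field_derivative_def intro!: derivative_eq_intros\<close>)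
   note D = pd_eqI[OF this]
   show "dx (%p. bz (snd p)) = (%p. 0)" "dz (%p. bz (snd p)) = (%p. pd 1 bz (snd p))"
    by (rule ext, simp add: D e\<^sub>x_def e\<^sub>z_def)+
  qed
  have sbm: "smooth (%p. bz (snd p) * m p)" by (rule smooth_mult[OF sbz sm])
  have sh: "smooth h" unfolding h_def[abs_def] by (intro smooth_add smooth_mult smooth_const sbm s)
  have sv1: "smooth v1" unfolding v1_def[abs_def] by (rule smooth_mult[OF sbz sG])
  have h0: "h (x, z) = 0" if "\<bar>x\<bar> > R0 \<or> z < d \<or> 1 - d < z" for x z
   using ph0[OF that] m0[of x z] bz_0[of z] that Rd by (auto simp: h_def)
  have Ah: "Az h p = 0" for p
  proof -
   have i: "(%t. ph (fst p, t)) integrable_on {0..1}"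
    using pint_cont1[OF conts(1,1,2,2,3) s, of "fst p" "snd p"] by (auto intro: integrable_continuous_interval)
   have mt: "m (fst p, t) = Az ph p" for t by (simp add: m_def Az_def pint_def)
   have ib: "bz integrable_on {0..1}" by (rule integrable_continuous_interval[OF smooth_continuous[OF bz_smooth]])
   have "Az h p = integral {0..1} (%t. ph (fst p, t) - bz t * Az ph p)"
    by (simp add: Az_def[of h] pint_def h_def mt)
   also have "\<dots> = integral {0..1} (%t. ph (fst p, t)) - integral {0..1} bz * Az ph p"
    using i ib by (subst Henstock_Kurzweil_Integration.integral_diff) (auto intro: integrable_on_mult_left)
   also have "\<dots> = 0" unfolding bz_integral by (simp add: Az_def pint_def)
   finally show ?thesis .
  qed
  define v2 where "v2 = Iz h"
  have sv2: "smooth v2" unfolding v2_def by (rule Iz_smooth[OF sh])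
  have v2_0: "v2 (x, z) = 0" if "\<bar>x\<bar> > R0 \<or> z < d \<or> 1 - d < z" for x z
   unfolding v2_def by (rule Iz_test[OF sh Rd(3,4) h0 Ah that])
  have v1_0: "v1 (x, z) = 0" if "\<bar>x\<bar> > R \<or> z < d \<or> 1 - d < z" for x z
   using G0[of x z] bz_0[of z] that Rd by (auto simp: v1_def)
  have t1: "v1 \<in> test \<Omega>" by (rule box_test[OF sv1 Rd(3), of R]) (rule v1_0)
  have t2: "v2 \<in> test \<Omega>" by (rule box_test[OF sv2 Rd(3), of R0]) (rule v2_0)
  have dv1: "dx v1 = (%p. bz (snd p) * g p)" "dz v1 = (%p. pd 1 bz (snd p) * G p)"
   unfolding v1_def[abs_def] pd_smooth_mult[OF sbz sG] dxG dzG dbz by simp_all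
  have dv2z: "dz v2 = h" unfolding v2_def by (rule Iz_dz[OF sh])
  have dxh: "dx h = (%p. dx ph p - bz (snd p) * dx m p)"
   unfolding h_def[abs_def] by (subst pd_lin[OF s sbm]) (simp add: pd_smooth_mult[OF sbz sm] dbz)
  have dv2x: "dx v2 = Iz (dx h)" unfolding v2_def by (rule Iz_dx[OF sh])
  have div: "dx v1 p + dz v2 p = ph p - c * (bz (snd p) * chi (fst p))" for p
   unfolding dv1 dv2z by (simp add: g_def h_def algebra_simps)
  have Cle: "A * (2 * R * ((1 + C1) * S)) <= C * S" "A' * (2 * R * ((1 + C1) * S)) <= C * S" "A * ((1 + C1) * S) <= C * S" "(1 + A) * S <= C * S"
  proof -
   define Q where "Q = (1 + C1) * S"
   have Q: "0 <= Q" using C1 S0 by (simp add: Q_def)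
   have e: "C * S = (A + A') * (2 * R + 1) * Q + (1 + A + A') * S" by (simp add: C_def Q_def algebra_simps)
   have n: "0 <= A * (R * Q)" "0 <= A' * (R * Q)" "0 <= A * Q" "0 <= A' * Q" "0 <= A * S" "0 <= A' * S"
    using A(1) A'(1) Q S0 Rd by simp_all
   have e': "(A + A') * (2 * R + 1) * Q = 2 * (A * (R * Q)) + 2 * (A' * (R * Q)) + A * Q + A' * Q" by (simp add: algebra_simps)
   have e2: "A * (2 * R * Q) = 2 * (A * (R * Q))" "A' * (2 * R * Q) = 2 * (A' * (R * Q))" "(1 + A + A') * S = S + A * S + A' * S"
    "(1 + A) * S = S + A * S" by (simp_all add: algebra_simps)
   show "A * (2 * R * ((1 + C1) * S)) <= C * S" "A' * (2 * R * ((1 + C1) * S)) <= C * S" "A * ((1 + C1) * S) <= C * S" "(1 + A) * S <= C * S"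
    unfolding Q_def[symmetric] e e' e2 using n S0 by linarith+
  qed
  have CS0: "0 <= C * S" using C0 S0 by simp
  have hS: "\<bar>h p\<bar> <= (1 + A) * S" for p
  proof -
   have "\<bar>bz (snd p) * m p\<bar> <= A * S" unfolding abs_mult using A mS[of p] by (intro mult_mono) (auto simp: less_imp_le)
   moreover have "\<bar>ph p\<bar> <= S" using S by blast
   ultimately show ?thesis by (simp add: h_def distrib_right abs_le_iff)
  qed
  have dxhS: "\<bar>dx h p\<bar> <= (1 + A) * S" for p
  proof -
   have "\<bar>bz (snd p) * dx m p\<bar> <= A * S" unfolding abs_mult using A dxmS[of p] by (intro mult_mono) (auto simp: less_imp_le)
   moreover have "\<bar>dx ph p\<bar> <= S" using S by blast
   ultimately show ?thesis by (simp add: dxh distrib_right abs_le_iff)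
  qed
  have b1: "\<bar>v1 p\<bar> <= C * S & \<bar>dx v1 p\<bar> <= C * S & \<bar>dz v1 p\<bar> <= C * S" for p
  proof (intro conjI)
   show "\<bar>dx v1 p\<bar> <= C * S"
   proof -
    have "\<bar>dx v1 p\<bar> <= A * ((1 + C1) * S)" unfolding dv1 abs_mult using A gS by (intro mult_mono) (auto simp: less_imp_le)
    then show ?thesis using Cle(3) by linarith
   qed
   show "\<bar>v1 p\<bar> <= C * S"
   proof (cases "\<bar>fst p\<bar> <= R")
    case True
    have "\<bar>v1 p\<bar> <= A * (2 * R * ((1 + C1) * S))" unfolding v1_def abs_mult using A GS[OF True] by (intro mult_mono) (auto simp: less_imp_le)
    then show ?thesis using Cle(1) by linarith
   next
    case False
    then show ?thesis using v1_0[of "fst p" "snd p"] CS0 by simp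
   qed
   show "\<bar>dz v1 p\<bar> <= C * S"
   proof (cases "\<bar>fst p\<bar> <= R")
    case True
    have "\<bar>dz v1 p\<bar> <= A' * (2 * R * ((1 + C1) * S))" unfolding dv1 abs_mult using A' GS[OF True] by (intro mult_mono) (auto simp: less_imp_le)
    then show ?thesis using Cle(2) by linarith
   next
    case False
    then show ?thesis using G0[of "fst p" "snd p"] CS0 by (simp add: dv1)
   qed
  qed
  have b2: "\<bar>v2 p\<bar> <= C * S & \<bar>dx v2 p\<bar> <= C * S & \<bar>dz v2 p\<bar> <= C * S" for p
  proof (cases "0 <= snd p & snd p <= 1")
   case True
   have "\<bar>v2 p\<bar> <= (1 + A) * S" "\<bar>dx v2 p\<bar> <= (1 + A) * S"
    unfolding v2_def Iz_dx[OF sh]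
    using Iz_bound[OF sh hS, of "snd p" "fst p"] Iz_bound[OF smooth_dx[OF sh] dxhS, of "snd p" "fst p"] True by simp_all
   moreover have "\<bar>dz v2 p\<bar> <= (1 + A) * S" unfolding dv2z by (rule hS)
   ultimately show ?thesis using Cle(4) by linarith
  next
   case False
   then have "p \<notin> \<Omega>" by (auto simp: mem_Omega)
   then show ?thesis using test_outside[OF t2] test_outside[OF test_dx[OF t2]] test_outside[OF test_dz[OF t2]] CS0 by simp
  qed
  have out: "v1 p = 0 & v2 p = 0" if "p \<notin> ?K'" for p
  proof -
   have "\<bar>fst p\<bar> > R \<or> snd p < d \<or> 1 - d < snd p" using that by (cases p) (simp add: cbox_Pair_eq, linarith)
   then show ?thesis using v1_0[of "fst p" "snd p"] v2_0[of "fst p" "snd p"] Rd(2) by auto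
  qed
  show ?thesis using t1 t2 div out b1 b2 by blast
 qed
 moreover have "?K' \<subseteq> \<Omega>" using Rd by (auto simp: cbox_Pair_eq Omega_def)
 ultimately show ?thesis using C0 compact_cbox by (intro exI[of _ ?K'] exI[of _ C]) blast
qed

end

lemma iter_deriv_test:
 "ph \<in> test S ==> set vs \<subseteq> Basis ==> iter_deriv vs ph \<in> test S"
proof (induction vs)
 case (Cons v vs)
 then have "pd v (iter_deriv vs ph) \<in> test S" by (intro test_pd) auto
 then show ?case by (simp add: pd_def)
qed simp

lemma C1_le_seminorm:
 fixes ph :: "point => real"
 assumes ph: "ph \<in> test S"
 defines "Q \<equiv> \<Sum>vs | set vs \<subseteq> Basis & length vs <= 1. SUP x. \<bar>iter_deriv vs ph x\<bar>"
 shows "\<bar>ph p\<bar> <= Q" "\<bar>dx ph p\<bar> <= Q" "\<bar>dz ph p\<bar> <= Q"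
proof -
 have bdd: "bdd_above (range (%x. \<bar>iter_deriv vs ph x\<bar>))" if vs: "set vs \<subseteq> Basis" for vs
 proof -
  obtain C where "!!x. \<bar>iter_deriv vs ph x\<bar> <= C" by (rule test_bounded[OF iter_deriv_test[OF ph vs]]) blast
  then show ?thesis by (intro bdd_aboveI2)
 qed
 have up: "\<bar>iter_deriv vs ph p\<bar> <= (SUP x. \<bar>iter_deriv vs ph x\<bar>)" if "set vs \<subseteq> Basis" for vs p
  by (rule cSUP_upper[OF _ bdd[OF that]]) simp
 have fin: "finite {vs. set vs \<subseteq> (Basis :: point set) & length vs <= 1}" by (rule finite_lists_length_le[OF finite_Basis])
 have le: "\<bar>iter_deriv vs ph p\<bar> <= Q" if vs: "set vs \<subseteq> Basis" "length vs <= 1" for vs p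
 proof -
  have "(SUP x. \<bar>iter_deriv vs ph x\<bar>) <= Q"
   unfolding Q_def
  proof (rule member_le_sum[OF _ _ fin])
   fix ws :: "point list" assume "ws \<in> {vs. set vs \<subseteq> Basis & length vs <= 1} - {vs}"
   then have "set ws \<subseteq> Basis" by simp
   from up[OF this, of p] show "0 <= (SUP x. \<bar>iter_deriv ws ph x\<bar>)" using abs_ge_zero order_trans by blast
  qed (use vs in simp)
  with up[OF vs(1), of p] show ?thesis by linarith
 qed
 show "\<bar>ph p\<bar> <= Q" using le[of "[]" p] by simp
 show "\<bar>dx ph p\<bar> <= Q" using le[of "[e\<^sub>x]" p] by (simp add: pd_def)
 show "\<bar>dz ph p\<bar> <= Q" using le[of "[e\<^sub>z]" p] by (simp add: pd_def)
qed

context cutoff_fun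
begin

abbreviation beta :: "point => real" where "beta p \<equiv> bz (snd p) * chi (fst p)"

lemma beta_test: "beta \<in> test UNIV"
proof (rule test_functionsI[of _ "cbox (-1, 0) (2, 1)"])
 show "smooth beta" by (intro smooth_mult smooth_fst smooth_snd bz_smooth chi_smooth)
 fix p :: point assume "p \<notin> cbox (-1, 0) (2, 1)"
 then have "fst p <= -1 \<or> 2 <= fst p \<or> snd p <= 1/4 \<or> 3/4 <= snd p" by (cases p) (simp add: cbox_Pair_eq, linarith)
 then show "beta p = 0" using chi_0[of "fst p"] bz_0[of "snd p"] by auto
qed simp_all

lemma beta_integral_pos: "0 < (LBINT p. beta p)"
proof -
 let ?B = "cbox (1/4, 7/16) (1/2, 9/16) :: point set"
 define w where "w = integral {0..1} (bump (1/4) (3/4) 16)"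
 have w: "w > 0" unfolding w_def by (rule bump_integral_pos)
 have "measure lborel ?B = 1/32"
  by (simp add: content_Pair)
 then have "0 < (1 / w) * measure lborel ?B" using w by simp
 also have "\<dots> = (LBINT p. (1 / w) * indicator ?B p)" by simp
 also have "\<dots> <= (LBINT p. beta p)"
 proof (rule integral_mono)
  show "integrable lborel (%p. (1 / w) * indicator ?B p)"
   by (intro integrable_mult_right integrable_real_indicator) (simp, rule emeasure_bounded_finite[OF bounded_cbox])
  show "integrable lborel beta" by (rule test_integrable[OF beta_test])
  fix p :: point
  show "(1 / w) * indicator ?B p <= beta p"
  proof (cases "p \<in> ?B")
   case True
   then have x: "1/4 <= fst p" "fst p <= 1/2" "7/16 <= snd p" "snd p <= 9/16" by (cases p; simp add: cbox_Pair_eq)+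
   then have "chi (fst p) = 1" by (intro chi_1) auto
   moreover have "bump (1/4) (3/4) 16 (snd p) = 1" using x by (intro bump_1) auto
   ultimately show ?thesis using True by (simp add: bz_def w_def)
  next
   case False
   have "0 <= bz (snd p)" using w bump_range(1) by (simp add: bz_def w_def[symmetric])
   then show ?thesis using False chi_nonneg by simp
  qed
 qed
 finally show ?thesis .
qed

text \<open>The defect \<open>c\<close> is determined by \<open>ph\<close>: integrating over the
  plane shows that it is the integral of \<open>ph\<close> divided by that of
  \<open>beta\<close>.\<close>

definition divsol :: "(point => real) => (point => real) => (point => real) => real => bool" where
 "divsol ph v1 v2 c \<longleftrightarrow> v1 \<in> test \<Omega> & v2 \<in> test \<Omega> & (\<forall>p. dx v1 p + dz v2 p = ph p - c * beta p)"

lemma divsol_lin: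
 assumes "divsol ph v1 v2 c" "divsol ph' v1' v2' c'"
 shows "divsol (%p. a * ph p + b * ph' p) (%p. a * v1 p + b * v1' p) (%p. a * v2 p + b * v2' p) (a * c + b * c')"
proof -
 have t: "v1 \<in> test \<Omega>" "v2 \<in> test \<Omega>" "v1' \<in> test \<Omega>" "v2' \<in> test \<Omega>"
  and e: "!!p. dx v1 p + dz v2 p = ph p - c * beta p" "!!p. dx v1' p + dz v2' p = ph' p - c' * beta p"
  using assms by (auto simp: divsol_def)
 have "(a * dx v1 p + b * dx v1' p) + (a * dz v2 p + b * dz v2' p) = a * (dx v1 p + dz v2 p) + b * (dx v1' p + dz v2' p)" for p
  by (simp add: algebra_simps)
 then have "(a * dx v1 p + b * dx v1' p) + (a * dz v2 p + b * dz v2' p) = (a * ph p + b * ph' p) - (a * c + b * c') * beta p" for p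
  unfolding e by (simp add: algebra_simps)
 then show ?thesis
  unfolding divsol_def pd_lin[OF test_smooth[OF t(1)] test_smooth[OF t(3)]] pd_lin[OF test_smooth[OF t(2)] test_smooth[OF t(4)]]
  using t by (auto intro: test_lin)
qed

text \<open>The difference of two solutions has divergence a multiple of \<open>beta\<close>; its
  integral is 0, and \<open>beta\<close> has positive integral, so the difference is solenoidal. It
  is then a rotated gradient, on which the pair of functionals vanishes by the curl condition. This
  makes the transposed functional well defined.\<close>

lemma divsol_unique:
 assumes G: "linear_functional_on (test \<Omega>) G1" "linear_functional_on (test \<Omega>) G2"
  and curl: "!!\<eta>. \<eta> \<in> test \<Omega> ==> G1 (dz \<eta>) = G2 (dx \<eta>)"
  and v: "divsol ph v1 v2 c" "divsol ph v1' v2' c'"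
 shows "G1 v1 + G2 v2 = G1 v1' + G2 v2'"
proof -
 let ?w1 = "%p. 1 * v1 p + (-1) * v1' p" and ?w2 = "%p. 1 * v2 p + (-1) * v2' p"
 have d: "divsol (%p. 1 * ph p + (-1) * ph p) ?w1 ?w2 (1 * c + (-1) * c')" by (rule divsol_lin[OF v])
 have t: "v1 \<in> test \<Omega>" "v2 \<in> test \<Omega>" "v1' \<in> test \<Omega>" "v2' \<in> test \<Omega>"
  using v by (auto simp: divsol_def)
 have w: "?w1 \<in> test \<Omega>" "?w2 \<in> test \<Omega>" using d by (simp_all only: divsol_def)
 have div: "dx ?w1 p + dz ?w2 p = - (c - c') * beta p" for p
 proof -
  have "dx ?w1 p + dz ?w2 p = (1 * ph p + (-1) * ph p) - (1 * c + (-1) * c') * beta p"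
   using d unfolding divsol_def by blast
  also have "\<dots> = - (c - c') * beta p" by (simp add: algebra_simps)
  finally show ?thesis .
 qed
 have "(LBINT p. dx ?w1 p + dz ?w2 p) = 0"
  using integral_pd_test[OF w(1), of e\<^sub>x] integral_pd_test[OF w(2), of e\<^sub>z]
   test_integrable[OF test_dx[OF w(1)]] test_integrable[OF test_dz[OF w(2)]] by (simp only: Bochner_Integration.integral_add e_in_Basis add_0_left)
 then have "- (c - c') * (LBINT p. beta p) = 0" unfolding div by simp
 then have "c - c' = 0" using beta_integral_pos by simp
 then have div0: "dx ?w1 p + dz ?w2 p = 0" for p using div[of p] by simp
 obtain \<eta> where \<eta>: "\<eta> \<in> test \<Omega>" "?w1 = dz \<eta>" "?w2 = (%p. - dx \<eta> p)"
  using div_free_stream[OF w div0] by blast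
 have "G1 ?w1 = 1 * G1 v1 + (-1) * G1 v1'" using G(1) t unfolding linear_functional_on_def by blast
 moreover have "G2 ?w2 = 1 * G2 v2 + (-1) * G2 v2'" using G(2) t unfolding linear_functional_on_def by blast
 moreover have "G2 ?w2 = - G2 (dx \<eta>)"
 proof -
  have "G2 (%p. (-1) * dx \<eta> p + 0 * dx \<eta> p) = (-1) * G2 (dx \<eta>) + 0 * G2 (dx \<eta>)"
   using G(2) test_dx[OF \<eta>(1)] unfolding linear_functional_on_def by blast
  then show ?thesis unfolding \<eta>(3) by simp
 qed
 moreover have "G1 ?w1 = G2 (dx \<eta>)" unfolding \<eta>(2) by (rule curl[OF \<eta>(1)])
 ultimately show ?thesis by simp
qed

text \<open>De Rham's theorem on the strip, the pressure being obtained by transposing a right inverse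
 of the divergence.\<close>

lemma de_rham:
 assumes G: "linear_functional_on (test \<Omega>) G1" "linear_functional_on (test \<Omega>) G2"
  and loc: "local_C1 G1" "local_C1 G2"
  and curl: "!!\<eta>. \<eta> \<in> test \<Omega> ==> G1 (dz \<eta>) = G2 (dx \<eta>)"
 shows "\<exists>q\<in>distributions \<Omega>. \<forall>ph\<in>test \<Omega>. q (dx ph) = - G1 ph & q (dz ph) = - G2 ph"
proof -
 define q where "q ph = - (THE r. \<exists>v1 v2 c. divsol ph v1 v2 c & r = G1 v1 + G2 v2)" for ph
 have q: "q ph = - (G1 v1 + G2 v2)" if "divsol ph v1 v2 c" for ph v1 v2 c
 proof -
  have "(THE r. \<exists>v1 v2 c. divsol ph v1 v2 c & r = G1 v1 + G2 v2) = G1 v1 + G2 v2"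
   by (rule the_equality) (use that divsol_unique[OF G curl] in blast)+
  then show ?thesis by (simp add: q_def)
 qed
 have G0: "G1 (%p. 0) = 0" "G2 (%p. 0) = 0"
 proof -
  show "G1 (%p. 0) = 0" "G2 (%p. 0) = 0"
   using G(1)[unfolded linear_functional_on_def, rule_format, OF test_zero test_zero, of 0 0]
    G(2)[unfolded linear_functional_on_def, rule_format, OF test_zero test_zero, of 0 0] by simp_all
 qed
 have ex: "\<exists>v1 v2 c. divsol ph v1 v2 c" if ph: "ph \<in> test \<Omega>" for ph
 proof -
  obtain K where K: "compact K" "K \<subseteq> \<Omega>" "\<forall>p. p \<notin> K --> ph p = 0" using test_support[OF ph] by blast
  obtain S where S: "\<forall>p. \<bar>ph p\<bar> <= S & \<bar>dx ph p\<bar> <= S & \<bar>dz ph p\<bar> <= S" using C1_le_seminorm[OF ph] by blast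
  show ?thesis using bogovskii[OF K(1,2)] ph K(3) S unfolding divsol_def by meson
 qed
 have "q \<in> distributions \<Omega>"
  unfolding distributions_def
 proof (intro CollectI conjI allI impI)
  show "linear_functional_on (test \<Omega>) q"
   unfolding linear_functional_on_def
  proof (intro ballI allI)
   fix ph ph' a b assume "ph \<in> test \<Omega>" "ph' \<in> test \<Omega>"
   then obtain v1 v2 c v1' v2' c' where d: "divsol ph v1 v2 c" "divsol ph' v1' v2' c'" using ex[of ph] ex[of ph'] by blast
   have t: "v1 \<in> test \<Omega>" "v2 \<in> test \<Omega>" "v1' \<in> test \<Omega>" "v2' \<in> test \<Omega>"
    using d by (auto simp: divsol_def)
   have "G1 (%p. a * v1 p + b * v1' p) = a * G1 v1 + b * G1 v1'" "G2 (%p. a * v2 p + b * v2' p) = a * G2 v2 + b * G2 v2'"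
    using G t unfolding linear_functional_on_def by blast+
   then show "q (%x. a * ph x + b * ph' x) = a * q ph + b * q ph'"
    unfolding q[OF divsol_lin[OF d]] q[OF d(1)] q[OF d(2)] by (simp add: algebra_simps)
  qed
  fix K assume K: "compact K & K \<subseteq> \<Omega>"
  from bogovskii[OF conjunct1[OF K] conjunct2[OF K]]
  obtain K' C where KC: "compact K' & K' \<subseteq> \<Omega> & 0 <= C & (\<forall>ph\<in>test \<Omega>. \<forall>S. (\<forall>p. p \<notin> K --> ph p = 0) -->
   (\<forall>p. \<bar>ph p\<bar> <= S & \<bar>dx ph p\<bar> <= S & \<bar>dz ph p\<bar> <= S) -->
   (\<exists>v1\<in>test \<Omega>. \<exists>v2\<in>test \<Omega>. \<exists>c. (\<forall>p. dx v1 p + dz v2 p = ph p - c * beta p) &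
    (\<forall>p. p \<notin> K' --> v1 p = 0 & v2 p = 0) &
    (\<forall>p. \<bar>v1 p\<bar> <= C * S & \<bar>dx v1 p\<bar> <= C * S & \<bar>dz v1 p\<bar> <= C * S) &
    (\<forall>p. \<bar>v2 p\<bar> <= C * S & \<bar>dx v2 p\<bar> <= C * S & \<bar>dz v2 p\<bar> <= C * S)))"
   by (elim exE) (rule that)
  note K' = conjunct1[OF KC] conjunct1[OF conjunct2[OF KC]]
  note B = conjunct2[OF conjunct2[OF conjunct2[OF KC]], THEN bspec, THEN spec, THEN mp, THEN mp]
  from loc(1)[unfolded local_C1_def, THEN spec, THEN mp, OF conjI[OF K']]
  obtain C1 where C1': "0 <= C1 & (\<forall>ph\<in>test \<Omega>. \<forall>S. (\<forall>p. p \<notin> K' --> ph p = 0) -->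
    (\<forall>p. \<bar>ph p\<bar> <= S & \<bar>dx ph p\<bar> <= S & \<bar>dz ph p\<bar> <= S) --> \<bar>G1 ph\<bar> <= C1 * S)"
   by (elim exE) (rule that)
  note C1 = conjunct2[OF C1', THEN bspec, THEN spec, THEN mp, THEN mp]
  from loc(2)[unfolded local_C1_def, THEN spec, THEN mp, OF conjI[OF K']]
  obtain C2 where C2': "0 <= C2 & (\<forall>ph\<in>test \<Omega>. \<forall>S. (\<forall>p. p \<notin> K' --> ph p = 0) -->
    (\<forall>p. \<bar>ph p\<bar> <= S & \<bar>dx ph p\<bar> <= S & \<bar>dz ph p\<bar> <= S) --> \<bar>G2 ph\<bar> <= C2 * S)"
   by (elim exE) (rule that)
  note C2 = conjunct2[OF C2', THEN bspec, THEN spec, THEN mp, THEN mp]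
  have "\<bar>q ph\<bar> <= ((C1 + C2) * C) * (\<Sum>vs | set vs \<subseteq> Basis & length vs <= 1. SUP x. \<bar>iter_deriv vs ph x\<bar>)"
   if ph: "ph \<in> test \<Omega>" "\<forall>x. x \<notin> K --> ph x = 0" for ph
  proof -
   define Q where "Q = (\<Sum>vs | set vs \<subseteq> Basis & length vs <= 1. SUP x. \<bar>iter_deriv vs ph x\<bar>)"
   have "\<forall>p. \<bar>ph p\<bar> <= Q & \<bar>dx ph p\<bar> <= Q & \<bar>dz ph p\<bar> <= Q" unfolding Q_def using C1_le_seminorm[OF ph(1)] by blast
   from B[OF ph this] obtain v1 v2 c where v: "v1 \<in> test \<Omega>" "v2 \<in> test \<Omega>"
    "\<forall>p. dx v1 p + dz v2 p = ph p - c * beta p" "\<forall>p. p \<notin> K' --> v1 p = 0 & v2 p = 0"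
    "\<forall>p. \<bar>v1 p\<bar> <= C * Q & \<bar>dx v1 p\<bar> <= C * Q & \<bar>dz v1 p\<bar> <= C * Q"
    "\<forall>p. \<bar>v2 p\<bar> <= C * Q & \<bar>dx v2 p\<bar> <= C * Q & \<bar>dz v2 p\<bar> <= C * Q" by blast
   have "divsol ph v1 v2 c" using v(1-3) by (simp add: divsol_def)
   note qv = q[OF this]
   have "\<bar>G1 v1\<bar> <= C1 * (C * Q)" by (rule C1[OF v(1) _ v(5)]) (use v(4) in blast)
   moreover have "\<bar>G2 v2\<bar> <= C2 * (C * Q)" by (rule C2[OF v(2) _ v(6)]) (use v(4) in blast)
   ultimately show ?thesis unfolding qv Q_def[symmetric] by (simp add: algebra_simps abs_le_iff)
  qed
  then show "\<exists>C N. \<forall>ph\<in>test \<Omega>. (\<forall>x. x \<notin> K --> ph x = 0) -->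
    \<bar>q ph\<bar> <= C * (\<Sum>vs | set vs \<subseteq> Basis & length vs <= N. SUP x. \<bar>iter_deriv vs ph x\<bar>)" by blast
 qed
 moreover have "q (dx ph) = - G1 ph & q (dz ph) = - G2 ph" if ph: "ph \<in> test \<Omega>" for ph
 proof
  have "divsol (dx ph) ph (%p. 0) 0" using ph by (simp add: divsol_def)
  from q[OF this] show "q (dx ph) = - G1 ph" using G0 by simp
  have "divsol (dz ph) (%p. 0) ph 0" using ph by (simp add: divsol_def)
  from q[OF this] show "q (dz ph) = - G2 ph" using G0 by simp
 qed
 ultimately show ?thesis by blast
qed

lemma local_C1_add: "local_C1 S ==> local_C1 T ==> local_C1 (%ph. S ph + T ph)"
 unfolding local_C1_def
proof (intro allI impI)
 fix K
 assume S: "\<forall>K. compact K & K \<subseteq> \<Omega> --> (\<exists>C\<ge>0. \<forall>ph\<in>test \<Omega>. \<forall>Sa. (\<forall>p. p \<notin> K --> ph p = 0) -->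
   (\<forall>p. \<bar>ph p\<bar> <= Sa & \<bar>dx ph p\<bar> <= Sa & \<bar>dz ph p\<bar> <= Sa) --> \<bar>S ph\<bar> <= C * Sa)"
  and T: "\<forall>K. compact K & K \<subseteq> \<Omega> --> (\<exists>C\<ge>0. \<forall>ph\<in>test \<Omega>. \<forall>Sa. (\<forall>p. p \<notin> K --> ph p = 0) -->
   (\<forall>p. \<bar>ph p\<bar> <= Sa & \<bar>dx ph p\<bar> <= Sa & \<bar>dz ph p\<bar> <= Sa) --> \<bar>T ph\<bar> <= C * Sa)"
  and K: "compact K & K \<subseteq> \<Omega>"
 from S K obtain C where C: "C >= 0" "\<forall>ph\<in>test \<Omega>. \<forall>Sa. (\<forall>p. p \<notin> K --> ph p = 0) -->
   (\<forall>p. \<bar>ph p\<bar> <= Sa & \<bar>dx ph p\<bar> <= Sa & \<bar>dz ph p\<bar> <= Sa) --> \<bar>S ph\<bar> <= C * Sa" by blast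
 from T K obtain D where D: "D >= 0" "\<forall>ph\<in>test \<Omega>. \<forall>Sa. (\<forall>p. p \<notin> K --> ph p = 0) -->
   (\<forall>p. \<bar>ph p\<bar> <= Sa & \<bar>dx ph p\<bar> <= Sa & \<bar>dz ph p\<bar> <= Sa) --> \<bar>T ph\<bar> <= D * Sa" by blast
 show "\<exists>C\<ge>0. \<forall>ph\<in>test \<Omega>. \<forall>Sa. (\<forall>p. p \<notin> K --> ph p = 0) -->
   (\<forall>p. \<bar>ph p\<bar> <= Sa & \<bar>dx ph p\<bar> <= Sa & \<bar>dz ph p\<bar> <= Sa) --> \<bar>S ph + T ph\<bar> <= C * Sa"
 proof (intro exI[of _ "C + D"] conjI ballI allI impI)
  fix ph s assume *: "ph \<in> test \<Omega>" "\<forall>p. p \<notin> K --> ph p = 0"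
   "\<forall>p. \<bar>ph p\<bar> <= s & \<bar>dx ph p\<bar> <= s & \<bar>dz ph p\<bar> <= s"
  have "\<bar>S ph\<bar> <= C * s" "\<bar>T ph\<bar> <= D * s" using C(2) D(2) * by blast+
  then show "\<bar>S ph + T ph\<bar> <= (C + D) * s" unfolding distrib_right by linarith
 qed (use C D in simp)
qed

text \<open>Finitely many cutoffs meet a fixed compact set, and a function supported there with
  first-order bound \<open>S\<close> has H1 norm at most \<open>sqrt (3 a) * S\<close>, where a is
  the measure of the set.\<close>

lemma local_C1_H_minus1:
 assumes T: "linear_functional_on (test \<Omega>) T"
  and Tk: "!!k. cut_dist chi k T \<in> H_minus1" "!!k. H_minus1_norm (cut_dist chi k T) <= M"
 shows "local_C1 T"
 unfolding local_C1_def
proof (intro allI impI)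
 fix K assume K: "compact K & K \<subseteq> \<Omega>"
 have M: "0 <= M" using H_minus1_bound(2)[OF Tk(1)] Tk(2) order_trans by blast
 have T_lin: "T (%x. a * f x + b * h x) = a * T f + b * T h" if "f \<in> test \<Omega>" "h \<in> test \<Omega>" for a b f h
  using T that unfolding linear_functional_on_def by blast
 have T0: "T (%x. 0) = 0" using T_lin[OF test_zero test_zero, of 0 0] by simp
 have T_sum: "T (%x. \<Sum>i\<in>I. f i x) = (\<Sum>i\<in>I. T (f i))" if "finite I" "!!i. f i \<in> test \<Omega>" for I :: "int set" and f
  using that(1)
 proof (induction I rule: finite_induct)
  case (insert i I)
  then show ?case using T_lin[OF that(2)[of i] test_sum[OF insert(1), of f], of 1 1] that(2) by simp
 qed (simp add: T0)
 have ct: "cut_fun chi k h \<in> test \<Omega>" if "h \<in> test \<Omega>" for k h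
  unfolding cut_fun_def by (rule test_smooth_mult[OF smooth_fst[OF smooth_shift[OF chi_smooth]] that])
 obtain R where R: "!!p. p \<in> K ==> norm p <= R" using compact_imp_bounded[of K] K by (auto simp: bounded_iff)
 define n where "n = \<lceil>R\<rceil> + 1"
 let ?J = "{- n..n}"
 define a where "a = measure lborel K"
 have Kb: "K \<in> sets borel" "emeasure lborel K < \<infinity>"
  using K emeasure_bounded_finite[OF compact_imp_bounded, of K] by (blast intro: borel_compact)+
 show "\<exists>C\<ge>0. \<forall>ph\<in>test \<Omega>. \<forall>S. (\<forall>p. p \<notin> K --> ph p = 0) -->
   (\<forall>p. \<bar>ph p\<bar> <= S & \<bar>dx ph p\<bar> <= S & \<bar>dz ph p\<bar> <= S) --> \<bar>T ph\<bar> <= C * S"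
 proof (intro exI[of _ "real (card ?J) * (M * sqrt (3 * a))"] conjI ballI allI impI)
  show "0 <= real (card ?J) * (M * sqrt (3 * a))" using M by (simp add: a_def)
  fix ph S assume ph: "ph \<in> test \<Omega>" and z: "\<forall>p. p \<notin> K --> ph p = 0"
   and S: "\<forall>p. \<bar>ph p\<bar> <= S & \<bar>dx ph p\<bar> <= S & \<bar>dz ph p\<bar> <= S"
  have S0: "0 <= S" using S abs_ge_zero order_trans by blast
  have sum2: "(\<Sum>k\<in>?J. cut_fun chi k ph p) = 2 * ph p" for p
  proof (cases "ph p = 0")
   case False
   then have "p \<in> K" using z by blast
   then have "\<bar>fst p\<bar> <= R" using R[of p] norm_fst_le[of "fst p" "snd p"] by simp
   then have "(\<Sum>k\<in>?J. chi (fst p - of_int k)) = 2" unfolding n_def by (intro chi_sum_eq') (auto simp: abs_le_iff, linarith+)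
   then show ?thesis by (simp add: cut_fun_def sum_distrib_right[symmetric])
  qed (simp add: cut_fun_def)
  have dz0: "dx ph p = 0" "dz ph p = 0" if "p \<notin> K" for p
   using pd_zero_outside[of K ph p] z that K compact_imp_closed by blast+
  have n1: "n1 ph (dx ph) (dz ph) <= sqrt (3 * a) * S"
  proof -
   have "(n1 ph (dx ph) (dz ph))^2 <= (LBINT p. indicator K p * (3 * S\<^sup>2))"
    unfolding n1_test_sq[OF ph]
   proof (rule integral_mono)
    show "integrable lborel (%p. (ph p)^2 + (dx ph p)^2 + (dz ph p)^2)"
     by (intro Bochner_Integration.integrable_add sqi_integrable test_sqi[of _ \<Omega>] ph test_dx test_dz)
    show "integrable lborel (%p. indicator K p * (3 * S\<^sup>2))"
     by (intro integrable_mult_left integrable_real_indicator) (use Kb in auto)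
    fix p
    have "x\<^sup>2 <= S\<^sup>2" if "\<bar>x\<bar> <= S" for x using power_mono[OF that, of 2] by simp
    then have "(ph p)^2 <= S\<^sup>2" "(dx ph p)^2 <= S\<^sup>2" "(dz ph p)^2 <= S\<^sup>2" using S by blast+
    then show "(ph p)^2 + (dx ph p)^2 + (dz ph p)^2 <= indicator K p * (3 * S\<^sup>2)"
     using dz0[of p] z[rule_format, of p] by (cases "p \<in> K") simp_all
   qed
   also have "\<dots> = (3 * a) * S\<^sup>2" using Kb by (simp add: a_def)
   finally have "n1 ph (dx ph) (dz ph) <= sqrt ((3 * a) * S\<^sup>2)" by (rule real_le_rsqrt)
   then show ?thesis using S0 by (simp add: real_sqrt_mult)
  qed
  have Tcut: "\<bar>T (cut_fun chi k ph)\<bar> <= M * (sqrt (3 * a) * S)" for k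
  proof -
   have "\<bar>T (cut_fun chi k ph)\<bar> <= H_minus1_norm (cut_dist chi k T) * n1 ph (dx ph) (dz ph)"
    using H_minus1_bound(1)[OF Tk(1) ph, of k] by (simp add: cut_dist_def)
   also have "\<dots> <= M * (sqrt (3 * a) * S)" by (rule mult_mono[OF Tk(2) n1 M n1_nonneg])
   finally show ?thesis .
  qed
  have "2 * T ph = T (%p. \<Sum>k\<in>?J. cut_fun chi k ph p)" unfolding sum2 using T_lin[OF ph ph, of 2 0] by simp
  also have "\<dots> = (\<Sum>k\<in>?J. T (cut_fun chi k ph))" by (rule T_sum) (auto intro: ct ph)
  also have "\<bar>\<dots>\<bar> <= (\<Sum>k\<in>?J. M * (sqrt (3 * a) * S))" by (rule order_trans[OF sum_abs sum_mono[OF Tcut]])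
  also have "\<dots> = real (card ?J) * (M * (sqrt (3 * a) * S))" by simp
  finally have "\<bar>2 * T ph\<bar> <= real (card ?J) * (M * (sqrt (3 * a) * S))" .
  then show "\<bar>T ph\<bar> <= real (card ?J) * (M * sqrt (3 * a)) * S" by (simp only: abs_mult mult.assoc)
 qed
qed

end

text \<open>After \<open>conv_laplacian\<close> the weighted gradients are paired with first
  derivatives of \<open>ph\<close>; on a compact set, division by \<open>sw\<close> costs only a
  constant.\<close>

lemma local_C1_laplacian:
 assumes c: "conv E g" "conv (%n. dx (E n)) gx" "conv (%n. dz (E n)) gz"
 shows "local_C1 (%ph. (LINT p|lom. g p * dx (dx ph) p) + (LINT p|lom. g p * dz (dz ph) p))"
 unfolding local_C1_def
proof (intro allI impI)
 fix K assume K: "compact K & K \<subseteq> \<Omega>"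
 have bK: "bounded K" using K compact_imp_bounded by auto
 obtain b where ab': "K \<subseteq> cbox (-b) b" using bounded_subset_cbox_symmetric[OF bK] .
 define a where "a = -b"
 have ab: "K \<subseteq> cbox a b" using ab' by (simp add: a_def)
 obtain Q where Q: "!!p. p \<in> K ==> \<bar>qd (fst p)\<bar> <= Q"
 proof -
  have "bounded ((%p. qd (fst p)) ` K)"
   using K by (intro compact_imp_bounded compact_continuous_image smooth_continuous smooth_fst qd_smooth) auto
  then obtain B where "\<forall>y\<in>(%p. qd (fst p)) ` K. norm y <= B" unfolding bounded_iff ..
  then show thesis by (intro that[of B]) simp
 qed
 define I where "I = l2 lom (%p. \<bar>Q\<bar> * indicator (cbox a b) p)"
 define A where "A = l2 lom (%p. sw p * gx p)"
 define B where "B = l2 lom (%p. sw p * gz p)"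
 have nn: "0 <= I" "0 <= A" "0 <= B" by (simp_all add: I_def A_def B_def)
 show "\<exists>C\<ge>0. \<forall>ph\<in>test \<Omega>. \<forall>S. (\<forall>p. p \<notin> K --> ph p = 0) -->
   (\<forall>p. \<bar>ph p\<bar> <= S & \<bar>dx ph p\<bar> <= S & \<bar>dz ph p\<bar> <= S) -->
   \<bar>(LINT p|lom. g p * dx (dx ph) p) + (LINT p|lom. g p * dz (dz ph) p)\<bar> <= C * S"
 proof (intro exI[of _ "(A + B) * I"] conjI ballI allI impI)
  fix ph S assume ph: "ph \<in> test \<Omega>" and z: "\<forall>p. p \<notin> K --> ph p = 0"
   and S: "\<forall>p. \<bar>ph p\<bar> <= S & \<bar>dx ph p\<bar> <= S & \<bar>dz ph p\<bar> <= S"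
  have S0: "0 <= S" using S abs_ge_zero order_trans by blast
  have dz0: "dx ph p = 0" "dz ph p = 0" if "p \<notin> K" for p
   using pd_zero_outside[of K ph p] z that K compact_imp_closed by blast+
  have le: "l2 lom (%p. \<eta> p / sw p) <= S * I" if \<eta>: "\<eta> \<in> test \<Omega>" "!!p. p \<notin> K ==> \<eta> p = 0" "!!p. \<bar>\<eta> p\<bar> <= S" for \<eta>
  proof -
   have [measurable]: "\<eta> \<in> bmeas" by (rule test_measurable[OF \<eta>(1)])
   have i: "(%p. \<bar>Q\<bar> * indicator (cbox a b) p) \<in> sqi lom"
    by (rule sqi_cmult[OF sqi_lborel_lom[OF indicator_cbox_sqi]])
   have "l2 lom (%p. \<eta> p / sw p) <= l2 lom (%p. S * (\<bar>Q\<bar> * indicator (cbox a b) p))"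
   proof (rule l2_mono(2)[OF sqi_cmult[OF i]])
    show "(%p. \<eta> p / sw p) \<in> borel_measurable lom" by (rule lom_measurable_borel) measurable
    fix p
    show "\<bar>\<eta> p / sw p\<bar> <= \<bar>S * (\<bar>Q\<bar> * indicator (cbox a b) p)\<bar>"
    proof (cases "p \<in> K")
     case True
     have "\<bar>\<eta> p\<bar> * 1 <= S * (sw p * qd (fst p))" using \<eta>(3) sw_qd S0 by (intro mult_mono) auto
     also have "\<dots> <= S * (sw p * \<bar>Q\<bar>)" using Q[OF True] S0 sw_pos[of p] by (intro mult_left_mono) auto
     finally show ?thesis using True ab S0 sw_pos[of p] by (auto simp: abs_mult field_simps subset_eq)
    qed (simp add: \<eta>(2))
   qed
   then show ?thesis using S0 by (simp add: l2_cmult I_def)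
  qed
  have lx: "l2 lom (%p. dx ph p / sw p) <= S * I" by (rule le[OF test_dx[OF ph]]) (use dz0 S in auto)
  have lz: "l2 lom (%p. dz ph p / sw p) <= S * I" by (rule le[OF test_dz[OF ph]]) (use dz0 S in auto)
  have "\<bar>\<integral>p. gx p * dx ph p \<partial>lom\<bar> <= A * (S * I)"
   using conv_inner(2)[OF c(2) test_dx[OF ph]] mult_left_mono[OF lx nn(2)] unfolding A_def by linarith
  moreover have "\<bar>\<integral>p. gz p * dz ph p \<partial>lom\<bar> <= B * (S * I)"
   using conv_inner(2)[OF c(3) test_dz[OF ph]] mult_left_mono[OF lz nn(3)] unfolding B_def by linarith
  ultimately have "\<bar>(LINT p|lom. gx p * dx ph p) + (LINT p|lom. gz p * dz ph p)\<bar> <= A * (S * I) + B * (S * I)" by linarith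
  then show "\<bar>(LINT p|lom. g p * dx (dx ph) p) + (LINT p|lom. g p * dz (dz ph) p)\<bar> <= (A + B) * I * S"
   unfolding conv_laplacian[OF c ph] by (simp add: algebra_simps)
 qed (use nn in simp)
qed

lemma laplacian_lin:
 assumes c: "conv E g" and ph: "ph \<in> test \<Omega>" and \<eta>: "\<eta> \<in> test \<Omega>"
 shows "(LINT p|lom. g p * dx (dx (%x. a * ph x + b * \<eta> x)) p) + (LINT p|lom. g p * dz (dz (%x. a * ph x + b * \<eta> x)) p)
  = a * ((LINT p|lom. g p * dx (dx ph) p) + (LINT p|lom. g p * dz (dz ph) p))
  + b * ((LINT p|lom. g p * dx (dx \<eta>) p) + (LINT p|lom. g p * dz (dz \<eta>) p))"
proof -
 note i = conv_inner(3)[OF c test_dx[OF test_dx[OF ph]]] conv_inner(3)[OF c test_dx[OF test_dx[OF \<eta>]]]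
  conv_inner(3)[OF c test_dz[OF test_dz[OF ph]]] conv_inner(3)[OF c test_dz[OF test_dz[OF \<eta>]]]
 have d: "pd v (pd v (%x. a * ph x + b * \<eta> x)) = (%x. a * pd v (pd v ph) x + b * pd v (pd v \<eta>) x)" if "v \<in> Basis" for v
  using that test_smooth[OF ph] test_smooth[OF \<eta>] by (simp add: pd_lin smooth_pd)
 have e: "(%p. g p * (a * u p + b * w p)) = (%p. a * (g p * u p) + b * (g p * w p))" for u w
  by (simp add: fun_eq_iff algebra_simps)
 show ?thesis unfolding d[OF e_in_Basis(1)] d[OF e_in_Basis(2)] e using i by (simp add: algebra_simps)
qed

lemma dist_laplacian_eq:
 "dist_laplacian (dist_of u) ph = (LINT p|lom. u p * dx (dx ph) p) + (LINT p|lom. u p * dz (dz ph) p)"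
 unfolding dist_laplacian_def Basis_point by (simp add: dist_deriv_pd dist_of_lom)

context cutoff_fun
begin

text \<open>The velocity is the rotated limit of the gradients of the approximate stream functions;
  \<open>sqrt 2\<close> combines its two components, which obey the same bound. The curl identity
  for the limit is the compatibility condition that yields the pressure.\<close>

lemma stokes_exists:
 assumes f: "f \<in> H_minus1_uloc chi"
 shows "\<exists>u\<in>H1_uloc chi. stokes_zero_flux chi f u &
  H1_uloc_norm chi u <= sqrt 2 * (sqrt (6 * L\<^sup>2) * (10 * C0)) * H_minus1_uloc_norm chi f"
proof -
 obtain \<psi> where "stokes_seq chi f \<psi>" using stokes_seq_exists[OF f] by blast
 then interpret stokes_seq chi f \<psi> .
 obtain gx gz gxx gxz gzz where g: "conv (%n. dx (\<psi> n)) gx" "conv (%n. dz (\<psi> n)) gz" "conv (%n. dx (dx (\<psi> n))) gxx"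
  "conv (%n. dx (dz (\<psi> n))) gxz" "conv (%n. dz (dz (\<psi> n))) gzz" using limits_exist by blast
 define u where "u p = (gz p, - gx p)" for p
 have u1: "fst \<circ> u = gz" and u2: "snd \<circ> u = (%p. - gx p)" by (auto simp: u_def)
 note c1 = g(2) g(4) g(5)
 have m: "pd v (%p. - dx (\<psi> n) p) = (%p. - pd v (dx (\<psi> n)) p)" for v n
  by (rule pd_uminus[OF smooth_dx[OF test_smooth[OF \<psi>]]])
 have c2: "conv (%n p. - dx (\<psi> n) p) (%p. - gx p)" "conv (%n. dx (%p. - dx (\<psi> n) p)) (%p. - gxx p)"
  "conv (%n. dz (%p. - dx (\<psi> n) p)) (%p. - gxz p)"
  unfolding m dz_dx_psi by (rule conv_uminus[OF g(1)] conv_uminus[OF g(3)] conv_uminus[OF g(4)])+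
 note cc1 = conv_cut_fun[OF c1] and cc2 = conv_cut_fun[OF c2]
 have K0M: "0 <= K0 * M" using C0_pos M_nonneg by (simp add: K0_def)
 have b1: "H1_norm (cut_fun chi k gz) <= K0 * M" for k
  by (rule H1_norm_cut_bound[OF c1]) (simp add: jsq_def jet_def)
 have b2: "H1_norm (cut_fun chi k (%p. - gx p)) <= K0 * M" for k
  by (rule H1_norm_cut_bound[OF c2]) (simp add: jsq_def jet_def m dz_dx_psi)
 have vec: "H1_vec_norm_cut chi k u <= sqrt 2 * K0 * M" for k
 proof -
  have n: "0 <= H1_norm h" for h by (simp add: H1_norm_def)
  have "(H1_norm (cut_fun chi k gz))^2 + (H1_norm (cut_fun chi k (%p. - gx p)))^2 <= (K0 * M)^2 + (K0 * M)^2"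
   by (intro add_mono power_mono b1 b2 n)
  then have "H1_vec_norm_cut chi k u <= sqrt (2 * (K0 * M)^2)" unfolding H1_vec_norm_cut_def u1 u2 by simp
  then show ?thesis using K0M by (simp add: real_sqrt_mult mult.assoc)
 qed
 have "u \<in> H1_uloc chi" unfolding H1_uloc_def mem_Collect_eq u1 u2
  using cc1(1) cc2(1) vec by (auto intro!: bdd_aboveI2[of _ _ "sqrt 2 * K0 * M"])
 moreover have "H1_uloc_norm chi u <= sqrt 2 * (sqrt (6 * L\<^sup>2) * (10 * C0)) * M"
  unfolding H1_uloc_norm_def by (rule cSUP_least) (use vec in \<open>auto simp: K0_def\<close>)
 moreover have "stokes_zero_flux chi f u"
  unfolding stokes_zero_flux_def
 proof (intro conjI)
  show "zero_trace chi u" unfolding zero_trace_def u1 u2 using cc1(2) cc2(2) by blast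
  show "zero_flux u" unfolding zero_flux_def using limit_zero_flux[OF g(2)] by (simp add: u_def)
  show "divergence_free u"
   unfolding divergence_free_def u1 u2 dist_deriv_pd dist_of_lom
   using limit_divergence[OF g(1,2)] by simp
  have lin: "linear_functional_on (test \<Omega>) (fst f)" "linear_functional_on (test \<Omega>) (snd f)"
   using f by (auto simp: H_minus1_uloc_def distributions_def)
  have Tk: "cut_dist chi k (fst f) \<in> H_minus1" "cut_dist chi k (snd f) \<in> H_minus1" for k
   using f by (auto simp: H_minus1_uloc_def)
  let ?l = "%h ph. (LINT p|lom. h p * dx (dx ph) p) + (LINT p|lom. h p * dz (dz ph) p)"
  have "\<exists>q\<in>distributions \<Omega>. \<forall>ph\<in>test \<Omega>. q (dx ph) = - (fst f ph + ?l gz ph) & q (dz ph) = - (snd f ph + ?l (%p. - gx p) ph)"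
  proof (rule de_rham)
   have "fst f (%x. a * ph x + b * \<eta> x) = a * fst f ph + b * fst f \<eta>" "snd f (%x. a * ph x + b * \<eta> x) = a * snd f ph + b * snd f \<eta>"
    if "ph \<in> test \<Omega>" "\<eta> \<in> test \<Omega>" for a b ph \<eta> using lin that unfolding linear_functional_on_def by blast+
   note fl = this
   show "linear_functional_on (test \<Omega>) (%ph. fst f ph + ?l gz ph)"
    unfolding linear_functional_on_def
   proof (intro ballI allI)
    fix ph \<eta> a b assume t: "ph \<in> test \<Omega>" "\<eta> \<in> test \<Omega>"
    show "fst f (%x. a * ph x + b * \<eta> x) + ?l gz (%x. a * ph x + b * \<eta> x) = a * (fst f ph + ?l gz ph) + b * (fst f \<eta> + ?l gz \<eta>)"
     unfolding laplacian_lin[OF c1(1) t] fl(1)[OF t] by (simp add: algebra_simps)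
   qed
   show "linear_functional_on (test \<Omega>) (%ph. snd f ph + ?l (%p. - gx p) ph)"
    unfolding linear_functional_on_def
   proof (intro ballI allI)
    fix ph \<eta> a b assume t: "ph \<in> test \<Omega>" "\<eta> \<in> test \<Omega>"
    show "snd f (%x. a * ph x + b * \<eta> x) + ?l (%p. - gx p) (%x. a * ph x + b * \<eta> x)
      = a * (snd f ph + ?l (%p. - gx p) ph) + b * (snd f \<eta> + ?l (%p. - gx p) \<eta>)"
     unfolding laplacian_lin[OF c2(1) t] fl(2)[OF t] by (simp add: algebra_simps)
   qed
   show "local_C1 (%ph. fst f ph + ?l gz ph)"
    by (rule local_C1_add[OF local_C1_H_minus1[OF lin(1) Tk(1) H_minus1_uloc_components(1)[OF f]] local_C1_laplacian[OF c1]])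
   show "local_C1 (%ph. snd f ph + ?l (%p. - gx p) ph)"
    by (rule local_C1_add[OF local_C1_H_minus1[OF lin(2) Tk(2) H_minus1_uloc_components(2)[OF f]] local_C1_laplacian[OF c2]])
   fix \<eta> assume "\<eta> \<in> test \<Omega>"
   from limit_curl[OF g(1,2) this]
   show "fst f (dz \<eta>) + ?l gz (dz \<eta>) = snd f (dx \<eta>) + ?l (%p. - gx p) (dx \<eta>)"
    by (simp add: curlf_def)
  qed
  then obtain q where q: "q \<in> distributions \<Omega>" "!!ph. ph \<in> test \<Omega> ==> q (dx ph) = - (fst f ph + ?l gz ph)"
   "!!ph. ph \<in> test \<Omega> ==> q (dz ph) = - (snd f ph + ?l (%p. - gx p) ph)" by blast
  have "momentum_eq u q f"
   unfolding momentum_eq_def u1 u2 dist_laplacian_eq dist_deriv_pd using q(2,3) by simp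
  with q(1) show "\<exists>p\<in>distributions \<Omega>. momentum_eq u p f" by blast
 qed
 ultimately show ?thesis by blast
qed

end

section \<open>Mollification\<close>

lemma test_norm_support:
 assumes "ph \<in> test (S :: point set)"
 shows "\<exists>R>0. \<forall>y. norm y > R --> ph y = 0"
proof -
 obtain K where K: "compact K" "\<forall>x. x \<notin> K --> ph x = 0" using test_support[OF assms] by blast
 obtain B where B: "B > 0" "\<forall>x\<in>K. norm x <= B" using compact_imp_bounded[OF K(1)] bounded_pos by blast
 then show ?thesis using K(2) by (intro exI[of _ B]) force
qed

lemma point_linear_bound:
 fixes h :: point
 assumes "\<bar>a\<bar> <= A" "\<bar>b\<bar> <= B"
 shows "\<bar>fst h * a + snd h * b\<bar> <= (A + B) * norm h"
proof -
 have "\<bar>fst h\<bar> <= norm h" "\<bar>snd h\<bar> <= norm h" using norm_fst_le[of "fst h" "snd h"] norm_snd_le[of "snd h" "fst h"] by simp_all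
 then have "\<bar>fst h\<bar> * \<bar>a\<bar> <= norm h * A" "\<bar>snd h\<bar> * \<bar>b\<bar> <= norm h * B" using assms by (auto intro!: mult_mono)
 then have "\<bar>fst h * a\<bar> <= norm h * A" "\<bar>snd h * b\<bar> <= norm h * B" by (simp_all add: abs_mult)
 then show ?thesis by (simp add: algebra_simps abs_le_iff)
qed

lemma test_lipschitz:
 assumes ph: "ph \<in> test (S :: point set)"
 shows "\<exists>C\<ge>0. \<forall>a b. \<bar>ph b - ph a\<bar> <= C * norm (b - a)"
proof -
 obtain A where A: "A > 0" "!!p. \<bar>dx ph p\<bar> <= A" using test_bounded[OF test_dx[OF ph]] by metis
 obtain B where B: "B > 0" "!!p. \<bar>dz ph p\<bar> <= B" using test_bounded[OF test_dz[OF ph]] by metis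
 have "norm (ph b - ph a) <= (A + B) * norm (b - a)" for a b
 proof (rule differentiable_bound[of UNIV])
  show "(ph has_derivative (%h. fst h * dx ph p + snd h * dz ph p)) (at p within UNIV)" for p
   using smooth_has_derivative_point[OF test_smooth[OF ph]] by simp
  show "onorm (%h. fst h * dx ph p + snd h * dz ph p) <= A + B" for p
   by (rule onorm_le) (simp add: point_linear_bound A B)
 qed auto
 then show ?thesis using A(1) B(1) by (intro exI[of _ "A + B"]) auto
qed

text \<open>Lipschitz continuity of the gradient and the mean value inequality on the ball of radius
  \<open>norm v\<close> give a quadratic remainder. Its uniformity in the base point is what allows
  integration under a convolution.\<close>

lemma test_taylor:
 assumes r: "r \<in> test (S :: point set)"
 shows "\<exists>C\<ge>0. \<forall>a v. \<bar>r (a + v) - r a - (fst v * dx r a + snd v * dz r a)\<bar> <= C * (norm v)^2"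
proof -
 obtain A where A: "A >= 0" "!!a b. \<bar>dx r b - dx r a\<bar> <= A * norm (b - a)" using test_lipschitz[OF test_dx[OF r]] by blast
 obtain B where B: "B >= 0" "!!a b. \<bar>dz r b - dz r a\<bar> <= B * norm (b - a)" using test_lipschitz[OF test_dz[OF r]] by blast
 have "norm (r (a + v) - r a - (fst v * dx r a + snd v * dz r a)) <= (A + B) * (norm v)^2" for a v
 proof -
  define g where "g = (%y. r y - (fst y * dx r a + snd y * dz r a))"
  have "norm (g (a + v) - g a) <= ((A + B) * norm v) * norm ((a + v) - a)"
  proof (rule differentiable_bound[of "cball a (norm v)"])
   fix y assume y: "y \<in> cball a (norm v)"
   have "(g has_derivative (%h. (fst h * dx r y + snd h * dz r y) - (fst h * dx r a + snd h * dz r a))) (at y)"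
    unfolding g_def by (rule has_derivative_diff[OF smooth_has_derivative_point[OF test_smooth[OF r]]])
     (auto intro!: derivative_eq_intros)
   then show "(g has_derivative (%h. fst h * (dx r y - dx r a) + snd h * (dz r y - dz r a))) (at y within cball a (norm v))"
    by (auto intro: has_derivative_at_withinI simp: algebra_simps)
   have n: "norm (y - a) <= norm v" using y by (simp add: dist_norm norm_minus_commute)
   have "\<bar>dx r y - dx r a\<bar> <= A * norm v" "\<bar>dz r y - dz r a\<bar> <= B * norm v"
    by (rule order_trans[OF A(2) mult_left_mono[OF n A(1)]], rule order_trans[OF B(2) mult_left_mono[OF n B(1)]])
   from point_linear_bound[OF this]
   show "onorm (%h. fst h * (dx r y - dx r a) + snd h * (dz r y - dz r a)) <= (A + B) * norm v"
    by (intro onorm_le) (simp add: algebra_simps)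
  qed (auto simp: dist_norm)
  then show ?thesis by (simp add: g_def power2_eq_square algebra_simps)
 qed
 then show ?thesis using A(1) B(1) by (intro exI[of _ "A + B"]) auto
qed

definition moll :: "(point => real) => (point => real) => point => real" where
 "moll r h p = (LBINT q. r (p - q) * h q)"

definition loci :: "(point => real) => bool" where
 "loci h \<longleftrightarrow> h \<in> bmeas & (\<forall>R. integrable lborel (%q. indicator (cball 0 R) q * h q))"

lemma bounded_kernel_integral:
 assumes h: "loci h" and [measurable]: "D \<in> bmeas" and D: "!!q. \<bar>D q\<bar> <= C"
  and z: "!!q. norm q > R ==> D q = 0"
 shows "integrable lborel (%q. D q * h q)" "\<bar>\<integral>q. D q * h q \<partial>lborel\<bar> <= C * (LBINT q. \<bar>indicator (cball 0 R) q * h q\<bar>)"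
proof -
 have [measurable]: "h \<in> bmeas" and i: "integrable lborel (%q. indicator (cball 0 R) q * h q)"
  using h by (auto simp: loci_def)
 have le: "\<bar>D q * h q\<bar> <= C * \<bar>indicator (cball 0 R) q * h q\<bar>" for q
  using D[of q] z[of q] by (cases "norm q > R") (auto simp: abs_mult indicator_def intro: mult_right_mono)
 have i2: "integrable lborel (%q. C * \<bar>indicator (cball 0 R) q * h q\<bar>)" using i by auto
 show int: "integrable lborel (%q. D q * h q)"
 proof (rule Bochner_Integration.integrable_bound[OF i2])
  show "AE q in lborel. norm (D q * h q) <= norm (C * \<bar>indicator (cball 0 R) q * h q\<bar>)"
   using order_trans[OF le abs_ge_self] by (intro AE_I2) simp
 qed measurable
 have "\<bar>\<integral>q. D q * h q \<partial>lborel\<bar> <= (LBINT q. \<bar>D q * h q\<bar>)" by (rule integral_abs_bound)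
 also have "\<dots> <= (LBINT q. C * \<bar>indicator (cball 0 R) q * h q\<bar>)"
  by (rule integral_mono[OF _ i2 le]) (use int in auto)
 finally show "\<bar>\<integral>q. D q * h q \<partial>lborel\<bar> <= C * (LBINT q. \<bar>indicator (cball 0 R) q * h q\<bar>)" by simp
qed

lemma moll_integrable:
 assumes r: "r \<in> test (S :: point set)" and h: "loci h"
 shows "integrable lborel (%q. r (p - q) * h q)"
proof -
 obtain R where R: "\<forall>y. norm y > R --> r y = 0" using test_norm_support[OF r] by blast
 obtain C where C: "!!x. \<bar>r x\<bar> <= C" using test_bounded[OF r] by metis
 have [measurable]: "r \<in> bmeas" by (rule test_measurable[OF r])
 have "r (p - q) = 0" if "norm q > norm p + R" for q
 proof -
  have "norm (p - q) > R" using norm_triangle_ineq2[of q p] that by (simp add: norm_minus_commute)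
  then show ?thesis using R by blast
 qed
 then show ?thesis by (intro bounded_kernel_integral(1)[OF h, of "%q. r (p - q)" C "norm p + R"] C) auto
qed

text \<open>The Taylor remainder of the kernel is quadratic in the increment and, for increments
  below 1, supported in a fixed ball. Integrated against a locally integrable function it stays
  quadratic.\<close>

lemma moll_has_derivative:
 assumes r: "r \<in> test (S :: point set)" and h: "loci h"
 shows "(moll r h has_derivative (%v. fst v * moll (dx r) h p + snd v * moll (dz r) h p)) (at p)"
proof -
 obtain C where C: "C >= 0" "!!a v. \<bar>r (a + v) - r a - (fst v * dx r a + snd v * dz r a)\<bar> <= C * (norm v)^2"
  using test_taylor[OF r] by blast
 obtain R where R: "R > 0" "!!y. norm y > R ==> r y = 0" using test_norm_support[OF r] by blast
 have z: "dx r y = 0" "dz r y = 0" if "norm y > R" for y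
  using pd_zero_outside[of "cball 0 R" r y] R(2) that by auto
 define B where "B = (LBINT q. \<bar>indicator (cball 0 (norm p + 1 + R)) q * h q\<bar>)"
 have [measurable]: "r \<in> bmeas" "dx r \<in> bmeas" "dz r \<in> bmeas"
  using r by (auto intro: test_measurable test_dx test_dz)
 show ?thesis
 proof (rule has_derivativeI_sandwich[of 1 _ _ _ _ "%y. C * B * norm (y - p)"])
  show "bounded_linear (%v. fst v * moll (dx r) h p + snd v * moll (dz r) h p)"
   by (intro bounded_linear_add bounded_linear_mult_const bounded_linear_fst bounded_linear_snd)
  show "((%y. C * B * norm (y - p)) \<longlongrightarrow> 0) (at p)"
   by (rule tendsto_eq_intros refl | simp)+
  fix y assume yp: "y ~= p" "dist y p < 1"
  define v where "v = y - p"
  have v: "norm v < 1" "v ~= 0" "y = p + v" using yp by (auto simp: v_def dist_norm)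
  let ?D = "%q. r (p - q + v) - r (p - q) - (fst v * dx r (p - q) + snd v * dz r (p - q))"
  have pq: "p + v - q = p - q + v" for q by simp
  have i0: "integrable lborel (%q. r (p - q + v) * h q)" using moll_integrable[OF r h, of "p + v"] unfolding pq .
  have i: "integrable lborel (%q. r (p - q) * h q)"
   "integrable lborel (%q. dx r (p - q) * h q)" "integrable lborel (%q. dz r (p - q) * h q)"
   by (rule moll_integrable[OF r h] moll_integrable[OF test_dx[OF r] h] moll_integrable[OF test_dz[OF r] h])+
  have "(LBINT q. ?D q * h q) = (LBINT q. r (p - q + v) * h q - r (p - q) * h q - (fst v * (dx r (p - q) * h q) + snd v * (dz r (p - q) * h q)))"
   by (rule LINT_cong) (auto simp: algebra_simps)
  also have "\<dots> = moll r h y - moll r h p - (fst v * moll (dx r) h p + snd v * moll (dz r) h p)"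
   unfolding moll_def v(3) pq using i i0 by simp
  finally have eq: "moll r h y - moll r h p - (fst v * moll (dx r) h p + snd v * moll (dz r) h p) = (LBINT q. ?D q * h q)" ..
  have "\<bar>\<integral>q. ?D q * h q \<partial>lborel\<bar> <= C * (norm v)^2 * B" unfolding B_def
  proof (rule bounded_kernel_integral(2)[OF h])
   fix q :: point assume q: "norm q > norm p + 1 + R"
   have "norm (p - q) > 1 + R" using norm_triangle_ineq2[of q p] q by (simp add: norm_minus_commute)
   moreover have "norm (p - q + v) >= norm (p - q) - norm v" using norm_diff_ineq[of "p - q" v] by simp
   ultimately show "?D q = 0" using v(1) R z by simp
  qed (use C in auto)
  then have "norm (moll r h y - moll r h p - (fst v * moll (dx r) h p + snd v * moll (dz r) h p)) <= (C * B * norm v) * norm v"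
   unfolding eq by (simp add: power2_eq_square algebra_simps)
  then show "norm (moll r h y - moll r h p - (fst (y - p) * moll (dx r) h p + snd (y - p) * moll (dz r) h p)) / norm (y - p) <= C * B * norm (y - p)"
   using v(2) unfolding v_def[symmetric] by (simp add: field_simps)
 qed auto
qed

lemma moll_pd: "r \<in> test (S :: point set) ==> loci h ==> v \<in> Basis ==> pd v (moll r h) = moll (pd v r) h"
proof (rule ext)
 fix p assume r: "r \<in> test S" and h: "loci h" and v: "v \<in> Basis"
 have "pd v (moll r h) p = fst v * moll (dx r) h p + snd v * moll (dz r) h p" by (rule pd_eqI[OF moll_has_derivative[OF r h]])
 then show "pd v (moll r h) p = moll (pd v r) h p" using v by (auto simp: Basis_point e\<^sub>x_def e\<^sub>z_def)
qed

lemma moll_smooth: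
 assumes r: "r \<in> test (S :: point set)" and h: "loci h"
 shows "smooth (moll r h)"
proof (rule smooth_coinduct[of "%f. \<exists>r\<in>test S. f = moll r h"])
 show "\<exists>ra\<in>test S. moll r h = moll ra h" using r by blast
 fix g assume "\<exists>r\<in>test S. g = moll r h"
 then obtain s where s: "s \<in> test S" "g = moll s h" by blast
 show "(\<forall>x. g differentiable at x) & (\<forall>v\<in>Basis. \<exists>r\<in>test S. pd v g = moll r h)"
  unfolding s(2) differentiable_def using moll_has_derivative[OF s(1) h] moll_pd[OF s(1) h] test_pd[OF s(1)] by blast
qed

lemma nn_integral_affine_point:
 fixes f :: "point => ennreal"
 assumes [measurable]: "f \<in> bmeas" and c: "c ~= 0"
 shows "(\<integral>\<^sup>+p. f p \<partial>lborel) = ennreal (c\<^sup>2) * (\<integral>\<^sup>+p. f (t + c *\<^sub>R p) \<partial>lborel)"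
 by (subst lborel_affine[OF c, of t])
  (simp add: nn_integral_density nn_integral_distr nn_integral_cmult power2_eq_square ennreal_mult[symmetric])

text \<open>The strip is dilated before mollifying, so that the support moves away from the boundary.\<close>

context cutoff_fun
begin

definition eps :: "nat => real" where "eps n = 1 / (real n + 8)"

text \<open>Dilating by 1 + 4 eps moves both boundary lines outwards by 2 eps, which exceeds the
  width eps of the kernel.\<close>

definition lam :: "nat => real" where "lam n = 1 + 4 * eps n"

text \<open>The translation keeps the centre line z = 1/2 of the strip fixed.\<close>

definition dil :: "nat => point => point" where "dil n p = lam n *\<^sub>R p + (0, (1 - lam n) / 2)"

definition be :: "nat => real => real" where "be n x = (1 / eps n) * bz ((1 / eps n) * x + 0)"

definition ker :: "nat => point => real" where "ker n p = be n (fst p) * be n (snd p)"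

definition T :: "nat => (point => real) => point => real" where "T n h p = moll (ker n) h (dil n p)"

lemma eps: "0 < eps n" "eps n <= 1/8" and lam: "1 < lam n" "lam n <= 3/2" "lam n > 0"
 by (auto simp: eps_def lam_def field_simps)

lemma eps_tendsto: "eps ---> 0"
 unfolding eps_def by real_asymp

lemma be_smooth: "smooth (be n)"
 unfolding be_def[abs_def] by (intro smooth_mult smooth_const smooth_shift_real bz_smooth)

lemma be_0: "x < 0 \<or> eps n < x ==> be n x = 0"
 using eps(1)[of n] by (auto simp: be_def field_simps intro!: bz_0)

lemma be_nonneg: "0 <= be n x"
 using eps(1)[of n] bump_integral_pos bump_range(1) by (auto simp: be_def bz_def less_imp_le)

lemma be_test: "be n \<in> test UNIV"
 by (rule test_functionsI[OF be_smooth, of "{0..eps n}"]) (auto intro: be_0)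

lemma be_integral: "(LBINT x. be n x) = 1"
proof -
 have i: "integrable lborel bz" by (rule test_integrable[OF bz_test])
 have "(LBINT x. bz x) = integral UNIV bz" using has_integral_integral_lborel[OF i] by (rule integral_unique[symmetric])
 also have "\<dots> = integral {0..1} bz"
  unfolding integral_restrict_UNIV[of "{0..1}" bz, symmetric] by (rule integral_cong) (auto intro: bz_0)
 finally have "(LBINT x. bz x) = 1" by (simp add: bz_integral)
 moreover have "(LBINT x. bz x) = (LBINT x. (1 / eps n) * bz (0 + (1 / eps n) * x))"
  using lborel_integral_real_affine[of "1 / eps n" bz 0] eps(1)[of n] by simp
 ultimately show ?thesis by (simp add: be_def[abs_def])
qed

lemma ker_test: "ker n \<in> test UNIV"
proof (rule test_functionsI[of _ "cbox (0, 0) (eps n, eps n)"])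
 show "smooth (ker n)" unfolding ker_def[abs_def] by (intro smooth_mult smooth_fst smooth_snd be_smooth)
 show "ker n p = 0" if "p \<notin> cbox (0, 0) (eps n, eps n)" for p
  using that be_0[of "fst p" n] be_0[of "snd p" n] by (cases p) (auto simp: ker_def not_le)
qed auto

lemma ker_nonneg: "0 <= ker n p" by (simp add: ker_def be_nonneg)

lemma ker_0: "ker n p ~= 0 ==> 0 <= fst p & fst p <= eps n & 0 <= snd p & snd p <= eps n"
 using be_0[of "fst p" n] be_0[of "snd p" n] by (force simp: ker_def)

lemma ker_measurable [measurable]: "ker n \<in> bmeas" by (rule test_measurable[OF ker_test])

lemma dil_measurable [measurable]: "dil n \<in> bmeas" unfolding dil_def[abs_def] by measurable

lemma ker_integral: "(LBINT p. ker n p) = 1"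
proof -
 have "integrable (lborel \<Otimes>\<^sub>M lborel) (%(x, y). be n x * be n y)"
  using test_integrable[OF ker_test] by (simp add: ker_def[abs_def] lborel_prod split_def)
 from lborel_pair.integral_fst[OF this]
 have "(LBINT p. ker n p) = (LBINT x. (LBINT y. be n x * be n y))"
  by (simp add: lborel_prod ker_def[abs_def] split_def)
 then show ?thesis by (simp add: be_integral)
qed

lemma ker_nn_integral: "(\<integral>\<^sup>+p. ennreal (ker n p) \<partial>lborel) = 1"
 using nn_integral_eq_integral[OF test_integrable[OF ker_test], of n] by (simp add: ker_nonneg ker_integral)

lemma ker_integral_q: "integrable lborel (%q. ker n (p - q))" "(LBINT q. ker n (p - q)) = 1"
proof -
 have "(\<integral>\<^sup>+q. ennreal (ker n (p - q)) \<partial>lborel) = 1"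
  using nn_integral_affine_point[of "%q. ennreal (ker n q)" "-1" p] by (simp add: ker_nn_integral)
 moreover have "(%q. ker n (p - q)) \<in> borel_measurable lborel" by measurable
 ultimately show "integrable lborel (%q. ker n (p - q))" "(LBINT q. ker n (p - q)) = 1"
  by (auto simp: integrable_iff_bounded integral_eq_nn_integral ker_nonneg)
qed

text \<open>The dilation has Jacobian \<open>(lam n)^2\<close>, at least 1, and the kernel has mass
  1.\<close>

lemma ker_integral_p: "(\<integral>\<^sup>+p. ennreal (ker n (dil n p - q)) \<partial>lborel) <= 1"
proof -
 have "1 = (\<integral>\<^sup>+p. ennreal (ker n p) \<partial>lborel)" by (simp add: ker_nn_integral)
 also have "\<dots> = ennreal ((lam n)^2) * (\<integral>\<^sup>+p. ennreal (ker n ((0, (1 - lam n) / 2) - q + lam n *\<^sub>R p)) \<partial>lborel)"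
  using lam(3)[of n] by (intro nn_integral_affine_point) auto
 also have "(%p. (0, (1 - lam n) / 2) - q + lam n *\<^sub>R p) = (%p. dil n p - q)" by (auto simp: dil_def)
 finally have "1 = ennreal ((lam n)^2) * (\<integral>\<^sup>+p. ennreal (ker n (dil n p - q)) \<partial>lborel)" .
 moreover have "1 <= ennreal ((lam n)^2)" using lam(1)[of n] by simp
 ultimately show ?thesis by (metis mult_right_mono mult_1 zero_le)
qed

lemma sqi_loci:
 assumes h: "h \<in> sqi (lborel :: point measure)"
 shows "loci h"
proof -
 have "integrable lborel (%q. indicator (cball 0 R) q * h q)" for R :: real
 proof (rule sqi_mult[OF _ h])
  have "(indicator (cball 0 R) :: point => real) \<in> bmeas" by (intro borel_measurable_indicator borel_closed closed_cball)
  moreover have "integrable lborel (indicator (cball (0::point) R) :: point => real)"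
   by (rule integrable_real_indicator) (use emeasure_lborel_cball_finite[of "0 :: point" R] in \<open>auto simp: top.not_eq_extremum\<close>)
  moreover have "(%x. (indicator (cball (0::point) R) x)^2 :: real) = indicator (cball 0 R)" by (auto simp: indicator_def)
  ultimately show "indicator (cball (0::point) R) \<in> sqi lborel" by (simp add: sqi_def)
 qed
 then show ?thesis using sqi_measurable[OF h] by (simp add: loci_def)
qed

lemma T_smooth: "loci h ==> smooth (T n h)"
 unfolding T_def[abs_def] dil_def by (intro smooth_affine moll_smooth[OF ker_test] bounded_linear_scaleR_right)

lemma T_pd:
 assumes h: "loci h" and v: "v \<in> Basis"
 shows "pd v (T n h) p = lam n * moll (pd v (ker n)) h (dil n p)"
proof -
 have "(dil n has_derivative (%h. lam n *\<^sub>R h)) (at p)" unfolding dil_def[abs_def] by (auto intro!: derivative_eq_intros)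
 from has_derivative_compose[OF this moll_has_derivative[OF ker_test[of n] h]]
 have "pd v (T n h) p = fst (lam n *\<^sub>R v) * moll (dx (ker n)) h (dil n p) + snd (lam n *\<^sub>R v) * moll (dz (ker n)) h (dil n p)"
  unfolding T_def[abs_def] by (rule pd_eqI)
 then show ?thesis using v by (auto simp: Basis_point e\<^sub>x_def e\<^sub>z_def)
qed

text \<open>Jensen's inequality for the probability density given by the kernel, obtained by
  expanding the nonnegative weighted variance of \<open>h\<close>.\<close>

lemma T_sq_le:
 assumes h: "h \<in> sqi (lborel :: point measure)"
 shows "ennreal ((T n h p)^2) <= (\<integral>\<^sup>+q. ennreal (ker n (dil n p - q) * (h q)^2) \<partial>lborel)"
proof -
 let ?r = "%q. ker n (dil n p - q)" and ?m = "T n h p"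
 have [measurable]: "h \<in> bmeas" using sqi_measurable[OF h] by simp
 obtain C where C: "!!x. \<bar>ker n x\<bar> <= C" using test_bounded[OF ker_test] by metis
 have i1: "integrable lborel (%q. ?r q * h q)" by (rule moll_integrable[OF ker_test sqi_loci[OF h]])
 have i2: "integrable lborel (%q. ?r q * (h q)^2)"
  by (rule Bochner_Integration.integrable_bound[OF integrable_mult_right[OF sqi_integrable[OF h], of C]])
   (use C in \<open>auto simp: abs_mult intro!: mult_right_mono order_trans[OF C abs_ge_self]\<close>)
 have "0 <= (LBINT q. ?r q * (h q - ?m)^2)" by (simp add: ker_nonneg)
 also have "\<dots> = (LBINT q. ?r q * (h q)^2 - 2 * ?m * (?r q * h q) + ?m\<^sup>2 * ?r q)"
  by (rule LINT_cong) (auto simp: power2_eq_square algebra_simps)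
 also have "\<dots> = (LBINT q. ?r q * (h q)^2) - 2 * ?m * ?m + ?m\<^sup>2 * 1"
  using i1 i2 ker_integral_q[of n "dil n p"] by (simp add: T_def[symmetric] moll_def[symmetric])
 finally have "?m\<^sup>2 <= (LBINT q. ?r q * (h q)^2)" by (simp add: power2_eq_square)
 then show ?thesis using i2 by (simp add: nn_integral_eq_integral ker_nonneg)
qed

text \<open>Jensen's inequality and Fubini: integrating in \<open>p\<close> first leaves the mass of
  the kernel in that variable, which is at most 1. Hence mollification is a contraction in
  L2.\<close>

lemma T_l2:
 assumes h: "h \<in> sqi (lborel :: point measure)"
 shows "T n h \<in> sqi lborel" "l2 lborel (T n h) <= l2 lborel h"
proof -
 have [measurable]: "h \<in> bmeas" using sqi_measurable[OF h] by simp
 have m [measurable]: "T n h \<in> bmeas" by (rule smooth_measurable[OF T_smooth[OF sqi_loci[OF h]]])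
 have "(\<integral>\<^sup>+p. ennreal ((T n h p)^2) \<partial>lborel) <= (\<integral>\<^sup>+p. (\<integral>\<^sup>+q. ennreal (ker n (dil n p - q) * (h q)^2) \<partial>lborel) \<partial>lborel)"
  by (intro nn_integral_mono T_sq_le[OF h])
 also have "\<dots> = (\<integral>\<^sup>+q. (\<integral>\<^sup>+p. ennreal (ker n (dil n p - q) * (h q)^2) \<partial>lborel) \<partial>lborel)"
  by (rule lborel_pair.Fubini') measurable
 also have "\<dots> <= (\<integral>\<^sup>+q. ennreal ((h q)^2) \<partial>lborel)"
 proof (rule nn_integral_mono)
  fix q
  have "(\<integral>\<^sup>+p. ennreal (ker n (dil n p - q) * (h q)^2) \<partial>lborel) = (\<integral>\<^sup>+p. ennreal (ker n (dil n p - q)) \<partial>lborel) * ennreal ((h q)^2)"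
   by (simp add: ennreal_mult ker_nonneg nn_integral_multc)
  also have "\<dots> <= 1 * ennreal ((h q)^2)" by (rule mult_right_mono[OF ker_integral_p]) simp
  finally show "(\<integral>\<^sup>+p. ennreal (ker n (dil n p - q) * (h q)^2) \<partial>lborel) <= ennreal ((h q)^2)" by simp
 qed
 also have "\<dots> = ennreal (LBINT q. (h q)^2)" by (rule nn_integral_eq_integral[OF sqi_integrable[OF h]]) simp
 finally have le: "(\<integral>\<^sup>+p. ennreal ((T n h p)^2) \<partial>lborel) <= ennreal (LBINT q. (h q)^2)" .
 have int: "integrable lborel (%p. (T n h p)^2)"
  by (rule integrableI_bounded) (use le in \<open>auto intro: le_less_trans simp: ennreal_less_top\<close>)
 then show "T n h \<in> sqi lborel" by (simp add: sqi_def)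
 have "(LBINT p. (T n h p)^2) <= (LBINT q. (h q)^2)"
  using le by (simp add: nn_integral_eq_integral[OF int])
 then show "l2 lborel (T n h) <= l2 lborel h" by (simp add: l2_def)
qed

lemma T_diff:
 assumes "loci f" "loci g"
 shows "T n (%q. f q - g q) p = T n f p - T n g p"
 unfolding T_def moll_def using moll_integrable[OF ker_test assms(1)] moll_integrable[OF ker_test assms(2)]
 by (simp add: right_diff_distrib)

text \<open>A Lipschitz function moves by at most its constant times the displacement, and dilation
  and kernel together displace a point by \<open>eps n\<close> times an affine function of its
  position. The support grows by at most 3, so this stays bounded.\<close>

lemma T_test_bound:
 assumes ph: "ph \<in> test (UNIV :: point set)"
 shows "\<exists>C R. \<forall>n p. \<bar>T n ph p - ph p\<bar> <= eps n * C * indicator (cbox (-R, -R) (R, R)) p"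
proof -
 obtain A where A: "A >= 0" "!!a b. \<bar>ph b - ph a\<bar> <= A * norm (b - a)" using test_lipschitz[OF ph] by blast
 obtain R where R: "R > 0" "!!p. \<bar>fst p\<bar> > R \<or> \<bar>snd p\<bar> > R ==> ph p = 0" using test_box_support[OF ph] by metis
 have l: "loci ph" by (rule sqi_loci[OF test_sqi[OF ph]])
 define S where "S = R + 3"
 define C where "C = A * (8 * S + 8)"
 have C: "C >= 0" using A(1) R(1) by (simp add: C_def S_def)
 have eq: "T n ph p - ph p = (LBINT q. ker n (dil n p - q) * (ph q - ph p))" for n p
  using moll_integrable[OF ker_test l, of n "dil n p"] ker_integral_q[of n "dil n p"]
  by (simp add: T_def moll_def right_diff_distrib)
 have near: "\<bar>fst q - fst p\<bar> <= eps n * (4 * \<bar>fst p\<bar> + 1)" "\<bar>snd q - snd p\<bar> <= eps n * (4 * \<bar>snd p\<bar> + 3)"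
  "\<bar>fst p\<bar> <= \<bar>fst q\<bar> + 1" "\<bar>snd p\<bar> <= \<bar>snd q\<bar> + 3"
  if "ker n (dil n p - q) ~= 0" for n p q
 proof -
  have k: "0 <= fst p + 4 * (eps n * fst p) - fst q" "fst p + 4 * (eps n * fst p) - fst q <= eps n"
   "0 <= snd p + 4 * (eps n * snd p) - 2 * eps n - snd q" "snd p + 4 * (eps n * snd p) - 2 * eps n - snd q <= eps n"
   using ker_0[OF that] by (auto simp: dil_def lam_def algebra_simps)
  have e: "0 < eps n" "eps n <= 1/8" by (fact eps)+
  have m: "eps n * \<bar>x\<bar> = \<bar>eps n * x\<bar>" for x :: real using e by (simp add: abs_mult)
  have b: "\<bar>eps n * x\<bar> <= \<bar>x\<bar>" for x :: real using e mult_right_mono[of "eps n" 1 "\<bar>x\<bar>"] by (simp add: abs_mult)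
  have sg: "0 <= x --> 0 <= eps n * x" "x <= 0 --> eps n * x <= 0" for x :: real
   using e by (auto simp: mult_nonneg_nonpos)
  show "\<bar>fst q - fst p\<bar> <= eps n * (4 * \<bar>fst p\<bar> + 1)" "\<bar>snd q - snd p\<bar> <= eps n * (4 * \<bar>snd p\<bar> + 3)"
  proof -
   have "\<bar>fst q - fst p\<bar> <= 4 * \<bar>eps n * fst p\<bar> + eps n" "\<bar>snd q - snd p\<bar> <= 4 * \<bar>eps n * snd p\<bar> + 3 * eps n"
    using k e by linarith+
   then show "\<bar>fst q - fst p\<bar> <= eps n * (4 * \<bar>fst p\<bar> + 1)" "\<bar>snd q - snd p\<bar> <= eps n * (4 * \<bar>snd p\<bar> + 3)"
    unfolding m[symmetric] by (simp_all add: algebra_simps)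
  qed
  show "\<bar>fst p\<bar> <= \<bar>fst q\<bar> + 1" using k e sg[of "fst p"] by linarith
  show "\<bar>snd p\<bar> <= \<bar>snd q\<bar> + 3" using k e sg[of "snd p"] by linarith
 qed
 have "\<bar>T n ph p - ph p\<bar> <= eps n * C * indicator (cbox (-S, -S) (S, S)) p" for n p
 proof (cases "\<bar>fst p\<bar> <= S & \<bar>snd p\<bar> <= S")
  case True
  have le: "\<bar>ker n (dil n p - q) * (ph q - ph p)\<bar> <= (eps n * C) * ker n (dil n p - q)" for q
  proof (cases "ker n (dil n p - q) = 0")
   case False
   have "norm (q - p) <= \<bar>fst q - fst p\<bar> + \<bar>snd q - snd p\<bar>"
    using norm_Pair_le[of "fst q - fst p" "snd q - snd p"] by (cases q; cases p) simp
   also have "\<dots> <= eps n * (4 * \<bar>fst p\<bar> + 1) + eps n * (4 * \<bar>snd p\<bar> + 3)" using near[OF False] by linarith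
   also have "\<dots> = eps n * (4 * \<bar>fst p\<bar> + 4 * \<bar>snd p\<bar> + 4)" by (simp add: algebra_simps)
   also have "\<dots> <= eps n * (8 * S + 8)" using True eps(1)[of n] by (intro mult_left_mono) auto
   finally have "A * norm (q - p) <= A * (eps n * (8 * S + 8))" using A(1) by (rule mult_left_mono)
   then have "\<bar>ph q - ph p\<bar> <= eps n * C" using A(2)[of q p] by (simp add: C_def algebra_simps)
   then show ?thesis using ker_nonneg[of n "dil n p - q"] by (simp add: abs_mult mult.commute[of "ker n (dil n p - q)"] mult_right_mono)
  qed simp
  have "\<bar>T n ph p - ph p\<bar> <= (LBINT q. (eps n * C) * ker n (dil n p - q))" unfolding eq
   using ker_integral_q(1)[of n "dil n p"] moll_integrable[OF ker_test l, of n "dil n p"]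
   by (intro order_trans[OF integral_abs_bound] integral_mono le integrable_abs) (auto simp: right_diff_distrib)
  then show ?thesis using True by (cases p) (simp add: ker_integral_q indicator_def abs_le_iff)
 next
  case False
  then have "\<bar>fst p\<bar> > R \<or> \<bar>snd p\<bar> > R" unfolding S_def by linarith
  then have p0: "ph p = 0" by (rule R(2))
  have z: "ker n (dil n p - q) * (ph q - ph p) = 0" for q
  proof (cases "ker n (dil n p - q) = 0")
   case F: False
   have "\<bar>fst q\<bar> > R \<or> \<bar>snd q\<bar> > R" using near(3,4)[OF F] False unfolding S_def by linarith
   then show ?thesis using R(2) p0 by auto
  qed simp
  have "T n ph p - ph p = 0" unfolding eq z by simp
  then show ?thesis using C eps(1)[of n] by simp
 qed
 then show ?thesis by blast
qed

text \<open>Density of test functions and contractivity reduce the convergence to test functions,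
  where it is uniform with a fixed bounded support.\<close>

lemma T_tendsto:
 assumes h: "h \<in> sqi (lborel :: point measure)"
 shows "(%n. l2 lborel (%p. T n h p - h p)) ---> 0"
proof (rule LIMSEQ_I)
 fix e :: real assume e: "0 < e"
 obtain ph where ph: "ph \<in> test UNIV" "l2 lborel (%p. h p - ph p) < e / 3" using test_dense[OF h, of "e / 3"] e by auto
 obtain C R where CR: "!!n p. \<bar>T n ph p - ph p\<bar> <= eps n * C * indicator (cbox (-R, -R) (R, R)) p" using T_test_bound[OF ph(1)] by blast
 define I where "I = l2 lborel (%p. C * indicator (cbox (-R, -R) (R, R)) p :: real)"
 have phs: "ph \<in> sqi lborel" by (rule test_sqi[OF ph(1)])
 have d: "(%p. h p - ph p) \<in> sqi lborel" by (rule sqi_diff[OF h phs])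
 have "(%n. eps n * I) ---> 0" using tendsto_mult_left_zero[OF eps_tendsto] .
 then have "\<forall>\<^sub>F n in sequentially. eps n * I < e / 3" using e by (intro order_tendstoD(2)) auto
 then obtain N where N: "!!n. n >= N ==> eps n * I < e / 3" unfolding eventually_sequentially by blast
 have "norm (l2 lborel (%p. T n h p - h p) - 0) < e" if "n >= N" for n
 proof -
  have 1: "l2 lborel (%p. T n h p - T n ph p) < e / 3"
  proof -
   have "T n (%p. h p - ph p) = (%p. T n h p - T n ph p)" by (rule ext) (rule T_diff[OF sqi_loci[OF h] sqi_loci[OF phs]])
   then show ?thesis using T_l2(2)[OF d, of n] ph(2) by simp
  qed
  have i: "(%p. eps n * (C * indicator (cbox (-R, -R) (R, R)) p)) \<in> sqi lborel"
   by (intro sqi_cmult indicator_cbox_sqi)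
  have "l2 lborel (%p. T n ph p - ph p) <= l2 lborel (%p. eps n * (C * indicator (cbox (-R, -R) (R, R)) p))"
  proof (rule l2_mono(2)[OF i])
   show "(%p. T n ph p - ph p) \<in> borel_measurable lborel" using sqi_measurable[OF sqi_diff[OF T_l2(1)[OF phs] phs]] .
   show "\<bar>T n ph p - ph p\<bar> <= \<bar>eps n * (C * indicator (cbox (-R, -R) (R, R)) p)\<bar>" for p
    using order_trans[OF CR abs_ge_self] by (simp add: mult.assoc)
  qed
  also have "\<dots> = eps n * I" unfolding I_def using eps(1)[of n] by (subst l2_cmult) simp
  finally have 2: "l2 lborel (%p. T n ph p - ph p) < e / 3" using N[OF that] by simp
  have 3: "l2 lborel (%p. ph p - h p) < e / 3" using ph(2) l2_minus_commute[of lborel ph h] by simp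
  have "l2 lborel (%p. T n h p - h p) <= l2 lborel (%p. T n h p - T n ph p) + l2 lborel (%p. T n ph p - h p)"
   by (rule l2_triangle_diff[OF T_l2(1)[OF h] T_l2(1)[OF phs] h])
  moreover have "l2 lborel (%p. T n ph p - h p) <= l2 lborel (%p. T n ph p - ph p) + l2 lborel (%p. ph p - h p)"
   by (rule l2_triangle_diff[OF T_l2(1)[OF phs] phs h])
  ultimately show ?thesis using 1 2 3 by simp
 qed
 then show "\<exists>N. \<forall>n\<ge>N. norm (l2 lborel (%p. T n h p - h p) - 0) < e" by blast
qed

end

section \<open>Extension by zero\<close>

lemma integral_FTC_open:
 fixes f :: "real => real"
 assumes d: "!!x. (F has_field_derivative f x) (at x)" and c: "continuous_on UNIV f"
 shows "(LBINT x. indicator {0<..<1} x * f x) = F 1 - F 0"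
proof -
 have [measurable]: "f \<in> bmeas" by (rule borel_measurable_continuous_onI[OF c])
 have "(LBINT x. indicator {0<..<1} x * f x) = (LBINT x. f x * indicator {0..1} x)"
 proof (rule integral_cong_AE)
  show "AE x in lborel. indicator {0<..<1} x * f x = f x * indicator {0..1} x"
   using AE_lborel_singleton[of 0] AE_lborel_singleton[of 1] by eventually_elim (auto simp: indicator_def)
 qed auto
 also have "\<dots> = F 1 - F 0"
  by (rule integral_FTC_Icc_real) (use d c in \<open>auto simp: continuous_on_eq_continuous_at\<close>)
 finally show ?thesis .
qed

lemma slice_sqi:
 assumes ph: "ph \<in> test (S :: point set)"
 shows "(%x. ph (x, b)) \<in> sqi lborel"
proof -
 obtain R where R: "R > 0" "!!p. \<bar>fst p\<bar> > R \<or> \<bar>snd p\<bar> > R ==> ph p = 0" using test_box_support[OF ph] by metis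
 obtain C where C: "!!x. \<bar>ph x\<bar> <= C" using test_bounded[OF ph] by metis
 have [measurable]: "ph \<in> bmeas" by (rule test_measurable[OF ph])
 have i: "(%x. C * indicator (cbox (-R) R) x) \<in> sqi lborel" by (intro sqi_cmult indicator_cbox_sqi)
 show ?thesis
 proof (rule l2_mono(1)[OF i])
  show "\<bar>ph (x, b)\<bar> <= \<bar>C * indicator (cbox (- R) R) x\<bar>" for x
   using C[of "(x, b)"] R(2)[of "(x, b)"] by (cases "\<bar>x\<bar> <= R") (auto simp: indicator_def)
 qed measurable
qed

lemma fst_borel [measurable (raw)]: "f \<in> borel_measurable M ==> (%x. fst (f x :: point)) \<in> borel_measurable M"
 by (rule borel_measurable_continuous_on[OF continuous_on_fst[OF continuous_on_id]])

lemma pd_zero_box: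
 fixes R :: real
 assumes "!!p. \<bar>fst p\<bar> > R \<or> \<bar>snd p\<bar> > R ==> ph p = 0" "\<bar>fst p\<bar> > R"
 shows "pd v ph p = (0 :: real)"
proof (rule pd_zero_outside)
 have box: "p \<notin> cbox (-R, -R) (R, R) \<longleftrightarrow> \<bar>fst p\<bar> > R \<or> \<bar>snd p\<bar> > R" for p :: point by (cases p) auto
 show "ph x = 0" if "x \<notin> cbox (-R, -R) (R, R)" for x using assms(1) that unfolding box .
 show "p \<notin> cbox (-R, -R) (R, R)" using assms(2) unfolding box by blast
qed (rule closed_cbox)

lemma lom_integral_dz:
 assumes F: "F \<in> test (S :: point set)"
 shows "(LINT p|lom. dz F p) = (LBINT x. F (x, 1) - F (x, 0))"
proof -
 have "integrable lborel (%p. indicator \<Omega> p * dz F p)"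
  using sqi_mult test_integrable[OF test_dz[OF F]] integrable_real_mult_indicator[of \<Omega> lborel "dz F"]
  by (simp add: mult.commute)
 then have "integrable (lborel \<Otimes>\<^sub>M lborel) (%(x, z). indicator \<Omega> (x, z) * dz F (x, z))"
  by (simp add: lborel_prod split_def)
 from lborel_pair.integral_fst[OF this]
 have "(LINT p|lom. dz F p) = (LBINT x. (LBINT z. indicator \<Omega> (x, z) * dz F (x, z)))"
  by (simp add: lom_integral lborel_prod split_def)
 also have "(%x. \<integral>z. indicator \<Omega> (x, z) * dz F (x, z) \<partial>lborel) = (%x. F (x, 1) - F (x, 0))"
 proof (rule ext)
  fix x
  have ind: "indicator \<Omega> (x, z) = (indicator {0<..<1} z :: real)" for z by (auto simp: indicator_def mem_Omega)
  have "continuous_on UNIV (%z. dz F (x, z))"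
   using smooth_slice_z[OF smooth_dz[OF test_smooth[OF F]]] by (auto simp: continuous_on_eq_continuous_at intro: DERIV_isCont)
  from integral_FTC_open[OF smooth_slice_z[OF test_smooth[OF F]] this]
  show "(LBINT z. indicator \<Omega> (x, z) * dz F (x, z)) = F (x, 1) - F (x, 0)" unfolding ind .
 qed
 finally show ?thesis .
qed

lemma lom_integral_dx:
 assumes F: "F \<in> test (S :: point set)"
 shows "(LINT p|lom. dx F p) = 0"
proof -
 obtain R where R: "R > 0" "!!p. \<bar>fst p\<bar> > R \<or> \<bar>snd p\<bar> > R ==> F p = 0" using test_box_support[OF F] by metis
 have z: "dx F (x, z) = 0" if "\<bar>x\<bar> > R" for x z
  by (rule pd_zero_box[OF R(2)]) (use that in auto)
 have "integrable lborel (%p. indicator \<Omega> p * dx F p)"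
  using test_integrable[OF test_dx[OF F]] integrable_real_mult_indicator[of \<Omega> lborel "dx F"]
  by (simp add: mult.commute)
 then have "integrable (lborel \<Otimes>\<^sub>M lborel) (%(x, z). indicator \<Omega> (x, z) * dx F (x, z))"
  by (simp add: lborel_prod split_def)
 from lborel_pair.integral_snd[OF this]
 have "(LINT p|lom. dx F p) = (LBINT z. (LBINT x. indicator \<Omega> (x, z) * dx F (x, z)))"
  by (simp add: lom_integral lborel_prod split_def)
 also have "(%z. \<integral>x. indicator \<Omega> (x, z) * dx F (x, z) \<partial>lborel) = (%z. 0)"
 proof (rule ext)
  fix z
  have ind: "indicator \<Omega> (x, z) = (indicator {0<..<1} z :: real)" for x by (auto simp: indicator_def mem_Omega)
  have "continuous_on UNIV (%x. dx F (x, z))"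
   using smooth_slice_x[OF smooth_dx[OF test_smooth[OF F]]] by (auto simp: continuous_on_eq_continuous_at intro: DERIV_isCont)
  then have "(LBINT x. dx F (x, z)) = 0"
   by (rule integral_deriv_eq_0[OF smooth_slice_x[OF test_smooth[OF F]]]) (use R z in auto)
  then show "(LBINT x. indicator \<Omega> (x, z) * dx F (x, z)) = 0" unfolding ind by simp
 qed
 finally show ?thesis by simp
qed

text \<open>Weak derivatives on the whole plane. The test functions need not vanish on the boundary
  of the strip, so for extensions by zero this relation encodes zero boundary values.\<close>

definition wrel :: "point => (point => real) => (point => real) => bool" where
 "wrel v h h' \<longleftrightarrow> (\<forall>ph\<in>test UNIV. (LBINT p. h p * pd v ph p) = - (LBINT p. h' p * ph p))"

text \<open>Uniformly local L2 functions on the strip, extended by zero. Half-open slabs replace the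
  smooth cutoffs, because disjoint pieces can be glued and summed directly.\<close>

definition ul :: "real => (point => real) => bool" where
 "ul M h \<longleftrightarrow> h \<in> bmeas & (\<forall>p. p \<notin> \<Omega> --> h p = 0) &
  (\<forall>j. (%p. if \<lfloor>fst p\<rfloor> = j then h p else 0) \<in> sqi lborel & l2 lborel (%p. if \<lfloor>fst p\<rfloor> = j then h p else 0) <= M)"

lemma ul_measurable: "ul M h ==> h \<in> bmeas"
 and ul_outside: "ul M h ==> p \<notin> \<Omega> ==> h p = 0"
 and ul_slab: "ul M h ==> (%p. if \<lfloor>fst p\<rfloor> = j then h p else 0) \<in> sqi lborel"
  "ul M h ==> l2 lborel (%p. if \<lfloor>fst p\<rfloor> = j then h p else 0) <= M"
 unfolding ul_def by blast+

lemma ul_diff: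
 assumes f: "ul M f" and g: "ul N g"
 shows "ul (M + N) (%p. f p - g p)"
proof -
 have eq: "(%p. if \<lfloor>fst p\<rfloor> = j then f p - g p else 0) = (%p. (if \<lfloor>fst p\<rfloor> = j then f p else 0) - (if \<lfloor>fst p\<rfloor> = j then g p else 0))" for j
  by auto
 have [simp]: "(%x. 0 - (if \<lfloor>fst x\<rfloor> = j then g x else 0)) = (%x. - 1 * (if \<lfloor>fst x\<rfloor> = j then g x else 0))" for j by auto
 have "l2 lborel (%p. (if \<lfloor>fst p\<rfloor> = j then f p else 0) - (if \<lfloor>fst p\<rfloor> = j then g p else 0)) <= M + N" for j
  using l2_triangle_diff[OF ul_slab(1)[OF f, of j] sqi_zero ul_slab(1)[OF g, of j]] ul_slab(2)[OF f, of j] ul_slab(2)[OF g, of j]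
   l2_cmult[of lborel "- 1" "%p. if \<lfloor>fst p\<rfloor> = j then g p else 0"] by simp
 then show ?thesis unfolding ul_def eq
  using sqi_diff[OF ul_slab(1)[OF f] ul_slab(1)[OF g]] ul_measurable[OF f] ul_measurable[OF g] ul_outside[OF f] ul_outside[OF g]
  by auto
qed

lemma ul_local:
 assumes h: "ul M h"
 shows "(%p. indicator {-R..R} (fst p) * h p) \<in> sqi lborel"
proof -
 define J where "J = {-\<lceil>R\<rceil> - 1..\<lceil>R\<rceil>}"
 have [measurable]: "h \<in> bmeas" by (rule ul_measurable[OF h])
 have s: "(%p. \<Sum>j\<in>J. if \<lfloor>fst p\<rfloor> = j then h p else 0) \<in> sqi lborel"
  by (rule sqi_sum) (auto simp: J_def ul_slab(1)[OF h])
 show ?thesis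
 proof (rule l2_mono(1)[OF s])
  fix p :: point
  show "\<bar>indicator {-R..R} (fst p) * h p\<bar> <= \<bar>\<Sum>j\<in>J. if \<lfloor>fst p\<rfloor> = j then h p else 0\<bar>"
  proof (cases "fst p \<in> {-R..R}")
   case True
   then have "\<lfloor>fst p\<rfloor> \<in> J" unfolding J_def by (auto; linarith)
   then show ?thesis using True by (simp add: J_def)
  qed simp
 qed measurable
qed

lemma ul_integrable:
 assumes h: "ul M h" and ph: "ph \<in> test (S :: point set)"
 shows "integrable lborel (%p. h p * ph p)"
proof -
 obtain R where R: "R > 0" "!!p. \<bar>fst p\<bar> > R \<or> \<bar>snd p\<bar> > R ==> ph p = 0" using test_box_support[OF ph] by metis
 have "(%p. h p * ph p) = (%p. (indicator {-R..R} (fst p) * h p) * ph p)"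
 proof (rule ext)
  fix p
  show "h p * ph p = (indicator {-R..R} (fst p) * h p) * ph p"
   using R(2)[of p] by (cases "\<bar>fst p\<bar> > R") (auto simp: indicator_def)
 qed
 then show ?thesis using sqi_mult[OF ul_local[OF h] test_sqi[OF ph]] by simp
qed

lemma wrel_diff:
 assumes "ul M f" "ul M' f'" "ul N g" "ul N' g'" "wrel v f f'" "wrel v g g'" "v \<in> Basis"
 shows "wrel v (%p. f p - g p) (%p. f' p - g' p)"
 unfolding wrel_def
proof
 fix ph :: "point => real" assume ph: "ph \<in> test UNIV"
 note i = ul_integrable[OF _ ph] ul_integrable[OF _ test_pd[OF ph assms(7)]]
 show "(LBINT p. (f p - g p) * pd v ph p) = - (LBINT p. (f' p - g' p) * ph p)"
  using assms(5,6) ph i[OF assms(1)] i[OF assms(2)] i[OF assms(3)] i[OF assms(4)]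
  by (simp add: left_diff_distrib wrel_def)
qed

text \<open>Summability of the weights puts uniformly local functions into weighted L2: slab j
  contributes at most \<open>2 * wt 0 j * M\<^sup>2\<close>, in total 2 * 803 = 1606 times
  \<open>M\<^sup>2\<close>, and Fatou's lemma exhausts the strip.\<close>

lemma ul_sw:
 assumes h: "ul M h"
 shows "(%p. sw p * h p) \<in> sqi lborel"
proof -
 have M: "0 <= M" by (rule order_trans[OF l2_nonneg ul_slab(2)[OF h, of 0]])
 have [measurable]: "h \<in> bmeas" by (rule ul_measurable[OF h])
 let ?f = "%p. ennreal ((sw p * h p)^2)"
 define u where "u n p = (if \<lfloor>fst p\<rfloor> \<in> {-int n..int n} then ?f p else 0)" for n and p :: point
 have ueq: "u n p = (\<Sum>j\<in>{-int n..int n}. if \<lfloor>fst p\<rfloor> = j then ?f p else 0)" for n p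
  unfolding u_def by (subst sum.delta') auto
 have [measurable]: "u n \<in> bmeas" for n unfolding ueq[abs_def] by measurable
 have slab: "(\<integral>\<^sup>+p. (if \<lfloor>fst p\<rfloor> = j then ?f p else 0) \<partial>lborel) <= ennreal (2 * wt 0 (of_int j) * M\<^sup>2)" for j
 proof -
  have "(if \<lfloor>fst p\<rfloor> = j then ?f p else 0) <= ennreal (2 * wt 0 (of_int j) * (if \<lfloor>fst p\<rfloor> = j then h p else 0)^2)" for p :: point
  proof (cases "\<lfloor>fst p\<rfloor> = j")
   case True
   then have "\<bar>fst p - of_int j\<bar> <= 5" by linarith
   from wt_near[OF this, of 0] have "(sw p * h p)^2 <= 2 * wt 0 (of_int j) * (h p)^2"
    by (simp add: power_mult_distrib sw_sq mult_right_mono)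
   then show ?thesis using True by (auto intro: ennreal_leI)
  qed simp
  then have "(\<integral>\<^sup>+p. (if \<lfloor>fst p\<rfloor> = j then ?f p else 0) \<partial>lborel) <= (\<integral>\<^sup>+p. ennreal (2 * wt 0 (of_int j) * (if \<lfloor>fst p\<rfloor> = j then h p else 0)^2) \<partial>lborel)"
   by (rule nn_integral_mono)
  also have "\<dots> = ennreal (LBINT p. 2 * wt 0 (of_int j) * (if \<lfloor>fst p\<rfloor> = j then h p else 0)^2)"
   using sqi_integrable[OF ul_slab(1)[OF h, of j]] wt_pos[of 0 "of_int j"]
   by (intro nn_integral_eq_integral AE_I2 integrable_mult_right mult_nonneg_nonneg) auto
  also have "\<dots> = ennreal (2 * wt 0 (of_int j) * (l2 lborel (%p. if \<lfloor>fst p\<rfloor> = j then h p else 0))^2)"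
   by (simp add: l2_sq)
  also have "\<dots> <= ennreal (2 * wt 0 (of_int j) * M\<^sup>2)"
   using ul_slab(2)[OF h, of j] wt_pos[of 0 "of_int j"] by (intro ennreal_leI mult_left_mono power_mono) auto
  finally show ?thesis .
 qed
 have un: "(\<integral>\<^sup>+p. u n p \<partial>lborel) <= ennreal (1606 * M\<^sup>2)" for n
 proof -
  have "(\<integral>\<^sup>+p. u n p \<partial>lborel) = (\<Sum>j\<in>{-int n..int n}. \<integral>\<^sup>+p. (if \<lfloor>fst p\<rfloor> = j then ?f p else 0) \<partial>lborel)"
   unfolding ueq by (rule nn_integral_sum) measurable
  also have "\<dots> <= (\<Sum>j\<in>{-int n..int n}. ennreal (2 * wt 0 (of_int j) * M\<^sup>2))" by (rule sum_mono[OF slab])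
  also have "\<dots> = ennreal (\<Sum>j\<in>{-int n..int n}. 2 * wt 0 (of_int j) * M\<^sup>2)"
   by (rule sum_ennreal) (simp add: less_imp_le[OF wt_pos])
  also have "(\<Sum>j\<in>{-int n..int n}. 2 * wt 0 (of_int j) * M\<^sup>2) = (\<Sum>j\<in>{-int n..int n}. wt 0 (of_int j)) * (2 * M\<^sup>2)"
   unfolding sum_distrib_right by (rule sum.cong) simp_all
  also have "\<dots> <= 803 * (2 * M\<^sup>2)" using wt_sum_le[of "{-int n..int n}" 0] by (intro mult_right_mono) auto
  finally show ?thesis by (auto intro: ennreal_leI)
 qed
 have "?f p = liminf (%n. u n p)" for p
 proof (rule sym, rule lim_imp_Liminf)
  have "u n p = ?f p" if "n >= nat \<bar>\<lfloor>fst p\<rfloor>\<bar>" for n using that by (auto simp: u_def)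
  then show "(%n. u n p) ---> ?f p" by (intro tendsto_eventually) (auto simp: eventually_sequentially)
 qed simp
 then have "(\<integral>\<^sup>+p. ?f p \<partial>lborel) = (\<integral>\<^sup>+p. liminf (%n. u n p) \<partial>lborel)" by simp
 also have "\<dots> <= liminf (%n. \<integral>\<^sup>+p. u n p \<partial>lborel)" by (rule nn_integral_liminf) measurable
 also have "\<dots> <= ennreal (1606 * M\<^sup>2)"
  using Liminf_mono[of "%n. \<integral>\<^sup>+p. u n p \<partial>lborel" "%n. ennreal (1606 * M\<^sup>2)" sequentially] un by (simp add: Liminf_const)
 finally have "(\<integral>\<^sup>+p. ?f p \<partial>lborel) < \<infinity>" by (rule le_less_trans) simp
 then have "integrable lborel (%p. (sw p * h p)^2)" by (intro integrableI_bounded) auto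
 then show ?thesis by (simp add: sqi_def)
qed

context cutoff_fun
begin

lemma ul_loci:
 assumes h: "ul M h"
 shows "loci h"
proof -
 have "integrable lborel (%q. indicator (cball 0 R) q * h q)" for R :: real
 proof -
  have l: "loci (%p. indicator {-R..R} (fst p) * h p)" by (rule sqi_loci[OF ul_local[OF h]])
  have "indicator (cball 0 R) q * (indicator {-R..R} (fst q) * h q) = indicator (cball 0 R) q * h q" for q :: point
   using norm_fst_le[of "fst q" "snd q"] by (auto simp: indicator_def)
  moreover have "integrable lborel (%q. indicator (cball 0 R) q * (indicator {-R..R} (fst q) * h q))"
   using l unfolding loci_def by blast
  ultimately show ?thesis by (simp only:)
 qed
 then show ?thesis using ul_measurable[OF h] by (simp add: loci_def)
qed

text \<open>Continuity extends the value 1 from the open interval to its end points. The left one is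
  needed because the slabs given by \<open>floor\<close> contain their left edge.\<close>

lemma chi_closed: "0 <= x ==> x <= 1 ==> chi x = 1"
proof -
 have "closed (chi -` {1})" by (rule closed_vimage) (auto intro: smooth_continuous chi_smooth)
 then have "closure {0<..<1} \<subseteq> chi -` {1}" by (intro closure_minimal) (auto intro: chi_1)
 then show "0 <= x ==> x <= 1 ==> chi x = 1" by auto
qed

text \<open>For smooth approximants, integration by parts up to the boundary leaves boundary
  integrals in the z direction only. These pair \<open>ph\<close> with traces that tend to 0 in
  L2.\<close>

lemma zero_trace_extension:
 assumes W: "weak_grad a gx gz" and tr: "has_trace a (%_. 0)" and ph: "ph \<in> test (UNIV :: point set)"
 shows "(LINT p|lom. a p * dx ph p) = - (LINT p|lom. gx p * ph p)"
  "(LINT p|lom. a p * dz ph p) = - (LINT p|lom. gz p * ph p)"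
proof -
 obtain s where s: "!!n::nat. s n \<in> test UNIV" and lim: "(%n. H1_norm (%p. s n p - a p)) ---> 0"
  and bd: "!!b. b \<in> {0, 1} ==> (%n. LINT x|lborel. (s n (x, b))^2) ---> 0"
  using tr unfolding has_trace_def by auto
 have Wn: "weak_grad (%p. s n p - a p) (%p. dx (s n) p - gx p) (%p. dz (s n) p - gz p)" for n
  by (rule weak_grad_diff[OF weak_grad_test[OF s] W])
 have l: "(%n. l2 lom (%p. s n p - a p)) ---> 0" "(%n. l2 lom (%p. dx (s n) p - gx p)) ---> 0"
  "(%n. l2 lom (%p. dz (s n) p - gz p)) ---> 0"
  by (rule tendsto_sandwich[OF _ _ tendsto_const lim]; simp add: H1_norm_eq[OF Wn] n1_ge)+
 have sq: "a \<in> sqi lom" "gx \<in> sqi lom" "gz \<in> sqi lom" using W by (auto simp: weak_grad_def)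
 have ss: "s n \<in> sqi lom" "dx (s n) \<in> sqi lom" "dz (s n) \<in> sqi lom" for n
  using test_sqi_lom[OF s] test_sqi_lom[OF test_dx[OF s]] test_sqi_lom[OF test_dz[OF s]] by auto
 have p: "ph \<in> sqi lom" "dx ph \<in> sqi lom" "dz ph \<in> sqi lom"
  using test_sqi_lom[OF ph] test_sqi_lom[OF test_dx[OF ph]] test_sqi_lom[OF test_dz[OF ph]] by auto
 have c: "(%n. l2 lom (%p. f p - f p)) ---> 0" for f :: "point => real" by (simp add: l2_def)
 have F: "(%p. s n p * ph p) \<in> test UNIV" for n by (rule test_smooth_mult[OF test_smooth[OF s] ph])
 have pdF: "pd v (%p. s n p * ph p) = (%p. s n p * pd v ph p + pd v (s n) p * ph p)" for v n
  using pd_smooth_mult[OF test_smooth[OF s] test_smooth[OF ph]] by (auto simp: add.commute)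
 have lx: "(%n. (LINT p|lom. s n p * dx ph p) + (LINT p|lom. dx (s n) p * ph p)) ---> (LINT p|lom. a p * dx ph p) + (LINT p|lom. gx p * ph p)"
  by (intro tendsto_add l2_tendsto_inner l c ss p sq)
 have lz: "(%n. (LINT p|lom. s n p * dz ph p) + (LINT p|lom. dz (s n) p * ph p)) ---> (LINT p|lom. a p * dz ph p) + (LINT p|lom. gz p * ph p)"
  by (intro tendsto_add l2_tendsto_inner l c ss p sq)
 have eq0: "(LINT p|lom. s n p * dx ph p) + (LINT p|lom. dx (s n) p * ph p) = 0" for n
  using lom_integral_dx[OF F[of n]] sqi_mult[OF ss(1) p(2), of n] sqi_mult[OF ss(2) p(1), of n] by (simp add: pdF)
 then show "(LINT p|lom. a p * dx ph p) = - (LINT p|lom. gx p * ph p)"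
  using LIMSEQ_unique[OF lx[unfolded eq0] tendsto_const] by simp
 have eq: "(LINT p|lom. s n p * dz ph p) + (LINT p|lom. dz (s n) p * ph p) = (LBINT x. s n (x, 1) * ph (x, 1)) - (LBINT x. s n (x, 0) * ph (x, 0))" for n
  using lom_integral_dz[OF F[of n]] sqi_mult[OF ss(1) p(3), of n] sqi_mult[OF ss(3) p(1), of n]
   sqi_mult[OF slice_sqi[OF s] slice_sqi[OF ph], of n] by (simp add: pdF)
 have b0: "(%n. \<integral>x. s n (x, b) * ph (x, b) \<partial>lborel) ---> 0" if "b \<in> {0, 1}" for b
 proof -
  have "(%n. l2 lborel (%x. s n (x, b)) * l2 lborel (%x. ph (x, b))) ---> sqrt 0 * l2 lborel (%x. ph (x, b))"
   unfolding l2_def by (intro tendsto_mult tendsto_const tendsto_real_sqrt bd that)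
  then have "(%n. l2 lborel (%x. s n (x, b)) * l2 lborel (%x. ph (x, b))) ---> 0" by simp
  then show ?thesis
   by (rule Lim_null_comparison[rotated]) (auto intro!: always_eventually l2_cauchy_schwarz slice_sqi[OF s] slice_sqi[OF ph])
 qed
 have "(%n. (LINT p|lom. s n p * dz ph p) + (LINT p|lom. dz (s n) p * ph p)) ---> 0 - 0"
  unfolding eq by (intro tendsto_diff b0) auto
 from LIMSEQ_unique[OF lz this] show "(LINT p|lom. a p * dz ph p) = - (LINT p|lom. gz p * ph p)" by simp
qed

text \<open>On each slab the member of the family whose cutoff is 1 there is used; this merges the
  derivatives of the cut pieces into one function.\<close>

definition glue :: "(int => point => real) => point => real" where
 "glue G p = indicator \<Omega> p * G \<lfloor>fst p\<rfloor> p"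

lemma glue_ul:
 assumes G: "!!k. G k \<in> sqi lom" "!!k. l2 lom (G k) <= M"
 shows "ul M (glue G)"
proof -
 have Gm: "(%p. indicator \<Omega> p * G k p) \<in> bmeas" for k
  using sqi_measurable[OF G(1)] by (simp add: lom_measurable)
 have "(%p. (%k p. indicator \<Omega> p * G k p) (\<lfloor>fst p\<rfloor>) p) \<in> bmeas"
  by (rule measurable_compose_countable[OF Gm]) measurable
 then have m [measurable]: "glue G \<in> bmeas" unfolding glue_def[abs_def] by simp
 have s: "(%p. indicator \<Omega> p * G j p) \<in> sqi lborel" for j using G(1) by (simp add: sqi_lom)
 have le: "\<bar>if \<lfloor>fst p\<rfloor> = j then glue G p else 0\<bar> <= \<bar>indicator \<Omega> p * G j p\<bar>" for p j by (auto simp: glue_def)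
 have m2: "(%p. if \<lfloor>fst p\<rfloor> = j then glue G p else 0) \<in> borel_measurable lborel" for j by measurable
 have "l2 lborel (%p. if \<lfloor>fst p\<rfloor> = j then glue G p else 0) <= M" for j
  using l2_mono(2)[OF s[of j] m2[of j] le] G(2)[of j] by (simp add: l2_lom)
 then show ?thesis unfolding ul_def using m l2_mono(1)[OF s m2 le] by (auto simp: glue_def)
qed

lemma AE_fst_not_int: "AE p in (lborel :: point measure). fst p ~= of_int j"
proof -
 have "negligible {p :: point. p \<bullet> e\<^sub>x = of_int j}" by (rule negligible_standard_hyperplane) simp
 then have "{p :: point. p \<bullet> e\<^sub>x = of_int j} \<in> null_sets lborel"
  by (simp add: negligible_iff_null_sets null_sets_completion_iff closed_hyperplane borel_closed inner_commute)
 from AE_not_in[OF this] show ?thesis by eventually_elim (auto simp: e\<^sub>x_def inner_prod_def)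
qed

text \<open>Zero boundary values turn weak derivatives on the strip into weak derivatives on the plane
 of the extension by zero.\<close>

lemma glue_wrel:
 assumes v: "v \<in> Basis" and a: "!!k. cut_fun chi k d \<in> sqi lom" and G: "!!k. G k \<in> sqi lom" "!!k. l2 lom (G k) <= M"
  and rel: "!!k ph. ph \<in> test UNIV ==> (LINT p|lom. cut_fun chi k d p * pd v ph p) = - (LINT p|lom. G k p * ph p)"
 shows "wrel v (%p. indicator \<Omega> p * d p) (glue G)"
proof -
 let ?a = "%k. cut_fun chi k d"
 define S where "S j = {of_int j<..<of_int j + 1 :: real} \<times> {0<..<1 :: real}" for j :: int
 have Iint: "integrable lom (%p. (\<Sum>k\<in>I. H k p) / 2 * ph p)" "(LINT p|lom. (\<Sum>k\<in>I. H k p) / 2 * ph p) = (\<Sum>k\<in>I. \<integral>p. H k p * ph p \<partial>lom) / 2"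
  if H: "!!k. H k \<in> sqi lom" and ph: "ph \<in> test S'" and I: "finite (I::int set)" for H ph S' I
 proof -
  have i: "integrable lom (%p. H k p * ph p)" for k by (rule sqi_mult[OF H test_sqi_lom[OF ph]])
  have eq: "(%p. (\<Sum>k\<in>I. H k p) / 2 * ph p) = (%p. (\<Sum>k\<in>I. H k p * ph p) / 2)" by (simp add: sum_distrib_right)
  show "integrable lom (%p. (\<Sum>k\<in>I. H k p) / 2 * ph p)" "(LINT p|lom. (\<Sum>k\<in>I. H k p) / 2 * ph p) = (\<Sum>k\<in>I. \<integral>p. H k p * ph p \<partial>lom) / 2"
   unfolding eq using i by simp_all
 qed
 have sum_a: "(\<Sum>k\<in>{-N..N}. ?a k p) / 2 = d p" if "\<bar>fst p\<bar> <= of_int N - 1" for N p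
  using chi_sum_eq'[of "-N" "fst p" N] that by (simp add: cut_fun_def sum_distrib_right[symmetric])
 have rel2: "(LINT p|lom. (\<Sum>k\<in>I. ?a k p) / 2 * pd v ph p) = - (LINT p|lom. (\<Sum>k\<in>I. G k p) / 2 * ph p)"
  if "finite I" "ph \<in> test UNIV" for I ph
  unfolding Iint(2)[OF a test_pd[OF that(2) v] that(1)] Iint(2)[OF G(1) that(2,1)] by (simp add: rel[OF that(2)] sum_negf)
 \<comment> \<open>On slab j both sides are weak derivatives of the same function: half the sum of
   the cutoffs is 1 there, and so is the j-th cutoff alone. The fundamental lemma identifies them;
   the margin 2 keeps the whole slab where the finite sum is complete.\<close>
 have loc: "AE p in lborel. p \<in> S j --> (\<Sum>k\<in>{-N..N}. G k p) / 2 = G j p" if j: "\<bar>j\<bar> + 2 <= N" for j N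
 proof -
  define g where "g p = indicator \<Omega> p * ((\<Sum>k\<in>{-N..N}. G k p) / 2 - G j p)" for p
  have gs: "g \<in> sqi lborel"
  proof -
   have "(%p. (1/2) * (\<Sum>k\<in>{-N..N}. G k p) - G j p) \<in> sqi lom" by (intro sqi_diff sqi_cmult sqi_sum G) auto
   then show ?thesis by (simp add: sqi_lom g_def[abs_def])
  qed
  have "AE p in lborel. p \<in> S j --> g p = 0"
  proof (rule fundamental_lemma)
   show "open (S j)" unfolding S_def by (intro open_Times) auto
   show "g \<in> bmeas" using sqi_measurable[OF gs] by simp
   show "integrable lborel (%p. indicator (cbox c b) p * g p)" for c b by (rule sqi_mult[OF indicator_cbox_sqi gs])
   fix ph assume ph: "ph \<in> test (S j)"
   have U: "ph \<in> test UNIV" by (rule test_UNIV[OF ph])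
   have "(LBINT p. g p * ph p) = (LINT p|lom. (\<Sum>k\<in>{-N..N}. G k p) / 2 * ph p - G j p * ph p)"
    by (auto simp: lom_integral g_def algebra_simps intro!: LINT_cong)
   also have "\<dots> = (LINT p|lom. (\<Sum>k\<in>{-N..N}. G k p) / 2 * ph p) - (LINT p|lom. G j p * ph p)"
    by (intro Bochner_Integration.integral_diff Iint(1)[OF G(1) U] sqi_mult G test_sqi_lom[OF U]) auto
   also have "\<dots> = (LINT p|lom. ?a j p * pd v ph p) - (LINT p|lom. (\<Sum>k\<in>{-N..N}. ?a k p) / 2 * pd v ph p)"
    using rel[OF U, of j] rel2[OF _ U, of "{-N..N}"] by simp
   also have "(%p. (\<Sum>k\<in>{-N..N}. ?a k p) / 2 * pd v ph p) = (%p. ?a j p * pd v ph p)"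
   proof (rule ext)
    fix p
    show "(\<Sum>k\<in>{-N..N}. ?a k p) / 2 * pd v ph p = ?a j p * pd v ph p"
    proof (cases "p \<in> S j")
     case True
     have jN: "real_of_int \<bar>j\<bar> + 2 <= of_int N" using j by linarith
     have jx: "of_int j < fst p" "fst p < of_int j + 1" using True by (auto simp: S_def)
     then have "?a j p = d p" using chi_1[of "fst p - of_int j"] by (simp add: cut_fun_def)
     moreover have "\<bar>fst p\<bar> <= of_int N - 1" using jx jN by linarith
     ultimately show ?thesis using sum_a by simp
    next
     case False
     then have "pd v ph p = 0" using test_outside[OF test_pd[OF ph v]] by blast
     then show ?thesis by simp
    qed
   qed
   finally show "(LBINT p. g p * ph p) = 0" by simp
  qed
  then show ?thesis
  proof eventually_elim
   case (elim p)
   show ?case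
   proof
    assume p: "p \<in> S j"
    then have "p \<in> \<Omega>" by (auto simp: S_def mem_Omega)
    then show "(\<Sum>k\<in>{-N..N}. G k p) / 2 = G j p" using elim p by (simp add: g_def)
   qed
  qed
 qed
 show ?thesis unfolding wrel_def
 proof
  fix ph :: "point => real" assume ph: "ph \<in> test UNIV"
  obtain R where R: "R > 0" "!!p. \<bar>fst p\<bar> > R \<or> \<bar>snd p\<bar> > R ==> ph p = 0" using test_box_support[OF ph] by metis
  have z: "pd v ph p = 0" if "\<bar>fst p\<bar> > R" for p
   by (rule pd_zero_box[OF R(2) that])
  define N where "N = \<lceil>R\<rceil> + 4"
  have N: "R + 4 <= of_int N" unfolding N_def by linarith
  have "(LBINT p. indicator \<Omega> p * d p * pd v ph p) = (LINT p|lom. (\<Sum>k\<in>{-N..N}. ?a k p) / 2 * pd v ph p)"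
   unfolding lom_integral
  proof (rule LINT_cong[OF refl])
   fix p
   show "indicator \<Omega> p * d p * pd v ph p = indicator \<Omega> p * ((\<Sum>k\<in>{-N..N}. ?a k p) / 2 * pd v ph p)"
   proof (cases "\<bar>fst p\<bar> > R")
    case True then show ?thesis by (simp add: z)
   next
    case False
    then have "\<bar>fst p\<bar> <= of_int N - 1" using N by linarith
    then show ?thesis using sum_a by simp
   qed
  qed
  also have "\<dots> = - (LINT p|lom. (\<Sum>k\<in>{-N..N}. G k p) / 2 * ph p)" by (rule rel2[OF _ ph]) simp
  also have "(LINT p|lom. (\<Sum>k\<in>{-N..N}. G k p) / 2 * ph p) = (LBINT p. glue G p * ph p)"
   unfolding lom_integral
  proof (rule integral_cong_AE)
   show "(%p. indicator \<Omega> p * ((\<Sum>k\<in>{-N..N}. G k p) / 2 * ph p)) \<in> borel_measurable lborel"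
    using borel_measurable_integrable[OF Iint(1)[OF G(1) ph, of "{-N..N}"]] by (simp add: lom_measurable)
   show "(%p. glue G p * ph p) \<in> borel_measurable lborel"
    using ul_measurable[OF glue_ul[OF G]] test_measurable[OF ph] by measurable
   have "AE p in lborel. \<forall>j. fst p ~= of_int j & (\<bar>j\<bar> + 2 <= N --> p \<in> S j --> (\<Sum>k\<in>{-N..N}. G k p) / 2 = G j p)"
    unfolding AE_all_countable
   proof
    fix j
    have "AE p in lborel. \<bar>j\<bar> + 2 <= N --> p \<in> S j --> (\<Sum>k\<in>{-N..N}. G k p) / 2 = G j p"
     using loc[of j N] by (cases "\<bar>j\<bar> + 2 <= N") auto
    with AE_fst_not_int[of j] show "AE p in lborel. fst p ~= of_int j & (\<bar>j\<bar> + 2 <= N --> p \<in> S j --> (\<Sum>k\<in>{-N..N}. G k p) / 2 = G j p)"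
     by eventually_elim blast
   qed
   then show "AE p in lborel. indicator \<Omega> p * ((\<Sum>k\<in>{-N..N}. G k p) / 2 * ph p) = glue G p * ph p"
   proof eventually_elim
    case (elim p)
    show ?case
    proof (cases "\<bar>fst p\<bar> > R \<or> p \<notin> \<Omega>")
     case True then show ?thesis using R(2)[of p] by (auto simp: glue_def)
    next
     case False
     have b: "\<bar>\<lfloor>fst p\<rfloor>\<bar> + 2 <= N" using False N by linarith
     have ne: "fst p ~= of_int \<lfloor>fst p\<rfloor>" using elim by blast
     have "of_int \<lfloor>fst p\<rfloor> < fst p" "fst p < of_int \<lfloor>fst p\<rfloor> + 1" using ne by linarith+
     then have "p \<in> S \<lfloor>fst p\<rfloor>" using False by (cases p) (auto simp: S_def mem_Omega)
     then have "(\<Sum>k\<in>{-N..N}. G k p) / 2 = G \<lfloor>fst p\<rfloor> p" using elim b by blast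
     then show ?thesis using False by (simp add: glue_def)
    qed
   qed
  qed
  finally show "(LBINT p. indicator \<Omega> p * d p * pd v ph p) = - (LBINT p. glue G p * ph p)" .
 qed
qed

lemma uloc_extension:
 assumes H: "!!k. cut_fun chi k d \<in> H1" and tr: "!!k. has_trace (cut_fun chi k d) (%_. 0)"
  and M: "!!k. H1_norm (cut_fun chi k d) <= M"
 shows "\<exists>gx gz. ul M (%p. indicator \<Omega> p * d p) & ul M gx & ul M gz &
  wrel e\<^sub>x (%p. indicator \<Omega> p * d p) gx & wrel e\<^sub>z (%p. indicator \<Omega> p * d p) gz"
proof -
 let ?a = "%k. cut_fun chi k d" and ?X = "%k. weak_deriv e\<^sub>x (cut_fun chi k d)" and ?Z = "%k. weak_deriv e\<^sub>z (cut_fun chi k d)"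
 have W: "weak_grad (?a k) (?X k) (?Z k)" for k by (rule H1_weak_grad[OF H])
 then have s: "?a k \<in> sqi lom" "?X k \<in> sqi lom" "?Z k \<in> sqi lom" for k by (auto simp: weak_grad_def)
 have b: "l2 lom (?a k) <= M" "l2 lom (?X k) <= M" "l2 lom (?Z k) <= M" for k
 proof -
  have n: "n1 (?a k) (?X k) (?Z k) <= M" using M[of k] unfolding H1_norm_eq[OF W[of k]] .
  show "l2 lom (?a k) <= M" "l2 lom (?X k) <= M" "l2 lom (?Z k) <= M"
   by (rule order_trans[OF n1_ge(1) n] order_trans[OF n1_ge(2) n] order_trans[OF n1_ge(3) n])+
 qed
 have ga: "glue ?a = (%p. indicator \<Omega> p * d p)"
 proof (rule ext)
  fix p :: point
  have "chi (fst p - of_int \<lfloor>fst p\<rfloor>) = 1" by (rule chi_closed) linarith+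
  then show "glue ?a p = indicator \<Omega> p * d p" by (simp add: glue_def cut_fun_def)
 qed
 have "ul M (%p. indicator \<Omega> p * d p)" using glue_ul[of ?a M, OF s(1) b(1)] unfolding ga .
 moreover have "wrel e\<^sub>x (%p. indicator \<Omega> p * d p) (glue ?X)"
  by (rule glue_wrel[OF _ s(1) s(2) b(2)]) (auto intro: zero_trace_extension(1)[OF W tr])
 moreover have "wrel e\<^sub>z (%p. indicator \<Omega> p * d p) (glue ?Z)"
  by (rule glue_wrel[OF _ s(1) s(3) b(3)]) (auto intro: zero_trace_extension(2)[OF W tr])
 ultimately show ?thesis using glue_ul[of ?X M, OF s(2) b(2)] glue_ul[of ?Z M, OF s(3) b(3)] by blast
qed

end

section \<open>Mollified and truncated uniformly local fields\<close>

lemma pd_scale: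
 assumes "smooth (g :: real => real)"
 shows "pd 1 (%x. g (a * x + c)) = (%x. a * pd 1 g (a * x + c))"
proof (rule ext, rule pd_real_eqI)
 fix x
 have "((%x. a * x + c) has_field_derivative a) (at x)" by (auto intro!: derivative_eq_intros)
 from DERIV_chain2[OF smooth_has_field_derivative[OF assms] this]
 show "((%x. g (a * x + c)) has_field_derivative a * pd 1 g (a * x + c)) (at x)" by (simp add: mult.commute)
qed

text \<open>Zero flux in weak form, tested with bounded compactly supported functions of x. In this
  form it passes through convolution by Fubini.\<close>

definition zf :: "(point => real) => bool" where
 "zf h \<longleftrightarrow> (\<forall>m C R. m \<in> bmeas --> (\<forall>x. \<bar>m x\<bar> <= C * indicator {-R..R} x) -->
  (LBINT q. m (fst q) * h q) = 0)"

lemma ul_mult_integrable: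
 assumes h: "ul M h" and [measurable]: "m \<in> bmeas" and m: "!!x. \<bar>m x\<bar> <= C * indicator {-R..R} x"
 shows "integrable lborel (%q. m (fst q) * h q)"
proof -
 have i: "(%q. C * indicator (cbox (-R, 0) (R, 1)) q) \<in> sqi (lborel :: point measure)" by (intro sqi_cmult indicator_cbox_sqi)
 have "(%q. m (fst q) * indicator (cbox (-R, 0) (R, 1)) q) \<in> sqi (lborel :: point measure)"
 proof (rule l2_mono(1)[OF i])
  fix q :: point
  show "\<bar>m (fst q) * indicator (cbox (-R, 0) (R, 1)) q\<bar> <= \<bar>C * indicator (cbox (-R, 0) (R, 1)) q\<bar>"
   using m[of "fst q"] by (cases q) (auto simp: indicator_def split: if_splits)
 qed measurable
 from sqi_mult[OF this ul_local[OF h, of R]]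
 have "integrable lborel (%q. (m (fst q) * indicator (cbox (-R, 0) (R, 1)) q) * (indicator {-R..R} (fst q) * h q))" .
 also have "(%q. (m (fst q) * indicator (cbox (-R, 0) (R, 1)) q) * (indicator {-R..R} (fst q) * h q)) = (%q. m (fst q) * h q)"
 proof (rule ext)
  fix q :: point
  show "(m (fst q) * indicator (cbox (-R, 0) (R, 1)) q) * (indicator {-R..R} (fst q) * h q) = m (fst q) * h q"
   using m[of "fst q"] ul_outside[OF h, of q] by (cases "q \<in> \<Omega>"; cases q) (auto simp: indicator_def mem_Omega split: if_splits)
 qed
 finally show ?thesis .
qed

lemma zf_diff:
 assumes "ul M f" "ul N g" "zf f" "zf g"
 shows "zf (%p. f p - g p)"
 unfolding zf_def
proof (intro allI impI)
 fix m :: "real => real" and C R assume m: "m \<in> bmeas" "\<forall>x. \<bar>m x\<bar> <= C * indicator {-R..R} x"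
 then have "(LBINT q. m (fst q) * f q) = 0" "(LBINT q. m (fst q) * g q) = 0" using assms(3,4) unfolding zf_def by blast+
 then show "(LBINT q. m (fst q) * (f q - g q)) = 0"
  using ul_mult_integrable[OF assms(1) m(1) m(2)[rule_format]] ul_mult_integrable[OF assms(2) m(1) m(2)[rule_format]] by (simp add: right_diff_distrib)
qed

lemma Iz_fst: "Iz (%p. r (fst p) * ph p) p = r (fst p) * Iz ph p"
 and Az_fst: "Az (%p. r (fst p) * ph p) p = r (fst p) * Az ph p"
 by (simp_all add: Iz_def Az_def pint_def)

context cutoff_fun
begin

lemma T_cong_near:
 assumes "!!q. \<bar>fst q\<bar> <= 3/2 * \<bar>fst p\<bar> + 1 ==> f q = g q"
 shows "T n f p = T n g p"
 unfolding T_def moll_def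
proof (rule LINT_cong[OF refl])
 fix q
 show "ker n (dil n p - q) * f q = ker n (dil n p - q) * g q"
 proof (cases "ker n (dil n p - q) = 0")
  case False
  have k: "0 <= lam n * fst p - fst q" "lam n * fst p - fst q <= eps n" using ker_0[OF False] by (auto simp: dil_def)
  have "\<bar>lam n * fst p\<bar> <= 3/2 * \<bar>fst p\<bar>" using lam[of n] mult_right_mono[of "lam n" "3/2" "\<bar>fst p\<bar>"] by (simp add: abs_mult)
  then have "\<bar>fst q\<bar> <= 3/2 * \<bar>fst p\<bar> + 1" using k eps(2)[of n] by linarith
  then show ?thesis using assms by simp
 qed simp
qed

lemma T_AE_cong:
 assumes "AE p in lborel. f p = g p" "f \<in> bmeas" "g \<in> bmeas"
 shows "T n f p = T n g p"
 unfolding T_def moll_def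
proof (rule integral_cong_AE)
 note [measurable] = assms(2,3)
 show "(%q. ker n (dil n p - q) * f q) \<in> borel_measurable lborel" "(%q. ker n (dil n p - q) * g q) \<in> borel_measurable lborel" by measurable
 show "AE q in lborel. ker n (dil n p - q) * f q = ker n (dil n p - q) * g q" using assms(1) by eventually_elim simp
qed

lemma T_local_tendsto:
 assumes h: "ul M h"
 shows "(%n. l2 lborel (%p. indicator {-R..R} (fst p) * (T n h p - h p))) ---> 0"
proof -
 define h' where "h' = (%p. indicator {-(2 * \<bar>R\<bar> + 1)..2 * \<bar>R\<bar> + 1} (fst p) * h p)"
 have h': "h' \<in> sqi lborel" unfolding h'_def by (rule ul_local[OF h])
 have [measurable]: "h \<in> bmeas" "T n h \<in> bmeas" for n
  using ul_measurable[OF h] smooth_measurable[OF T_smooth[OF ul_loci[OF h]]] by auto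
 have le: "\<bar>indicator {-R..R} (fst p) * (T n h p - h p)\<bar> <= \<bar>T n h' p - h' p\<bar>" for n p
 proof (cases "fst p \<in> {-R..R}")
  case True
  have "T n h p = T n h' p" by (rule T_cong_near) (use True in \<open>auto simp: h'_def indicator_def\<close>)
  moreover have "h p = h' p" using True by (auto simp: h'_def indicator_def)
  ultimately show ?thesis using True by simp
 qed simp
 show ?thesis
 proof (rule tendsto_sandwich[OF _ _ tendsto_const T_tendsto[OF h']])
  show "\<forall>\<^sub>F n in sequentially. l2 lborel (%p. indicator {-R..R} (fst p) * (T n h p - h p)) <= l2 lborel (%p. T n h' p - h' p)"
   by (intro always_eventually allI l2_mono(2)[OF sqi_diff[OF T_l2(1)[OF h'] h']] le) measurable
 qed simp
qed

text \<open>The reflected kernel \<open>ker n (P - q)\<close> is a test function of \<open>q\<close>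
  on the whole plane, so the weak relation moves the derivative from the kernel to
  \<open>h'\<close>. The factor \<open>lam n\<close> is the chain rule for the dilation.\<close>

lemma T_wrel:
 assumes h: "ul M h" and h': "ul M' h'" and w: "wrel v h h'" and v: "v \<in> Basis"
 shows "pd v (T n h) p = lam n * T n h' p"
proof -
 define P where "P = dil n p"
 let ?ph = "%q. ker n (P - q)"
 obtain R where R: "\<forall>y. norm y > R --> ker n y = 0" using test_norm_support[OF ker_test] by blast
 have sm: "smooth ?ph" using smooth_affine[OF test_smooth[OF ker_test[of n]] bounded_linear_minus[OF bounded_linear_ident], of P] by simp
 have ph: "?ph \<in> test UNIV"
 proof (rule test_functionsI[OF sm, of "cball P R"])
  fix q assume "q \<notin> cball P R"
  then have "norm (P - q) > R" by (simp add: dist_norm)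
  then show "ker n (P - q) = 0" using R by blast
 qed auto
 have pdph: "pd v ?ph = (%q. - pd v (ker n) (P - q))"
 proof (rule ext)
  fix q
  have "((%q. P - q) has_derivative (%h. - h)) (at q)" by (auto intro!: derivative_eq_intros)
  from has_derivative_compose[OF this smooth_has_derivative_point[OF test_smooth[OF ker_test[of n]]]]
  have "pd v ?ph q = fst (- v) * dx (ker n) (P - q) + snd (- v) * dz (ker n) (P - q)" by (rule pd_eqI)
  then show "pd v ?ph q = - pd v (ker n) (P - q)" using v by (auto simp: Basis_point e\<^sub>x_def e\<^sub>z_def)
 qed
 have "(LBINT q. h q * - pd v (ker n) (P - q)) = - (LBINT q. h' q * ker n (P - q))"
  using w[unfolded wrel_def, rule_format, OF ph] unfolding pdph .
 then have "moll (pd v (ker n)) h P = moll (ker n) h' P" by (simp add: moll_def mult.commute)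
 then show ?thesis unfolding T_pd[OF ul_loci[OF h] v] T_def P_def by simp
qed

text \<open>Within \<open>eps n / 2\<close> of the boundary or beyond it, the dilated point is so
  far outside the strip that a kernel of width \<open>eps n\<close> does not reach back into
  it.\<close>

lemma T_support:
 assumes h: "ul M h" and z: "snd p < eps n / 2 \<or> 1 - eps n / 2 < snd p"
 shows "T n h p = 0"
proof -
 define e where "e = eps n"
 have e: "0 < e" "e <= 1/8" using eps[of n] by (auto simp: e_def)
 have "ker n (dil n p - q) * h q = 0" for q
 proof (cases "ker n (dil n p - q) = 0 \<or> q \<notin> \<Omega>")
  case True then show ?thesis using ul_outside[OF h, of q] by auto
 next
  case False
  then have q: "0 < snd q" "snd q < 1" by (auto simp: mem_Omega)
  have k: "0 <= snd p * (1 + 4 * e) - 2 * e - snd q" "snd p * (1 + 4 * e) - 2 * e - snd q <= e"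
   using ker_0[of n "dil n p - q"] False by (auto simp: dil_def lam_def e_def algebra_simps)
  from z[folded e_def] show ?thesis
  proof
   assume "snd p < e / 2"
   then have "snd p * (1 + 4 * e) <= (e / 2) * (1 + 4 * e)" using e by (intro mult_right_mono) auto
   also have "\<dots> <= (e / 2) * 2" using e by (intro mult_left_mono) auto
   finally show ?thesis using k q e by linarith
  next
   assume "1 - e / 2 < snd p"
   then have "(1 - e / 2) * (1 + 4 * e) <= snd p * (1 + 4 * e)" using e by (intro mult_right_mono) auto
   moreover have "(1 - e / 2) * (1 + 4 * e) = 1 + 7 / 2 * e - 2 * (e * e)" by (simp add: algebra_simps)
   moreover have "e * e <= e * (1/8)" using e by (intro mult_left_mono) auto
   ultimately show ?thesis using k q e by linarith
  qed
 qed
 then have "(LBINT q. ker n (dil n p - q) * h q) = (\<integral>q. 0 \<partial>(lborel :: point measure))" by (intro LINT_cong) auto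
 then show ?thesis by (simp add: T_def moll_def)
qed

text \<open>Integrating the product kernel over z first gives 1 / \<open>lam n\<close> whatever the
  vertical coordinate of \<open>q\<close>. What remains is \<open>h\<close> tested with a function
  of x alone, which is the weak form of zero flux.\<close>

lemma T_flux:
 assumes h: "ul M h" and zf: "zf h"
 shows "(LBINT z. T n h (x, z)) = 0"
proof -
 have [measurable]: "h \<in> bmeas" "be n \<in> bmeas"
  using ul_measurable[OF h] smooth_measurable[OF be_smooth] by auto
 let ?c = "(1 - lam n) / 2"
 define f where "f q z = (be n (lam n * x - fst q) * be n (lam n * z + ?c - snd q)) * h q" for q :: point and z
 define m where "m y = be n (lam n * x - y) / lam n" for y
 have bi: "(LBINT z. be n (lam n * z + ?c - b)) = 1 / lam n" "integrable lborel (%z. be n (lam n * z + ?c - b))" for b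
 proof -
  have eq: "lam n * z + ?c - b = (?c - b) + lam n * z" for z by simp
  show "(LBINT z. be n (lam n * z + ?c - b)) = 1 / lam n"
   using lborel_integral_real_affine[of "lam n" "be n" "?c - b"] lam(3)[of n] unfolding eq by (simp add: be_integral field_simps)
  show "integrable lborel (%z. be n (lam n * z + ?c - b))"
   unfolding eq using lborel_integrable_real_affine[OF test_integrable[OF be_test[of n]], of "lam n" "?c - b"] lam(3)[of n] by simp
 qed
 obtain C where C: "!!x. \<bar>be n x\<bar> <= C" using test_bounded[OF be_test[of n]] by metis
 have C0: "0 <= C" using order_trans[OF abs_ge_zero C] .
 define R where "R = \<bar>lam n * x\<bar> + 1"
 have mb: "\<bar>m y\<bar> <= C * indicator {-R..R} y" for y
 proof (cases "y \<in> {-R..R}")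
  case True
  have "\<bar>m y\<bar> <= C / 1" unfolding m_def abs_divide using lam[of n] C C0 by (intro frac_le) auto
  then show ?thesis using True by simp
 next
  case False
  then have "lam n * x - y < 0 \<or> eps n < lam n * x - y" using eps(2)[of n] unfolding R_def atLeastAtMost_iff by linarith
  then show ?thesis using be_0 C0 by (simp add: m_def)
 qed
 have mm [measurable]: "m \<in> bmeas" unfolding m_def by measurable
 have mi: "integrable lborel (%q. m (fst q) * h q)" by (rule ul_mult_integrable[OF h mm mb])
 have inner: "(LBINT z. f q z) = m (fst q) * h q" "integrable lborel (f q)" "(LBINT z. norm (f q z)) = \<bar>m (fst q) * h q\<bar>" for q
 proof -
  have fz: "f q = (%z. (be n (lam n * x - fst q) * h q) * be n (lam n * z + ?c - snd q))" by (auto simp: f_def)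
  show "(LBINT z. f q z) = m (fst q) * h q" "integrable lborel (f q)" unfolding fz using bi by (simp_all add: m_def)
  have "norm (f q z) = (be n (lam n * x - fst q) * \<bar>h q\<bar>) * be n (lam n * z + ?c - snd q)" for z
   by (simp add: fz abs_mult be_nonneg)
  then show "(LBINT z. norm (f q z)) = \<bar>m (fst q) * h q\<bar>" using bi lam(3)[of n] by (simp add: m_def abs_mult be_nonneg)
 qed
 have sndm [measurable]: "(%x. snd (g x :: point)) \<in> borel_measurable N" if "g \<in> borel_measurable N" for g and N :: "(point \<times> real) measure"
  by (rule borel_measurable_continuous_on[OF continuous_on_snd[OF continuous_on_id] that])
 have fm: "case_prod f \<in> borel_measurable (lborel \<Otimes>\<^sub>M lborel)" unfolding f_def split_def
 proof -
  have [measurable]: "fst \<in> (lborel :: point measure) \<Otimes>\<^sub>M (lborel :: real measure) \<rightarrow>\<^sub>M borel"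
   "snd \<in> (lborel :: point measure) \<Otimes>\<^sub>M (lborel :: real measure) \<rightarrow>\<^sub>M borel" by measurable
  have [measurable]: "(%w. fst (fst w)) \<in> borel_measurable ((lborel :: point measure) \<Otimes>\<^sub>M (lborel :: real measure))"
   "(%w. snd (fst w)) \<in> borel_measurable ((lborel :: point measure) \<Otimes>\<^sub>M (lborel :: real measure))"
   by (rule borel_measurable_continuous_on[OF continuous_on_fst[OF continuous_on_id]] borel_measurable_continuous_on[OF continuous_on_snd[OF continuous_on_id]], measurable)+
  show "(%p. be n (lam n * x - fst (fst p)) * be n (lam n * snd p + ?c - snd (fst p)) * h (fst p)) \<in> borel_measurable ((lborel :: point measure) \<Otimes>\<^sub>M (lborel :: real measure))"
   by measurable
 qed
 have "integrable (lborel \<Otimes>\<^sub>M lborel) (case_prod f)"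
  by (rule lborel_pair.Fubini_integrable[OF fm]) (use mi inner in auto)
 from lborel_pair.Fubini_integral[OF this]
 have "(LBINT z. (LBINT q. f q z)) = (LBINT q. m (fst q) * h q)" by (simp add: inner)
 also have "\<dots> = 0" using zf mm mb unfolding zf_def by blast
 finally show ?thesis by (simp add: T_def moll_def f_def ker_def dil_def)
qed

lemma l2_lom_le: "f \<in> sqi lborel ==> l2 lom f <= l2 lborel f"
 unfolding l2_lom by (rule l2_mono(2)) (auto simp: indicator_def dest: sqi_measurable)

text \<open>The error splits into the mollification error on the support of the m-th multiplier,
  small by the choice of \<open>N m\<close>, and the error of replacing the multiplier by its limit,
  which tends to 0 by dominated convergence since \<open>sw * h\<close> is square
  integrable.\<close>

lemma cut_tendsto:
 fixes c :: "nat => real => real" and c' K :: real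
 assumes h: "ul M h" and N: "!!m. l2 lborel (%p. indicator {-5 * real (Suc m)..5 * real (Suc m)} (fst p) * (T (N m) h p - h p)) <= 1 / real (Suc m)"
  and cm: "!!m. c m \<in> bmeas" and cb: "!!m x. \<bar>c m x\<bar> <= K" and c0: "!!m x. \<bar>x\<bar> > 5 * real (Suc m) ==> c m x = 0"
  and cl: "!!x. (%m. c m x) ---> c'"
 shows "(%p. sw p * (c m (fst p) * T (N m) h p)) \<in> sqi lborel"
  "(%m. l2 lborel (%p. sw p * (c m (fst p) * T (N m) h p) - c' * (sw p * h p))) ---> 0"
proof -
 note [measurable] = cm
 have [measurable]: "h \<in> bmeas" "T n h \<in> bmeas" for n
  using ul_measurable[OF h] smooth_measurable[OF T_smooth[OF ul_loci[OF h]]] by auto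
 have K: "0 <= K" using order_trans[OF abs_ge_zero cb] .
 define a where "a m p = indicator {-5 * real (Suc m)..5 * real (Suc m)} (fst p) * (T (N m) h p - h p)" for m and p :: point
 have as: "a m \<in> sqi lborel" for m
 proof -
  let ?R = "5 * real (Suc m)"
  define h' where "h' = (%p. indicator {-(2 * \<bar>?R\<bar> + 1)..2 * \<bar>?R\<bar> + 1} (fst p) * h p)"
  have h': "h' \<in> sqi lborel" unfolding h'_def by (rule ul_local[OF h])
  have "(%p. T (N m) h' p - h' p) \<in> sqi lborel" by (rule sqi_diff[OF T_l2(1)[OF h'] h'])
  then show ?thesis
  proof (rule l2_mono(1))
   show "a m \<in> borel_measurable lborel" unfolding a_def by measurable
   show "\<bar>a m p\<bar> <= \<bar>T (N m) h' p - h' p\<bar>" for p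
   proof (cases "fst p \<in> {-?R..?R}")
    case True
    have "T (N m) h p = T (N m) h' p" by (rule T_cong_near) (use True in \<open>auto simp: h'_def indicator_def\<close>)
    moreover have "h p = h' p" using True by (auto simp: h'_def indicator_def)
    ultimately show ?thesis using True by (simp add: a_def)
   qed (simp add: a_def)
  qed
 qed
 have s: "(%p. sw p * h p) \<in> sqi lborel" by (rule ul_sw[OF h])
 define b1 where "b1 m p = (sw p * c m (fst p)) * a m p" for m p
 define b2 where "b2 m p = (c m (fst p) - c') * (sw p * h p)" for m p
 have bl: "\<bar>sw p * c m (fst p)\<bar> <= K" for m p
  using mult_mono[OF sw_le_1[of p] cb[of m "fst p"]] sw_pos[of p] by (simp add: abs_mult)
 have b1s: "b1 m \<in> sqi lborel" for m unfolding b1_def by (rule sqi_bounded_mult[OF as _ bl]) measurable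
 have clb: "\<bar>c m x - c'\<bar> <= K + \<bar>c'\<bar>" for m x using cb[of m x] by linarith
 have b2s: "b2 m \<in> sqi lborel" for m unfolding b2_def by (rule sqi_bounded_mult[OF s _ clb]) measurable
 have split: "sw p * (c m (fst p) * T (N m) h p) = b1 m p + b2 m p + c' * (sw p * h p)" for m p
  using c0[of m "fst p"] by (cases "\<bar>fst p\<bar> > 5 * real (Suc m)") (auto simp: b1_def b2_def a_def indicator_def algebra_simps)
 show "(%p. sw p * (c m (fst p) * T (N m) h p)) \<in> sqi lborel" unfolding split by (intro sqi_add b1s b2s sqi_cmult s)
 have "l2 lborel (b1 m) <= K * (1 / real (Suc m))" for m
 proof -
  have "l2 lborel (b1 m) <= l2 lborel (%p. K * a m p)"
  proof (rule l2_mono(2)[OF sqi_cmult[OF as]])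
   show "b1 m \<in> borel_measurable lborel" by (rule sqi_measurable[OF b1s])
   show "\<bar>b1 m p\<bar> <= \<bar>K * a m p\<bar>" for p unfolding b1_def abs_mult[of _ "a m p"]
    using mult_right_mono[OF bl abs_ge_zero, of p m "a m p"] K by (simp add: abs_mult)
  qed
  also have "\<dots> = K * l2 lborel (a m)" using K by (subst l2_cmult) simp
  also have "\<dots> <= K * (1 / real (Suc m))" using N[of m] K unfolding a_def by (rule mult_left_mono)
  finally show ?thesis .
 qed
 note b1le = this
 have lk: "(%m. K * (1 / real (Suc m))) ---> 0"
  using tendsto_mult_right_zero[OF LIMSEQ_inverse_real_of_nat, of K] by (simp add: inverse_eq_divide)
 have l1: "(%m. l2 lborel (b1 m)) ---> 0"
  by (rule tendsto_sandwich[OF _ _ tendsto_const lk]) (use b1le in auto)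
 have "(%m. \<integral>p. (b2 m p)^2 \<partial>lborel) ---> (\<integral>p. 0 \<partial>(lborel :: point measure))"
 proof (rule integral_dominated_convergence[where w = "%p. (K + \<bar>c'\<bar>)^2 * (sw p * h p)^2"])
  show "integrable lborel (%p. (K + \<bar>c'\<bar>)^2 * (sw p * h p)^2)" by (intro integrable_mult_right sqi_integrable[OF s])
  show "AE p in lborel. (%m. (b2 m p)^2) ---> 0"
  proof (rule AE_I2)
   fix p :: point
   have "(%m. ((c m (fst p) - c') * (sw p * h p))^2) ---> ((c' - c') * (sw p * h p))\<^sup>2" by (intro tendsto_intros cl)
   then show "(%m. (b2 m p)^2) ---> 0" by (simp add: b2_def)
  qed
  show "AE p in lborel. norm ((b2 m p)^2) <= (K + \<bar>c'\<bar>)^2 * (sw p * h p)^2" for m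
  proof (rule AE_I2)
   fix p :: point
   have "(c m (fst p) - c')^2 <= (K + \<bar>c'\<bar>)^2" using power_mono[OF clb abs_ge_zero, of m "fst p" 2] by simp
   then show "norm ((b2 m p)^2) <= (K + \<bar>c'\<bar>)^2 * (sw p * h p)^2"
    unfolding b2_def power_mult_distrib[of "c m (fst p) - c'"] by (simp add: mult_right_mono)
  qed
  show "(%p. (b2 m p)^2) \<in> borel_measurable lborel" for m unfolding b2_def by measurable
 qed simp
 then have "(%m. l2 lborel (b2 m)) ---> sqrt 0" unfolding l2_def by (intro tendsto_real_sqrt) simp
 from tendsto_add[OF l1 this] have lim: "(%m. l2 lborel (b1 m) + l2 lborel (b2 m)) ---> 0" by simp
 have eq: "(%p. sw p * (c m (fst p) * T (N m) h p) - c' * (sw p * h p)) = (%p. b1 m p + b2 m p)" for m by (auto simp: split)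
 show "(%m. l2 lborel (%p. sw p * (c m (fst p) * T (N m) h p) - c' * (sw p * h p))) ---> 0"
  unfolding eq by (rule tendsto_sandwich[OF _ _ tendsto_const lim]) (auto intro!: always_eventually l2_triangle b1s b2s)
qed

end

section \<open>Uniqueness\<close>

lemma pd_cmult: "smooth f ==> pd v (%x. a * f x) = (%x. a * pd v f x)"
 using pd_lin[of f f v a 0] by simp

lemma l2_null_add:
 assumes "!!m. u m \<in> sqi M" "!!m. w m \<in> sqi M" "(%m. l2 M (u m)) ---> 0" "(%m. l2 M (w m)) ---> 0"
 shows "(%m. l2 M (%p. u m p + w m p)) ---> 0"
proof -
 have lim: "(%m. l2 M (u m) + l2 M (w m)) ---> 0" using tendsto_add[OF assms(3,4)] by simp
 show ?thesis by (rule tendsto_sandwich[OF _ _ tendsto_const lim]) (auto intro!: always_eventually l2_triangle assms)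
qed

lemma l2_null_cmult: "(%m. l2 M (u m)) ---> 0 ==> (%m. l2 M (%p. c * u m p)) ---> 0"
 unfolding l2_cmult using tendsto_mult_right_zero by blast

context cutoff_fun
begin

lemma convI:
 assumes E: "!!m. F m \<in> test \<Omega>" and g: "(%p. sw p * g p) \<in> sqi lborel"
  and lim: "(%m. l2 lborel (%p. sw p * F m p - sw p * g p)) ---> 0"
 shows "conv F g"
proof -
 have s: "(%p. sw p * F m p) \<in> sqi lborel" for m
  by (rule sqi_bounded_mult[OF test_sqi[OF E], of sw 1]) (use sw_pos sw_le_1 in \<open>auto simp: abs_of_pos\<close>)
 have "(%m. l2 lom (%p. sw p * F m p - sw p * g p)) ---> 0"
  by (rule tendsto_sandwich[OF _ _ tendsto_const lim]) (auto intro!: always_eventually l2_lom_le sqi_diff s g)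
 then show ?thesis using E sqi_lborel_lom[OF g] by (simp add: conv_def)
qed

lemma Az_T:
 assumes h: "ul M h" and zf: "zf h"
 shows "Az (T n h) p = 0"
proof -
 obtain x z where p: "p = (x, z)" by (cases p)
 have sm: "smooth (T n h)" by (rule T_smooth[OF ul_loci[OF h]])
 have c: "continuous_on {0..1} (%z. T n h (x, z))"
  using smooth_slice_z[OF sm] by (intro continuous_at_imp_continuous_on) (auto intro: DERIV_isCont)
 have "integral {0..1} (%z. T n h (x, z)) = (LINT z:{0..1}|lborel. T n h (x, z))"
  by (rule set_borel_integral_eq_integral(2)[OF borel_integrable_atLeastAtMost'[OF c], symmetric])
 also have "\<dots> = (LBINT z. T n h (x, z))"
  unfolding set_lebesgue_integral_def
 proof (rule LINT_cong[OF refl])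
  fix z
  show "indicator {0..1} z *\<^sub>R T n h (x, z) = T n h (x, z)"
   using T_support[OF h, of "(x, z)" n] eps(1)[of n] by (cases "z \<in> {0..1}") auto
 qed
 also have "\<dots> = 0" by (rule T_flux[OF h zf])
 finally show ?thesis by (simp add: Az_def pint_def p)
qed

text \<open>Cutting off a field would destroy its vanishing divergence, so the stream function is
  cut off instead. Terms in which the cutoff is differentiated carry a factor 1 / (m + 1) and
  disappear in the weighted norm. The mollification is tied to the cutoff by a diagonal choice,
  since mollified uniformly local fields converge only on bounded ranges of x.\<close>

lemma stream_approx:
 assumes ul: "ul M d1" "ul M d2" "ul M g11" "ul M g12" "ul M g21" "ul M g22"
  and w: "wrel e\<^sub>x d1 g11" "wrel e\<^sub>z d1 g12" "wrel e\<^sub>x d2 g21" "wrel e\<^sub>z d2 g22"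
  and div: "AE p in lborel. g11 p + g22 p = 0" and zf: "zf d1"
 shows "\<exists>E. (\<forall>m. E m \<in> test \<Omega>) & conv (%m. dx (E m)) (%p. - d2 p) & conv (%m. dz (E m)) d1 &
  conv (%m. dx (dx (E m))) (%p. - g21 p) & conv (%m. dx (dz (E m))) g11 & conv (%m. dz (dz (E m))) g12"
proof -
 \<comment> \<open>The m-th cutoff lives on this slab; the mollification index is chosen afterwards,
   so that the error there is at most 1 / (m + 1).\<close>
 define P where "P m n h \<longleftrightarrow> l2 lborel (%p. indicator {-5 * real (Suc m)..5 * real (Suc m)} (fst p) * (T n h p - h p)) <= 1 / real (Suc m)" for m n h
 have ev: "\<forall>\<^sub>F n in sequentially. P m n h" if "ul M h" for m h
  using order_tendstoD(2)[OF T_local_tendsto[OF that, of "5 * real (Suc m)"], of "1 / real (Suc m)"]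
  by (auto simp: P_def elim!: eventually_mono)
 have "\<forall>m. \<exists>n. (P m n d1 & P m n d2 & P m n g11 & P m n g12 & P m n g21) & n >= m"
 proof (intro allI)
  fix m
  have "\<forall>\<^sub>F n in sequentially. (P m n d1 & P m n d2 & P m n g11 & P m n g12 & P m n g21) & n >= m"
   by (intro eventually_conj ev ul eventually_ge_at_top)
  from eventually_happens'[OF sequentially_bot this]
  show "\<exists>n. (P m n d1 & P m n d2 & P m n g11 & P m n g12 & P m n g21) & n >= m" .
 qed
 from choice[OF this] obtain N where N0: "\<forall>m. (P m (N m) d1 & P m (N m) d2 & P m (N m) g11 & P m (N m) g12 & P m (N m) g21) & N m >= m" ..
 then have NP: "P m (N m) d1" "P m (N m) d2" "P m (N m) g11" "P m (N m) g12" "P m (N m) g21" and Nm: "N m >= m" for m by blast+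
 note N = NP[unfolded P_def]
 \<comment> \<open>Inverse of the cutoff scale: \<open>zeta (a m * x)\<close> is 1 for |x| at most 2
   (m + 1) and 0 for |x| at least 5 (m + 1).\<close>
 define a where "a m = inverse (real (Suc m))" for m
 have a: "0 < a m" "a m <= 1" "a m * (5 * real (Suc m)) = 5" for m by (auto simp: a_def field_simps)
 have a0: "a ---> 0" unfolding a_def by (rule LIMSEQ_inverse_real_of_nat)
 have L0: "0 <= L" using L_ge by simp
 define l where "l m = lam (N m)" for m
 have l: "\<bar>l m\<bar> <= 2" for m using lam[of "N m"] by (simp add: l_def)
 have l1: "l ---> 1"
 proof -
  have "(%m. 1 + 4 * eps m) ---> 1 + 4 * 0" by (intro tendsto_intros eps_tendsto)
  then have hi: "(%m. 1 + 4 * eps m) ---> 1" by simp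
  have "eps (N m) <= eps m" for m using Nm[of m] by (simp add: eps_def frac_le)
  then show ?thesis
   by (intro tendsto_sandwich[OF _ _ tendsto_const hi] always_eventually allI) (use lam(1) in \<open>auto simp: l_def lam_def less_imp_le\<close>)
 qed
 define \<kappa> where "\<kappa> m x = zeta (a m * x + 0)" for m x
 define k1 where "k1 m x = a m * pd 1 zeta (a m * x + 0)" for m x
 define k2 where "k2 m x = a m * (a m * pd 1 (pd 1 zeta) (a m * x + 0))" for m x
 have zs: "smooth (pd 1 zeta)" "smooth (pd 1 (pd 1 zeta))" by (intro smooth_deriv zeta_smooth)+
 have sm: "smooth (\<kappa> m)" "smooth (k1 m)" "smooth (k2 m)" for m
  unfolding \<kappa>_def[abs_def] k1_def[abs_def] k2_def[abs_def] by (intro smooth_mult smooth_const smooth_shift_real zeta_smooth zs)+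
 have pd\<kappa>: "pd 1 (\<kappa> m) = k1 m" and pdk1: "pd 1 (k1 m) = k2 m" for m
  unfolding \<kappa>_def[abs_def] k1_def[abs_def] k2_def[abs_def]
  by (simp only: pd_scale[OF zeta_smooth]) (subst pd_cmult[OF smooth_shift_real[OF zs(1)]], simp only: pd_scale[OF zs(1)])
 have far: "\<bar>a m * x + 0\<bar> > 5" if "\<bar>x\<bar> > 5 * real (Suc m)" for m x
 proof -
  have "5 < a m * \<bar>x\<bar>" using mult_strict_left_mono[OF that a(1)[of m]] unfolding a(3) .
  then show ?thesis using a(1)[of m] by (simp add: abs_mult)
 qed
 have k0: "\<kappa> m x = 0" "k1 m x = 0" "k2 m x = 0" if "\<bar>x\<bar> > 5 * real (Suc m)" for m x
 proof -
  note f = far[OF that]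
  show "\<kappa> m x = 0" unfolding \<kappa>_def by (rule zeta_0) (use f in simp)
  show "k1 m x = 0" unfolding k1_def using pd_zeta_0[OF f] by simp
  have "pd 1 (pd 1 zeta) (a m * x + 0) = 0"
   by (rule pd_zero_outside[of "{-5..5}"]) (use f pd_zeta_0 in \<open>auto simp: abs_le_iff not_le\<close>)
  then show "k2 m x = 0" unfolding k2_def by simp
 qed
 have kb: "\<bar>\<kappa> m x\<bar> <= L" "\<bar>k1 m x\<bar> <= a m * L" "\<bar>k2 m x\<bar> <= a m * L" for m x
 proof -
  show "\<bar>\<kappa> m x\<bar> <= L" unfolding \<kappa>_def by (rule L_bounds)
  show "\<bar>k1 m x\<bar> <= a m * L" unfolding k1_def abs_mult using a(1)[of m] L_bounds(5) by (simp add: mult_left_mono)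
  have "\<bar>a m * pd 1 (pd 1 zeta) (a m * x + 0)\<bar> <= 1 * L" unfolding abs_mult using a(1,2)[of m] L_bounds(6) by (intro mult_mono) auto
  then show "\<bar>k2 m x\<bar> <= a m * L" unfolding k2_def abs_mult[of "a m" "a m * _"] using a(1)[of m] by (simp add: mult_left_mono)
 qed
 have aL: "a m * L <= L" for m using mult_right_mono[OF a(2) L0, of m] by simp
 have lim\<kappa>: "(%m. \<kappa> m x) ---> 1" for x
 proof (rule tendsto_eventually)
  have "(%m. \<bar>a m * x\<bar>) ---> 0" using tendsto_mult_left_zero[OF a0, of x] by (rule tendsto_rabs_zero)
  then have "\<forall>\<^sub>F m in sequentially. \<bar>a m * x\<bar> < 2" by (rule order_tendstoD(2)) simp
  then show "\<forall>\<^sub>F m in sequentially. \<kappa> m x = 1" by eventually_elim (simp add: \<kappa>_def zeta_1)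
 qed
 have aL0: "(%m. a m * L) ---> 0" by (rule tendsto_mult_left_zero[OF a0])
 have limk: "(%m. k1 m x) ---> 0" "(%m. k2 m x) ---> 0" for x
  by (rule Lim_null_comparison[OF _ aL0], simp add: kb)+
 have meas: "\<kappa> m \<in> bmeas" "k1 m \<in> bmeas" "k2 m \<in> bmeas" for m
  by (rule smooth_measurable[OF sm(1)] smooth_measurable[OF sm(2)] smooth_measurable[OF sm(3)])+
 define \<theta>1 where "\<theta>1 m = T (N m) d1" for m
 define \<theta>2 where "\<theta>2 m = T (N m) d2" for m
 define \<psi> where "\<psi> m = Iz (\<theta>1 m)" for m
 have s\<theta>: "smooth (\<theta>1 m)" "smooth (\<theta>2 m)" for m unfolding \<theta>1_def \<theta>2_def by (intro T_smooth ul_loci[OF ul(1)] ul_loci[OF ul(2)])+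
 have s\<psi>: "smooth (\<psi> m)" for m unfolding \<psi>_def by (rule Iz_smooth[OF s\<theta>(1)])
 have dz\<psi>: "dz (\<psi> m) = \<theta>1 m" for m unfolding \<psi>_def by (rule Iz_dz[OF s\<theta>(1)])
 have dx\<theta>1: "dx (\<theta>1 m) = (%p. l m * T (N m) g11 p)" and dz\<theta>1: "dz (\<theta>1 m) = (%p. l m * T (N m) g12 p)"
  and dx\<theta>2: "dx (\<theta>2 m) = (%p. l m * T (N m) g21 p)" and dz\<theta>2: "dz (\<theta>2 m) = (%p. l m * T (N m) g22 p)" for m
  unfolding \<theta>1_def \<theta>2_def l_def using T_wrel[OF ul(1,3) w(1)] T_wrel[OF ul(1,4) w(2)] T_wrel[OF ul(2,5) w(3)] T_wrel[OF ul(2,6) w(4)]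
  by (auto intro!: ext)
 have Tdiv: "T n g11 p = - T n g22 p" for n p
 proof -
  have "T n g11 p = T n (%p. - g22 p) p"
  proof (rule T_AE_cong)
   show "AE p in lborel. g11 p = - g22 p" using div by eventually_elim simp
  qed (use ul_measurable[OF ul(3)] ul_measurable[OF ul(6)] in auto)
  then show ?thesis by (simp add: T_def moll_def)
 qed
 have dx\<psi>: "dx (\<psi> m) = (%p. (-1) * \<theta>2 m p)" for m
 proof (rule ext)
  fix p :: point obtain x z where p: "p = (x, z)" by (cases p)
  have "dx (\<theta>1 m) = dz (%p. (-1) * \<theta>2 m p)" unfolding pd_cmult[OF s\<theta>(2)] dx\<theta>1 dz\<theta>2 by (simp add: Tdiv)
  then have "dx (\<psi> m) = Iz (dz (%p. (-1) * \<theta>2 m p))" unfolding \<psi>_def by (simp only: Iz_dx[OF s\<theta>(1)])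
  then have "dx (\<psi> m) p = (-1) * \<theta>2 m (x, z) - (-1) * \<theta>2 m (x, 0)"
   unfolding p by (simp only: Iz_of_dz[OF smooth_mult[OF smooth_const s\<theta>(2)]])
  \<comment> \<open>The lower boundary contributes nothing, because the mollified field vanishes
    near it.\<close>
  moreover have "\<theta>2 m (x, 0) = 0" unfolding \<theta>2_def by (rule T_support[OF ul(2)]) (simp add: eps)
  ultimately show "dx (\<psi> m) p = (-1) * \<theta>2 m p" by (simp add: p)
 qed
 \<comment> \<open>A factor depending on x commutes with \<open>Iz\<close> and with the vertical
   mean, so the product is itself an antiderivative of a function with mean 0 and has compact
   support.\<close>
 have tst: "(%p. r (fst p) * \<psi> m p) \<in> test \<Omega>"
  if r: "smooth r" "!!x. \<bar>x\<bar> > 5 * real (Suc m) ==> r x = 0" for r m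
 proof -
  define ph where "ph p = r (fst p) * \<theta>1 m p" for p
  define d where "d = eps (N m) / 2"
  have d: "0 < d" "d < 1/2" using eps[of "N m"] by (auto simp: d_def)
  have s: "smooth ph" unfolding ph_def[abs_def] by (intro smooth_mult smooth_fst r s\<theta>)
  have z: "ph (x, z) = 0" if "\<bar>x\<bar> > 5 * real (Suc m) \<or> z < d \<or> 1 - d < z" for x z
   using that r(2)[of x] T_support[OF ul(1), of "(x, z)" "N m"] by (auto simp: ph_def \<theta>1_def d_def)
  have A: "Az ph p = 0" for p unfolding ph_def[abs_def] Az_fst \<theta>1_def by (simp add: Az_T[OF ul(1) zf])
  have "Iz ph \<in> test \<Omega>"
   by (rule box_test[OF Iz_smooth[OF s] d(1)], rule Iz_test[OF s d z A])
  moreover have "Iz ph = (%p. r (fst p) * \<psi> m p)" unfolding ph_def[abs_def] \<psi>_def by (rule ext) (rule Iz_fst)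
  ultimately show ?thesis by simp
 qed
 \<comment> \<open>No convergence of \<open>\<psi> m\<close> itself is available. Poincare in z
   replaces it by its z derivative, the mollified first component, against a vanishing
   multiplier.\<close>
 have low: "(%p. sw p * (r m (fst p) * \<psi> m p)) \<in> sqi lborel" "(%m. l2 lborel (%p. sw p * (r m (fst p) * \<psi> m p))) ---> 0"
  if r: "!!m. smooth (r m)" "!!m x. \<bar>x\<bar> > 5 * real (Suc m) ==> r m x = 0" "!!m x. \<bar>r m x\<bar> <= L" "!!x. (%m. r m x) ---> 0" for r m
 proof -
  define F where "F m p = r m (fst p) * \<psi> m p" for m p
  have F: "F m \<in> test \<Omega>" for m unfolding F_def[abs_def] by (rule tst[OF r(1,2)])
  have bm: "(%p. sw p * f p) \<in> sqi lborel" if "f \<in> test \<Omega>" for f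
   by (rule sqi_bounded_mult[OF test_sqi[OF that], of sw 1]) (use sw_pos sw_le_1 in \<open>auto simp: abs_of_pos\<close>)
  show "(%p. sw p * (r m (fst p) * \<psi> m p)) \<in> sqi lborel" using bm[OF F[of m]] by (simp add: F_def)
  have dzF: "dz (F m) = (%p. r m (fst p) * \<theta>1 m p)" for m
   unfolding F_def[abs_def] pd_smooth_mult[OF smooth_fst[OF r(1)] s\<psi>] pd_fst[OF r(1)] dz\<psi> by simp
  have wi: "wi 0 f = (l2 lborel (%p. sw p * f p))^2" for f by (simp add: wi_def l2_sq power_mult_distrib sw_sq)
  have le: "l2 lborel (%p. sw p * F m p) <= l2 lborel (%p. sw p * (r m (fst p) * \<theta>1 m p))" for m
   using poincare[OF F[of m], of 0] unfolding wi dzF by (rule power2_le_imp_le) simp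
  have mr: "!!m. r m \<in> bmeas" by (rule smooth_measurable[OF r(1)])
  have "(%m. l2 lborel (%p. sw p * (r m (fst p) * T (N m) d1 p) - 0 * (sw p * d1 p))) ---> 0"
   by (rule cut_tendsto(2)[OF ul(1) N(1) mr r(3) r(2) r(4)])
  then have lim: "(%m. l2 lborel (%p. sw p * (r m (fst p) * \<theta>1 m p))) ---> 0" by (simp add: \<theta>1_def)
  have "(%m. l2 lborel (%p. sw p * F m p)) ---> 0"
   by (rule tendsto_sandwich[OF _ _ tendsto_const lim]) (use le in auto)
  then show "(%m. l2 lborel (%p. sw p * (r m (fst p) * \<psi> m p))) ---> 0" by (simp add: F_def)
 qed
 have k1L: "\<bar>k1 m x\<bar> <= L" and k2L: "\<bar>k2 m x\<bar> <= L" for m x using kb(2,3)[of m x] aL[of m] by linarith+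
 note low1 = low[of k1, OF sm(2) k0(2) k1L limk(1)] and low2 = low[of k2, OF sm(3) k0(3) k2L limk(2)]
 \<comment> \<open>The factor \<open>l m\<close>, which tends to 1, comes from differentiating the
   dilation.\<close>
 define \<kappa>l where "\<kappa>l m x = \<kappa> m x * l m" for m x
 define k1' where "k1' m x = 2 * k1 m x" for m x
 have \<kappa>l: "!!m. \<kappa>l m \<in> bmeas" "!!m x. \<bar>\<kappa>l m x\<bar> <= L * 2" "!!m x. \<bar>x\<bar> > 5 * real (Suc m) ==> \<kappa>l m x = 0" "!!x. (%m. \<kappa>l m x) ---> 1"
 proof -
  show "\<kappa>l m \<in> bmeas" for m unfolding \<kappa>l_def[abs_def] using meas(1)[of m] by measurable
  show "\<bar>\<kappa>l m x\<bar> <= L * 2" for m x unfolding \<kappa>l_def abs_mult by (intro mult_mono kb l L0) auto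
  show "\<kappa>l m x = 0" if "\<bar>x\<bar> > 5 * real (Suc m)" for m x using k0(1)[OF that] by (simp add: \<kappa>l_def)
  show "(%m. \<kappa>l m x) ---> 1" for x using tendsto_mult[OF lim\<kappa>[of x] l1] by (simp add: \<kappa>l_def)
 qed
 have k1': "!!m. k1' m \<in> bmeas" "!!m x. \<bar>k1' m x\<bar> <= 2 * L" "!!m x. \<bar>x\<bar> > 5 * real (Suc m) ==> k1' m x = 0" "!!x. (%m. k1' m x) ---> 0"
 proof -
  show "k1' m \<in> bmeas" for m unfolding k1'_def[abs_def] using meas(2)[of m] by measurable
  show "\<bar>k1' m x\<bar> <= 2 * L" for m x using k1L[of m x] by (simp add: k1'_def abs_mult)
  show "k1' m x = 0" if "\<bar>x\<bar> > 5 * real (Suc m)" for m x using k0(2)[OF that] by (simp add: k1'_def)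
  show "(%m. k1' m x) ---> 0" for x using tendsto_mult_right_zero[OF limk(1)[of x], of 2] by (simp add: k1'_def)
 qed
 note swd = ul_sw[OF ul(1)] ul_sw[OF ul(2)] ul_sw[OF ul(3)] ul_sw[OF ul(4)] ul_sw[OF ul(5)]
 note c1 = cut_tendsto[OF ul(1) N(1) meas(1) kb(1) k0(1) lim\<kappa>]
 note c2 = cut_tendsto[OF ul(2) N(2) meas(1) kb(1) k0(1) lim\<kappa>]
 note c11 = cut_tendsto[OF ul(3) N(3) \<kappa>l(1,2,3,4)]
 note c12 = cut_tendsto[OF ul(4) N(4) \<kappa>l(1,2,3,4)]
 note c21 = cut_tendsto[OF ul(5) N(5) \<kappa>l(1,2,3,4)]
 note e1 = cut_tendsto[OF ul(1) N(1) meas(2) k1L k0(2) limk(1)]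
 note e2 = cut_tendsto[OF ul(2) N(2) k1'(1,2,3,4)]
 define E where "E m p = \<kappa> m (fst p) * \<psi> m p" for m p
 have E: "E m \<in> test \<Omega>" for m unfolding E_def[abs_def] by (rule tst[OF sm(1) k0(1)])
 have jE: "jet (E m) p = jmult (\<kappa> m (fst p)) (k1 m (fst p)) (k2 m (fst p)) (jet (\<psi> m) p)" for m p
  using jet_mult[OF sm(1) s\<psi>, of m m p] unfolding pd\<kappa> pdk1 E_def[abs_def] .
 have dxx: "dx (dx (\<psi> m)) = (%p. (-1) * (l m * T (N m) g21 p))" for m unfolding dx\<psi> pd_cmult[OF s\<theta>(2)] dx\<theta>2 ..
 have j: "dx (E m) p = \<kappa> m (fst p) * ((-1) * \<theta>2 m p) + k1 m (fst p) * \<psi> m p" "dz (E m) p = \<kappa> m (fst p) * \<theta>1 m p"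
  "dx (dx (E m)) p = \<kappa> m (fst p) * ((-1) * (l m * T (N m) g21 p)) + 2 * k1 m (fst p) * ((-1) * \<theta>2 m p) + k2 m (fst p) * \<psi> m p"
  "dx (dz (E m)) p = \<kappa> m (fst p) * (l m * T (N m) g11 p) + k1 m (fst p) * \<theta>1 m p"
  "dz (dz (E m)) p = \<kappa> m (fst p) * (l m * T (N m) g12 p)" for m p
  using jE[of m p] unfolding jet_def jmult_def dz\<psi> dxx unfolding dx\<psi> dx\<theta>1 dz\<theta>1 by simp_all
 have s': "(%p. u p - c * w p) \<in> sqi lborel" if "u \<in> sqi lborel" "w \<in> sqi lborel" for u w :: "point => real" and c
  by (rule sqi_diff[OF that(1) sqi_cmult[OF that(2)]])
 have neg: "(%p. sw p * - g p) \<in> sqi lborel" if "(%p. sw p * g p) \<in> sqi lborel" for g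
  using sqi_uminus[OF that] by simp
 have "conv (%m. dx (E m)) (%p. - d2 p)"
 proof (rule convI[OF test_dx[OF E] neg[OF swd(2)]])
  have "(%m. l2 lborel (%p. (-1) * (sw p * (\<kappa> m (fst p) * T (N m) d2 p) - 1 * (sw p * d2 p)) + sw p * (k1 m (fst p) * \<psi> m p))) ---> 0"
   by (intro l2_null_add l2_null_cmult c2(2) low1(2) low1(1) sqi_cmult s' c2(1) swd)
  then show "(%m. l2 lborel (%p. sw p * dx (E m) p - sw p * - d2 p)) ---> 0"
   unfolding j \<theta>2_def by (simp add: algebra_simps)
 qed
 moreover have "conv (%m. dz (E m)) d1"
  by (rule convI[OF test_dz[OF E] swd(1)]) (use c1(2) in \<open>simp add: j \<theta>1_def\<close>)
 moreover have "conv (%m. dx (dx (E m))) (%p. - g21 p)"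
 proof (rule convI[OF test_dx[OF test_dx[OF E]] neg[OF swd(5)]])
  have "(%m. l2 lborel (%p. ((-1) * (sw p * (\<kappa>l m (fst p) * T (N m) g21 p) - 1 * (sw p * g21 p))
    + (-1) * (sw p * (k1' m (fst p) * T (N m) d2 p) - 0 * (sw p * d2 p))) + sw p * (k2 m (fst p) * \<psi> m p))) ---> 0"
   by (intro l2_null_add l2_null_cmult c21(2) e2(2) low2(2) low2(1) sqi_add sqi_cmult s' c21(1) e2(1) swd)
  then show "(%m. l2 lborel (%p. sw p * dx (dx (E m)) p - sw p * - g21 p)) ---> 0"
   unfolding j \<theta>2_def \<kappa>l_def k1'_def by (simp add: algebra_simps)
 qed
 moreover have "conv (%m. dx (dz (E m))) g11"
 proof (rule convI[OF test_dx[OF test_dz[OF E]] swd(3)])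
  have "(%m. l2 lborel (%p. (sw p * (\<kappa>l m (fst p) * T (N m) g11 p) - 1 * (sw p * g11 p))
    + (sw p * (k1 m (fst p) * T (N m) d1 p) - 0 * (sw p * d1 p)))) ---> 0"
   by (intro l2_null_add c11(2) e1(2) s' c11(1) e1(1) swd)
  then show "(%m. l2 lborel (%p. sw p * dx (dz (E m)) p - sw p * g11 p)) ---> 0"
   unfolding j \<theta>1_def \<kappa>l_def by (simp add: algebra_simps)
 qed
 moreover have "conv (%m. dz (dz (E m))) g12"
  by (rule convI[OF test_dz[OF test_dz[OF E]] swd(4)]) (use c12(2) in \<open>simp add: j \<kappa>l_def mult.assoc\<close>)
 ultimately show ?thesis using E by blast
qed

text \<open>The limit equation is tested with the weight times \<open>E m\<close>. Since the limits
  pair to 0 with this function, the form evaluated at \<open>E m\<close> sees only the differences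
  between the second derivatives and their limits. Coercivity then bounds the root of the energy by
  15 times these differences: 5 from \<open>coercive\<close>, and 3 from the square root of the 9 in
  \<open>jsq_mult_le\<close>.\<close>

lemma energy_vanishes:
 assumes E: "!!m. E m \<in> test \<Omega>"
  and c: "conv (%m. dx (E m)) hx" "conv (%m. dz (E m)) hz" "conv (%m. dx (dx (E m))) hxx"
   "conv (%m. dx (dz (E m))) hxz" "conv (%m. dz (dz (E m))) hzz"
  and eq: "!!\<eta>. \<eta> \<in> test \<Omega> ==>
   (LINT p|lom. hxx p * dx (dx \<eta>) p) + 2 * (LINT p|lom. hxz p * dx (dz \<eta>) p) + (LINT p|lom. hzz p * dz (dz \<eta>) p) = 0"
 shows "AE p in lom. hx p = 0" "AE p in lom. hz p = 0"
proof -
 define A where "A m = l2 lom (%p. sw p * dx (dx (E m)) p - sw p * hxx p)" for m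
 define B where "B m = l2 lom (%p. sw p * dx (dz (E m)) p - sw p * hxz p)" for m
 define C where "C m = l2 lom (%p. sw p * dz (dz (E m)) p - sw p * hzz p)" for m
 define \<eta> where "\<eta> m p = wt 0 (fst p) * E m p" for m p
 define Q where "Q m = sqrt (energy 0 (E m))" for m
 have \<eta>: "\<eta> m \<in> test \<Omega>" for m unfolding \<eta>_def[abs_def] by (rule test_wt[OF E])
 have swE: "(%p. sw p * f p) \<in> sqi lom" if "f \<in> test \<Omega>" for f by (rule sw_mult_sqi[OF test_sqi_lom[OF that]])
 have j\<eta>: "jsq (jet (\<eta> m) p) <= 9 * (wt 0 (fst p))^2 * jsq (jet (E m) p)" for m p
 proof -
  have w: "0 < wt 0 (fst p)" by (rule wt_pos)
  have "jet (\<eta> m) p = jmult (wt 0 (fst p)) (pd 1 (wt 0) (fst p)) (pd 1 (pd 1 (wt 0)) (fst p)) (jet (E m) p)"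
   unfolding \<eta>_def[abs_def] by (rule jet_mult[OF wt_smooth test_smooth[OF E]])
  then show ?thesis using jsq_mult_le[of "wt 0 (fst p)" "wt 0 (fst p)" "pd 1 (wt 0) (fst p)" "pd 1 (pd 1 (wt 0)) (fst p)" "jet (E m) p"]
   wt_deriv_bound[of 0 "fst p"] wt_deriv2_bound[of 0 "fst p"] w by simp
 qed
 \<comment> \<open>Second derivatives of the weighted function carry one full power of the weight,
   so dividing by \<open>sw\<close> still leaves them bounded by the weighted energy.\<close>
 have D: "(%p. D p / sw p) \<in> sqi lom" "l2 lom (%p. D p / sw p) <= 3 * Q m"
  if t: "D \<in> test \<Omega>" and le: "!!p. (D p)^2 <= jsq (jet (\<eta> m) p)" for D m
 proof -
  have [measurable]: "D \<in> bmeas" by (rule test_measurable[OF t])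
  have i: "integrable lborel (%p. 9 * (wt 0 (fst p) * jsq (jet (E m) p)))" by (intro integrable_mult_right energy_integrable[OF E])
  have pt: "(D p / sw p)^2 <= 9 * (wt 0 (fst p) * jsq (jet (E m) p))" for p
  proof -
   have "(D p)^2 <= (9 * (wt 0 (fst p) * jsq (jet (E m) p))) * wt 0 (fst p)"
    using order_trans[OF le j\<eta>] by (simp add: power2_eq_square algebra_simps)
   then show ?thesis using wt_pos[of 0 "fst p"] by (simp add: power_divide sw_sq pos_divide_le_eq)
  qed
  have int: "integrable lborel (%p. (D p / sw p)^2)"
  proof (rule Bochner_Integration.integrable_bound[OF i])
   show "AE p in lborel. norm ((D p / sw p)^2) <= norm (9 * (wt 0 (fst p) * jsq (jet (E m) p)))"
    using order_trans[OF pt abs_ge_self] by (intro AE_I2) simp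
  qed measurable
  have s: "(%p. D p / sw p) \<in> sqi lborel" unfolding sqi_def using int by simp
  show "(%p. D p / sw p) \<in> sqi lom" by (rule sqi_lborel_lom[OF s])
  have "(LBINT p. (D p / sw p)^2) <= (LBINT p. 9 * (wt 0 (fst p) * jsq (jet (E m) p)))"
   by (rule integral_mono[OF int i pt])
  also have "\<dots> = 9 * energy 0 (E m)" by (simp add: energy_def)
  finally have "l2 lborel (%p. D p / sw p) <= sqrt (9 * energy 0 (E m))" unfolding l2_def by (rule real_sqrt_le_mono)
  then have "l2 lborel (%p. D p / sw p) <= 3 * Q m" by (simp add: Q_def real_sqrt_mult)
  then show "l2 lom (%p. D p / sw p) <= 3 * Q m" using l2_lom_le[OF s] by linarith
 qed
 have Q0: "0 <= Q m" for m by (simp add: Q_def energy_nonneg)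
 have pair: "\<bar>(LINT p|lom. F p * D p) - (LINT p|lom. h p * D p)\<bar> <= l2 lom (%p. sw p * F p - sw p * h p) * (3 * Q m)"
  if cF: "conv F' h" and F: "F \<in> test \<Omega>" and t: "D \<in> test \<Omega>" and le: "!!p. (D p)^2 <= jsq (jet (\<eta> m) p)" for F F' h D m
 proof -
  have sh: "(%p. sw p * h p) \<in> sqi lom" using cF by (simp add: conv_def)
  have "(LINT p|lom. F p * D p) - (LINT p|lom. h p * D p) = (LINT p|lom. F p * D p - h p * D p)"
   using sqi_mult[OF test_sqi_lom[OF F] test_sqi_lom[OF t]] conv_inner(3)[OF cF t] by simp
  also have "\<dots> = (LINT p|lom. (sw p * F p - sw p * h p) * (D p / sw p))"
  proof (rule LINT_cong[OF refl])
   fix p show "F p * D p - h p * D p = (sw p * F p - sw p * h p) * (D p / sw p)"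
    using sw_pos[of p] by (simp add: field_simps)
  qed
  finally have e: "(LINT p|lom. F p * D p) - (LINT p|lom. h p * D p) = (LINT p|lom. (sw p * F p - sw p * h p) * (D p / sw p))" .
  show ?thesis unfolding e
   by (rule order_trans[OF l2_cauchy_schwarz[OF sqi_diff[OF swE[OF F] sh] D(1)[OF t le]] mult_left_mono[OF D(2)[OF t le] l2_nonneg]])
 qed
 have Qle: "Q m <= 15 * (A m + 2 * B m + C m)" for m
 proof -
  let ?D1 = "dx (dx (\<eta> m))" and ?D2 = "dx (dz (\<eta> m))" and ?D3 = "dz (dz (\<eta> m))"
  have t: "?D1 \<in> test \<Omega>" "?D2 \<in> test \<Omega>" "?D3 \<in> test \<Omega>"
   "dx (dx (E m)) \<in> test \<Omega>" "dx (dz (E m)) \<in> test \<Omega>" "dz (dz (E m)) \<in> test \<Omega>"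
   by (intro test_dx test_dz \<eta> E)+
  have d: "(?D1 p)^2 <= jsq (jet (\<eta> m) p)" "(?D2 p)^2 <= jsq (jet (\<eta> m) p)" "(?D3 p)^2 <= jsq (jet (\<eta> m) p)" for p
   by (simp_all add: jsq_def jet_def)
  have i: "integrable lom (%p. dx (dx (E m)) p * ?D1 p)" "integrable lom (%p. dx (dz (E m)) p * ?D2 p)" "integrable lom (%p. dz (dz (E m)) p * ?D3 p)"
   by (rule sqi_mult[OF test_sqi_lom[OF t(4)] test_sqi_lom[OF t(1)]] sqi_mult[OF test_sqi_lom[OF t(5)] test_sqi_lom[OF t(2)]]
     sqi_mult[OF test_sqi_lom[OF t(6)] test_sqi_lom[OF t(3)]])+
  have "bform (E m) (\<eta> m) = (LINT p|lom. jform (jet (E m) p) (jet (\<eta> m) p))" unfolding bform_def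
   by (rule test_lom_integral[symmetric]) (rule test_outside[OF jform_test[OF E \<eta>]])
  also have "\<dots> = (LINT p|lom. dx (dx (E m)) p * ?D1 p + 2 * (dx (dz (E m)) p * ?D2 p) + dz (dz (E m)) p * ?D3 p)"
   by (simp add: jform_def jet_def)
  also have "\<dots> = (LINT p|lom. dx (dx (E m)) p * ?D1 p) + 2 * (LINT p|lom. dx (dz (E m)) p * ?D2 p) + (LINT p|lom. dz (dz (E m)) p * ?D3 p)"
   using i by simp
  finally have "bform (E m) (\<eta> m) = (LINT p|lom. dx (dx (E m)) p * ?D1 p) + 2 * (LINT p|lom. dx (dz (E m)) p * ?D2 p) + (LINT p|lom. dz (dz (E m)) p * ?D3 p)" .
  note bE = this
  have b: "bform (E m) (\<eta> m) = ((LINT p|lom. dx (dx (E m)) p * ?D1 p) - (LINT p|lom. hxx p * ?D1 p))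
    + 2 * ((LINT p|lom. dx (dz (E m)) p * ?D2 p) - (LINT p|lom. hxz p * ?D2 p))
    + ((LINT p|lom. dz (dz (E m)) p * ?D3 p) - (LINT p|lom. hzz p * ?D3 p))"
  proof -
   have arith: "b = (x1 - y1) + 2 * (x2 - y2) + (x3 - y3)"
    if b: "b = x1 + 2 * x2 + x3" and y: "y1 + 2 * y2 + y3 = 0" for b x1 x2 x3 y1 y2 y3 :: real
   proof -
    have "(x1 - y1) + 2 * (x2 - y2) + (x3 - y3) = (x1 + 2 * x2 + x3) - (y1 + 2 * y2 + y3)" by (simp add: algebra_simps)
    then show ?thesis unfolding b y by simp
   qed
   show ?thesis by (rule arith[OF bE eq[OF \<eta>[of m]]])
  qed
  have "bform (E m) (\<eta> m) <= A m * (3 * Q m) + 2 * (B m * (3 * Q m)) + C m * (3 * Q m)"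
   unfolding b A_def B_def C_def
   by (intro add_mono mult_left_mono order_trans[OF abs_ge_self pair[OF c(3) t(4) t(1) d(1)]]
     order_trans[OF abs_ge_self pair[OF c(4) t(5) t(2) d(2)]] order_trans[OF abs_ge_self pair[OF c(5) t(6) t(3) d(3)]]) simp
  moreover have "energy 0 (E m) <= 5 * bform (E m) (\<eta> m)" unfolding \<eta>_def[abs_def] by (rule coercive[OF E])
  ultimately have "energy 0 (E m) <= (15 * (A m + 2 * B m + C m)) * Q m" by (simp add: algebra_simps)
  moreover have "energy 0 (E m) = Q m * Q m" by (simp add: Q_def energy_nonneg)
  ultimately have le: "Q m * Q m <= (15 * (A m + 2 * B m + C m)) * Q m" by simp
  show ?thesis
  proof (cases "Q m = 0")
   case True then show ?thesis by (simp add: A_def B_def C_def)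
  next
   case False
   then have "0 < Q m" using Q0[of m] by simp
   with le show ?thesis by (rule mult_right_le_imp_le)
  qed
 qed
 have "A ---> 0" "B ---> 0" "C ---> 0" using c(3,4,5) unfolding conv_def A_def[abs_def] B_def[abs_def] C_def[abs_def] by blast+
 then have "(%m. 15 * (A m + 2 * B m + C m)) ---> 15 * (0 + 2 * 0 + 0)" by (intro tendsto_intros)
 then have lim: "(%m. 15 * (A m + 2 * B m + C m)) ---> 0" by simp
 have Qlim: "Q ---> 0" by (rule tendsto_sandwich[OF _ _ tendsto_const lim]) (use Qle Q0 in auto)
 have zero: "AE p in lom. h p = 0" if ch: "conv F h" and le: "!!m p. (F m p)^2 <= jsq (jet (E m) p)" for F h
 proof -
  have t: "F m \<in> test \<Omega>" for m using ch by (simp add: conv_def)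
  have sh: "(%p. sw p * h p) \<in> sqi lom" using ch by (simp add: conv_def)
  have "l2 lom (%p. sw p * F m p) <= Q m" for m
  proof -
   have s: "(%p. sw p * F m p) \<in> sqi lborel"
    by (rule sqi_bounded_mult[OF test_sqi[OF t], of sw 1]) (use sw_pos sw_le_1 in \<open>auto simp: abs_of_pos\<close>)
   have "(LBINT p. (sw p * F m p)^2) <= energy 0 (E m)" unfolding energy_def
   proof (rule integral_mono[OF sqi_integrable[OF s] energy_integrable[OF E]])
    show "(sw p * F m p)^2 <= wt 0 (fst p) * jsq (jet (E m) p)" for p
     unfolding power_mult_distrib sw_sq by (rule mult_left_mono[OF le]) (simp add: less_imp_le[OF wt_pos])
   qed
   then have "l2 lborel (%p. sw p * F m p) <= Q m" unfolding l2_def Q_def by (rule real_sqrt_le_mono)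
   then show ?thesis using l2_lom_le[OF s] by linarith
  qed
  then have "(%m. l2 lom (%p. sw p * F m p)) ---> 0"
   by (intro tendsto_sandwich[OF _ _ tendsto_const Qlim]) auto
  moreover have "(%m. l2 lom (%p. sw p * F m p)) ---> l2 lom (%p. sw p * h p)"
   using ch unfolding conv_def by (intro l2_tendsto_norm swE t sh) auto
  ultimately have "l2 lom (%p. sw p * h p) = 0" using LIMSEQ_unique by blast
  from l2_eq_0_AE[OF sh this] show ?thesis
  proof eventually_elim
   case (elim p) then show ?case using sw_pos[of p] by simp
  qed
 qed
 show "AE p in lom. hx p = 0" by (rule zero[OF c(1)]) (simp add: jsq_def jet_def)
 show "AE p in lom. hz p = 0" by (rule zero[OF c(2)]) (simp add: jsq_def jet_def)
qed

lemma zero_flux_zf: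
 assumes u: "ul M (%p. indicator \<Omega> p * fst (u p))" and z: "zero_flux u"
 shows "zf (%p. indicator \<Omega> p * fst (u p))"
 unfolding zf_def
proof (intro allI impI)
 fix m :: "real => real" and C R assume m: "m \<in> bmeas" "\<forall>x. \<bar>m x\<bar> <= C * indicator {-R..R} x"
 have "integrable lborel (%q. m (fst q) * (indicator \<Omega> q * fst (u q)))"
  by (rule ul_mult_integrable[OF u m(1) m(2)[rule_format]])
 then have "integrable (lborel \<Otimes>\<^sub>M lborel) (%(x, z). m x * (indicator \<Omega> (x, z) * fst (u (x, z))))"
  by (simp add: lborel_prod split_def)
 from lborel_pair.integral_fst[OF this]
 have "(LBINT q. m (fst q) * (indicator \<Omega> q * fst (u q))) = (LBINT x. (LBINT z. m x * (indicator \<Omega> (x, z) * fst (u (x, z)))))"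
  by (simp add: lborel_prod split_def)
 also have "\<dots> = 0"
 proof (rule integral_eq_zero_AE)
  show "AE x in lborel. (LBINT z. m x * (indicator \<Omega> (x, z) * fst (u (x, z)))) = 0"
   using z unfolding zero_flux_def
  proof eventually_elim
   case (elim x)
   have ind: "indicator \<Omega> (x, z) = (indicator {0<..<1} z :: real)" for z by (auto simp: indicator_def mem_Omega)
   show ?case using elim by (simp add: ind set_lebesgue_integral_def)
  qed
 qed
 finally show "(LBINT q. m (fst q) * (indicator \<Omega> q * fst (u q))) = 0" .
qed

lemma wrel_lom:
 assumes "wrel v (%p. indicator \<Omega> p * u p) g" "ph \<in> test S"
 shows "(LINT p|lom. u p * pd v ph p) = - (LBINT p. g p * ph p)"
 using assms(1)[unfolded wrel_def, rule_format, OF test_UNIV[OF assms(2)]] by (simp add: lom_integral mult.assoc)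

text \<open>Inside the strip this is the fundamental lemma; outside both functions are 0, which
  gives the identity on the whole plane as needed for the mollification.\<close>

lemma divergence_AE:
 assumes u: "ul M g11" "ul M g22" "wrel e\<^sub>x (%p. indicator \<Omega> p * fst (u p)) g11" "wrel e\<^sub>z (%p. indicator \<Omega> p * snd (u p)) g22"
  and div: "divergence_free u"
 shows "AE p in lborel. g11 p + g22 p = 0"
proof -
 have m: "g11 \<in> bmeas" "g22 \<in> bmeas" using u(1,2) ul_measurable by blast+
 have "AE p in lborel. p \<in> \<Omega> --> g11 p + g22 p = 0"
 proof (rule fundamental_lemma[OF Omega_open])
  show "(%p. g11 p + g22 p) \<in> bmeas" using m by simp
  fix a b :: point
  define R where "R = max \<bar>fst a\<bar> \<bar>fst b\<bar>"
  have i: "integrable lborel (%p. indicator (cbox a b) p * (indicator {-R..R} (fst p) * g11 p + indicator {-R..R} (fst p) * g22 p))"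
   by (rule sqi_mult[OF indicator_cbox_sqi sqi_add[OF ul_local[OF u(1)] ul_local[OF u(2)]]])
  have "indicator (cbox a b) p * (indicator {-R..R} (fst p) * g11 p + indicator {-R..R} (fst p) * g22 p) = indicator (cbox a b) p * (g11 p + g22 p)" for p
  proof (cases "p \<in> cbox a b")
   case True
   then have "fst a <= fst p" "fst p <= fst b" by (cases a; cases b; cases p; simp)+
   then have "fst p \<in> {-R..R}" by (auto simp: R_def)
   then show ?thesis by simp
  qed simp
  then show "integrable lborel (%p. indicator (cbox a b) p * (g11 p + g22 p))" using i by (simp only:)
 next
  fix ph assume ph: "ph \<in> test \<Omega>"
  have "- (LINT p|lom. fst (u p) * dx ph p) + - (LINT p|lom. snd (u p) * dz ph p) = 0"
   using div ph unfolding divergence_free_def dist_deriv_pd dist_of_lom comp_def by blast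
  then have "(LINT p|lom. fst (u p) * dx ph p) + (LINT p|lom. snd (u p) * dz ph p) = 0" by linarith
  then show "(LBINT p. (g11 p + g22 p) * ph p) = 0"
   using wrel_lom[OF u(3) ph] wrel_lom[OF u(4) ph] ul_integrable[OF u(1) ph] ul_integrable[OF u(2) ph] by (simp add: distrib_right)
 qed
 then show ?thesis
 proof eventually_elim
  case (elim p) then show ?case using ul_outside[OF u(1), of p] ul_outside[OF u(2), of p] by (cases "p \<in> \<Omega>") auto
 qed
qed

text \<open>The first equation is tested with \<open>dz \<eta>\<close> and the second with
  \<open>dx \<eta>\<close>; the pressure cancels because mixed derivatives commute. The Laplacians
  become pairings with the gradients of the extended fields.\<close>

lemma momentum_curl:
 assumes w: "wrel e\<^sub>x (%p. indicator \<Omega> p * fst (u p)) g11" "wrel e\<^sub>z (%p. indicator \<Omega> p * fst (u p)) g12"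
   "wrel e\<^sub>x (%p. indicator \<Omega> p * snd (u p)) g21" "wrel e\<^sub>z (%p. indicator \<Omega> p * snd (u p)) g22"
  and mom: "momentum_eq u q f" and \<eta>: "\<eta> \<in> test \<Omega>"
 shows "(LBINT p. g11 p * dx (dz \<eta>) p) + (LBINT p. g12 p * dz (dz \<eta>) p)
  - (LBINT p. g21 p * dx (dx \<eta>) p) - (LBINT p. g22 p * dx (dz \<eta>) p) = curlf f \<eta>"
proof -
 have pc: "dz (dx \<eta>) = dx (dz \<eta>)" by (rule pd_commute[OF test_smooth[OF \<eta>]])
 have t: "dz \<eta> \<in> test \<Omega>" "dx \<eta> \<in> test \<Omega>" by (intro test_dx test_dz \<eta>)+
 have "- dist_laplacian (dist_of (fst \<circ> u)) (dz \<eta>) - q (dx (dz \<eta>)) = fst f (dz \<eta>)"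
  "- dist_laplacian (dist_of (snd \<circ> u)) (dx \<eta>) - q (dz (dx \<eta>)) = snd f (dx \<eta>)"
  using mom t unfolding momentum_eq_def dist_deriv_pd by force+
 then show ?thesis
  unfolding curlf_def dist_laplacian_eq pc
  using wrel_lom[OF w(1) test_dx[OF t(1)]] wrel_lom[OF w(2) test_dz[OF t(1)]] wrel_lom[OF w(3) test_dx[OF t(2)]] wrel_lom[OF w(4) test_dz[OF t(2)]]
  by (simp add: pc)
qed

lemma solution_extension:
 assumes u: "u \<in> H1_uloc chi" and s: "stokes_zero_flux chi f u"
 shows "\<exists>M g11 g12 g21 g22. ul M (%p. indicator \<Omega> p * fst (u p)) & ul M (%p. indicator \<Omega> p * snd (u p)) &
  ul M g11 & ul M g12 & ul M g21 & ul M g22 &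
  wrel e\<^sub>x (%p. indicator \<Omega> p * fst (u p)) g11 & wrel e\<^sub>z (%p. indicator \<Omega> p * fst (u p)) g12 &
  wrel e\<^sub>x (%p. indicator \<Omega> p * snd (u p)) g21 & wrel e\<^sub>z (%p. indicator \<Omega> p * snd (u p)) g22"
proof -
 have H: "cut_fun chi k (fst \<circ> u) \<in> H1" "cut_fun chi k (snd \<circ> u) \<in> H1" for k using u by (auto simp: H1_uloc_def)
 have tr: "has_trace (cut_fun chi k (fst \<circ> u)) (%_. 0)" "has_trace (cut_fun chi k (snd \<circ> u)) (%_. 0)" for k
  using s by (auto simp: stokes_zero_flux_def zero_trace_def)
 have bdd: "bdd_above (range (%k. H1_vec_norm_cut chi k u))" using u by (simp add: H1_uloc_def)
 have v: "H1_vec_norm_cut chi k u <= H1_uloc_norm chi u" for k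
  unfolding H1_uloc_norm_def by (rule cSUP_upper[OF UNIV_I bdd])
 have n: "H1_norm (cut_fun chi k (fst \<circ> u)) <= H1_uloc_norm chi u" "H1_norm (cut_fun chi k (snd \<circ> u)) <= H1_uloc_norm chi u" for k
  by (rule order_trans[OF _ v[of k]]; simp add: H1_vec_norm_cut_def)+
 show ?thesis
  using uloc_extension[OF H(1) tr(1) n(1)] uloc_extension[OF H(2) tr(2) n(2)] unfolding comp_def by blast
qed

text \<open>The two solutions may come with different pressures, but each of them drops out of its
  own curl identity. The difference thus satisfies the homogeneous biharmonic equation in weak form,
  and \<open>stream_approx\<close> supplies what \<open>energy_vanishes\<close> needs.\<close>

theorem stokes_unique:
 assumes u: "u \<in> H1_uloc chi" "stokes_zero_flux chi f u" and v: "v \<in> H1_uloc chi" "stokes_zero_flux chi f v"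
 shows "AE p in lborel. p \<in> \<Omega> --> v p = u p"
proof -
 obtain M a11 a12 a21 a22 where a: "ul M (%p. indicator \<Omega> p * fst (u p))" "ul M (%p. indicator \<Omega> p * snd (u p))"
  "ul M a11" "ul M a12" "ul M a21" "ul M a22"
  "wrel e\<^sub>x (%p. indicator \<Omega> p * fst (u p)) a11" "wrel e\<^sub>z (%p. indicator \<Omega> p * fst (u p)) a12"
  "wrel e\<^sub>x (%p. indicator \<Omega> p * snd (u p)) a21" "wrel e\<^sub>z (%p. indicator \<Omega> p * snd (u p)) a22"
  using solution_extension[OF u] by (elim exE conjE) (rule that)
 obtain N b11 b12 b21 b22 where b: "ul N (%p. indicator \<Omega> p * fst (v p))" "ul N (%p. indicator \<Omega> p * snd (v p))"
  "ul N b11" "ul N b12" "ul N b21" "ul N b22"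
  "wrel e\<^sub>x (%p. indicator \<Omega> p * fst (v p)) b11" "wrel e\<^sub>z (%p. indicator \<Omega> p * fst (v p)) b12"
  "wrel e\<^sub>x (%p. indicator \<Omega> p * snd (v p)) b21" "wrel e\<^sub>z (%p. indicator \<Omega> p * snd (v p)) b22"
  using solution_extension[OF v] by (elim exE conjE) (rule that)
 obtain q where q: "momentum_eq u q f" using u(2) unfolding stokes_zero_flux_def by blast
 obtain q' where q': "momentum_eq v q' f" using v(2) unfolding stokes_zero_flux_def by blast
 have su: "divergence_free u" "zero_flux u" and sv: "divergence_free v" "zero_flux v" using u(2) v(2) by (auto simp: stokes_zero_flux_def)
 let ?d1 = "%p. indicator \<Omega> p * fst (u p) - indicator \<Omega> p * fst (v p)" and ?d2 = "%p. indicator \<Omega> p * snd (u p) - indicator \<Omega> p * snd (v p)"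
 let ?g11 = "%p. a11 p - b11 p" and ?g12 = "%p. a12 p - b12 p" and ?g21 = "%p. a21 p - b21 p" and ?g22 = "%p. a22 p - b22 p"
 have div: "AE p in lborel. ?g11 p + ?g22 p = 0"
  using divergence_AE[OF a(3,6,7,10) su(1)] divergence_AE[OF b(3,6,7,10) sv(1)] by eventually_elim simp
 have U: "ul (M + N) ?d1" "ul (M + N) ?d2" "ul (M + N) ?g11" "ul (M + N) ?g12" "ul (M + N) ?g21" "ul (M + N) ?g22"
  by (rule ul_diff[OF a(1) b(1)] ul_diff[OF a(2) b(2)] ul_diff[OF a(3) b(3)] ul_diff[OF a(4) b(4)] ul_diff[OF a(5) b(5)] ul_diff[OF a(6) b(6)])+
 have W: "wrel e\<^sub>x ?d1 ?g11" "wrel e\<^sub>z ?d1 ?g12" "wrel e\<^sub>x ?d2 ?g21" "wrel e\<^sub>z ?d2 ?g22"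
  by (rule wrel_diff[OF a(1,3) b(1,3) a(7) b(7)] wrel_diff[OF a(1,4) b(1,4) a(8) b(8)]
    wrel_diff[OF a(2,5) b(2,5) a(9) b(9)] wrel_diff[OF a(2,6) b(2,6) a(10) b(10)], simp)+
 have Z: "zf ?d1" by (rule zf_diff[OF a(1) b(1) zero_flux_zf[OF a(1) su(2)] zero_flux_zf[OF b(1) sv(2)]])
 obtain E where E: "!!m. E m \<in> test \<Omega>" "conv (%m. dx (E m)) (%p. - ?d2 p)" "conv (%m. dz (E m)) ?d1"
  "conv (%m. dx (dx (E m))) (%p. - ?g21 p)" "conv (%m. dx (dz (E m))) ?g11" "conv (%m. dz (dz (E m))) ?g12"
  using stream_approx[OF U W div Z] by (elim exE conjE) (rule that, blast+)
 have eq: "(LINT p|lom. - ?g21 p * dx (dx \<eta>) p) + 2 * (LINT p|lom. ?g11 p * dx (dz \<eta>) p) + (LINT p|lom. ?g12 p * dz (dz \<eta>) p) = 0"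
  if \<eta>: "\<eta> \<in> test \<Omega>" for \<eta>
 proof -
  have t: "dx (dx \<eta>) \<in> test \<Omega>" "dx (dz \<eta>) \<in> test \<Omega>" "dz (dz \<eta>) \<in> test \<Omega>" by (intro test_dx test_dz \<eta>)+
  have lom: "(LINT p|lom. g p * ph p) = (LBINT p. g p * ph p)" if "ph \<in> test \<Omega>" for g ph :: "point => real"
   by (rule test_lom_integral) (simp add: test_outside[OF that])
  \<comment> \<open>Vanishing divergence merges the two mixed terms of the curl identity into the
    coefficient 2 of the Hessian form.\<close>
  have "(LBINT p. ?g22 p * dx (dz \<eta>) p) = (LBINT p. - (?g11 p * dx (dz \<eta>) p))"
  proof (rule integral_cong_AE)
   show "AE p in lborel. ?g22 p * dx (dz \<eta>) p = - (?g11 p * dx (dz \<eta>) p)"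
    using div
   proof eventually_elim
    case (elim p)
    then have "?g22 p = - ?g11 p" by linarith
    then show ?case by (simp only: mult_minus_left)
   qed
  qed (use ul_measurable[OF U(3)] ul_measurable[OF U(6)] test_measurable[OF t(2)] in auto)
  then have e22: "(LBINT p. ?g22 p * dx (dz \<eta>) p) = - (LBINT p. ?g11 p * dx (dz \<eta>) p)" by simp
  have sp: "(LBINT p. (g p - h p) * ph p) = (LBINT p. g p * ph p) - (LBINT p. h p * ph p)"
   if "ul M g" "ul N h" "ph \<in> test \<Omega>" for g h ph
   using ul_integrable[OF that(1,3)] ul_integrable[OF that(2,3)] by (simp add: left_diff_distrib)
  have neg: "(LBINT p. - ?g21 p * dx (dx \<eta>) p) = - (LBINT p. ?g21 p * dx (dx \<eta>) p)"
   unfolding mult_minus_left by simp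
  show ?thesis
   unfolding lom[OF t(1)] lom[OF t(2)] lom[OF t(3)] neg
   using momentum_curl[OF a(7-10) q \<eta>] momentum_curl[OF b(7-10) q' \<eta>] e22
    sp[OF a(3) b(3) t(2)] sp[OF a(4) b(4) t(3)] sp[OF a(5) b(5) t(1)] sp[OF a(6) b(6) t(2)] by linarith
 qed
 have "AE p in lom. - ?d2 p = 0" "AE p in lom. ?d1 p = 0" by (rule energy_vanishes[OF E eq]; assumption)+
 then have "AE p in lborel. p \<in> \<Omega> --> - ?d2 p = 0" "AE p in lborel. p \<in> \<Omega> --> ?d1 p = 0" by (simp_all only: lom_AE)
 then show ?thesis
 proof eventually_elim
  case (elim p)
  then show ?case by (auto simp: prod_eq_iff)
 qed
qed

section \<open>Transfer of the estimate to every solution\<close>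

lemma H1_norm_AE_cong:
 assumes u: "u \<in> H1" and v: "v \<in> H1" and eq: "AE p in lom. v p = u p"
 shows "H1_norm v = H1_norm u"
proof -
 let ?g = "weak_deriv e\<^sub>x u" and ?h = "weak_deriv e\<^sub>z u"
 have W: "weak_grad u ?g ?h" by (rule H1_weak_grad[OF u])
 have vs: "v \<in> sqi lom" and us: "u \<in> sqi lom" using v u by (auto simp: H1_def L2_sqi)
 have cong: "(LINT p|lom. v p * pd w ph p) = (LINT p|lom. u p * pd w ph p)" if "ph \<in> test \<Omega>" "w \<in> Basis" for w ph
 proof (rule integral_cong_AE)
  have [measurable]: "v \<in> borel_measurable lom" "u \<in> borel_measurable lom" "pd w ph \<in> borel_measurable lom"
   using sqi_measurable[OF vs] sqi_measurable[OF us] lom_measurable_borel[OF test_measurable[OF test_pd[OF that]]] by auto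
  show "(%p. v p * pd w ph p) \<in> borel_measurable lom" "(%p. u p * pd w ph p) \<in> borel_measurable lom" by measurable
  show "AE p in lom. v p * pd w ph p = u p * pd w ph p" using eq by eventually_elim simp
 qed
 have "weak_grad v ?g ?h" using W vs unfolding weak_grad_def is_weak_deriv_iff by (simp add: cong)
 moreover have "l2 lom v = l2 lom u" by (rule l2_cong_AE[OF eq sqi_measurable[OF vs] sqi_measurable[OF us]])
 ultimately show ?thesis by (simp add: H1_norm_eq[OF W] H1_norm_eq n1_def)
qed

text \<open>Uniqueness gives equality almost everywhere only, so the norm bound for the constructed
  solution reaches another representative through this invariance.\<close>

lemma H1_uloc_norm_AE_cong:
 assumes u: "u \<in> H1_uloc chi" and v: "v \<in> H1_uloc chi" and eq: "AE p in lborel. p \<in> \<Omega> --> v p = u p"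
 shows "H1_uloc_norm chi v = H1_uloc_norm chi u"
proof -
 have e: "AE p in lom. v p = u p" using eq by (simp add: lom_AE)
 have H: "cut_fun chi k (fst \<circ> w) \<in> H1" "cut_fun chi k (snd \<circ> w) \<in> H1" if "w \<in> H1_uloc chi" for k w
  using that by (auto simp: H1_uloc_def)
 have c: "AE p in lom. cut_fun chi k (fst \<circ> v) p = cut_fun chi k (fst \<circ> u) p" "AE p in lom. cut_fun chi k (snd \<circ> v) p = cut_fun chi k (snd \<circ> u) p" for k
  using e by (eventually_elim, simp add: cut_fun_def)+
 have "H1_vec_norm_cut chi k v = H1_vec_norm_cut chi k u" for k
  unfolding H1_vec_norm_cut_def
  by (simp only: H1_norm_AE_cong[OF H(1)[OF u] H(1)[OF v] c(1)] H1_norm_AE_cong[OF H(2)[OF u] H(2)[OF v] c(2)])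
 then show ?thesis by (simp add: H1_uloc_norm_def)
qed

end

theorem theorem3p2:
 fixes chi :: "real \<Rightarrow> real"
 assumes "cutoff chi"
 shows "(\<forall>f\<in>H_minus1_uloc chi.
      \<exists>u\<in>H1_uloc chi. stokes_zero_flux chi f u \<and>
       (\<forall>v\<in>H1_uloc chi. stokes_zero_flux chi f v \<longrightarrow> (AE p in lborel. p \<in> \<Omega> \<longrightarrow> v p = u p))) \<and>
    (\<exists>C>0. \<forall>f\<in>H_minus1_uloc chi. \<forall>u\<in>H1_uloc chi. stokes_zero_flux chi f u \<longrightarrow>
      H1_uloc_norm chi u \<le> C * H_minus1_uloc_norm chi f)"
proof -
 interpret cutoff_fun chi by unfold_locales fact
 \<comment> \<open>The constant depends on \<open>chi\<close> only, through \<open>L\<close> and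
   \<open>C0\<close>.\<close>
 define C where "C = sqrt 2 * (sqrt (6 * L\<^sup>2) * (10 * C0))"
 have C: "0 < C" using C0_pos L_ge by (simp add: C_def)
 have "\<exists>u\<in>H1_uloc chi. stokes_zero_flux chi f u \<and>
   (\<forall>v\<in>H1_uloc chi. stokes_zero_flux chi f v \<longrightarrow> (AE p in lborel. p \<in> \<Omega> \<longrightarrow> v p = u p))"
  if "f \<in> H_minus1_uloc chi" for f
  using stokes_exists[OF that] stokes_unique by blast
 moreover have "H1_uloc_norm chi u \<le> C * H_minus1_uloc_norm chi f"
  if f: "f \<in> H_minus1_uloc chi" and u: "u \<in> H1_uloc chi" "stokes_zero_flux chi f u" for f u
 proof -
  \<comment> \<open>The estimate is known for the solution built by \<open>stokes_exists\<close>;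
    uniqueness identifies the given one with it.\<close>
  obtain w where w: "w \<in> H1_uloc chi" "stokes_zero_flux chi f w" "H1_uloc_norm chi w \<le> C * H_minus1_uloc_norm chi f"
   using stokes_exists[OF f] unfolding C_def by blast
  have "H1_uloc_norm chi u = H1_uloc_norm chi w"
   by (rule H1_uloc_norm_AE_cong[OF w(1) u(1) stokes_unique[OF w(1,2) u]])
  then show ?thesis using w(3) by simp
 qed
 ultimately show ?thesis using C by blast
qed

end
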